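(* Let $n\ge1$, let $k\ge0$ be an integer, and let $D$ be a bounded domain in $\mathbb H^{n+1}$ with smooth boundary such that $\mathbb H^{n+1}\setminus\overline D$ is connected. If $f$ is a smooth $k$-CF function on $bD$, then there exists a $k$-regular function $\widetilde f$ on $D$, smooth up to the boundary, such that $\widetilde f=f$ on $bD$.
   Context: Identify $\mathbb H^{n+1}$ with $\mathbb R^{4n+4}$ by $q_{l+1}=x_{4l+1}+x_{4l+2}\mathbf i+x_{4l+3}\mathbf j+x_{4l+4}\mathbf k$, $l=0,\dots,n$; $\partial_m=\partial/\partial x_m$. Put $\nabla_{(2l)0'}=\partial_{4l+1}+\mathbf i\partial_{4l+2}$, $\nabla_{(2l)1'}=-\partial_{4l+3}-\mathbf i\partial_{4l+4}$, $\nabla_{(2l+1)0'}=\partial_{4l+3}-\mathbf i\partial_{4l+4}$, $\nabla_{(2l+1)1'}=\partial_{4l+1}-\mathbf i\partial_{4l+2}$ ($l=0,\dots,n$), and $\nabla_{\dot A}^{0'}=\nabla_{\dot A1'}$, $\nabla_{\dot A}^{1'}=-\nabla_{\dot A0'}$, $\dot A=0,\dots,2n+1$. For a basis $\omega^0,\dots,\omega^{2n+1}$ of $\mathbb C^{2n+2}$ and $f=f_{\mathbf{\dot A}}\omega^{\mathbf{\dot A}}$ let $d^{A'}f=\nabla_{\dot A}^{A'}f_{\mathbf{\dot A}}\,\omega^{\dot A}\wedge\omega^{\mathbf{\dot A}}$, $A'=0',1'$ (repeated indices summed). Identify $\odot^\sigma\mathbb C^2$ with homogeneous polynomials of degree $\sigma$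 in $(s^{0'},s^{1'})$; $\partial_{A'}=\partial/\partial s^{A'}$, $s_{0'}=-s^{1'}$, $s_{1'}=s^{0'}$. Let $\sigma_j=k-j,\tau_j=j$ for $j\le k$ and $\sigma_j=j-k-1,\tau_j=j+1$ for $j\ge k+1$, $\mathcal V_j=\odot^{\sigma_j}\mathbb C^2\otimes\wedge^{\tau_j}\mathbb C^{2n+2}$, and $\mathcal D_j=\partial_{A'}d^{A'}$ for $j<k$, $\mathcal D_k=d^{0'}d^{1'}$, $\mathcal D_j=s_{A'}d^{A'}$ for $j>k$, mapping smooth $\mathcal V_j$-valued functions to $\mathcal V_{j+1}$-valued ones. A smooth function $f:D\to\mathcal V_0=\odot^k\mathbb C^2$ is $k$-regular if $\mathcal D_0f=0$. For $U$ an open neighborhood of $bD$, a smooth $u:U\to\mathcal V_1$ has zero Cauchy data on $bD$ for $\mathcal D_1$ if $\int_D\langle\mathcal D_1u,\psi\rangle dV=\int_D\langle u,\mathcal D_1^*\psi\rangle dV$ for every smooth $\mathcal V_2$-valued $\psi$ compactly supported in $U$ ($\mathcal D_1^*$ the formal adjoint with respect to constant Hermitian inner products); $\mathcal J_1$ denotes the space of such $u$. A smooth $f:bD\to\odot^k\mathbb C^2$ is $k$-CF if it is annihilated by the operator $\mathscr D_0$ of the boundary complex (the quotient of the $\mathcal V_\bullet$-valued smooth functions by those with zero Cauchy data, with maps induced by $\mathcal D_\bullet$); that is, if $f$ has a smooth extension $F$ to a neighborhood of $bD$ with $\mathcal D_0F\in\mathcal J_1$. (For $k\ge1$ this does not depend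 on the extension $F$; for $k=0$ the boundary datum consists of $F|_{bD}$ together with the first normal derivative of $F$, and $f=F|_{bD}$.) *)

theory Defs
  imports "HOL-Analysis.Analysis"
begin

text \<open>
  The space \<open>\<real>\<^sup>4\<^sup>n\<^sup>+\<^sup>4\<close> is a Euclidean space \<open>'a\<close> together with an enumeration
  \<open>e 1, \<dots>, e (4n+4)\<close> of its standard orthonormal basis, so that \<open>x\<^sub>m = x \<bullet> e m\<close>
  and \<open>q\<^sub>l\<^sub>+\<^sub>1 = x\<^sub>4\<^sub>l\<^sub>+\<^sub>1 + x\<^sub>4\<^sub>l\<^sub>+\<^sub>2 i + x\<^sub>4\<^sub>l\<^sub>+\<^sub>3 j + x\<^sub>4\<^sub>l\<^sub>+\<^sub>4 k\<close>.
\<close>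

subsection \<open>Smooth functions\<close>

definition dir_deriv :: "'a::real_normed_vector \<Rightarrow> ('a \<Rightarrow> 'b::real_normed_vector) \<Rightarrow> 'a \<Rightarrow> 'b"
  where "dir_deriv v f = (\<lambda>x. frechet_derivative f (at x) v)"

text \<open>For open \<open>W\<close>: all iterated partial derivatives of \<open>f\<close> exist and are (Frechet)
  differentiable at every point of \<open>W\<close>.\<close>

definition C_infinity_on :: "'a::euclidean_space set \<Rightarrow> ('a \<Rightarrow> 'b::real_normed_vector) \<Rightarrow> bool"
  where "C_infinity_on W f \<longleftrightarrow>
    (\<forall>vs. set vs \<subseteq> Basis \<longrightarrow> (\<forall>x\<in>W. foldr dir_deriv vs f differentiable (at x)))"

text \<open>Smoothness on an arbitrary set \<open>A\<close> means having a smooth extension to a neighbourhood of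
  \<open>A\<close>.  For open \<open>A\<close> this is just \<open>C_infinity_on A f\<close>, for a smooth hypersurface \<open>A\<close> it is
  smoothness along \<open>A\<close>, and for \<open>A = closure D\<close> it is smoothness up to the boundary.\<close>

definition smooth_on :: "'a::euclidean_space set \<Rightarrow> ('a \<Rightarrow> 'b::real_normed_vector) \<Rightarrow> bool"
  where "smooth_on A f \<longleftrightarrow>
    (\<exists>W g. open W \<and> A \<subseteq> W \<and> C_infinity_on W g \<and> (\<forall>x\<in>A. g x = f x))"

text \<open>\<open>D\<close> lies locally on one side of its boundary, which has smooth local defining functions.\<close>

definition smooth_boundary :: "'a::euclidean_space set \<Rightarrow> bool"
  where "smooth_boundary D \<longleftrightarrow>
    (\<forall>p\<in>frontier D. \<exists>W (\<rho> :: 'a \<Rightarrow> real). open W \<and> p \<in> W \<and> smooth_on W \<rho> \<and>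
        (\<exists>v. frechet_derivative \<rho> (at p) v \<noteq> 0) \<and> D \<inter> W = {x \<in> W. \<rho> x < 0})"

subsection \<open>The bundles\<close>

text \<open>
  An element \<open>v\<close> of \<open>\<odot>\<^sup>\<sigma>\<complex>\<^sup>2 \<otimes> \<and>\<^sup>\<tau>\<complex>\<^sup>2\<^sup>n\<^sup>+\<^sup>2\<close> is given by its coefficients: \<open>v a b S\<close> is the
  coefficient of \<open>(s\<^sup>0\<^sup>')\<^sup>a (s\<^sup>1\<^sup>')\<^sup>b \<otimes> \<omega>\<^sup>S\<close>, where \<open>\<omega>\<^sup>S = \<omega>\<^sup>A\<^sup>1 \<and> \<dots> \<and> \<omega>\<^sup>A\<^sup>\<tau>\<close> for
  \<open>S = {A1 < \<dots> < A\<tau>} \<subseteq> {0..2n+1}\<close>.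
\<close>

type_synonym fiber = "nat \<Rightarrow> nat \<Rightarrow> nat set \<Rightarrow> complex"

definition sigma_deg :: "nat \<Rightarrow> nat \<Rightarrow> nat"
  where "sigma_deg k j = (if j \<le> k then k - j else j - k - 1)"

definition tau_deg :: "nat \<Rightarrow> nat \<Rightarrow> nat"
  where "tau_deg k j = (if j \<le> k then j else j + 1)"

definition basis_index :: "nat \<Rightarrow> nat \<Rightarrow> nat \<Rightarrow> (nat \<times> nat \<times> nat set) set"
  where "basis_index n k j =
    {(a, b, S). a + b = sigma_deg k j \<and> S \<subseteq> {0..2*n+1} \<and> card S = tau_deg k j}"

definition bundle_fiber :: "nat \<Rightarrow> nat \<Rightarrow> nat \<Rightarrow> fiber set"
  where "bundle_fiber n k j = {v. \<forall>a b S. v a b S \<noteq> 0 \<longrightarrow> (a, b, S) \<in> basis_index n k j}"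

text \<open>The Hermitian inner product making the monomial basis of \<open>bundle_fiber n k j\<close> orthonormal.  Another
  choice of constant inner products changes the test sections in \<open>zero_cauchy_data\<close> below only by
  a constant invertible matrix, so the space defined there is independent of it.\<close>

definition herm :: "nat \<Rightarrow> nat \<Rightarrow> nat \<Rightarrow> fiber \<Rightarrow> fiber \<Rightarrow> complex"
  where "herm n k j v w = (\<Sum>(a, b, S)\<in>basis_index n k j. v a b S * cnj (w a b S))"

definition smooth_sections ::
    "nat \<Rightarrow> nat \<Rightarrow> nat \<Rightarrow> 'a::euclidean_space set \<Rightarrow> ('a \<Rightarrow> fiber) set"
  where "smooth_sections n k j A =
    {u. (\<forall>x\<in>A. u x \<in> bundle_fiber n k j) \<and> (\<forall>a b S. smooth_on A (\<lambda>x. u x a b S))}"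

definition test_sections ::
    "nat \<Rightarrow> nat \<Rightarrow> nat \<Rightarrow> 'a::euclidean_space set \<Rightarrow> ('a \<Rightarrow> fiber) set"
  where "test_sections n k j U =
    {\<psi> \<in> smooth_sections n k j UNIV. \<exists>K. compact K \<and> K \<subseteq> U \<and> (\<forall>x. x \<notin> K \<longrightarrow> \<psi> x = (\<lambda>a b S. 0))}"

subsection \<open>The operators\<close>

datatype primed = P0 | P1

text \<open>\<open>nabla_low e A A'\<close> is \<open>\<nabla>\<^sub>A\<^sub>A\<^sub>'\<close>, with \<open>A = 2l\<close> or \<open>A = 2l + 1\<close>, and
  \<open>nabla e A A'\<close> is \<open>\<nabla>\<^sub>A\<close> with raised primed index.\<close>

fun nabla_low ::
    "(nat \<Rightarrow> 'a::euclidean_space) \<Rightarrow> nat \<Rightarrow> primed \<Rightarrow> ('a \<Rightarrow> complex) \<Rightarrow> 'a \<Rightarrow> complex"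
  where
    "nabla_low e A P0 f x = (let l = A div 2 in
       if even A then dir_deriv (e (4*l+1)) f x + \<i> * dir_deriv (e (4*l+2)) f x
       else dir_deriv (e (4*l+3)) f x - \<i> * dir_deriv (e (4*l+4)) f x)"
  | "nabla_low e A P1 f x = (let l = A div 2 in
       if even A then - dir_deriv (e (4*l+3)) f x - \<i> * dir_deriv (e (4*l+4)) f x
       else dir_deriv (e (4*l+1)) f x - \<i> * dir_deriv (e (4*l+2)) f x)"

fun nabla ::
    "(nat \<Rightarrow> 'a::euclidean_space) \<Rightarrow> nat \<Rightarrow> primed \<Rightarrow> ('a \<Rightarrow> complex) \<Rightarrow> 'a \<Rightarrow> complex"
  where
    "nabla e A P0 f x = nabla_low e A P1 f x"
  | "nabla e A P1 f x = - nabla_low e A P0 f x"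

text \<open>Left exterior multiplication by \<open>\<omega>\<^sup>A\<close>; the sign comes from moving \<open>\<omega>\<^sup>A\<close> past the factors
  with smaller index.\<close>

definition omega_wedge :: "nat \<Rightarrow> (nat set \<Rightarrow> complex) \<Rightarrow> nat set \<Rightarrow> complex"
  where "omega_wedge A \<eta> T =
    (if A \<in> T then (- 1) ^ card {B \<in> T. B < A} * \<eta> (T - {A}) else 0)"

definition d_prime ::
    "nat \<Rightarrow> (nat \<Rightarrow> 'a::euclidean_space) \<Rightarrow> primed \<Rightarrow> ('a \<Rightarrow> fiber) \<Rightarrow> 'a \<Rightarrow> fiber"
  where "d_prime n e A' u x a b =
    (\<lambda>T. \<Sum>A = 0..2*n+1. omega_wedge A (\<lambda>S. nabla e A A' (\<lambda>y. u y a b S) x) T)"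

text \<open>\<open>s_deriv A'\<close> is the derivative with respect to \<open>s\<^sup>A\<^sup>'\<close>; \<open>s_mult A'\<close> is multiplication by
  \<open>s\<^sub>A\<^sub>'\<close> with lowered index, that is, by \<open>- s\<^sup>1\<^sup>'\<close> and by \<open>s\<^sup>0\<^sup>'\<close> respectively.\<close>

fun s_deriv :: "primed \<Rightarrow> fiber \<Rightarrow> fiber"
  where
    "s_deriv P0 v a b S = of_nat (a + 1) * v (a + 1) b S"
  | "s_deriv P1 v a b S = of_nat (b + 1) * v a (b + 1) S"

fun s_mult :: "primed \<Rightarrow> fiber \<Rightarrow> fiber"
  where
    "s_mult P0 v a b S = (if b = 0 then 0 else - v a (b - 1) S)"
  | "s_mult P1 v a b S = (if a = 0 then 0 else v (a - 1) b S)"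

definition DD ::
    "nat \<Rightarrow> (nat \<Rightarrow> 'a::euclidean_space) \<Rightarrow> nat \<Rightarrow> nat \<Rightarrow> ('a \<Rightarrow> fiber) \<Rightarrow> 'a \<Rightarrow> fiber"
  where "DD n e k j u x a b S =
    (if j < k then s_deriv P0 (d_prime n e P0 u x) a b S + s_deriv P1 (d_prime n e P1 u x) a b S
     else if j = k then d_prime n e P0 (d_prime n e P1 u) x a b S
     else s_mult P0 (d_prime n e P0 u x) a b S + s_mult P1 (d_prime n e P1 u x) a b S)"

subsection \<open>Zero Cauchy data, \<open>k\<close>-regular functions and \<open>k\<close>-CF functions\<close>

text \<open>The formal adjoint of the constant coefficient operator \<open>DD n e k j\<close>, given by its defining
  property; integration by parts gives existence for every smooth \<open>\<psi>\<close>.\<close>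

definition DD_adjoint ::
    "nat \<Rightarrow> (nat \<Rightarrow> 'a::euclidean_space) \<Rightarrow> nat \<Rightarrow> nat \<Rightarrow> ('a \<Rightarrow> fiber) \<Rightarrow> 'a \<Rightarrow> fiber"
  where "DD_adjoint n e k j \<psi> = (THE \<phi>. \<phi> \<in> smooth_sections n k j UNIV \<and>
    (\<forall>v\<in>test_sections n k j UNIV.
       (LINT x|lborel. herm n k (Suc j) (DD n e k j v x) (\<psi> x)) =
       (LINT x|lborel. herm n k j (v x) (\<phi> x))))"

definition zero_cauchy_data ::
    "nat \<Rightarrow> (nat \<Rightarrow> 'a::euclidean_space) \<Rightarrow> nat \<Rightarrow> nat \<Rightarrow> 'a set \<Rightarrow> 'a set \<Rightarrow> ('a \<Rightarrow> fiber) set"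
  where "zero_cauchy_data n e k j D U =
    {u \<in> smooth_sections n k j U.
       \<forall>\<psi>\<in>test_sections n k (Suc j) U.
         (LINT x:D|lborel. herm n k (Suc j) (DD n e k j u x) (\<psi> x)) =
         (LINT x:D|lborel. herm n k j (u x) (DD_adjoint n e k j \<psi> x))}"

definition k_regular ::
    "nat \<Rightarrow> (nat \<Rightarrow> 'a::euclidean_space) \<Rightarrow> nat \<Rightarrow> 'a set \<Rightarrow> ('a \<Rightarrow> fiber) \<Rightarrow> bool"
  where "k_regular n e k D f \<longleftrightarrow>
    f \<in> smooth_sections n k 0 D \<and> (\<forall>x\<in>D. DD n e k 0 f x = (\<lambda>a b S. 0))"

definition k_CF ::
    "nat \<Rightarrow> (nat \<Rightarrow> 'a::euclidean_space) \<Rightarrow> nat \<Rightarrow> 'a set \<Rightarrow> ('a \<Rightarrow> fiber) \<Rightarrow> bool"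
  where "k_CF n e k D f \<longleftrightarrow>
    f \<in> smooth_sections n k 0 (frontier D) \<and>
    (\<exists>U F. open U \<and> frontier D \<subseteq> U \<and> F \<in> smooth_sections n k 0 U \<and>
       (\<forall>x\<in>frontier D. F x = f x) \<and> DD n e k 0 F \<in> zero_cauchy_data n e k 1 D U)"

end

theory Submission
  imports Defs "HOL-Real_Asymp.Real_Asymp" "HOL-Complex_Analysis.Conformal_Mappings"
begin

text \<open>
  Let \<open>F\<close> be a compactly supported extension of \<open>f\<close> with \<open>\<D>\<^sub>0F \<in> \<J>\<^sub>1\<close>. Rescaling the test functions
  around a boundary point shows that the leading jet of \<open>\<D>\<^sub>0F\<close> there lies in the kernel of the symbol of
  \<open>\<D>\<^sub>1\<close> at the conormal. The symbol sequence is exact, so this jet can be removed by subtracting from \<open>F\<close> a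
  power of the defining function times a smooth section. Iterating, and summing by Borel's method, makes
  \<open>\<D>\<^sub>0F\<close> vanish to infinite order on \<open>bD\<close> without changing \<open>F\<close> there. Its extension by zero is then a smooth,
  compactly supported \<open>G\<close> with \<open>\<D>\<^sub>1G = 0\<close>.

  Exactness at both the symbol and the operator level comes from one identity for each quaternionic variable
  \<open>q\<^sub>l\<close>: on \<open>\<D>\<^sub>1\<close>-closed sections, \<open>\<D>\<^sub>0 R\<^sub>l = \<Delta>\<^sub>l\<close> with \<open>\<Delta>\<^sub>l\<close> the Laplacian in \<open>q\<^sub>l\<close> alone. Convolving \<open>R\<^sub>0 G\<close> with
  the Newtonian kernel in the first quaternionic variable therefore solves \<open>\<D>\<^sub>0u = G\<close>. As \<open>n \<ge> 1\<close>, this \<open>u\<close>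
  vanishes where another coordinate is large; it is harmonic off the closure of \<open>D\<close>, whose complement is
  connected, so it vanishes there and on \<open>bD\<close>. The solution is \<open>F - u\<close>.
\<close>

subsection \<open>Smooth functions\<close>

text \<open>A kernel in all variables would give a solution that merely decays at infinity. A kernel
  in four of the \<open>4*n+4\<close> variables gives one that vanishes on a whole half space, and
  this is what unique continuation starts from. The boundary condition is weak, and a blow-up at a
  point recovers only the leading jet. It is needed only for jets of order less than that of
  \<open>\<D>\<^sub>1\<close>; from there on \<open>\<D>\<^sub>1 \<D>\<^sub>0 F = 0\<close> by
  itself yields the symbol equation. One blow-up therefore suffices unless \<open>k = 1\<close>,
  where \<open>\<D>\<^sub>1\<close> has order two: there the weak condition must survive the first
  correction, which it does because \<open>\<D>\<^sub>0\<close> has order one and the correction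
  vanishes on the boundary. For \<open>k = 0\<close> the operator \<open>\<D>\<^sub>0\<close> has
  order two, and the corrections start with the square of the defining function. The three ranges of
  \<open>k\<close> share all of the analysis. Operators are lists of terms, from which both the
  operator and its symbol are read, and the algebra enters only through a locale of
  identities.\<close>

lemma dir_deriv_eqI: "(f has_derivative f') (at x) \<Longrightarrow> dir_deriv v f x = f' v"
  unfolding dir_deriv_def using frechet_derivative_at by metis

lemma has_derivative_dir_deriv:
  "f differentiable (at x) \<Longrightarrow> (f has_derivative (\<lambda>v. dir_deriv v f x)) (at x)"
  unfolding dir_deriv_def using frechet_derivative_works by blast

lemma dir_deriv_expand:
  fixes f :: "'a::euclidean_space \<Rightarrow> 'b::real_normed_vector"
  assumes "f differentiable (at x)"
  shows "dir_deriv v f x = (\<Sum>b\<in>Basis. (v \<bullet> b) *\<^sub>R dir_deriv b f x)"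
proof -
  have L: "linear (\<lambda>v. dir_deriv v f x)"
    using has_derivative_dir_deriv[OF assms] has_derivative_bounded_linear bounded_linear.linear by blast
  have "dir_deriv v f x = dir_deriv (\<Sum>b\<in>Basis. (v \<bullet> b) *\<^sub>R b) f x"
    by (simp add: euclidean_representation)
  also have "\<dots> = (\<Sum>b\<in>Basis. (v \<bullet> b) *\<^sub>R dir_deriv b f x)"
    using linear_sum[OF L, of "\<lambda>b. (v \<bullet> b) *\<^sub>R b" Basis] linear_scale[OF L] by simp
  finally show ?thesis .
qed

lemma dir_deriv_cong:
  assumes "open W" "x \<in> W" "\<And>y. y \<in> W \<Longrightarrow> f y = g y"
  shows "dir_deriv v f x = dir_deriv v g x"
proof -
  have "(f has_derivative f') (at x) \<longleftrightarrow> (g has_derivative f') (at x)" for f'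
    using assms has_derivative_transform_within_open[of f f' x UNIV W g]
      has_derivative_transform_within_open[of g f' x UNIV W f] by auto
  then show ?thesis unfolding dir_deriv_def frechet_derivative_def by simp
qed

lemma differentiable_cong_open:
  assumes "open W" "x \<in> W" "\<And>y. y \<in> W \<Longrightarrow> f y = g y"
  shows "f differentiable (at x) \<longleftrightarrow> g differentiable (at x)"
  using assms has_derivative_transform_within_open[of f _ x UNIV W g]
      has_derivative_transform_within_open[of g _ x UNIV W f] unfolding differentiable_def by metis

text \<open>Smoothness itself offers no induction over products or composites; at a finite order the
  derivative is a sum of products of order one less, and the induction closes. Order
  \<open>0\<close> is plain differentiability, which makes \<open>C_infinity_on\<close> the
  conjunction over all orders.\<close>

fun Cn_on :: "nat \<Rightarrow> 'a::euclidean_space set \<Rightarrow> ('a \<Rightarrow> 'b::real_normed_vector) \<Rightarrow> bool" where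
  "Cn_on 0 W f \<longleftrightarrow> (\<forall>x\<in>W. f differentiable (at x))"
| "Cn_on (Suc n) W f \<longleftrightarrow> (\<forall>x\<in>W. f differentiable (at x)) \<and> (\<forall>b\<in>Basis. Cn_on n W (dir_deriv b f))"

lemma Cn_on_iff:
  "Cn_on n W f \<longleftrightarrow> (\<forall>vs. set vs \<subseteq> Basis \<and> length vs \<le> n \<longrightarrow>
     (\<forall>x\<in>W. foldr dir_deriv vs f differentiable (at x)))"
proof (induction n arbitrary: f)
  case 0
  then show ?case by auto
next
  case (Suc n)
  show ?case
  proof
    assume *: "Cn_on (Suc n) W f"
    show "\<forall>vs. set vs \<subseteq> Basis \<and> length vs \<le> Suc n \<longrightarrow> (\<forall>x\<in>W. foldr dir_deriv vs f differentiable (at x))"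
    proof (intro allI impI)
      fix vs :: "'a list" assume vs: "set vs \<subseteq> Basis \<and> length vs \<le> Suc n"
      show "\<forall>x\<in>W. foldr dir_deriv vs f differentiable (at x)"
      proof (cases vs rule: rev_cases)
        case Nil
        then show ?thesis using * by simp
      next
        case (snoc us b)
        then have "b \<in> Basis" "set us \<subseteq> Basis" "length us \<le> n" using vs by auto
        then show ?thesis using * Suc.IH[of "dir_deriv b f"] snoc by auto
      qed
    qed
  next
    assume *: "\<forall>vs. set vs \<subseteq> Basis \<and> length vs \<le> Suc n \<longrightarrow> (\<forall>x\<in>W. foldr dir_deriv vs f differentiable (at x))"
    have "Cn_on n W (dir_deriv b f)" if "b \<in> Basis" for b
      unfolding Suc.IH
    proof (intro allI impI)
      fix vs :: "'a list" assume vs: "set vs \<subseteq> Basis \<and> length vs \<le> n"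
      show "\<forall>x\<in>W. foldr dir_deriv vs (dir_deriv b f) differentiable at x"
        using *[rule_format, of "vs @ [b]"] vs that by auto
    qed
    then show "Cn_on (Suc n) W f" using *[rule_format, of "[]"] by auto
  qed
qed

lemma C_infinity_on_iff_Cn_on: "C_infinity_on W f \<longleftrightarrow> (\<forall>n. Cn_on n W f)"
  unfolding C_infinity_on_def Cn_on_iff by auto

lemma Cn_on_differentiable: "Cn_on n W f \<Longrightarrow> x \<in> W \<Longrightarrow> f differentiable (at x)"
  by (cases n) auto

lemma Cn_on_SucD: "Cn_on (Suc n) W f \<Longrightarrow> Cn_on n W f"
  unfolding Cn_on_iff by auto

lemma Cn_on_cong:
  assumes "open W" "\<And>y. y \<in> W \<Longrightarrow> f y = g y" "Cn_on n W g"
  shows "Cn_on n W f"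
  using assms(2,3)
proof (induction n arbitrary: f g)
  case 0
  then show ?case using differentiable_cong_open[OF assms(1)] by (metis Cn_on.simps(1))
next
  case (Suc n)
  have "Cn_on n W (dir_deriv b f)" if "b \<in> Basis" for b
    by (rule Suc.IH[of "dir_deriv b f" "dir_deriv b g"])
       (use dir_deriv_cong[OF assms(1) _ Suc.prems(1)] Suc.prems(2) that in auto)
  moreover have "\<forall>x\<in>W. f differentiable (at x)"
    using Suc.prems(2) differentiable_cong_open[OF assms(1) _ Suc.prems(1)] by simp
  ultimately show ?case by simp
qed

lemma Cn_on_const: "Cn_on n W (\<lambda>x. c)"
proof (induction n arbitrary: c)
  case (Suc n)
  have "dir_deriv b (\<lambda>x. c) = (\<lambda>x. 0)" for b :: 'a by (intro ext dir_deriv_eqI) auto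
  then show ?case using Suc by auto
qed auto

lemma Cn_on_add:
  assumes "open W" "Cn_on n W f" "Cn_on n W g"
  shows "Cn_on n W (\<lambda>x. f x + g x)"
  using assms(2,3)
proof (induction n arbitrary: f g)
  case (Suc n)
  have "Cn_on n W (dir_deriv b (\<lambda>x. f x + g x))" if "b \<in> Basis" for b
  proof (rule Cn_on_cong[OF assms(1) _ Suc.IH[of "dir_deriv b f" "dir_deriv b g"]])
    fix x assume "x \<in> W"
    then have "f differentiable at x" "g differentiable at x" using Suc.prems by auto
    then show "dir_deriv b (\<lambda>x. f x + g x) x = dir_deriv b f x + dir_deriv b g x"
      by (intro dir_deriv_eqI[THEN trans]) (auto intro!: has_derivative_add has_derivative_dir_deriv)
  qed (use that Suc.prems in auto)
  then show ?case using Suc.prems by auto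
qed auto

lemma Cn_on_bounded_linear:
  assumes "open W" "bounded_linear h" "Cn_on n W f"
  shows "Cn_on n W (\<lambda>x. h (f x))"
  using assms(3)
proof (induction n arbitrary: f)
  case 0
  then show ?case using bounded_linear_imp_differentiable[OF assms(2)] differentiable_compose[of h f] by auto
next
  case (Suc n)
  have "Cn_on n W (dir_deriv b (\<lambda>x. h (f x)))" if "b \<in> Basis" for b
  proof (rule Cn_on_cong[OF assms(1) _ Suc.IH[of "dir_deriv b f"]])
    fix x assume "x \<in> W"
    then have "f differentiable at x" using Suc.prems by auto
    then show "dir_deriv b (\<lambda>x. h (f x)) x = h (dir_deriv b f x)"
      by (intro dir_deriv_eqI[THEN trans])
         (auto intro!: bounded_linear.has_derivative[OF assms(2)] has_derivative_dir_deriv)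
  qed (use that Suc.prems in auto)
  then show ?case using Suc.prems bounded_linear_imp_differentiable[OF assms(2)] differentiable_compose[of h f] by auto
qed

lemma Cn_on_bilinear:
  assumes "open W" "bounded_bilinear pr" "Cn_on n W f" "Cn_on n W g"
  shows "Cn_on n W (\<lambda>x. pr (f x) (g x))"
proof -
  interpret bounded_bilinear pr by fact
  have D: "(\<lambda>x. pr (f x) (g x)) differentiable at x \<and>
      dir_deriv b (\<lambda>x. pr (f x) (g x)) x = pr (f x) (dir_deriv b g x) + pr (dir_deriv b f x) (g x)"
    if "f differentiable at x" "g differentiable at x" for f g b and x :: 'a
  proof -
    have *: "((\<lambda>x. pr (f x) (g x)) has_derivative
        (\<lambda>b. pr (f x) (dir_deriv b g x) + pr (dir_deriv b f x) (g x))) (at x)"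
      using FDERIV[OF that[THEN has_derivative_dir_deriv]] .
    then show ?thesis using dir_deriv_eqI[OF *] differentiable_def by blast
  qed
  show ?thesis using assms(3,4)
  proof (induction n arbitrary: f g)
    case 0
    then show ?case using D by auto
  next
    case (Suc n)
    have "Cn_on n W (dir_deriv b (\<lambda>x. pr (f x) (g x)))" if "b \<in> Basis" for b
    proof (rule Cn_on_cong[OF assms(1) _ Cn_on_add[OF assms(1) Suc.IH[of f "dir_deriv b g"] Suc.IH[of "dir_deriv b f" g]]])
      fix x assume "x \<in> W"
      then show "dir_deriv b (\<lambda>x. pr (f x) (g x)) x = pr (f x) (dir_deriv b g x) + pr (dir_deriv b f x) (g x)"
        using D Suc.prems by auto
    qed (use that Suc.prems Cn_on_SucD[OF Suc.prems(1)] Cn_on_SucD[OF Suc.prems(2)] in auto)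
    then show ?case using Suc.prems D by auto
  qed
qed

section \<open>Calculus of smooth functions\<close>

lemma C_infinity_on_differentiable: "C_infinity_on W f \<Longrightarrow> x \<in> W \<Longrightarrow> f differentiable (at x)"
  unfolding C_infinity_on_iff_Cn_on using Cn_on_differentiable by blast

lemma C_infinity_on_dir_deriv: "C_infinity_on W f \<Longrightarrow> b \<in> Basis \<Longrightarrow> C_infinity_on W (dir_deriv b f)"
  unfolding C_infinity_on_iff_Cn_on using Cn_on.simps(2) by blast

lemma C_infinity_on_foldr:
  "C_infinity_on W f \<Longrightarrow> set vs \<subseteq> Basis \<Longrightarrow> C_infinity_on W (foldr dir_deriv vs f)"
  by (induction vs) (auto intro: C_infinity_on_dir_deriv)

lemma C_infinity_onI:
  assumes "\<And>x. x \<in> W \<Longrightarrow> f differentiable (at x)" "\<And>b. b \<in> Basis \<Longrightarrow> C_infinity_on W (dir_deriv b f)"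
  shows "C_infinity_on W f"
  unfolding C_infinity_on_iff_Cn_on
proof
  fix n show "Cn_on n W f" using assms unfolding C_infinity_on_iff_Cn_on by (cases n) auto
qed

lemma C_infinity_on_cong:
  assumes "open W" "\<And>y. y \<in> W \<Longrightarrow> f y = g y" "C_infinity_on W g"
  shows "C_infinity_on W f"
  using Cn_on_cong[OF assms(1), of f g] assms(2,3) unfolding C_infinity_on_iff_Cn_on by simp

lemma C_infinity_on_subset: "C_infinity_on W f \<Longrightarrow> V \<subseteq> W \<Longrightarrow> C_infinity_on V f"
  unfolding C_infinity_on_def by auto

lemma C_infinity_on_UNIV: "C_infinity_on UNIV f \<Longrightarrow> C_infinity_on V f"
  using C_infinity_on_subset by blast

lemma C_infinity_on_local:
  assumes "\<And>x. x \<in> W \<Longrightarrow> \<exists>V. x \<in> V \<and> C_infinity_on V f"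
  shows "C_infinity_on W f"
  using assms unfolding C_infinity_on_def by blast

lemma C_infinity_on_continuous: "C_infinity_on W f \<Longrightarrow> continuous_on W f"
  by (meson C_infinity_on_differentiable continuous_at_imp_continuous_on differentiable_imp_continuous_within)

lemma C_infinity_on_const: "C_infinity_on W (\<lambda>x. c)"
  unfolding C_infinity_on_iff_Cn_on using Cn_on_const by blast

lemma C_infinity_on_add:
  "open W \<Longrightarrow> C_infinity_on W f \<Longrightarrow> C_infinity_on W g \<Longrightarrow> C_infinity_on W (\<lambda>x. f x + g x)"
  unfolding C_infinity_on_iff_Cn_on using Cn_on_add by blast

lemma C_infinity_on_bounded_linear:
  "open W \<Longrightarrow> bounded_linear h \<Longrightarrow> C_infinity_on W f \<Longrightarrow> C_infinity_on W (\<lambda>x. h (f x))"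
  unfolding C_infinity_on_iff_Cn_on using Cn_on_bounded_linear by blast

lemma C_infinity_on_bilinear:
  "open W \<Longrightarrow> bounded_bilinear pr \<Longrightarrow> C_infinity_on W f \<Longrightarrow> C_infinity_on W g \<Longrightarrow>
   C_infinity_on W (\<lambda>x. pr (f x) (g x))"
  unfolding C_infinity_on_iff_Cn_on using Cn_on_bilinear by blast

lemma C_infinity_on_mult:
  fixes f g :: "'a::euclidean_space \<Rightarrow> 'b::real_normed_algebra"
  shows "open W \<Longrightarrow> C_infinity_on W f \<Longrightarrow> C_infinity_on W g \<Longrightarrow> C_infinity_on W (\<lambda>x. f x * g x)"
  by (rule C_infinity_on_bilinear[OF _ bounded_bilinear_mult])

lemma C_infinity_on_scaleR:
  "open W \<Longrightarrow> C_infinity_on W f \<Longrightarrow> C_infinity_on W g \<Longrightarrow> C_infinity_on W (\<lambda>x. f x *\<^sub>R g x)"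
  by (rule C_infinity_on_bilinear[OF _ bounded_bilinear_scaleR])

lemma C_infinity_on_minus:
  "open W \<Longrightarrow> C_infinity_on W f \<Longrightarrow> C_infinity_on W (\<lambda>x. - f x)"
  by (rule C_infinity_on_bounded_linear[of W uminus]) (auto intro: bounded_linear_minus bounded_linear_ident)

lemma C_infinity_on_diff:
  "open W \<Longrightarrow> C_infinity_on W f \<Longrightarrow> C_infinity_on W g \<Longrightarrow> C_infinity_on W (\<lambda>x. f x - g x)"
  using C_infinity_on_add[of W f "\<lambda>x. - g x"] C_infinity_on_minus[of W g] by simp

lemma C_infinity_on_sum:
  "open W \<Longrightarrow> (\<And>i. i \<in> I \<Longrightarrow> C_infinity_on W (f i)) \<Longrightarrow> C_infinity_on W (\<lambda>x. \<Sum>i\<in>I. f i x)"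
  by (induction I rule: infinite_finite_induct) (auto intro: C_infinity_on_add C_infinity_on_const)

lemma C_infinity_on_power:
  fixes f :: "'a::euclidean_space \<Rightarrow> 'b::real_normed_algebra_1"
  shows "open W \<Longrightarrow> C_infinity_on W f \<Longrightarrow> C_infinity_on W (\<lambda>x. f x ^ m)"
  by (induction m) (auto intro: C_infinity_on_mult C_infinity_on_const)

lemma C_infinity_on_linear:
  assumes "bounded_linear h"
  shows "C_infinity_on W h"
proof (rule C_infinity_onI)
  fix b :: 'a
  have "dir_deriv b h = (\<lambda>x. h b)"
    by (intro ext dir_deriv_eqI bounded_linear_imp_has_derivative assms)
  then show "C_infinity_on W (dir_deriv b h)" using C_infinity_on_const by metis
qed (use assms in \<open>auto intro: bounded_linear_imp_differentiable\<close>)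

text \<open>By the chain rule the derivative is a sum of smooth coefficients times composites of
  partial derivatives of \<open>f\<close> with the same \<open>g\<close>; hence the induction on the
  order generalises \<open>f\<close> and keeps \<open>g\<close> fixed.\<close>

lemma C_infinity_on_compose:
  fixes f :: "'c::euclidean_space \<Rightarrow> 'b::real_normed_vector" and g :: "'a::euclidean_space \<Rightarrow> 'c"
  assumes "open V" "open W" "g ` W \<subseteq> V" and f: "C_infinity_on V f" and g: "C_infinity_on W g"
  shows "C_infinity_on W (\<lambda>x. f (g x))"
proof -
  have D: "((\<lambda>x. f (g x)) has_derivative (\<lambda>v. \<Sum>c\<in>Basis. (dir_deriv v g x \<bullet> c) *\<^sub>R dir_deriv c f (g x))) (at x)"
    if "x \<in> W" "f differentiable at (g x)" for f :: "'c \<Rightarrow> 'b" and x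
  proof -
    have "((\<lambda>x. f (g x)) has_derivative (\<lambda>v. dir_deriv (dir_deriv v g x) f (g x))) (at x)"
      using has_derivative_compose[OF has_derivative_dir_deriv[OF C_infinity_on_differentiable[OF g that(1)]]
          has_derivative_dir_deriv[OF that(2)]] .
    moreover have "(\<lambda>v. dir_deriv (dir_deriv v g x) f (g x)) =
        (\<lambda>v. \<Sum>c\<in>Basis. (dir_deriv v g x \<bullet> c) *\<^sub>R dir_deriv c f (g x))"
      by (rule ext, rule dir_deriv_expand[OF that(2)])
    ultimately show ?thesis by (simp only:)
  qed
  have "Cn_on n W (\<lambda>x. f (g x))" for n using f
  proof (induction n arbitrary: f)
    case 0
    then have "f differentiable at (g x)" if "x \<in> W" for x
      using that assms(3) C_infinity_on_differentiable[OF 0] by blast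
    then show ?case using D unfolding differentiable_def Cn_on.simps by blast
  next
    case (Suc n)
    have d: "f differentiable at (g x)" if "x \<in> W" for x
      using that assms(3) C_infinity_on_differentiable[OF Suc.prems] by blast
    have "Cn_on n W (dir_deriv b (\<lambda>x. f (g x)))" if b: "b \<in> Basis" for b
    proof (rule Cn_on_cong[OF assms(2)])
      show "Cn_on n W (\<lambda>x. \<Sum>c\<in>Basis. (dir_deriv b g x \<bullet> c) *\<^sub>R dir_deriv c f (g x))"
      proof -
        have "Cn_on n W (\<lambda>x. \<Sum>c\<in>S. (dir_deriv b g x \<bullet> c) *\<^sub>R dir_deriv c f (g x))" if "S \<subseteq> Basis" for S
          using finite_subset[OF that finite_Basis] that
        proof (induction S rule: finite_induct)
          case empty
          then show ?case using Cn_on_const by auto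
        next
          case (insert c S)
          have "C_infinity_on W (\<lambda>x. dir_deriv b g x \<bullet> c)"
            using C_infinity_on_bounded_linear[OF assms(2) bounded_linear_inner_left C_infinity_on_dir_deriv[OF g b]] .
          then have "Cn_on n W (\<lambda>x. (dir_deriv b g x \<bullet> c) *\<^sub>R dir_deriv c f (g x))"
            using Suc.IH[OF C_infinity_on_dir_deriv[OF Suc.prems, of c]] insert.prems
            by (intro Cn_on_bilinear[OF assms(2) bounded_bilinear_scaleR]) (auto simp: C_infinity_on_iff_Cn_on)
          then show ?case using insert Cn_on_add[OF assms(2)] by auto
        qed
        then show ?thesis by auto
      qed
      fix x assume "x \<in> W"
      then show "dir_deriv b (\<lambda>x. f (g x)) x = (\<Sum>c\<in>Basis. (dir_deriv b g x \<bullet> c) *\<^sub>R dir_deriv c f (g x))"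
        using dir_deriv_eqI[OF D] d by blast
    qed
    moreover have "\<forall>x\<in>W. (\<lambda>x. f (g x)) differentiable at x"
      using D d unfolding differentiable_def by blast
    ultimately show ?case by simp
  qed
  then show ?thesis unfolding C_infinity_on_iff_Cn_on by blast
qed

lemma C_infinity_on_inverse:
  fixes f :: "'a::euclidean_space \<Rightarrow> 'b::real_normed_field"
  assumes "open W" "C_infinity_on W f" "\<And>x. x \<in> W \<Longrightarrow> f x \<noteq> 0"
  shows "C_infinity_on W (\<lambda>x. inverse (f x))"
proof -
  have D: "((\<lambda>x. inverse (f x)) has_derivative (\<lambda>v. - (dir_deriv v f x * (inverse (f x) * inverse (f x))))) (at x)"
    if "x \<in> W" for x
    using Deriv.has_derivative_inverse[OF assms(3)[OF that] has_derivative_dir_deriv[OF C_infinity_on_differentiable[OF assms(2) that]]]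
    by (simp add: algebra_simps)
  have "Cn_on n W (\<lambda>x. inverse (f x))" for n
  proof (induction n)
    case 0
    then show ?case using D unfolding differentiable_def Cn_on.simps by blast
  next
    case (Suc n)
    have "Cn_on n W (dir_deriv b (\<lambda>x. inverse (f x)))" if b: "b \<in> Basis" for b
    proof (rule Cn_on_cong[OF assms(1) dir_deriv_eqI[OF D]])
      have "Cn_on n W (dir_deriv b f)"
        using C_infinity_on_dir_deriv[OF assms(2) b] C_infinity_on_iff_Cn_on by blast
      then have "Cn_on n W (\<lambda>x. dir_deriv b f x * (inverse (f x) * inverse (f x)))"
        using Suc Cn_on_bilinear[OF assms(1) bounded_bilinear_mult] by blast
      then show "Cn_on n W (\<lambda>x. - (dir_deriv b f x * (inverse (f x) * inverse (f x))))"
        using Cn_on_bounded_linear[OF assms(1) bounded_linear_minus[OF bounded_linear_ident]] by blast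
    qed
    moreover have "\<forall>x\<in>W. (\<lambda>x. inverse (f x)) differentiable at x"
      using D unfolding differentiable_def by blast
    ultimately show ?case by simp
  qed
  then show ?thesis unfolding C_infinity_on_iff_Cn_on by blast
qed

lemma C_infinity_on_of_real:
  assumes "open W" "C_infinity_on W f"
  shows "C_infinity_on W (\<lambda>x. complex_of_real (f x))"
  by (rule C_infinity_on_bounded_linear[OF assms(1) bounded_linear_of_real assms(2)])

lemma C_infinity_on_inner: "C_infinity_on W (\<lambda>x. x \<bullet> v)"
  by (rule C_infinity_on_linear[OF bounded_linear_inner_left])

lemma C_infinity_on_id: "C_infinity_on W (\<lambda>x. x)"
  by (rule C_infinity_on_linear[OF bounded_linear_ident])

text \<open>The second difference \<open>f(x+tu+tv) - f(x+tu) - f(x+tv) + f(x)\<close>, divided by \<open>t\<^sup>2\<close>, converges to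
  \<open>\<partial>\<^sub>v \<partial>\<^sub>u f (x)\<close>, and it is symmetric in \<open>u\<close> and \<open>v\<close>.\<close>

lemma second_difference_limit:
  fixes f :: "'a::real_normed_vector \<Rightarrow> real"
  assumes d: "\<And>y. f differentiable (at y)" and du: "(dir_deriv u f) differentiable (at x)"
  shows "((\<lambda>t. (f (x + t *\<^sub>R u + t *\<^sub>R v) - f (x + t *\<^sub>R u) - f (x + t *\<^sub>R v) + f x) / t\<^sup>2)
    \<longlongrightarrow> dir_deriv v (dir_deriv u f) x) (at_right 0)"
proof -
  define g where "g = dir_deriv u f"
  define L where "L = (\<lambda>w. dir_deriv w g x)"
  have gd: "(g has_derivative L) (at x)"
    using has_derivative_dir_deriv[OF du] by (simp add: g_def L_def)
  then interpret L: bounded_linear L by (rule has_derivative_bounded_linear)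
  define C where "C = 2 * norm u + norm v + 1"
  have Cpos: "C > 0" by (simp add: C_def add_nonneg_pos)
  show ?thesis
  proof (rule tendstoI)
    fix e :: real assume e: "e > 0"
    define e' where "e' = e / (4 * C)"
    have e': "e' > 0" using e Cpos by (simp add: e'_def)
    obtain d where dpos: "d > 0" and dd: "\<And>y. norm (y - x) < d \<Longrightarrow> norm (g y - g x - L (y - x)) \<le> e' * norm (y - x)"
      using gd e' unfolding has_derivative_at_alt by metis
    have "dist ((f (x + t *\<^sub>R u + t *\<^sub>R v) - f (x + t *\<^sub>R u) - f (x + t *\<^sub>R v) + f x) / t\<^sup>2) (L v) < e"
      if t: "0 < t" "t < d / C" for t
    proof -
      \<comment> \<open>The second difference is the increment of \<open>h\<close> over
        \<open>[0, t]\<close>; the mean value theorem turns it into a difference of values of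
        \<open>\<partial>\<^sub>u f\<close> at two points within \<open>t * C\<close> of
        \<open>x\<close>.\<close>
      define h where "h = (\<lambda>s. f (x + t *\<^sub>R v + s *\<^sub>R u) - f (x + s *\<^sub>R u))"
      have hd: "(h has_real_derivative (g (x + t *\<^sub>R v + s *\<^sub>R u) - g (x + s *\<^sub>R u))) (at s)" for s
      proof -
        have 1: "((\<lambda>s. f (z + s *\<^sub>R u)) has_derivative (\<lambda>r. dir_deriv (r *\<^sub>R u) f (z + s *\<^sub>R u))) (at s)" for z
          by (rule has_derivative_compose[of "\<lambda>s. z + s *\<^sub>R u", OF _ has_derivative_dir_deriv[OF d]])
             (auto intro!: derivative_eq_intros)
        have 2: "dir_deriv (r *\<^sub>R u) f y = g y * r" for r y
          using linear_scale[OF bounded_linear.linear[OF has_derivative_bounded_linear[OF has_derivative_dir_deriv[OF d]]]]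
          by (simp add: g_def)
        show ?thesis
          unfolding h_def has_field_derivative_def
          by (rule has_derivative_eq_rhs[OF has_derivative_diff[OF 1 1]]) (auto simp: 2 algebra_simps)
      qed
      obtain s where s: "0 < s" "s < t" and hs: "h t - h 0 = (t - 0) * (g (x + t *\<^sub>R v + s *\<^sub>R u) - g (x + s *\<^sub>R u))"
        using MVT2[of 0 t h, OF t(1) hd] by blast
      define y1 where "y1 = x + t *\<^sub>R v + s *\<^sub>R u"
      define y2 where "y2 = x + s *\<^sub>R u"
      have n1: "norm (y1 - x) \<le> t * C"
      proof -
        have "norm (y1 - x) \<le> t * norm v + s * norm u"
          unfolding y1_def using t s norm_triangle_ineq[of "t *\<^sub>R v" "s *\<^sub>R u"] by simp
        also have "s * norm u \<le> t * norm u" using s by (simp add: mult_right_mono)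
        finally have "norm (y1 - x) \<le> t * (norm v + norm u)" by (simp add: algebra_simps)
        also have "\<dots> \<le> t * C" unfolding C_def using t by (intro mult_left_mono) auto
        finally show ?thesis .
      qed
      have n2: "norm (y2 - x) \<le> t * C"
      proof -
        have "norm (y2 - x) = s * norm u" unfolding y2_def using s by simp
        also have "s * norm u \<le> t * C" unfolding C_def using s t by (intro mult_mono) auto
        finally show ?thesis .
      qed
      have tC: "t * C < d" using t Cpos by (simp add: field_simps)
      have b1: "norm (g y1 - g x - L (y1 - x)) \<le> e' * (t * C)"
        using dd[of y1] n1 tC e' by (smt (verit) mult_left_mono)
      have b2: "norm (g y2 - g x - L (y2 - x)) \<le> e' * (t * C)"
        using dd[of y2] n2 tC e' by (smt (verit) mult_left_mono)
      have "L (y1 - x) - L (y2 - x) = t * L v"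
        unfolding y1_def y2_def using L.diff[symmetric] L.scaleR by (simp add: algebra_simps L.add L.scaleR)
      then have "norm (g y1 - g y2 - t * L v) \<le> 2 * (e' * (t * C))"
        using b1 b2 unfolding real_norm_def by linarith
      also have "\<dots> = t * (e / 2)" using Cpos by (simp add: e'_def field_simps)
      finally have B: "\<bar>g y1 - g y2 - t * L v\<bar> \<le> t * (e / 2)" by simp
      have "f (x + t *\<^sub>R u + t *\<^sub>R v) - f (x + t *\<^sub>R u) - f (x + t *\<^sub>R v) + f x = h t - h 0"
        by (simp add: h_def algebra_simps)
      also have "\<dots> = t * (g y1 - g y2)" using hs by (simp add: y1_def y2_def)
      finally have E: "(f (x + t *\<^sub>R u + t *\<^sub>R v) - f (x + t *\<^sub>R u) - f (x + t *\<^sub>R v) + f x) / t\<^sup>2 = (g y1 - g y2) / t"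
        using t by (simp add: power2_eq_square)
      have "(g y1 - g y2) / t - L v = (g y1 - g y2 - t * L v) / t" using t by (simp add: field_simps)
      then have "\<bar>(g y1 - g y2) / t - L v\<bar> \<le> e / 2"
        using B t by (simp add: field_simps)
      then show ?thesis unfolding E dist_real_def using e by linarith
    qed
    moreover have "eventually (\<lambda>t. 0 < t \<and> t < d / C) (at_right (0::real))"
      using dpos Cpos by (auto simp: eventually_at_right_field intro!: exI[of _ "d/C"])
    ultimately show "\<forall>\<^sub>F t in at_right 0. dist ((f (x + t *\<^sub>R u + t *\<^sub>R v) - f (x + t *\<^sub>R u) - f (x + t *\<^sub>R v) + f x) / t\<^sup>2)
            (dir_deriv v (dir_deriv u f) x) < e"
      unfolding L_def g_def by (auto elim!: eventually_mono)
  qed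
qed

lemma dir_deriv_commute_real:
  fixes f :: "'a::real_normed_vector \<Rightarrow> real"
  assumes "\<And>y. f differentiable (at y)"
    and "(dir_deriv u f) differentiable (at x)" "(dir_deriv v f) differentiable (at x)"
  shows "dir_deriv v (dir_deriv u f) x = dir_deriv u (dir_deriv v f) x"
proof (rule tendsto_unique[OF _ second_difference_limit[OF assms(1,2), of v]])
  show "((\<lambda>t. (f (x + t *\<^sub>R u + t *\<^sub>R v) - f (x + t *\<^sub>R u) - f (x + t *\<^sub>R v) + f x) / t\<^sup>2)
    \<longlongrightarrow> dir_deriv u (dir_deriv v f) x) (at_right 0)"
    using second_difference_limit[OF assms(1,3), of u] by (simp add: algebra_simps)
qed simp

lemma dir_deriv_bounded_linear:
  assumes "bounded_linear h" "f differentiable (at x)"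
  shows "dir_deriv v (\<lambda>y. h (f y)) x = h (dir_deriv v f x)"
  by (intro dir_deriv_eqI[THEN trans])
     (auto intro!: bounded_linear.has_derivative[OF assms(1)] has_derivative_dir_deriv assms(2))

lemma differentiable_bounded_linear:
  "bounded_linear h \<Longrightarrow> f differentiable (at x) \<Longrightarrow> (\<lambda>y. h (f y)) differentiable (at x)"
  using bounded_linear_imp_differentiable differentiable_compose[of h f] by blast

text \<open>The mean value theorem behind the real case has no complex form, so real and imaginary
  parts are compared separately.\<close>

lemma dir_deriv_commute:
  fixes f :: "'a::real_normed_vector \<Rightarrow> complex"
  assumes f: "\<And>y. f differentiable (at y)"
    and u: "\<And>y. (dir_deriv u f) differentiable (at y)" and v: "\<And>y. (dir_deriv v f) differentiable (at y)"
  shows "dir_deriv v (dir_deriv u f) x = dir_deriv u (dir_deriv v f) x"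
proof -
  have "h (dir_deriv v (dir_deriv u f) x) = h (dir_deriv u (dir_deriv v f) x)"
    if h: "bounded_linear h" for h :: "complex \<Rightarrow> real"
  proof -
    have e: "dir_deriv w (\<lambda>y. h (f y)) = (\<lambda>y. h (dir_deriv w f y))" for w
      by (intro ext dir_deriv_bounded_linear h f)
    have "dir_deriv v (dir_deriv u (\<lambda>y. h (f y))) x = dir_deriv u (dir_deriv v (\<lambda>y. h (f y))) x"
      by (rule dir_deriv_commute_real) (simp_all add: e differentiable_bounded_linear[OF h] f u v)
    then show ?thesis by (simp add: e dir_deriv_bounded_linear[OF h] u v)
  qed
  from this[OF bounded_linear_Re] this[OF bounded_linear_Im] show ?thesis
    by (rule complex_eqI)
qed

subsection \<open>Cutoff functions\<close>

text \<open>The powers of \<open>t\<close> in the denominator make the family of all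
  \<open>flat_exp k\<close> closed under differentiation up to linear combinations, so smoothness at
  \<open>0\<close> is an induction that ranges over all \<open>k\<close>.\<close>

definition flat_exp :: "nat \<Rightarrow> real \<Rightarrow> real" where
  "flat_exp k t = (if t \<le> 0 then 0 else exp (- 1 / t) / t ^ k)"

lemma flat_exp_deriv:
  "(flat_exp k has_real_derivative (flat_exp (k + 2) t - real k * flat_exp (k + 1) t)) (at t)"
proof -
  consider "t < 0" | "t > 0" | "t = 0" by linarith
  then show ?thesis
  proof cases
    case 1
    have "((\<lambda>_. 0) has_real_derivative 0) (at t)" by simp
    then have "(flat_exp k has_real_derivative 0) (at t)"
      by (rule has_field_derivative_transform_within_open[of _ _ _ "{..<0}"]) (use 1 in \<open>auto simp: flat_exp_def\<close>)
    then show ?thesis using 1 by (simp add: flat_exp_def)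
  next
    case 2
    have "((\<lambda>t. exp (- 1 / t) / t ^ k) has_real_derivative
        (exp (- 1 / t) / t ^ (k + 2) - real k * (exp (- 1 / t) / t ^ (k + 1)))) (at t)"
    proof -
      have "((\<lambda>t. exp (- 1 / t) / t ^ k) has_real_derivative
         ((exp (- 1 / t) * (1 / (t * t))) * t ^ k - exp (- 1 / t) * (real k * t ^ (k - 1))) / (t ^ k * t ^ k)) (at t)"
        using 2 by (auto intro!: derivative_eq_intros)
      moreover have "((exp (- 1 / t) * (1 / (t * t))) * t ^ k - exp (- 1 / t) * (real k * t ^ (k - 1))) / (t ^ k * t ^ k)
          = exp (- 1 / t) / t ^ (k + 2) - real k * (exp (- 1 / t) / t ^ (k + 1))"
        using 2 by (cases k) (auto simp: divide_simps, simp add: algebra_simps)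
      ultimately show ?thesis by simp
    qed
    then have "(flat_exp k has_real_derivative
        (exp (- 1 / t) / t ^ (k + 2) - real k * (exp (- 1 / t) / t ^ (k + 1)))) (at t)"
      by (rule has_field_derivative_transform_within_open[of _ _ _ "{0<..}"]) (use 2 in \<open>auto simp: flat_exp_def\<close>)
    then show ?thesis using 2 by (simp add: flat_exp_def)
  next
    case 3
    have "((\<lambda>h. exp (- 1 / h) / h ^ (k + 1)) \<longlongrightarrow> 0) (at_right (0::real))"
      by real_asymp
    then have "((\<lambda>h. flat_exp k h / h) \<longlongrightarrow> 0) (at_right 0)"
      by (rule Lim_transform_eventually)
         (auto simp: eventually_at_right_field flat_exp_def intro!: exI[of _ 1])
    moreover have "((\<lambda>h. flat_exp k h / h) \<longlongrightarrow> 0) (at_left 0)"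
      by (rule Lim_transform_eventually[OF tendsto_const])
         (auto simp: eventually_at_left_field flat_exp_def intro!: exI[of _ "-1"])
    ultimately have "((\<lambda>h. flat_exp k h / h) \<longlongrightarrow> 0) (at 0)"
      using filterlim_split_at by blast
    then show ?thesis using 3 by (simp add: DERIV_def flat_exp_def)
  qed
qed

lemma flat_exp_smooth: "C_infinity_on UNIV (flat_exp k)"
proof -
  have D: "(flat_exp k has_derivative (\<lambda>v. (flat_exp (k + 2) t - real k * flat_exp (k + 1) t) * v)) (at t)" for k t
    using flat_exp_deriv[of k t] unfolding has_field_derivative_def by simp
  have "Cn_on n UNIV (flat_exp k)" for n
  proof (induction n arbitrary: k)
    case 0
    then show ?case using D unfolding differentiable_def Cn_on.simps by blast
  next
    case (Suc n)
    have "Cn_on n UNIV (dir_deriv 1 (flat_exp k))"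
    proof (rule Cn_on_cong)
      show "Cn_on n UNIV (\<lambda>t. flat_exp (k + 2) t + (- real k) * flat_exp (k + 1) t)"
        by (intro Cn_on_add Suc Cn_on_bounded_linear[OF _ bounded_linear_mult_right]) auto
    qed (use dir_deriv_eqI[OF D] in auto)
    moreover have "\<forall>t\<in>UNIV. flat_exp k differentiable at t"
      using D unfolding differentiable_def by blast
    ultimately show ?case by simp
  qed
  then show ?thesis unfolding C_infinity_on_iff_Cn_on by blast
qed

text \<open>The quotient makes sense everywhere because \<open>t\<close> and \<open>1 - t\<close>
  are never both nonpositive.\<close>

definition smooth_step :: "real \<Rightarrow> real" where
  "smooth_step t = flat_exp 0 t * inverse (flat_exp 0 t + flat_exp 0 (1 - t))"

lemma smooth_step_denom: "flat_exp 0 t + flat_exp 0 (1 - t) > 0"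
  by (auto simp: flat_exp_def add_pos_pos)

lemma smooth_step_smooth: "C_infinity_on UNIV smooth_step"
proof -
  have 1: "C_infinity_on UNIV (\<lambda>t::real. 1 - t)"
    by (intro C_infinity_on_diff C_infinity_on_const C_infinity_on_id) auto
  have "C_infinity_on UNIV (\<lambda>t. flat_exp 0 (1 - t))"
    by (rule C_infinity_on_compose[OF _ _ _ flat_exp_smooth 1]) auto
  then have "C_infinity_on UNIV (\<lambda>t. flat_exp 0 t * inverse (flat_exp 0 t + flat_exp 0 (1 - t)))"
    using smooth_step_denom
    by (intro C_infinity_on_mult C_infinity_on_inverse C_infinity_on_add flat_exp_smooth)
       (auto simp: less_le)
  then show ?thesis by (simp add: smooth_step_def[abs_def])
qed

lemma smooth_step_bounds: "0 \<le> smooth_step t" "smooth_step t \<le> 1"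
  using smooth_step_denom[of t] by (auto simp: smooth_step_def flat_exp_def field_simps)

lemma smooth_step_eq_0: "t \<le> 0 \<Longrightarrow> smooth_step t = 0"
  by (simp add: smooth_step_def flat_exp_def)

lemma smooth_step_eq_1: "t \<ge> 1 \<Longrightarrow> smooth_step t = 1"
  by (simp add: smooth_step_def flat_exp_def)

section \<open>Test functions\<close>

definition test_on :: "'a::euclidean_space set \<Rightarrow> ('a \<Rightarrow> 'b::real_normed_vector) \<Rightarrow> bool" where
  "test_on U f \<longleftrightarrow> C_infinity_on UNIV f \<and> (\<exists>K. compact K \<and> K \<subseteq> U \<and> (\<forall>x. x \<notin> K \<longrightarrow> f x = 0))"

lemma test_on_smooth: "test_on U f \<Longrightarrow> C_infinity_on UNIV f"
  by (simp add: test_on_def)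

lemma test_on_mono: "test_on U f \<Longrightarrow> U \<subseteq> V \<Longrightarrow> test_on V f"
  unfolding test_on_def by blast

lemma test_on_UNIV: "test_on U f \<Longrightarrow> test_on UNIV f"
  by (rule test_on_mono) auto

lemma test_on_outside: "test_on U f \<Longrightarrow> x \<notin> U \<Longrightarrow> f x = 0"
  unfolding test_on_def by blast

lemma dir_deriv_const [simp]: "dir_deriv v (\<lambda>x. c) = (\<lambda>x. 0)"
  by (intro ext dir_deriv_eqI) auto

lemma foldr_dir_deriv_zero [simp]: "foldr dir_deriv vs (\<lambda>x. 0) = (\<lambda>x. 0)"
  by (induction vs) auto

lemma dir_deriv_local_zero:
  "open W \<Longrightarrow> x \<in> W \<Longrightarrow> (\<And>y. y \<in> W \<Longrightarrow> f y = 0) \<Longrightarrow> dir_deriv v f x = 0"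
  using dir_deriv_cong[of W x f "\<lambda>_. 0" v] by auto

lemma foldr_dir_deriv_cong:
  assumes "open W" "x \<in> W" "\<And>y. y \<in> W \<Longrightarrow> f y = g y"
  shows "foldr dir_deriv vs f x = foldr dir_deriv vs g x"
  using assms(2)
proof (induction vs arbitrary: x)
  case (Cons v vs)
  then show ?case using dir_deriv_cong[OF assms(1) Cons.prems, of "foldr dir_deriv vs f" "foldr dir_deriv vs g" v] by auto
qed (use assms in auto)

lemma dir_deriv_outside_compact:
  assumes "compact K" "\<And>x. x \<notin> K \<Longrightarrow> f x = 0" "x \<notin> K"
  shows "dir_deriv v f x = 0"
  by (rule dir_deriv_local_zero[of "- K"]) (use assms compact_imp_closed in auto)

lemma test_on_dir_deriv: "test_on U f \<Longrightarrow> b \<in> Basis \<Longrightarrow> test_on U (dir_deriv b f)"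
  unfolding test_on_def using dir_deriv_outside_compact C_infinity_on_dir_deriv by metis

lemma test_on_zero: "test_on U (\<lambda>x. 0)"
  unfolding test_on_def using C_infinity_on_const by (auto intro!: exI[of _ "{}"])

lemma test_on_add: "test_on U f \<Longrightarrow> test_on U g \<Longrightarrow> test_on U (\<lambda>x. f x + g x)"
  unfolding test_on_def
proof (elim conjE exE, intro conjI)
  fix K L assume "compact K" "K \<subseteq> U" "\<forall>x. x \<notin> K \<longrightarrow> f x = 0" "compact L" "L \<subseteq> U" "\<forall>x. x \<notin> L \<longrightarrow> g x = 0"
  then show "\<exists>K. compact K \<and> K \<subseteq> U \<and> (\<forall>x. x \<notin> K \<longrightarrow> f x + g x = 0)"
    by (intro exI[of _ "K \<union> L"]) auto
qed (intro C_infinity_on_add; simp)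

lemma test_on_bilinear_left:
  assumes "bounded_bilinear pr" "test_on U f" "C_infinity_on UNIV g"
  shows "test_on U (\<lambda>x. pr (f x) (g x))"
proof -
  interpret bounded_bilinear pr by fact
  show ?thesis using assms zero_left unfolding test_on_def
    by (auto intro!: C_infinity_on_bilinear[OF open_UNIV assms(1)])
qed

lemma test_on_mult_left:
  fixes f g :: "'a::euclidean_space \<Rightarrow> 'b::real_normed_algebra"
  shows "test_on U f \<Longrightarrow> C_infinity_on UNIV g \<Longrightarrow> test_on U (\<lambda>x. f x * g x)"
  by (rule test_on_bilinear_left[OF bounded_bilinear_mult])

lemma test_on_mult_right:
  fixes f g :: "'a::euclidean_space \<Rightarrow> 'b::real_normed_algebra"
  shows "test_on U f \<Longrightarrow> C_infinity_on UNIV g \<Longrightarrow> test_on U (\<lambda>x. g x * f x)"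
  by (rule test_on_bilinear_left[OF bounded_bilinear.flip[OF bounded_bilinear_mult]])

lemma test_on_scaleR_left:
  "test_on U f \<Longrightarrow> C_infinity_on UNIV g \<Longrightarrow> test_on U (\<lambda>x. f x *\<^sub>R g x)"
  by (rule test_on_bilinear_left[OF bounded_bilinear_scaleR])

lemma test_on_bounded_linear:
  "bounded_linear h \<Longrightarrow> test_on U f \<Longrightarrow> test_on U (\<lambda>x. h (f x))"
  unfolding test_on_def
  by (auto intro!: C_infinity_on_bounded_linear[of UNIV h] simp: linear_0[OF bounded_linear.linear])

lemma test_on_minus: "test_on U f \<Longrightarrow> test_on U (\<lambda>x. - f x)"
  by (rule test_on_bounded_linear[OF bounded_linear_minus[OF bounded_linear_ident]])

lemma test_on_diff: "test_on U f \<Longrightarrow> test_on U g \<Longrightarrow> test_on U (\<lambda>x. f x - g x)"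
  using test_on_add[of U f "\<lambda>x. - g x"] test_on_minus[of U g] by simp

lemma test_on_sum: "(\<And>i. i \<in> I \<Longrightarrow> test_on U (f i)) \<Longrightarrow> test_on U (\<lambda>x. \<Sum>i\<in>I. f i x)"
  by (induction I rule: infinite_finite_induct) (auto intro: test_on_zero test_on_add)

lemma test_on_continuous: "test_on U f \<Longrightarrow> continuous_on S f"
  using C_infinity_on_continuous[OF test_on_smooth] continuous_on_subset by blast

lemma test_on_bounded:
  assumes "test_on U f"
  obtains B where "B > 0" "\<And>x. norm (f x) \<le> B"
proof -
  obtain K where K: "compact K" "\<forall>x. x \<notin> K \<longrightarrow> f x = 0" using assms unfolding test_on_def by blast
  have "bounded (f ` K)" using K(1) test_on_continuous[OF assms] compact_continuous_image compact_imp_bounded by blast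
  then obtain B where B: "B > 0" "\<forall>y\<in>f ` K. norm y \<le> B" unfolding bounded_pos by blast
  have "norm (f x) \<le> B" for x using B K by (cases "x \<in> K") auto
  then show ?thesis using that B by blast
qed

lemma test_on_cut_extend:
  fixes \<eta> :: "'a::euclidean_space \<Rightarrow> real" and F :: "'a \<Rightarrow> 'b::real_normed_vector"
  assumes "open U" "C_infinity_on U F" "test_on U \<eta>"
  shows "test_on U (\<lambda>x. if x \<in> U then \<eta> x *\<^sub>R F x else 0)"
proof -
  obtain K where K: "compact K" "K \<subseteq> U" "\<forall>x. x \<notin> K \<longrightarrow> \<eta> x = 0" using assms(3) unfolding test_on_def by blast
  have "C_infinity_on UNIV (\<lambda>x. if x \<in> U then \<eta> x *\<^sub>R F x else 0)"
  proof (rule C_infinity_on_local)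
    fix x
    show "\<exists>V. x \<in> V \<and> C_infinity_on V (\<lambda>x. if x \<in> U then \<eta> x *\<^sub>R F x else 0)"
    proof (cases "x \<in> U")
      case True
      have "C_infinity_on U (\<lambda>x. if x \<in> U then \<eta> x *\<^sub>R F x else 0)"
        by (rule C_infinity_on_cong[OF assms(1) _ C_infinity_on_scaleR[OF assms(1) C_infinity_on_UNIV[OF test_on_smooth[OF assms(3)]] assms(2)]]) auto
      then show ?thesis using True by blast
    next
      case False
      have "C_infinity_on (- K) (\<lambda>x. if x \<in> U then \<eta> x *\<^sub>R F x else 0)"
        by (rule C_infinity_on_cong[OF _ _ C_infinity_on_const[of _ 0]]) (use K compact_imp_closed in auto)
      then show ?thesis using False K by blast
    qed
  qed
  then show ?thesis unfolding test_on_def using K by (auto intro!: exI[of _ K])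
qed

lemma C_infinity_on_norm_square:
  fixes p :: "'a::euclidean_space"
  shows "C_infinity_on UNIV (\<lambda>x. (x - p) \<bullet> (x - p))"
  by (intro C_infinity_on_bilinear[OF _ bounded_bilinear_inner] C_infinity_on_diff
      C_infinity_on_id C_infinity_on_const) auto

lemma C_infinity_on_real_compose:
  fixes \<theta> :: "real \<Rightarrow> 'b::real_normed_vector" and g :: "'a::euclidean_space \<Rightarrow> real"
  shows "C_infinity_on UNIV \<theta> \<Longrightarrow> C_infinity_on UNIV g \<Longrightarrow> C_infinity_on UNIV (\<lambda>x. \<theta> (g x))"
  by (rule C_infinity_on_compose[of UNIV UNIV]) auto

lemma smooth_bump:
  fixes p :: "'a::euclidean_space"
  assumes "r > 0"
  obtains \<beta> :: "'a \<Rightarrow> real" where "test_on (cball p (2 * r)) \<beta>" "\<And>x. 0 \<le> \<beta> x" "\<And>x. \<beta> x \<le> 1"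
    "\<And>x. x \<in> cball p r \<Longrightarrow> \<beta> x = 1"
proof
  \<comment> \<open>The argument of the step is at least \<open>1\<close> when \<open>x\<close> is
    within \<open>r\<close> of \<open>p\<close>, and already negative at distance
    \<open>2 * r\<close>.\<close>
  define \<beta> where "\<beta> = (\<lambda>x. smooth_step (2 - ((x - p) \<bullet> (x - p)) * inverse (r\<^sup>2)))"
  have s: "C_infinity_on UNIV \<beta>"
    unfolding \<beta>_def
    by (intro C_infinity_on_real_compose[OF smooth_step_smooth] C_infinity_on_diff C_infinity_on_const
        C_infinity_on_mult C_infinity_on_norm_square) auto
  have z: "\<beta> x = 0" if "x \<notin> cball p (2 * r)" for x
  proof -
    have "norm (x - p) > 2 * r" using that by (simp add: dist_norm norm_minus_commute)
    then have "(norm (x - p))\<^sup>2 \<ge> (2 * r)\<^sup>2" using assms by (intro power_mono) auto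
    then have "(x - p) \<bullet> (x - p) * inverse (r\<^sup>2) \<ge> 4"
      using assms by (simp add: power2_norm_eq_inner field_simps)
    then show ?thesis unfolding \<beta>_def by (intro smooth_step_eq_0) linarith
  qed
  show "test_on (cball p (2 * r)) \<beta>"
    unfolding test_on_def using s z by (auto intro!: exI[of _ "cball p (2 * r)"])
  show "\<beta> x = 1" if "x \<in> cball p r" for x
  proof -
    have "norm (x - p) \<le> r" using that by (simp add: dist_norm norm_minus_commute)
    then have "(norm (x - p))\<^sup>2 \<le> r\<^sup>2" using assms by (intro power_mono) auto
    then have "(x - p) \<bullet> (x - p) * inverse (r\<^sup>2) \<le> 1"
      using assms by (simp add: power2_norm_eq_inner field_simps)
    then show ?thesis unfolding \<beta>_def by (intro smooth_step_eq_1) linarith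
  qed
qed (auto simp: smooth_step_bounds)

text \<open>A finite sum of bumps is at least \<open>1\<close> near \<open>K\<close>, but need not
  equal \<open>1\<close>; composing with \<open>smooth_step\<close> levels it to exactly
  \<open>1\<close> and keeps the support.\<close>

lemma smooth_cutoff:
  fixes K :: "'a::euclidean_space set"
  assumes "compact K" "open U" "K \<subseteq> U"
  obtains \<eta> :: "'a \<Rightarrow> real" and V where "test_on U \<eta>" "\<And>x. 0 \<le> \<eta> x" "\<And>x. \<eta> x \<le> 1"
    "open V" "K \<subseteq> V" "V \<subseteq> U" "\<And>x. x \<in> V \<Longrightarrow> \<eta> x = 1"
proof -
  have "\<exists>r>0. cball p (2 * r) \<subseteq> U" if p: "p \<in> K" for p
  proof -
    obtain e where "e > 0" "cball p e \<subseteq> U" using p assms(2,3) unfolding open_contains_cball by (meson subsetD)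
    then show ?thesis by (intro exI[of _ "e/2"]) auto
  qed
  then obtain r where r: "\<And>p. p \<in> K \<Longrightarrow> r p > 0" "\<And>p. p \<in> K \<Longrightarrow> cball p (2 * r p) \<subseteq> U" by metis
  have "\<exists>\<beta>::'a \<Rightarrow> real. test_on (cball p (2 * r p)) \<beta> \<and> (\<forall>x. 0 \<le> \<beta> x) \<and> (\<forall>x\<in>cball p (r p). \<beta> x = 1)" if "p \<in> K" for p
    using smooth_bump[OF r(1)[OF that], of p] by metis
  then have "\<forall>p\<in>K. \<exists>\<beta>::'a \<Rightarrow> real. test_on (cball p (2 * r p)) \<beta> \<and> (\<forall>x. 0 \<le> \<beta> x) \<and> (\<forall>x\<in>cball p (r p). \<beta> x = 1)" by blast
  then obtain \<beta> where "\<forall>p\<in>K. test_on (cball p (2 * r p)) (\<beta> p :: 'a \<Rightarrow> real) \<and> (\<forall>x. 0 \<le> \<beta> p x) \<and> (\<forall>x\<in>cball p (r p). \<beta> p x = 1)"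
    using bchoice[of K "\<lambda>p \<beta>. test_on (cball p (2 * r p)) (\<beta> :: 'a \<Rightarrow> real) \<and> (\<forall>x. 0 \<le> \<beta> x) \<and> (\<forall>x\<in>cball p (r p). \<beta> x = 1)"] by blast
  then have \<beta>: "\<And>p. p \<in> K \<Longrightarrow> test_on (cball p (2 * r p)) (\<beta> p)"
    "\<And>p x. p \<in> K \<Longrightarrow> 0 \<le> \<beta> p x" "\<And>p x. p \<in> K \<Longrightarrow> x \<in> cball p (r p) \<Longrightarrow> \<beta> p x = 1" by blast+
  have "K \<subseteq> (\<Union>p\<in>K. ball p (r p))" using r by force
  then obtain P where P: "P \<subseteq> K" "finite P" "K \<subseteq> (\<Union>p\<in>P. ball p (r p))"
    using compactE_image[OF assms(1), of K "\<lambda>p. ball p (r p)"] by (metis (no_types, lifting) open_ball)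
  define S where "S = (\<lambda>x. \<Sum>p\<in>P. \<beta> p x)"
  have tS: "test_on U S"
    unfolding S_def
  proof (rule test_on_sum)
    fix p assume "p \<in> P"
    then have "p \<in> K" using P by blast
    from test_on_mono[OF \<beta>(1)[OF this] r(2)[OF this]] show "test_on U (\<beta> p)" .
  qed
  define \<eta> where "\<eta> = (\<lambda>x. smooth_step (S x))"
  obtain L where L: "compact L" "L \<subseteq> U" "\<forall>x. x \<notin> L \<longrightarrow> S x = 0" using tS unfolding test_on_def by blast
  show ?thesis
  proof (rule that[of \<eta> "U \<inter> (\<Union>p\<in>P. ball p (r p))"])
    show "test_on U \<eta>"
      unfolding test_on_def \<eta>_def
      using L C_infinity_on_real_compose[OF smooth_step_smooth test_on_smooth[OF tS]] smooth_step_eq_0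
      by (intro conjI exI[of _ L]) auto
    fix x assume "x \<in> U \<inter> (\<Union>p\<in>P. ball p (r p))"
    then obtain p where p: "p \<in> P" "x \<in> cball p (r p)" using ball_subset_cball by blast
    have "\<beta> p x \<le> S x" unfolding S_def using p P \<beta>(2) by (intro member_le_sum) auto
    then show "\<eta> x = 1" unfolding \<eta>_def using \<beta>(3)[of p x] p P by (intro smooth_step_eq_1) auto
  qed (use P assms in \<open>auto simp: \<eta>_def smooth_step_bounds\<close>)
qed

subsection \<open>Constant coefficient differential operators\<close>

abbreviation smooth :: "('a::euclidean_space \<Rightarrow> 'b::real_normed_vector) \<Rightarrow> bool" where
  "smooth \<equiv> C_infinity_on UNIV"

text \<open>The coefficients are complex, unlike those of a direction vector in \<open>'a\<close>,
  because the fields \<nabla> combine real derivatives with the factor i.\<close>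

definition cd :: "('a::euclidean_space \<Rightarrow> complex) \<Rightarrow> ('a \<Rightarrow> complex) \<Rightarrow> 'a \<Rightarrow> complex" where
  "cd \<xi> f x = (\<Sum>b\<in>Basis. \<xi> b * dir_deriv b f x)"

lemma smooth_differentiable: "smooth f \<Longrightarrow> f differentiable (at x)"
  using C_infinity_on_differentiable by blast

lemma smooth_continuous: "smooth f \<Longrightarrow> continuous_on S f"
  using C_infinity_on_continuous continuous_on_subset by blast

lemma C_infinity_on_cd: "open W \<Longrightarrow> C_infinity_on W f \<Longrightarrow> C_infinity_on W (cd \<xi> f)"
  unfolding cd_def[abs_def]
  by (intro C_infinity_on_sum C_infinity_on_mult C_infinity_on_const C_infinity_on_dir_deriv) auto

lemma smooth_cd: "smooth f \<Longrightarrow> smooth (cd \<xi> f)"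
  by (rule C_infinity_on_cd) auto

lemma smooth_cds: "smooth f \<Longrightarrow> smooth (foldr cd \<xi>s f)"
  by (induction \<xi>s) (auto intro: smooth_cd)

lemma test_on_cd: "test_on U f \<Longrightarrow> test_on U (cd \<xi> f)"
  unfolding cd_def[abs_def]
  by (intro test_on_sum test_on_mult_right C_infinity_on_const test_on_dir_deriv)

lemma test_on_cds: "test_on U f \<Longrightarrow> test_on U (foldr cd \<xi>s f)"
  by (induction \<xi>s) (auto intro: test_on_cd)

lemma cd_cong: "open W \<Longrightarrow> x \<in> W \<Longrightarrow> (\<And>y. y \<in> W \<Longrightarrow> f y = g y) \<Longrightarrow> cd \<xi> f x = cd \<xi> g x"
  unfolding cd_def using dir_deriv_cong by (metis (no_types, lifting))

lemma cds_cong: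
  assumes "open W" "x \<in> W" "\<And>y. y \<in> W \<Longrightarrow> f y = g y"
  shows "foldr cd \<xi>s f x = foldr cd \<xi>s g x"
  using assms(2)
proof (induction \<xi>s arbitrary: x)
  case (Cons \<xi> \<xi>s)
  then show ?case using cd_cong[OF assms(1) Cons.prems, of "foldr cd \<xi>s f" "foldr cd \<xi>s g" \<xi>] by auto
qed (use assms in auto)

lemma dir_deriv_add:
  "f differentiable (at x) \<Longrightarrow> g differentiable (at x) \<Longrightarrow>
   dir_deriv v (\<lambda>x. f x + g x) x = dir_deriv v f x + dir_deriv v g x"
  by (intro dir_deriv_eqI[THEN trans]) (auto intro!: has_derivative_add has_derivative_dir_deriv)

lemma dir_deriv_mult:
  fixes f g :: "'a::real_normed_vector \<Rightarrow> 'b::real_normed_algebra"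
  shows "f differentiable (at x) \<Longrightarrow> g differentiable (at x) \<Longrightarrow>
   dir_deriv v (\<lambda>x. f x * g x) x = f x * dir_deriv v g x + dir_deriv v f x * g x"
  by (rule dir_deriv_eqI[OF has_derivative_mult[OF has_derivative_dir_deriv has_derivative_dir_deriv]])

lemma cd_zero [simp]: "cd \<xi> (\<lambda>x. 0) = (\<lambda>x. 0)"
  by (simp add: cd_def[abs_def])

lemma cds_zero [simp]: "foldr cd \<xi>s (\<lambda>x. 0) = (\<lambda>x. 0)"
  by (induction \<xi>s) auto

lemma cd_add: "smooth f \<Longrightarrow> smooth g \<Longrightarrow> cd \<xi> (\<lambda>x. f x + g x) = (\<lambda>x. cd \<xi> f x + cd \<xi> g x)"
  by (intro ext) (simp add: cd_def dir_deriv_add smooth_differentiable sum.distrib algebra_simps)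

lemma cd_cmult: "smooth f \<Longrightarrow> cd \<xi> (\<lambda>x. c * f x) = (\<lambda>x. c * cd \<xi> f x)"
proof
  fix x assume "smooth f"
  then have "dir_deriv v (\<lambda>x. c * f x) x = c * dir_deriv v f x" for v
    using dir_deriv_bounded_linear[OF bounded_linear_mult_right, of f x v c] smooth_differentiable by auto
  then show "cd \<xi> (\<lambda>x. c * f x) x = c * cd \<xi> f x"
    by (simp add: cd_def sum_distrib_left mult.left_commute)
qed

lemma smooth_cmult: "smooth f \<Longrightarrow> smooth (\<lambda>x. (c::complex) * f x)"
  by (intro C_infinity_on_mult C_infinity_on_const) auto

lemma cds_cmult: "smooth f \<Longrightarrow> foldr cd \<xi>s (\<lambda>x. c * f x) = (\<lambda>x. c * foldr cd \<xi>s f x)"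
  by (induction \<xi>s) (auto simp: cd_cmult smooth_cds)

lemma cd_minus: "smooth f \<Longrightarrow> cd \<xi> (\<lambda>x. - f x) = (\<lambda>x. - cd \<xi> f x)"
  using cd_cmult[of f \<xi> "-1"] by simp

lemma cd_diff: "smooth f \<Longrightarrow> smooth g \<Longrightarrow> cd \<xi> (\<lambda>x. f x - g x) = (\<lambda>x. cd \<xi> f x - cd \<xi> g x)"
  using cd_add[of f "\<lambda>x. - g x" \<xi>] cd_minus[of g \<xi>] C_infinity_on_minus[of UNIV g] by simp

lemma cds_add: "smooth f \<Longrightarrow> smooth g \<Longrightarrow>
    foldr cd \<xi>s (\<lambda>x. f x + g x) = (\<lambda>x. foldr cd \<xi>s f x + foldr cd \<xi>s g x)"
  by (induction \<xi>s) (auto simp: cd_add smooth_cds)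

lemma cds_diff: "smooth f \<Longrightarrow> smooth g \<Longrightarrow>
    foldr cd \<xi>s (\<lambda>x. f x - g x) = (\<lambda>x. foldr cd \<xi>s f x - foldr cd \<xi>s g x)"
  by (induction \<xi>s) (auto simp: cd_diff smooth_cds)

lemma cd_sum: "finite I \<Longrightarrow> (\<And>i. i \<in> I \<Longrightarrow> smooth (f i)) \<Longrightarrow>
    cd \<xi> (\<lambda>x. \<Sum>i\<in>I. f i x) = (\<lambda>x. \<Sum>i\<in>I. cd \<xi> (f i) x)"
proof (induction I rule: finite_induct)
  case (insert i I)
  then show ?case by (simp add: cd_add C_infinity_on_sum)
qed auto

lemma cd_mult: "smooth f \<Longrightarrow> smooth g \<Longrightarrow> cd \<xi> (\<lambda>x. f x * g x) = (\<lambda>x. f x * cd \<xi> g x + cd \<xi> f x * g x)"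
  by (intro ext) (simp add: cd_def dir_deriv_mult smooth_differentiable sum.distrib algebra_simps
      sum_distrib_left)

lemma smooth_sum: "(\<And>i. i \<in> I \<Longrightarrow> smooth (f i)) \<Longrightarrow> smooth (\<lambda>x. \<Sum>i\<in>I. f i x)"
  by (rule C_infinity_on_sum) auto

lemma smooth_add: "smooth f \<Longrightarrow> smooth g \<Longrightarrow> smooth (\<lambda>x. f x + g x)"
  by (rule C_infinity_on_add) auto

lemma smooth_diff: "smooth f \<Longrightarrow> smooth g \<Longrightarrow> smooth (\<lambda>x. f x - g x)"
  by (rule C_infinity_on_diff) auto

lemma smooth_minus: "smooth f \<Longrightarrow> smooth (\<lambda>x. - f x)"
  by (rule C_infinity_on_minus) auto

lemma smooth_mult:
  fixes f g :: "'a::euclidean_space \<Rightarrow> 'b::real_normed_algebra"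
  shows "smooth f \<Longrightarrow> smooth g \<Longrightarrow> smooth (\<lambda>x. f x * g x)"
  by (rule C_infinity_on_mult) auto

lemma smooth_dir_deriv: "smooth f \<Longrightarrow> b \<in> Basis \<Longrightarrow> smooth (dir_deriv b f)"
  by (rule C_infinity_on_dir_deriv)

lemma dir_deriv_cd:
  fixes f :: "'a::euclidean_space \<Rightarrow> complex"
  assumes "smooth f" "b \<in> Basis"
  shows "dir_deriv b (cd \<xi> f) x = cd \<xi> (dir_deriv b f) x"
proof -
  have d: "dir_deriv c f differentiable (at y)" if "c \<in> Basis" for c y
    using smooth_dir_deriv[OF assms(1) that] smooth_differentiable by blast
  have "((cd \<xi> f) has_derivative (\<lambda>v. \<Sum>c\<in>Basis. \<xi> c * dir_deriv v (dir_deriv c f) x)) (at x)"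
    unfolding cd_def[abs_def]
    by (auto intro!: has_derivative_sum bounded_linear.has_derivative[OF bounded_linear_mult_right] has_derivative_dir_deriv d)
  then have "dir_deriv b (cd \<xi> f) x = (\<Sum>c\<in>Basis. \<xi> c * dir_deriv b (dir_deriv c f) x)"
    by (rule dir_deriv_eqI)
  also have "\<dots> = cd \<xi> (dir_deriv b f) x"
    unfolding cd_def
    by (intro sum.cong refl arg_cong2[of _ _ _ _ "(*)"] dir_deriv_commute d assms smooth_differentiable)
  finally show ?thesis .
qed

lemma cd_commute: "smooth f \<Longrightarrow> cd \<xi> (cd \<eta> f) = cd \<eta> (cd \<xi> f)"
proof
  fix x assume f: "smooth f"
  have "cd \<xi> (cd \<eta> f) x = (\<Sum>b\<in>Basis. \<xi> b * cd \<eta> (dir_deriv b f) x)"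
    unfolding cd_def[of \<xi>] by (intro sum.cong refl) (simp add: dir_deriv_cd f)
  also have "\<dots> = cd \<eta> (\<lambda>x. \<Sum>b\<in>Basis. \<xi> b * dir_deriv b f x) x"
    using f by (subst cd_sum) (auto simp: cd_cmult smooth_dir_deriv smooth_cmult)
  finally show "cd \<xi> (cd \<eta> f) x = cd \<eta> (cd \<xi> f) x" by (simp add: cd_def[of \<xi>, abs_def])
qed

lemma cd_cds_commute: "smooth f \<Longrightarrow> cd \<xi> (foldr cd \<xi>s f) = foldr cd \<xi>s (cd \<xi> f)"
proof (induction \<xi>s)
  case (Cons \<eta> \<xi>s)
  then show ?case using cd_commute[OF smooth_cds[OF Cons.prems], of \<xi> \<eta> \<xi>s] by simp
qed auto

text \<open>One row of a matrix of constant coefficient operators: each pair composes the listed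
  fields and applies them to component \<open>i\<close>, the empty list of fields being the
  identity. The same list yields the symbol \<open>symb\<close>, so that operator identities and
  symbol identities concern one object.\<close>

definition cop :: "(('a::euclidean_space \<Rightarrow> complex) list \<times> 'i) list \<Rightarrow> ('i \<Rightarrow> 'a \<Rightarrow> complex) \<Rightarrow> 'a \<Rightarrow> complex" where
  "cop ts f x = (\<Sum>(\<xi>s, i)\<leftarrow>ts. foldr cd \<xi>s (f i) x)"

definition symb :: "(('a::euclidean_space \<Rightarrow> complex) list \<times> 'i) list \<Rightarrow> 'a \<Rightarrow> ('i \<Rightarrow> complex) \<Rightarrow> complex" where
  "symb ts n w = (\<Sum>(\<xi>s, i)\<leftarrow>ts. (\<Prod>\<xi>\<leftarrow>\<xi>s. \<Sum>b\<in>Basis. \<xi> b * of_real (n \<bullet> b)) * w i)"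

lemma cop_Nil [simp]: "cop [] f = (\<lambda>x. 0)"
  by (simp add: cop_def[abs_def])

lemma cop_Cons: "cop (t # ts) f = (\<lambda>x. foldr cd (fst t) (f (snd t)) x + cop ts f x)"
  by (simp add: cop_def[abs_def] case_prod_beta)

lemma smooth_cop: "(\<And>i. i \<in> snd ` set ts \<Longrightarrow> smooth (f i)) \<Longrightarrow> smooth (cop ts f)"
  by (induction ts) (auto simp: cop_Cons C_infinity_on_const intro!: smooth_add smooth_cds)

lemma test_on_cop: "(\<And>i. i \<in> snd ` set ts \<Longrightarrow> test_on U (f i)) \<Longrightarrow> test_on U (cop ts f)"
  by (induction ts) (auto simp: cop_Cons test_on_zero intro!: test_on_add test_on_cds)

lemma cop_cong: "open W \<Longrightarrow> x \<in> W \<Longrightarrow> (\<And>i y. i \<in> snd ` set ts \<Longrightarrow> y \<in> W \<Longrightarrow> f i y = g i y) \<Longrightarrow> cop ts f x = cop ts g x"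
  by (induction ts) (auto simp: cop_Cons intro!: arg_cong2[of _ _ _ _ "(+)"] cds_cong[of W])

lemma cop_diff: "(\<And>i. i \<in> snd ` set ts \<Longrightarrow> smooth (f i)) \<Longrightarrow> (\<And>i. i \<in> snd ` set ts \<Longrightarrow> smooth (g i)) \<Longrightarrow>
    cop ts (\<lambda>i x. f i x - g i x) = (\<lambda>x. cop ts f x - cop ts g x)"
  by (induction ts) (auto simp: cop_Cons cds_diff)

subsection \<open>Averaging a function against a kernel\<close>

definition locally_integrable :: "('b::euclidean_space \<Rightarrow> real) \<Rightarrow> bool" where
  "locally_integrable K \<longleftrightarrow> K \<in> borel_measurable borel \<and>
     (\<forall>R. integrable lborel (\<lambda>y. indicator (cball 0 R) y * K y))"

text \<open>The kernel lives on its own space and is carried into \<open>'a\<close> by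
  \<open>J\<close>, so that one construction covers partial convolution along a slice, plain
  integration (\<open>K = 1\<close>) and polynomial weights on a half space. The sign in
  \<open>x + J y\<close> is that of a correlation; the Newtonian kernel is even.\<close>

definition kconv :: "('b::euclidean_space \<Rightarrow> real) \<Rightarrow> ('b \<Rightarrow> 'a::euclidean_space) \<Rightarrow> ('a \<Rightarrow> complex) \<Rightarrow> 'a \<Rightarrow> complex" where
  "kconv K J f x = (LINT y|lborel. of_real (K y) * f (x + J y))"

lemma test_on_lipschitz:
  fixes f :: "'a::euclidean_space \<Rightarrow> complex"
  assumes "test_on UNIV f"
  obtains C where "C \<ge> 0" "\<And>x y. norm (f x - f y) \<le> C * norm (x - y)"
proof -
  have "\<forall>b\<in>Basis. \<exists>B. \<forall>x. norm (dir_deriv b f x) \<le> B"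
    using test_on_bounded[OF test_on_dir_deriv[OF assms]] by metis
  then obtain B where B: "\<And>b x. b \<in> Basis \<Longrightarrow> norm (dir_deriv b f x) \<le> B b" by metis
  define C where "C = (\<Sum>b\<in>Basis. B b)"
  have B0: "B b \<ge> 0" if "b \<in> Basis" for b using B[OF that, of 0] norm_ge_zero order_trans by blast
  have d: "f differentiable (at x)" for x using assms test_on_smooth smooth_differentiable by blast
  have bd: "norm (dir_deriv v f x) \<le> C * norm v" for v x
  proof -
    have "norm (dir_deriv v f x) \<le> (\<Sum>b\<in>Basis. norm ((v \<bullet> b) *\<^sub>R dir_deriv b f x))"
      by (subst dir_deriv_expand[OF d]) (rule norm_sum)
    also have "\<dots> \<le> (\<Sum>b\<in>Basis. norm v * B b)"
      by (intro sum_mono) (auto intro!: mult_mono B Basis_le_norm)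
    finally show ?thesis by (simp add: C_def sum_distrib_left mult.commute)
  qed
  have "norm (f x - f y) \<le> C * norm (x - y)" for x y
  proof (rule differentiable_bound[of UNIV f "\<lambda>x v. dir_deriv v f x"])
    show "onorm (\<lambda>v. dir_deriv v f x) \<le> C" for x
      using onorm_bound[OF sum_nonneg] bd B0 by (metis C_def onorm_bound sum_nonneg)
  qed (auto intro: has_derivative_dir_deriv d)
  moreover have "C \<ge> 0" unfolding C_def using B0 by (intro sum_nonneg) auto
  ultimately show ?thesis using that by blast
qed

text \<open>The constant does not depend on the base point, as the first derivatives are globally
  Lipschitz; this is what permits integrating the remainder against a kernel.\<close>

lemma test_on_taylor:
  fixes f :: "'a::euclidean_space \<Rightarrow> complex"
  assumes "test_on UNIV f"
  obtains C where "C \<ge> 0" "\<And>z h. norm (f (z + h) - f z - dir_deriv h f z) \<le> C * (norm h)\<^sup>2"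
proof -
  have "\<forall>b\<in>Basis. \<exists>B\<ge>0. \<forall>x y. norm (dir_deriv b f x - dir_deriv b f y) \<le> B * norm (x - y)"
    using test_on_lipschitz[OF test_on_dir_deriv[OF assms]] by metis
  then obtain B where B0: "\<And>b. b \<in> Basis \<Longrightarrow> B b \<ge> 0"
    and B: "\<And>b x y. b \<in> Basis \<Longrightarrow> norm (dir_deriv b f x - dir_deriv b f y) \<le> B b * norm (x - y)" by metis
  define C where "C = (\<Sum>b\<in>Basis. B b)"
  have C0: "C \<ge> 0" unfolding C_def using B0 by (intro sum_nonneg) auto
  have d: "f differentiable (at x)" for x using assms test_on_smooth smooth_differentiable by blast
  have bd: "norm (dir_deriv v f x - dir_deriv v f y) \<le> (C * norm (x - y)) * norm v" for v x y
  proof -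
    have "norm (dir_deriv v f x - dir_deriv v f y) = norm (\<Sum>b\<in>Basis. (v \<bullet> b) *\<^sub>R (dir_deriv b f x - dir_deriv b f y))"
      by (subst (1 2) dir_deriv_expand[OF d]) (simp add: sum_subtractf scaleR_diff_right)
    also have "\<dots> \<le> (\<Sum>b\<in>Basis. norm ((v \<bullet> b) *\<^sub>R (dir_deriv b f x - dir_deriv b f y)))"
      by (rule norm_sum)
    also have "\<dots> \<le> (\<Sum>b\<in>Basis. norm v * (B b * norm (x - y)))"
      by (intro sum_mono) (auto intro!: mult_mono B Basis_le_norm)
    also have "\<dots> = (C * norm (x - y)) * norm v"
      by (simp add: C_def sum_distrib_left sum_distrib_right mult_ac)
    finally show ?thesis .
  qed
  have "norm (f (z + h) - f z - dir_deriv h f z) \<le> C * (norm h)\<^sup>2" for z h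
  proof -
    have "norm (f (z + h) - f z - (\<lambda>v. dir_deriv v f z) (z + h - z)) \<le> norm (z + h - z) * (C * norm h)"
    proof (rule differentiable_bound_linearization[of z "z + h" "cball z (norm h)" f "\<lambda>x v. dir_deriv v f x" z])
      fix x assume "x \<in> cball z (norm h)"
      then have x: "norm (x - z) \<le> norm h" by (simp add: dist_norm norm_minus_commute)
      have "onorm (\<lambda>v. dir_deriv v f x - dir_deriv v f z) \<le> C * norm h"
      proof (rule onorm_bound)
        show "norm (dir_deriv v f x - dir_deriv v f z) \<le> C * norm h * norm v" for v
          using bd[of v x z] mult_right_mono[OF mult_left_mono[OF x C0], of "norm v"] by simp
      qed (use C0 in simp)
      then show "onorm ((\<lambda>v. dir_deriv v f x) - (\<lambda>v. dir_deriv v f z)) \<le> C * norm h"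
        by (simp add: fun_diff_def)
    qed (auto simp: dist_norm mult_left_le_one_le intro: has_derivative_at_withinI[OF has_derivative_dir_deriv[OF d]])
    then show ?thesis by (simp add: power2_eq_square mult_ac)
  qed
  then show ?thesis using that C0 by blast
qed

locale kernel_op =
  fixes K :: "'b::euclidean_space \<Rightarrow> real" and J :: "'b \<Rightarrow> 'a::euclidean_space"
  assumes li: "locally_integrable K" and lin: "linear J" and iso: "\<And>y. norm (J y) = norm y"
begin

lemma borel_J [measurable]: "J \<in> borel_measurable borel"
  using lin by (intro borel_measurable_continuous_onI linear_continuous_on) (simp add: linear_conv_bounded_linear)

lemma borel_K [measurable]: "K \<in> borel_measurable borel"
  using li by (simp add: locally_integrable_def)

lemma borel_shift: "continuous_on UNIV f \<Longrightarrow> (\<lambda>y. f (x + J y)) \<in> borel_measurable borel" for f :: "'a \<Rightarrow> complex"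
proof -
  assume "continuous_on UNIV f"
  then have [measurable]: "f \<in> borel_measurable borel" by (rule borel_measurable_continuous_onI)
  show ?thesis by measurable
qed

lemma integrable_abs_ball: "integrable lborel (\<lambda>y. indicator (cball 0 R) y * \<bar>K y\<bar>)"
proof -
  have "integrable lborel (\<lambda>y. indicator (cball 0 R) y * K y)" using li by (simp add: locally_integrable_def)
  from integrable_abs[OF this] show ?thesis by (simp add: abs_mult)
qed

lemma kernel_integrable:
  fixes f :: "'a \<Rightarrow> complex"
  assumes "test_on UNIV f"
  shows "integrable lborel (\<lambda>y. of_real (K y) * f (x + J y))"
proof -
  obtain B where B: "B > 0" "\<And>x. norm (f x) \<le> B" using test_on_bounded[OF assms] by blast
  obtain L where L: "compact L" "\<forall>x. x \<notin> L \<longrightarrow> f x = 0" using assms unfolding test_on_def by blast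
  obtain R where R: "\<forall>x\<in>L. norm x \<le> R" using compact_imp_bounded[OF L(1)] bounded_iff by blast
  show ?thesis
  proof (rule Bochner_Integration.integrable_bound)
    show "integrable lborel (\<lambda>y. B * (indicator (cball 0 (R + norm x)) y * \<bar>K y\<bar>))"
      using integrable_abs_ball by (intro integrable_mult_right) auto
    show "(\<lambda>y. of_real (K y) * f (x + J y)) \<in> borel_measurable lborel"
      using borel_shift[OF test_on_continuous[OF assms]] by simp
    show "AE y in lborel. norm (of_real (K y) * f (x + J y)) \<le> norm (B * (indicator (cball 0 (R + norm x)) y * \<bar>K y\<bar>))"
    proof (rule AE_I2)
      fix y
      show "norm (of_real (K y) * f (x + J y)) \<le> norm (B * (indicator (cball 0 (R + norm x)) y * \<bar>K y\<bar>))"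
      proof (cases "norm y \<le> R + norm x")
        case True
        then show ?thesis using B mult_right_mono[OF B(2)[of "x + J y"] abs_ge_zero[of "K y"]]
            by (simp add: norm_mult mult.commute)
      next
        case False
        have "norm (x + J y) > R" using False iso[of y] norm_triangle_ineq4[of "x + J y" x] by simp
        then have "f (x + J y) = 0" using L R by force
        then show ?thesis by simp
      qed
    qed
  qed
qed

text \<open>Differentiation under the integral by a direct estimate: the uniform quadratic remainder
  is integrated against \<open>\<bar>K\<bar>\<close> over one fixed ball.\<close>

lemma kconv_has_derivative:
  fixes f :: "'a \<Rightarrow> complex"
  assumes f: "test_on UNIV f"
  shows "((kconv K J f) has_derivative (\<lambda>h. kconv K J (dir_deriv h f) x)) (at x)"
proof -
  have d: "f differentiable (at z)" for z using f test_on_smooth smooth_differentiable by blast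
  have tb: "test_on UNIV (dir_deriv b f)" if "b \<in> Basis" for b using test_on_dir_deriv[OF f that] .
  have ex: "dir_deriv h f = (\<lambda>z. \<Sum>b\<in>Basis. of_real (h \<bullet> b) * dir_deriv b f z)" for h
    by (rule ext) (subst dir_deriv_expand[OF d], simp add: scaleR_conv_of_real)
  have th: "test_on UNIV (dir_deriv h f)" for h
    by (subst ex) (intro test_on_sum test_on_mult_right tb C_infinity_on_const)
  have L: "kconv K J (dir_deriv h f) x = (\<Sum>b\<in>Basis. of_real (h \<bullet> b) * kconv K J (dir_deriv b f) x)" for h
  proof -
    have "kconv K J (dir_deriv h f) x =
        (LINT y|lborel. (\<Sum>b\<in>Basis. of_real (h \<bullet> b) * (of_real (K y) * dir_deriv b f (x + J y))))"
      unfolding kconv_def by (subst ex) (simp add: sum_distrib_left mult_ac)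
    also have "\<dots> = (\<Sum>b\<in>Basis. (LINT y|lborel. of_real (h \<bullet> b) * (of_real (K y) * dir_deriv b f (x + J y))))"
      by (rule Bochner_Integration.integral_sum) (intro integrable_mult_right kernel_integrable tb)
    finally show ?thesis by (simp add: kconv_def)
  qed
  obtain C where C: "C \<ge> 0" "\<And>z h. norm (f (z + h) - f z - dir_deriv h f z) \<le> C * (norm h)\<^sup>2"
    using test_on_taylor[OF f] by blast
  obtain S where S: "compact S" "\<forall>x. x \<notin> S \<longrightarrow> f x = 0" using f unfolding test_on_def by blast
  obtain R where R: "\<forall>x\<in>S. norm x \<le> R" using compact_imp_bounded[OF S(1)] bounded_iff by blast
  have dz: "dir_deriv h f z = 0" if "z \<notin> S" for h z
    using dir_deriv_outside_compact[OF S(1) _ that] S(2) by blast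
  \<comment> \<open>Beyond this radius neither \<open>x + J y\<close> nor \<open>x + J y + h\<close>
    with \<open>norm h \<le> 1\<close> meets the support.\<close>
  define M where "M = (LINT y|lborel. indicator (cball 0 (R + norm x + 1)) y * \<bar>K y\<bar>)"
  have M0: "M \<ge> 0" unfolding M_def by (intro integral_nonneg_AE) auto
  have est: "norm (kconv K J f (x + h) - kconv K J f x - kconv K J (dir_deriv h f) x) \<le> M * C * (norm h)\<^sup>2"
    if h: "norm h \<le> 1" for h
  proof -
    define g where "g = (\<lambda>y. of_real (K y) * (f (x + J y + h) - f (x + J y) - dir_deriv h f (x + J y)))"
    have ge: "g = (\<lambda>y. of_real (K y) * f (x + h + J y) - of_real (K y) * f (x + J y) - of_real (K y) * dir_deriv h f (x + J y))"
      by (simp add: g_def algebra_simps)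
    have gi: "integrable lborel g"
      unfolding ge by (intro Bochner_Integration.integrable_diff kernel_integrable f th)
    have "kconv K J f (x + h) - kconv K J f x - kconv K J (dir_deriv h f) x = (LINT y|lborel. g y)"
      unfolding kconv_def ge
      by (simp add: Bochner_Integration.integral_diff Bochner_Integration.integrable_diff kernel_integrable f th)
    moreover have "norm (LINT y|lborel. g y) \<le> (LINT y|lborel. (C * (norm h)\<^sup>2) * (indicator (cball 0 (R + norm x + 1)) y * \<bar>K y\<bar>))"
    proof (rule Bochner_Integration.integral_norm_bound_integral[OF gi])
      show "integrable lborel (\<lambda>y. (C * (norm h)\<^sup>2) * (indicator (cball 0 (R + norm x + 1)) y * \<bar>K y\<bar>))"
        using integrable_abs_ball by (intro integrable_mult_right) auto
      fix y :: 'b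
      show "norm (g y) \<le> (C * (norm h)\<^sup>2) * (indicator (cball 0 (R + norm x + 1)) y * \<bar>K y\<bar>)"
      proof (cases "norm y \<le> R + norm x + 1")
        case True
        then show ?thesis using mult_left_mono[OF C(2)[of "x + J y" h], of "\<bar>K y\<bar>"]
          by (simp add: g_def norm_mult mult_ac)
      next
        case False
        have n: "norm (J y) \<le> norm (x + J y) + norm x" using norm_triangle_ineq4[of "x + J y" x] by simp
        have n2: "norm (x + J y) \<le> norm (x + J y + h) + norm h" using norm_triangle_ineq4[of "x + J y + h" h] by simp
        have "norm (x + J y) > R" "norm (x + J y + h) > R" using n n2 False h iso[of y] by auto
        then have "x + J y \<notin> S" "x + J y + h \<notin> S" using R by force+
        then have "f (x + J y + h) = 0" "f (x + J y) = 0" "dir_deriv h f (x + J y) = 0" using S dz by auto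
        then show ?thesis by (simp add: g_def C(1))
      qed
    qed
    moreover have "(LINT y|lborel. (C * (norm h)\<^sup>2) * (indicator (cball 0 (R + norm x + 1)) y * \<bar>K y\<bar>)) = (C * (norm h)\<^sup>2) * M"
      unfolding M_def by (rule integral_mult_right_zero)
    moreover have "(C * (norm h)\<^sup>2) * M = M * C * (norm h)\<^sup>2" by simp
    ultimately show ?thesis by (simp only:)
  qed
  have bl: "bounded_linear (\<lambda>h. kconv K J (dir_deriv h f) x)"
  proof -
    have "linear (\<lambda>h. \<Sum>b\<in>Basis. of_real (h \<bullet> b) * kconv K J (dir_deriv b f) x)"
      by (rule linearI) (auto simp: inner_add_left algebra_simps sum.distrib sum_distrib_left scaleR_conv_of_real)
    moreover have "(\<lambda>h. kconv K J (dir_deriv h f) x) = (\<lambda>h. \<Sum>b\<in>Basis. of_real (h \<bullet> b) * kconv K J (dir_deriv b f) x)"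
      by (rule ext, rule L)
    ultimately show ?thesis by (simp only: linear_conv_bounded_linear)
  qed
  show ?thesis
    unfolding has_derivative_at_alt
  proof (intro conjI allI impI bl)
    fix e :: real assume e: "e > 0"
    define \<delta> where "\<delta> = min 1 (e / (M * C + 1))"
    have MC: "M * C \<ge> 0" using M0 C by simp
    have "\<delta> > 0" using e MC by (simp add: \<delta>_def)
    moreover have "norm (kconv K J f y - kconv K J f x - kconv K J (dir_deriv (y - x) f) x) \<le> e * norm (y - x)"
      if y: "norm (y - x) < \<delta>" for y
    proof -
      have "norm (kconv K J f y - kconv K J f x - kconv K J (dir_deriv (y - x) f) x) \<le> M * C * (norm (y - x))\<^sup>2"
        using est[of "y - x"] y by (simp add: \<delta>_def)
      also have "\<dots> = (M * C * norm (y - x)) * norm (y - x)" by (simp add: power2_eq_square)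
      also have "M * C * norm (y - x) \<le> (M * C + 1) * (e / (M * C + 1))"
        using y MC by (intro mult_mono) (auto simp: \<delta>_def)
      also have "\<dots> = e" using MC by simp
      finally show ?thesis by (simp add: mult_right_mono)
    qed
    ultimately show "\<exists>d>0. \<forall>y. norm (y - x) < d \<longrightarrow>
        norm (kconv K J f y - kconv K J f x - kconv K J (dir_deriv (y - x) f) x) \<le> e * norm (y - x)" by blast
  qed
qed

lemma dir_deriv_kconv:
  "test_on UNIV f \<Longrightarrow> dir_deriv v (kconv K J f) x = kconv K J (dir_deriv v f) x"
  by (rule dir_deriv_eqI[OF kconv_has_derivative])

lemma smooth_kconv:
  assumes "test_on UNIV f"
  shows "smooth (kconv K J f)"
proof -
  have "Cn_on n UNIV (kconv K J f)" for n using assms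
  proof (induction n arbitrary: f)
    case 0
    then show ?case using kconv_has_derivative differentiable_def by (metis Cn_on.simps(1))
  next
    case (Suc n)
    have "dir_deriv b (kconv K J f) = kconv K J (dir_deriv b f)" for b
      using dir_deriv_kconv[OF Suc.prems] by blast
    moreover have "\<forall>x\<in>UNIV. kconv K J f differentiable at x"
      using kconv_has_derivative[OF Suc.prems] differentiable_def by blast
    ultimately show ?case using Suc.IH test_on_dir_deriv[OF Suc.prems] by simp
  qed
  then show ?thesis unfolding C_infinity_on_iff_Cn_on by blast
qed

lemma kconv_cmult: "kconv K J (\<lambda>x. c * f x) = (\<lambda>x. c * kconv K J f x)"
  by (rule ext) (simp add: kconv_def mult.left_commute)

lemma kconv_add: "test_on UNIV f \<Longrightarrow> test_on UNIV g \<Longrightarrow>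
    kconv K J (\<lambda>x. f x + g x) = (\<lambda>x. kconv K J f x + kconv K J g x)"
  by (rule ext) (simp add: kconv_def distrib_left kernel_integrable)

lemma kconv_sum: "(\<And>i. i \<in> I \<Longrightarrow> test_on UNIV (f i)) \<Longrightarrow>
    kconv K J (\<lambda>x. \<Sum>i\<in>I. f i x) = (\<lambda>x. \<Sum>i\<in>I. kconv K J (f i) x)"
proof (induction I rule: infinite_finite_induct)
  case (insert i I)
  then show ?case by (simp add: kconv_add test_on_sum)
qed (auto simp: kconv_def)

lemma cd_kconv: "test_on UNIV f \<Longrightarrow> cd \<xi> (kconv K J f) = kconv K J (cd \<xi> f)"
proof
  fix x assume f: "test_on UNIV f"
  have "kconv K J (cd \<xi> f) x = (\<Sum>b\<in>Basis. \<xi> b * kconv K J (dir_deriv b f) x)"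
    unfolding cd_def[abs_def]
    by (subst kconv_sum) (auto simp: kconv_cmult intro!: test_on_mult_right test_on_dir_deriv f C_infinity_on_const)
  then show "cd \<xi> (kconv K J f) x = kconv K J (cd \<xi> f) x"
    by (simp add: cd_def dir_deriv_kconv f)
qed

lemma cds_kconv: "test_on UNIV f \<Longrightarrow> foldr cd \<xi>s (kconv K J f) = kconv K J (foldr cd \<xi>s f)"
  by (induction \<xi>s) (auto simp: cd_kconv test_on_cds)

lemma cop_kconv:
  "(\<And>i. i \<in> snd ` set ts \<Longrightarrow> test_on UNIV (f i)) \<Longrightarrow> cop ts (\<lambda>i. kconv K J (f i)) = kconv K J (cop ts f)"
  by (induction ts) (auto simp: cop_Cons cds_kconv kconv_add test_on_cds test_on_cop, auto simp: kconv_def)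

end

section \<open>Integration by parts for test functions\<close>

lemma lborel_integral_affine:
  fixes f :: "'a::euclidean_space \<Rightarrow> complex"
  assumes c: "c \<noteq> 0" and [measurable]: "f \<in> borel_measurable borel"
  shows "(LINT x|lborel. f x) = \<bar>c\<bar> ^ DIM('a) *\<^sub>R (LINT x|lborel. f (t + c *\<^sub>R x))"
  by (subst lborel_affine[OF c, of t])
     (simp add: integral_density integral_distr)

lemma lborel_integral_translate:
  fixes f :: "'a::euclidean_space \<Rightarrow> complex"
  assumes "f \<in> borel_measurable borel"
  shows "(LINT x|lborel. f (t + x)) = (LINT x|lborel. f x)"
  using lborel_integral_affine[of 1 f t] assms by simp

lemma locally_integrable_const: "locally_integrable (\<lambda>_. c)"
  unfolding locally_integrable_def
proof (intro conjI allI)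
  fix R
  show "integrable lborel (\<lambda>y::'a. indicator (cball 0 R) y * c)"
    by (intro integrable_mult_left integrable_real_indicator)
       (use emeasure_lborel_cball_finite[of 0 R] in auto)
qed simp

text \<open>Against the constant kernel \<open>1\<close> the convolution is translation invariant,
  hence constant; its derivative is the integral in question.\<close>

lemma integral_dir_deriv_zero:
  fixes f :: "'a::euclidean_space \<Rightarrow> complex"
  assumes "test_on UNIV f"
  shows "(LINT x|lborel. dir_deriv b f x) = 0"
proof -
  interpret kernel_op "\<lambda>_. 1" "\<lambda>y::'a. y"
    by unfold_locales (auto simp: locally_integrable_const linear_id[unfolded id_def])
  have [measurable]: "f \<in> borel_measurable borel"
    by (rule borel_measurable_continuous_onI[OF test_on_continuous[OF assms]])
  have "kconv (\<lambda>_. 1) (\<lambda>y. y) f = (\<lambda>x. LINT x|lborel. f x)"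
    by (rule ext) (simp add: kconv_def lborel_integral_translate)
  then have "dir_deriv b (kconv (\<lambda>_. 1) (\<lambda>y. y) f) 0 = 0" by simp
  then show ?thesis using dir_deriv_kconv[OF assms, of b 0] by (simp add: kconv_def)
qed

lemma test_on_integrable:
  fixes f :: "'a::euclidean_space \<Rightarrow> complex"
  assumes "test_on UNIV f"
  shows "integrable lborel f"
proof -
  interpret kernel_op "\<lambda>_. 1" "\<lambda>y::'a. y"
    by unfold_locales (auto simp: locally_integrable_const linear_id[unfolded id_def])
  show ?thesis using kernel_integrable[OF assms, of 0] by simp
qed

lemma integral_cd_zero:
  assumes "test_on UNIV f"
  shows "(LINT x|lborel. cd \<xi> f x) = 0"
  unfolding cd_def
  using test_on_integrable[OF test_on_dir_deriv[OF assms]]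
  by (subst Bochner_Integration.integral_sum) (auto simp: integral_dir_deriv_zero[OF assms])

lemma integral_cd_by_parts:
  assumes "smooth f" "smooth g" "test_on UNIV f \<or> test_on UNIV g"
  shows "(LINT x|lborel. cd \<xi> f x * g x) = - (LINT x|lborel. f x * cd \<xi> g x)"
proof -
  have t: "test_on UNIV (\<lambda>x. f x * g x)" "test_on UNIV (\<lambda>x. cd \<xi> f x * g x)" "test_on UNIV (\<lambda>x. f x * cd \<xi> g x)"
    using assms by (auto intro: test_on_mult_left test_on_mult_right test_on_cd smooth_cd)
  have "(LINT x|lborel. f x * cd \<xi> g x + cd \<xi> f x * g x) = 0"
    using integral_cd_zero[OF t(1), of \<xi>] by (simp add: cd_mult assms)
  then show ?thesis
    by (subst (asm) Bochner_Integration.integral_add) (auto intro: test_on_integrable t simp: eq_neg_iff_add_eq_0 add.commute)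
qed

lemma integral_cds_by_parts:
  assumes "smooth f" "smooth g" "test_on UNIV f \<or> test_on UNIV g"
  shows "(LINT x|lborel. foldr cd \<xi>s f x * g x) = (-1) ^ length \<xi>s * (LINT x|lborel. f x * foldr cd \<xi>s g x)"
  using assms(2,3)
proof (induction \<xi>s arbitrary: g)
  case (Cons \<xi> \<xi>s)
  have "(LINT x|lborel. cd \<xi> (foldr cd \<xi>s f) x * g x) = - (LINT x|lborel. foldr cd \<xi>s f x * cd \<xi> g x)"
    using Cons.prems assms(1) by (intro integral_cd_by_parts) (auto intro: smooth_cds test_on_cds)
  also have "(LINT x|lborel. foldr cd \<xi>s f x * cd \<xi> g x) =
      (-1) ^ length \<xi>s * (LINT x|lborel. f x * foldr cd \<xi>s (cd \<xi> g) x)"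
    using Cons.prems by (intro Cons.IH) (auto intro: smooth_cd test_on_cd)
  finally show ?case using Cons.prems by (simp add: cd_cds_commute)
qed simp

subsection \<open>The fundamental solution of the Laplacian\<close>

text \<open>This takes the place of polar coordinates: a radial bound is a series of multiples of
  indicators of balls, whose measures are known. The origin, where a singular kernel escapes the
  bound, is a null set.\<close>

lemma integrable_dyadic_bound:
  fixes f :: "'b::euclidean_space \<Rightarrow> real"
  assumes [measurable]: "f \<in> borel_measurable borel"
    and a: "\<And>j. 0 \<le> a j" and r: "\<And>j. 0 \<le> r j"
    and summ: "summable (\<lambda>j::nat. a j * r j ^ DIM('b))"
    and bd: "\<And>y. y \<noteq> 0 \<Longrightarrow> f y = 0 \<or> (\<exists>j. \<bar>f y\<bar> \<le> a j \<and> norm y \<le> r j)"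
  shows "integrable lborel f"
proof (rule integrableI_bounded)
  have "(\<integral>\<^sup>+ y. ennreal (norm (f y)) \<partial>lborel) \<le> (\<integral>\<^sup>+ (y::'b). (\<Sum>j. ennreal (a j) * indicator (cball 0 (r j)) y) \<partial>lborel)"
  proof (rule nn_integral_mono_AE)
    have "AE y in lborel. y \<noteq> (0::'b)" by (rule AE_lborel_singleton)
    then show "AE y in lborel. ennreal (norm (f y)) \<le> (\<Sum>j. ennreal (a j) * indicator (cball 0 (r j)) y)"
    proof eventually_elim
      case (elim y)
      show ?case
      proof (cases "f y = 0")
        case False
        then obtain j where j: "\<bar>f y\<bar> \<le> a j" "norm y \<le> r j" using bd[OF elim] by blast
        have "ennreal (norm (f y)) \<le> ennreal (a j) * indicator (cball 0 (r j)) y"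
          using j by (simp add: ennreal_leI)
        also have "\<dots> \<le> (\<Sum>j. ennreal (a j) * indicator (cball 0 (r j)) y)"
        proof -
          define g where "g = (\<lambda>i. ennreal (a i) * indicator (cball 0 (r i)) y)"
          have "sum g {j} \<le> suminf g" by (rule sum_le_suminf) (auto intro: summableI)
          moreover have "sum g {j} = g j" by simp
          ultimately show ?thesis by (simp only: g_def)
        qed
        finally show ?thesis .
      qed simp
    qed
  qed
  also have "\<dots> = (\<Sum>j. ennreal (unit_ball_vol (DIM('b)) * (a j * r j ^ DIM('b))))"
  proof (subst nn_integral_suminf)
    fix j
    show "(\<lambda>y::'b. ennreal (a j) * indicator (cball 0 (r j)) y) \<in> borel_measurable lborel"
      by (intro borel_measurable_times_ennreal borel_measurable_const borel_measurable_indicator) auto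
  next
    have "(\<integral>\<^sup>+ (y::'b). ennreal (a j) * indicator (cball 0 (r j)) y \<partial>lborel) =
        ennreal (unit_ball_vol (DIM('b)) * (a j * r j ^ DIM('b)))" for j
      using a[of j] r[of j]
      by (subst nn_integral_cmult_indicator) (auto simp: emeasure_cball ennreal_mult'[symmetric] mult_ac)
    then show "(\<Sum>j. \<integral>\<^sup>+ (y::'b). ennreal (a j) * indicator (cball 0 (r j)) y \<partial>lborel) =
        (\<Sum>j. ennreal (unit_ball_vol (DIM('b)) * (a j * r j ^ DIM('b))))" by simp
  qed
  also have "\<dots> < \<infinity>"
  proof -
    have "(\<Sum>j. ennreal (unit_ball_vol (DIM('b)) * (a j * r j ^ DIM('b)))) \<noteq> top"
      by (intro ennreal_suminf_neq_top summable_mult summ mult_nonneg_nonneg a zero_le_power r) simp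
    then show ?thesis by (simp add: less_top)
  qed
  finally show "(\<integral>\<^sup>+ y. ennreal (norm (f y)) \<partial>lborel) < \<infinity>" .
qed auto

lemma dyadic_interval:
  fixes x :: real
  assumes "x \<ge> 1"
  obtains j :: nat where "2 ^ j \<le> x" "x < 2 ^ Suc j"
proof -
  have ex: "\<exists>j::nat. x < 2 ^ j" using real_arch_pow[of 2 x] by auto
  define k where "k = (LEAST j::nat. x < 2 ^ j)"
  have k: "x < 2 ^ k" unfolding k_def using ex by (rule LeastI_ex)
  have "k \<noteq> 0" using k assms by (cases k) auto
  then obtain j where j: "k = Suc j" by (cases k) auto
  have "\<not> x < 2 ^ j" using j not_less_Least[of j "\<lambda>j. x < 2 ^ j"] k_def by auto
  then show ?thesis using that[of j] k j by auto
qed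

text \<open>In dimension \<open>2*m+2\<close> with \<open>s = 0\<close> this is
  \<open>norm y\<close> to the power \<open>2 - DIM\<close>, the Newtonian kernel up to a constant
  factor; a positive \<open>s\<close> removes the singularity. The even dimension keeps the exponent
  a natural number.\<close>

definition newton :: "nat \<Rightarrow> real \<Rightarrow> 'b::euclidean_space \<Rightarrow> real" where
  "newton m s y = inverse ((y \<bullet> y + s) ^ m)"

lemma borel_newton [measurable]: "newton m s \<in> borel_measurable borel"
  unfolding newton_def[abs_def] by measurable

lemma borel_of_real_newton: "(\<lambda>y. complex_of_real (newton m s y)) \<in> borel_measurable borel"
  by (rule measurable_compose[OF borel_newton borel_measurable_of_real])

lemma newton_nonneg: "s \<ge> 0 \<Longrightarrow> newton m s y \<ge> 0"
  by (simp add: newton_def)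

lemma two_power_square: "((2 ^ j)\<^sup>2 :: real) = 4 ^ j"
proof -
  have "((2 ^ j)\<^sup>2 :: real) = (2\<^sup>2) ^ j" by (simp only: power_mult[symmetric] mult.commute)
  then show ?thesis by simp
qed

lemma newton_locally_integrable:
  assumes "DIM('b::euclidean_space) = 2 * m + 2"
  shows "locally_integrable (newton m 0 :: 'b \<Rightarrow> real)"
  unfolding locally_integrable_def
proof (intro conjI allI)
  fix R0 :: real
  define R where "R = max R0 1"
  have R: "R > 0" "R0 \<le> R" by (auto simp: R_def)
  show "integrable lborel (\<lambda>y::'b. indicator (cball 0 R0) y * newton m 0 y)"
  proof (rule integrable_dyadic_bound)
    show "(\<lambda>y::'b. indicator (cball 0 R0) y * newton m 0 y) \<in> borel_measurable borel"
      by (intro borel_measurable_times borel_measurable_indicator borel_newton borel_closed closed_cball)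
    \<comment> \<open>Dyadic shells around the origin: \<open>?a j\<close> bounds the kernel outside
      radius \<open>R / 2 ^ Suc j\<close>, and the shell lies in the ball of radius
      \<open>?r j\<close>. The kernel grows like the radius to the power \<open>-2m\<close> against
      a volume of degree \<open>2m+2\<close>, which leaves the ratio \<open>1/4\<close>.\<close>
    let ?a = "\<lambda>j::nat. inverse ((R / 2 ^ Suc j) ^ (2 * m))"
    let ?r = "\<lambda>j::nat. R / 2 ^ j"
    have "?a j * ?r j ^ DIM('b) = (R\<^sup>2 * 2 ^ (2 * m)) * (1/4) ^ j" for j
    proof -
      have "?a j * ?r j ^ DIM('b) = (2 ^ Suc j) ^ (2 * m) / R ^ (2 * m) * (R ^ (2 * m) * R\<^sup>2 / ((2 ^ j) ^ (2 * m) * (2 ^ j)\<^sup>2))"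
        unfolding assms by (simp add: power_divide power_add power2_eq_square)
      also have "\<dots> = R\<^sup>2 * ((2 ^ Suc j) ^ (2 * m) / (2 ^ j) ^ (2 * m)) / (2 ^ j)\<^sup>2"
        using R by (simp add: field_simps)
      also have "(2 ^ Suc j) ^ (2 * m) / (2 ^ j) ^ (2 * m) = (2 ^ (2 * m) :: real)"
        by (simp add: power_mult_distrib)
      also have "((2 ^ j)\<^sup>2 :: real) = 4 ^ j" by (rule two_power_square)
      finally show ?thesis by (simp add: power_divide)
    qed
    then show "summable (\<lambda>j. ?a j * ?r j ^ DIM('b))"
      by (simp add: summable_mult summable_geometric)
    fix y :: 'b assume y: "y \<noteq> 0"
    show "indicator (cball 0 R0) y * newton m 0 y = 0 \<or>
        (\<exists>j. \<bar>indicator (cball 0 R0) y * newton m 0 y\<bar> \<le> ?a j \<and> norm y \<le> ?r j)"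
    proof (cases "norm y \<le> R0")
      case True
      then have "R / norm y \<ge> 1" using R y by simp
      then obtain j where j: "2 ^ j \<le> R / norm y" "R / norm y < 2 ^ Suc j" using dyadic_interval by blast
      have 1: "norm y \<le> R / 2 ^ j" "R / 2 ^ Suc j \<le> norm y" using j y by (auto simp: field_simps)
      have "newton m 0 y = inverse (norm y ^ (2 * m))"
        by (simp add: newton_def power_mult power2_norm_eq_inner)
      also have "\<dots> \<le> ?a j" using 1(2) R by (intro le_imp_inverse_le power_mono) auto
      finally show ?thesis using 1 True newton_nonneg[of 0 m y] by auto
    qed auto
  qed (use R in auto)
qed measurable

text \<open>The profile is, up to a constant, the Laplacian of the regularised kernel at
  \<open>s = 1\<close>. It decays like the radius to the power \<open>-(2m+4)\<close> in dimension
  \<open>2m+2\<close>, so the shells between consecutive powers of two sum geometrically.\<close>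

lemma newton_profile_integrable:
  assumes "DIM('b::euclidean_space) = 2 * m + 2"
  shows "integrable lborel (newton (m + 2) 1 :: 'b \<Rightarrow> real)"
proof (rule integrable_dyadic_bound)
  let ?a = "\<lambda>j::nat. inverse ((2 ^ j)\<^sup>2 ^ (m + 2)) :: real"
  let ?r = "\<lambda>j::nat. 2 ^ Suc j :: real"
  have "?a j * ?r j ^ DIM('b) = 2 ^ (2 * m + 2) * (1/4) ^ j" for j
  proof -
    have 4: "((2 ^ j)\<^sup>2 :: real) = 4 ^ j" by (rule two_power_square)
    have "?r j ^ DIM('b) = 2 ^ (2 * m + 2) * ((2 ^ j)\<^sup>2) ^ (m + 1)"
      unfolding assms by (simp add: power_mult_distrib power_mult[symmetric] power_add[symmetric] algebra_simps)
    then have "?r j ^ DIM('b) = 2 ^ (2 * m + 2) * (4 ^ j) ^ (m + 1)" by (simp only: 4)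
    then have "?a j * ?r j ^ DIM('b) = 2 ^ (2 * m + 2) * ((4 ^ j) ^ (m + 1) / (4 ^ j) ^ (m + 2))"
      unfolding 4 by (simp add: divide_inverse)
    also have "(4 ^ j) ^ (m + 1) / (4 ^ j) ^ (m + 2) = (1 / 4 ^ j :: real)" by (simp add: field_simps)
    finally show ?thesis by (simp add: power_divide)
  qed
  then show "summable (\<lambda>j. ?a j * ?r j ^ DIM('b))"
    by (simp add: summable_mult summable_geometric)
  fix y :: 'b assume "y \<noteq> 0"
  show "newton (m + 2) 1 y = 0 \<or> (\<exists>j. \<bar>newton (m + 2) 1 y\<bar> \<le> ?a j \<and> norm y \<le> ?r j)"
  proof (cases "norm y \<ge> 1")
    case True
    then obtain j where j: "2 ^ j \<le> norm y" "norm y < 2 ^ Suc j" using dyadic_interval by blast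
    have "(2 ^ j)\<^sup>2 \<le> (norm y)\<^sup>2" using j by (intro power_mono) auto
    then have "newton (m + 2) 1 y \<le> ?a j"
      unfolding newton_def by (intro le_imp_inverse_le power_mono) (auto simp: power2_norm_eq_inner)
    then show ?thesis using j newton_nonneg[of 1 "m+2" y] by (intro disjI2 exI[of _ j]) auto
  next
    case False
    have "newton (m + 2) 1 y \<le> inverse (1 ^ (m + 2))"
      unfolding newton_def by (intro le_imp_inverse_le power_mono) auto
    then show ?thesis using False newton_nonneg[of 1 "m+2" y] by (intro disjI2 exI[of _ 0]) auto
  qed
qed (auto simp del: power_Suc)

section \<open>The Laplacian of the regularised kernel\<close>

definition laplacian :: "('a::euclidean_space \<Rightarrow> complex) \<Rightarrow> 'a \<Rightarrow> complex" where
  "laplacian f x = (\<Sum>b\<in>Basis. dir_deriv b (dir_deriv b f) x)"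

lemma cd_basis: "b \<in> Basis \<Longrightarrow> cd (\<lambda>c. if c = b then 1 else 0) f = dir_deriv b f"
  by (rule ext) (simp add: cd_def if_distrib[of "\<lambda>z. z * _"] sum.delta cong: if_cong)

lemma integral_dir_deriv_by_parts:
  fixes f g :: "'a::euclidean_space \<Rightarrow> complex"
  assumes "smooth f" "smooth g" "test_on UNIV f \<or> test_on UNIV g" "b \<in> Basis"
  shows "(LINT x|lborel. dir_deriv b f x * g x) = - (LINT x|lborel. f x * dir_deriv b g x)"
  using integral_cd_by_parts[OF assms(1-3), of "\<lambda>c. if c = b then 1 else 0"]
  by (simp add: cd_basis assms(4))

lemma test_on_laplacian: "test_on U f \<Longrightarrow> test_on U (laplacian f)"
  unfolding laplacian_def[abs_def] by (intro test_on_sum test_on_dir_deriv)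

lemma integral_laplacian_symmetric:
  fixes f g :: "'a::euclidean_space \<Rightarrow> complex"
  assumes "smooth f" "test_on UNIV g"
  shows "(LINT x|lborel. f x * laplacian g x) = (LINT x|lborel. laplacian f x * g x)"
proof -
  have sg: "smooth g" using assms test_on_smooth by blast
  have t: "test_on UNIV (dir_deriv b g)" "test_on UNIV (dir_deriv b (dir_deriv b g))" if "b \<in> Basis" for b
    using that test_on_dir_deriv assms(2) by blast+
  have s: "smooth (dir_deriv b f)" "smooth (dir_deriv b (dir_deriv b f))" if "b \<in> Basis" for b
    using that smooth_dir_deriv assms(1) by blast+
  have "(LINT x|lborel. f x * dir_deriv b (dir_deriv b g) x) = (LINT x|lborel. dir_deriv b (dir_deriv b f) x * g x)"
    if b: "b \<in> Basis" for b
    using integral_dir_deriv_by_parts[OF assms(1) test_on_smooth[OF t(1)[OF b]] disjI2[OF t(1)[OF b]] b]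
      integral_dir_deriv_by_parts[OF s(1)[OF b] sg disjI2[OF assms(2)] b] by simp
  moreover have "(LINT x|lborel. f x * laplacian g x) = (\<Sum>b\<in>Basis. (LINT x|lborel. f x * dir_deriv b (dir_deriv b g) x))"
    unfolding laplacian_def sum_distrib_left
    by (rule Bochner_Integration.integral_sum) (intro test_on_integrable test_on_mult_right t assms)
  moreover have "(LINT x|lborel. laplacian f x * g x) = (\<Sum>b\<in>Basis. (LINT x|lborel. dir_deriv b (dir_deriv b f) x * g x))"
    unfolding laplacian_def sum_distrib_right
    by (rule Bochner_Integration.integral_sum) (intro test_on_integrable test_on_mult_right s assms)
  ultimately show ?thesis by simp
qed

lemma newton_smooth:
  assumes "s > 0"
  shows "smooth (\<lambda>y::'b::euclidean_space. complex_of_real (newton m s y))"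
proof -
  have "smooth (\<lambda>y::'b. (y \<bullet> y + s) ^ m)"
    by (intro C_infinity_on_power C_infinity_on_add C_infinity_on_bilinear[OF _ bounded_bilinear_inner]
        C_infinity_on_id C_infinity_on_const) auto
  then have "smooth (\<lambda>y::'b. inverse ((y \<bullet> y + s) ^ m))"
    by (rule C_infinity_on_inverse[OF open_UNIV]) (use assms in \<open>auto simp: add_nonneg_eq_0_iff\<close>)
  then show ?thesis
    unfolding newton_def by (intro C_infinity_on_of_real) auto
qed

lemma newton_dir_deriv:
  assumes "s > 0"
  shows "dir_deriv b (\<lambda>y::'b::euclidean_space. complex_of_real (newton m s y)) =
    (\<lambda>y. of_real (- 2 * real m * (y \<bullet> b) * newton (m + 1) s y))"
proof
  fix y :: 'b
  have pos: "y \<bullet> y + s > 0" using assms by (simp add: add_nonneg_pos)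
  have "((\<lambda>y::'b. inverse ((y \<bullet> y + s) ^ m)) has_derivative
      (\<lambda>v. - (inverse ((y \<bullet> y + s) ^ m) * (real m * (y \<bullet> v + v \<bullet> y) * (y \<bullet> y + s) ^ (m - 1)) * inverse ((y \<bullet> y + s) ^ m)))) (at y)"
    using pos by (auto intro!: derivative_eq_intros simp: mult_ac)
  then have "dir_deriv b (\<lambda>y::'b. complex_of_real (inverse ((y \<bullet> y + s) ^ m))) y =
     of_real (- (inverse ((y \<bullet> y + s) ^ m) * (real m * (y \<bullet> b + b \<bullet> y) * (y \<bullet> y + s) ^ (m - 1)) * inverse ((y \<bullet> y + s) ^ m)))"
    by (intro dir_deriv_eqI[THEN trans, OF bounded_linear.has_derivative[OF bounded_linear_of_real]]) auto
  also have "- (inverse ((y \<bullet> y + s) ^ m) * (real m * (y \<bullet> b + b \<bullet> y) * (y \<bullet> y + s) ^ (m - 1)) * inverse ((y \<bullet> y + s) ^ m)) =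
     - 2 * real m * (y \<bullet> b) * newton (m + 1) s y"
  proof -
    have "- (inverse (t ^ m) * (real m * c * t ^ (m - 1)) * inverse (t ^ m)) = - real m * c * inverse (t ^ (m + 1))"
      if "t > 0" for t c :: real
      using that by (cases m) (auto simp: field_simps)
    from this[OF pos, of "y \<bullet> b + b \<bullet> y"] show ?thesis unfolding newton_def by (simp add: inner_commute)
  qed
  finally show "dir_deriv b (\<lambda>y::'b. complex_of_real (newton m s y)) y =
     of_real (- 2 * real m * (y \<bullet> b) * newton (m + 1) s y)" unfolding newton_def[of m] .
qed

text \<open>In dimension \<open>2*m+2\<close> the terms without the factor \<open>s\<close> cancel.
  What remains concentrates at the origin as \<open>s\<close> tends to \<open>0\<close>, with total
  mass \<open>newton_const\<close> for every \<open>s\<close>.\<close>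

lemma newton_laplacian:
  assumes s: "s > 0" and dim: "DIM('b::euclidean_space) = 2 * m + 2"
  shows "laplacian (\<lambda>y::'b. complex_of_real (newton m s y)) y =
    of_real (- 4 * real m * (real m + 1) * s * newton (m + 2) s y)"
proof -
  have pos: "y \<bullet> y + s > 0" using s by (simp add: add_nonneg_pos)
  have "dir_deriv b (dir_deriv b (\<lambda>y::'b. complex_of_real (newton m s y))) y =
      of_real (- 2 * real m * (newton (m + 1) s y) + 4 * real m * (real m + 1) * newton (m + 2) s y * (y \<bullet> b)\<^sup>2)"
    if b: "b \<in> Basis" for b
  proof -
    have d1: "(\<lambda>y::'b. complex_of_real (newton (m + 1) s y)) differentiable (at y)"
      by (rule smooth_differentiable[OF newton_smooth[OF s]])
    have sm: "smooth (\<lambda>y::'b. complex_of_real (- 2 * real m * (y \<bullet> b)))"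
      by (intro C_infinity_on_of_real C_infinity_on_mult C_infinity_on_const C_infinity_on_inner) auto
    have dd: "dir_deriv b (\<lambda>y::'b. complex_of_real (- 2 * real m * (y \<bullet> b))) y = of_real (- 2 * real m)"
      by (rule dir_deriv_eqI[THEN trans, OF bounded_linear.has_derivative[OF bounded_linear_of_real]])
         (use b in \<open>auto intro!: derivative_eq_intros\<close>)
    have e: "dir_deriv b (\<lambda>y::'b. complex_of_real (newton m s y)) =
        (\<lambda>y. of_real (- 2 * real m * (y \<bullet> b)) * complex_of_real (newton (m + 1) s y))"
      unfolding newton_dir_deriv[OF s] by simp
    show ?thesis
      unfolding e
      by (subst dir_deriv_mult[OF smooth_differentiable[OF sm] d1], subst newton_dir_deriv[OF s], subst dd)
         (simp add: power2_eq_square algebra_simps numeral_2_eq_2)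
  qed
  then have "laplacian (\<lambda>y::'b. complex_of_real (newton m s y)) y =
     of_real (\<Sum>b\<in>(Basis::'b set). - 2 * real m * (newton (m + 1) s y) + 4 * real m * (real m + 1) * newton (m + 2) s y * (y \<bullet> b)\<^sup>2)"
    unfolding laplacian_def by simp
  also have "(\<Sum>b\<in>(Basis::'b set). - 2 * real m * (newton (m + 1) s y) + 4 * real m * (real m + 1) * newton (m + 2) s y * (y \<bullet> b)\<^sup>2)
     = - 2 * real m * (2 * real m + 2) * newton (m + 1) s y + 4 * real m * (real m + 1) * newton (m + 2) s y * (y \<bullet> y)"
    unfolding sum.distrib sum_distrib_left[symmetric] euclidean_inner[of y y]
    by (simp add: dim power2_eq_square)
  also have "newton (m + 1) s y = (y \<bullet> y + s) * newton (m + 2) s y"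
  proof -
    have "inverse (t ^ (m + 1)) = t * inverse (t ^ (m + 2))" if "t > 0" for t :: real
      using that by (simp add: field_simps)
    then show ?thesis unfolding newton_def using pos by blast
  qed
  also have "- 2 * real m * (2 * real m + 2) * ((y \<bullet> y + s) * newton (m + 2) s y) + 4 * real m * (real m + 1) * newton (m + 2) s y * (y \<bullet> y)
     = - 4 * real m * (real m + 1) * s * newton (m + 2) s y"
    by (simp add: algebra_simps)
  finally show ?thesis by simp
qed

definition newton_const :: "'b::euclidean_space itself \<Rightarrow> nat \<Rightarrow> complex" where
  "newton_const _ m = of_real (- 4 * real m * (real m + 1) * (LINT y|lborel. newton (m + 2) 1 (y::'b)))"

lemma newton_const_nonzero:
  assumes dim: "DIM('b::euclidean_space) = 2 * m + 2" and m: "m \<ge> 1"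
  shows "newton_const TYPE('b) m \<noteq> 0"
proof -
  have "(LINT y|lborel. newton (m + 2) 1 (y::'b)) \<noteq> 0"
  proof
    assume "(LINT y|lborel. newton (m + 2) 1 (y::'b)) = 0"
    then have "AE y in lborel. newton (m + 2) 1 (y::'b) = 0"
      by (subst (asm) integral_nonneg_eq_0_iff_AE[OF newton_profile_integrable[OF dim]])
         (auto simp: newton_nonneg)
    moreover have "newton (m + 2) 1 (y::'b) \<noteq> 0" for y
      by (simp add: newton_def add_nonneg_eq_0_iff)
    ultimately have "AE y in (lborel :: 'b measure). False" by simp
    then show False by (simp add: trivial_limit_def[symmetric] ae_filter_eq_bot_iff eventually_False)
  qed
  then show ?thesis unfolding newton_const_def of_real_eq_0_iff mult_eq_0_iff using m by auto
qed

text \<open>The kernel is regularised by \<open>s = \<epsilon>^2\<close>, the Laplacian is moved to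
  it, and the variable is rescaled by \<open>\<epsilon>\<close>. Dominated convergence applies on
  both sides: with the bound \<open>newton m 0\<close> before the rescaling, with the integrable
  profile after it.\<close>

lemma newton_fundamental:
  fixes \<phi> :: "'b::euclidean_space \<Rightarrow> complex"
  assumes dim: "DIM('b) = 2 * m + 2" and \<phi>: "test_on UNIV \<phi>"
  shows "(LINT y|lborel. of_real (newton m 0 y) * laplacian \<phi> y) = newton_const TYPE('b) m * \<phi> 0"
proof -
  define \<epsilon> where "\<epsilon> = (\<lambda>i::nat. 1 / real (Suc i))"
  have \<epsilon>: "\<epsilon> i > 0" for i by (simp add: \<epsilon>_def)
  have \<epsilon>0: "\<epsilon> \<longlonglongrightarrow> 0" unfolding \<epsilon>_def using LIMSEQ_inverse_real_of_nat by (simp add: inverse_eq_divide)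
  have lt: "test_on UNIV (laplacian \<phi>)" by (rule test_on_laplacian[OF \<phi>])
  have [measurable]: "laplacian \<phi> \<in> borel_measurable borel" "\<phi> \<in> borel_measurable borel"
    using borel_measurable_continuous_onI test_on_continuous lt \<phi> by blast+
  interpret ko: kernel_op "newton m 0 :: 'b \<Rightarrow> real" "\<lambda>y::'b. y"
    by unfold_locales (auto simp: newton_locally_integrable[OF dim] linear_id[unfolded id_def])
  have int0: "integrable lborel (\<lambda>y. of_real (newton m 0 y) * laplacian \<phi> y)"
    using ko.kernel_integrable[OF lt, of 0] by simp
  have L: "(\<lambda>i. LINT y|lborel. of_real (newton m ((\<epsilon> i)\<^sup>2) y) * laplacian \<phi> y) \<longlonglongrightarrow>
      (LINT y|lborel. of_real (newton m 0 y) * laplacian \<phi> y)"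
  proof (rule integral_dominated_convergence[where w = "\<lambda>y. norm (of_real (newton m 0 y) * laplacian \<phi> y)"])
    show "integrable lborel (\<lambda>y. norm (of_real (newton m 0 y) * laplacian \<phi> y))" using int0 by (rule integrable_norm)
    have ae: "AE y in lborel. y \<noteq> (0::'b)" by (rule AE_lborel_singleton)
    show "AE y in lborel. (\<lambda>i. of_real (newton m ((\<epsilon> i)\<^sup>2) y) * laplacian \<phi> y) \<longlonglongrightarrow> of_real (newton m 0 y) * laplacian \<phi> y"
      using ae
    proof eventually_elim
      case (elim y)
      have "(\<lambda>i. inverse ((y \<bullet> y + (\<epsilon> i)\<^sup>2) ^ m)) \<longlonglongrightarrow> inverse ((y \<bullet> y + 0\<^sup>2) ^ m)"
        using elim by (intro tendsto_inverse tendsto_power tendsto_add tendsto_const \<epsilon>0) auto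
      then show ?case unfolding newton_def by (intro tendsto_mult tendsto_of_real tendsto_const) simp
    qed
    show "AE y in lborel. norm (of_real (newton m ((\<epsilon> i)\<^sup>2) y) * laplacian \<phi> y) \<le> norm (of_real (newton m 0 y) * laplacian \<phi> y)" for i
      using ae
    proof eventually_elim
      case (elim y)
      have "newton m ((\<epsilon> i)\<^sup>2) y \<le> newton m 0 y"
        unfolding newton_def using elim by (intro le_imp_inverse_le power_mono) auto
      then show ?case using newton_nonneg[of "(\<epsilon> i)\<^sup>2" m y] newton_nonneg[of 0 m y]
        by (simp add: norm_mult mult_right_mono)
    qed
  qed auto
  obtain B where B: "B > 0" "\<And>x. norm (\<phi> x) \<le> B" using test_on_bounded[OF \<phi>] by blast
  have Ri: "(\<lambda>i. LINT z|lborel. of_real (newton (m + 2) 1 z) * \<phi> (\<epsilon> i *\<^sub>R z)) \<longlonglongrightarrow>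
      (LINT z|lborel. of_real (newton (m + 2) 1 (z::'b)) * \<phi> 0)"
  proof (rule integral_dominated_convergence[where w = "\<lambda>y::'b. newton (m + 2) 1 y * B"])
    show "integrable lborel (\<lambda>y::'b. newton (m + 2) 1 y * B)"
      by (intro integrable_mult_left newton_profile_integrable dim)
    show "AE y in lborel. (\<lambda>i. of_real (newton (m + 2) 1 y) * \<phi> (\<epsilon> i *\<^sub>R y)) \<longlonglongrightarrow> of_real (newton (m + 2) 1 y) * \<phi> 0"
    proof (rule AE_I2)
      fix y :: 'b
      have "(\<lambda>i. \<phi> (\<epsilon> i *\<^sub>R y)) \<longlonglongrightarrow> \<phi> (0 *\<^sub>R y)"
        using test_on_continuous[OF \<phi>, of UNIV]
        by (intro isCont_tendsto_compose[of _ \<phi>] tendsto_intros \<epsilon>0) (simp add: continuous_on_eq_continuous_at)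
      then show "(\<lambda>i. of_real (newton (m + 2) 1 y) * \<phi> (\<epsilon> i *\<^sub>R y)) \<longlonglongrightarrow> of_real (newton (m + 2) 1 y) * \<phi> 0"
        by (intro tendsto_intros) simp
    qed
    show "AE y in lborel. norm (of_real (newton (m + 2) 1 y) * \<phi> (\<epsilon> i *\<^sub>R y)) \<le> newton (m + 2) 1 y * B" for i
      using B by (intro AE_I2) (simp add: norm_mult abs_of_nonneg newton_nonneg mult_left_mono)
    have meas: "(\<lambda>y. \<phi> (\<epsilon> i *\<^sub>R y)) \<in> borel_measurable borel" for i
      by (intro borel_measurable_continuous_onI continuous_on_compose2[OF test_on_continuous[OF \<phi>, of UNIV]]
          continuous_intros) auto
    show "(\<lambda>y. of_real (newton (m + 2) 1 y) * \<phi> (\<epsilon> i *\<^sub>R y)) \<in> borel_measurable lborel" for i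
      using borel_measurable_times[OF borel_of_real_newton meas] by simp
    show "(\<lambda>y::'b. of_real (newton (m + 2) 1 y) * \<phi> 0) \<in> borel_measurable lborel"
      using borel_measurable_times[OF borel_of_real_newton borel_measurable_const] by simp
  qed
  have eq: "(LINT y|lborel. of_real (newton m ((\<epsilon> i)\<^sup>2) y) * laplacian \<phi> y) =
      of_real (- 4 * real m * (real m + 1)) * (LINT z|lborel. of_real (newton (m + 2) 1 z) * \<phi> (\<epsilon> i *\<^sub>R z))" for i
  proof -
    have e2: "(\<epsilon> i)\<^sup>2 > 0" using \<epsilon>[of i] by simp
    have "(LINT y|lborel. of_real (newton m ((\<epsilon> i)\<^sup>2) y) * laplacian \<phi> y) =
        (LINT y|lborel. of_real (- 4 * real m * (real m + 1)) * (of_real ((\<epsilon> i)\<^sup>2 * newton (m + 2) ((\<epsilon> i)\<^sup>2) y) * \<phi> y))"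
      by (subst integral_laplacian_symmetric[OF newton_smooth[OF e2] \<phi>])
         (simp only: newton_laplacian[OF e2 dim] of_real_mult mult.assoc)
    also have "\<dots> = of_real (- 4 * real m * (real m + 1)) * (LINT y|lborel. of_real ((\<epsilon> i)\<^sup>2 * newton (m + 2) ((\<epsilon> i)\<^sup>2) y) * \<phi> y)"
      by (rule integral_mult_right_zero)
    also have "(LINT y|lborel. of_real ((\<epsilon> i)\<^sup>2 * newton (m + 2) ((\<epsilon> i)\<^sup>2) y) * \<phi> y) =
        \<bar>\<epsilon> i\<bar> ^ DIM('b) *\<^sub>R (LINT z|lborel. of_real ((\<epsilon> i)\<^sup>2 * newton (m + 2) ((\<epsilon> i)\<^sup>2) (0 + \<epsilon> i *\<^sub>R z)) * \<phi> (0 + \<epsilon> i *\<^sub>R z))"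
      using \<epsilon>[of i] by (intro lborel_integral_affine) auto
    also have "\<dots> = (LINT z|lborel. of_real (newton (m + 2) 1 z) * \<phi> (\<epsilon> i *\<^sub>R z))"
    proof -
      \<comment> \<open>The powers of \<open>\<epsilon> i\<close> balance: \<open>2m+2\<close> from
        the volume and \<open>2\<close> from the factor \<open>s\<close>, against
        \<open>2(m+2)\<close> in the denominator.\<close>
      have "\<bar>\<epsilon> i\<bar> ^ DIM('b) * ((\<epsilon> i)\<^sup>2 * newton (m + 2) ((\<epsilon> i)\<^sup>2) (\<epsilon> i *\<^sub>R z)) = newton (m + 2) 1 z" for z :: 'b
      proof -
        have "(\<epsilon> i *\<^sub>R z) \<bullet> (\<epsilon> i *\<^sub>R z) + (\<epsilon> i)\<^sup>2 = (\<epsilon> i)\<^sup>2 * (z \<bullet> z + 1)" by (simp add: power2_eq_square algebra_simps)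
        then have "newton (m + 2) ((\<epsilon> i)\<^sup>2) (\<epsilon> i *\<^sub>R z) = inverse ((\<epsilon> i)\<^sup>2 ^ (m + 2)) * newton (m + 2) 1 z"
          unfolding newton_def by (simp only: power_mult_distrib inverse_mult_distrib)
        moreover have "\<bar>\<epsilon> i\<bar> ^ DIM('b) * (\<epsilon> i)\<^sup>2 = (\<epsilon> i)\<^sup>2 ^ (m + 2)"
          using \<epsilon>[of i] by (simp add: dim power_mult[symmetric] power_add[symmetric] algebra_simps)
        moreover have "(\<epsilon> i)\<^sup>2 ^ (m + 2) * inverse ((\<epsilon> i)\<^sup>2 ^ (m + 2)) = 1"
          using e2 by (intro right_inverse power_not_zero) simp
        ultimately show ?thesis by (metis mult.assoc mult.left_neutral)
      qed
      then have "\<bar>\<epsilon> i\<bar> ^ DIM('b) *\<^sub>R (of_real ((\<epsilon> i)\<^sup>2 * newton (m + 2) ((\<epsilon> i)\<^sup>2) (0 + \<epsilon> i *\<^sub>R z)) * \<phi> (0 + \<epsilon> i *\<^sub>R z)) =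
          of_real (newton (m + 2) 1 z) * \<phi> (\<epsilon> i *\<^sub>R z)" for z :: 'b
        unfolding scaleR_conv_of_real add_0 mult.assoc[symmetric] of_real_mult[symmetric] by simp
      then show ?thesis
        unfolding integral_scaleR_right[symmetric] by simp
    qed
    finally show ?thesis .
  qed
  have "(\<lambda>i. LINT y|lborel. of_real (newton m ((\<epsilon> i)\<^sup>2) y) * laplacian \<phi> y) \<longlonglongrightarrow>
     of_real (- 4 * real m * (real m + 1)) * (LINT z|lborel. of_real (newton (m + 2) 1 (z::'b)) * \<phi> 0)"
    unfolding eq by (intro tendsto_intros Ri)
  also have "of_real (- 4 * real m * (real m + 1)) * (LINT z|lborel. of_real (newton (m + 2) 1 (z::'b)) * \<phi> 0) = newton_const TYPE('b) m * \<phi> 0"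
    by (simp add: newton_const_def)
  finally show ?thesis using L LIMSEQ_unique by blast
qed

lemma newton_kernel_op:
  fixes J :: "'b::euclidean_space \<Rightarrow> 'a::euclidean_space"
  assumes "DIM('b) = 2 * m + 2" "linear J" "\<And>y. norm (J y) = norm y"
  shows "kernel_op (newton m 0) J"
  using assms newton_locally_integrable[OF assms(1)] by (simp add: kernel_op_def)

lemma dir_deriv_affine:
  assumes "linear J" "smooth f"
  shows "dir_deriv b (\<lambda>y::'b::euclidean_space. f (x + J y)) y = dir_deriv (J b) f (x + J y)"
proof -
  have bl: "bounded_linear J" using assms(1) linear_conv_bounded_linear by blast
  have "((\<lambda>y. x + J y) has_derivative J) (at y)"
    by (auto intro!: derivative_eq_intros bounded_linear_imp_has_derivative bl)
  from has_derivative_compose[OF this has_derivative_dir_deriv[OF smooth_differentiable[OF assms(2)]]]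
  show ?thesis by (rule dir_deriv_eqI)
qed

lemma test_on_affine:
  fixes J :: "'b::euclidean_space \<Rightarrow> 'a::euclidean_space"
  assumes "linear J" "\<And>y. norm (J y) = norm y" "test_on UNIV f"
  shows "test_on UNIV (\<lambda>y. f (x + J y))"
proof -
  have bl: "bounded_linear J" using assms(1) linear_conv_bounded_linear by blast
  have "smooth (\<lambda>y. f (x + J y))"
    by (rule C_infinity_on_compose[OF _ _ _ test_on_smooth[OF assms(3)]])
       (use C_infinity_on_add[OF open_UNIV C_infinity_on_const C_infinity_on_linear[OF bl]] in auto)
  moreover obtain L where L: "compact L" "\<forall>x. x \<notin> L \<longrightarrow> f x = 0" using assms(3) unfolding test_on_def by blast
  obtain R where R: "\<forall>x\<in>L. norm x \<le> R" using compact_imp_bounded[OF L(1)] bounded_iff by blast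
  have "f (x + J y) = 0" if "y \<notin> cball 0 (R + norm x)" for y
  proof -
    have "norm (x + J y) > R" using that assms(2)[of y] norm_triangle_ineq4[of "x + J y" x] by simp
    then show ?thesis using L R by force
  qed
  ultimately show ?thesis unfolding test_on_def by (auto intro!: exI[of _ "cball 0 (R + norm x)"])
qed

text \<open>The fundamental solution is applied on the affine slice \<open>x + J y\<close>, where
  the derivatives along \<open>J b\<close> are ordinary partial derivatives; the remaining variables
  are parameters.\<close>

lemma newton_slice:
  fixes J :: "'b::euclidean_space \<Rightarrow> 'a::euclidean_space"
  assumes dim: "DIM('b) = 2 * m + 2" and J: "linear J" "\<And>y. norm (J y) = norm y"
    and JB: "\<And>b. b \<in> Basis \<Longrightarrow> J b \<in> Basis" and f: "test_on UNIV f"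
  shows "kconv (newton m 0) J (\<lambda>z. \<Sum>b\<in>Basis. dir_deriv (J b) (dir_deriv (J b) f) z) x =
    newton_const TYPE('b) m * f x"
proof -
  have sf: "smooth f" by (rule test_on_smooth[OF f])
  have "laplacian (\<lambda>y. f (x + J y)) y = (\<Sum>b\<in>Basis. dir_deriv (J b) (dir_deriv (J b) f) (x + J y))" for y
    unfolding laplacian_def
  proof (rule sum.cong[OF refl])
    fix b :: 'b assume b: "b \<in> Basis"
    have "dir_deriv b (\<lambda>y. f (x + J y)) = (\<lambda>y. dir_deriv (J b) f (x + J y))"
      by (rule ext) (rule dir_deriv_affine[OF J(1) sf])
    then show "dir_deriv b (dir_deriv b (\<lambda>y. f (x + J y))) y = dir_deriv (J b) (dir_deriv (J b) f) (x + J y)"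
      using dir_deriv_affine[OF J(1) smooth_dir_deriv[OF sf JB[OF b]]] by simp
  qed
  then have "kconv (newton m 0) J (\<lambda>z. \<Sum>b\<in>Basis. dir_deriv (J b) (dir_deriv (J b) f) z) x =
      (LINT y|lborel. of_real (newton m 0 y) * laplacian (\<lambda>y. f (x + J y)) y)"
    unfolding kconv_def by simp
  also have "\<dots> = newton_const TYPE('b) m * f (x + J 0)"
    using newton_fundamental[OF dim test_on_affine[OF J f]] .
  finally show ?thesis by (simp add: linear_0[OF J(1)])
qed

subsection \<open>Unique continuation for harmonic functions\<close>

lemma newton_potential:
  fixes f :: "'a::euclidean_space \<Rightarrow> complex"
  assumes dim: "DIM('a) = 2 * m + 2" and f: "test_on UNIV f"
  shows "(LINT z|lborel. of_real (newton m 0 (z - x)) * laplacian f z) = newton_const TYPE('a) m * f x"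
proof -
  have [measurable]: "laplacian f \<in> borel_measurable borel"
    using borel_measurable_continuous_onI test_on_continuous test_on_laplacian[OF f] by blast
  have m1: "(\<lambda>z. complex_of_real (newton m 0 (z - x))) \<in> borel_measurable borel"
    by (rule measurable_compose[OF _ borel_of_real_newton]) measurable
  have "(LINT z|lborel. of_real (newton m 0 (x + z - x)) * laplacian f (x + z)) =
     (LINT z|lborel. of_real (newton m 0 (z - x)) * laplacian f z)"
    by (rule lborel_integral_translate[of "\<lambda>z. of_real (newton m 0 (z - x)) * laplacian f z"])
       (intro borel_measurable_times m1, measurable)
  moreover have "kconv (newton m 0) (\<lambda>y. y) (laplacian f) x = newton_const TYPE('a) m * f x"
    using newton_slice[OF dim, of "\<lambda>y. y" f x] f
    by (simp add: laplacian_def[abs_def] linear_id[unfolded id_def])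
  ultimately show ?thesis by (simp add: kconv_def)
qed

text \<open>Along a real line through \<open>q\<close> the Newtonian potential of a density vanishing near \<open>q\<close> extends
  holomorphically to a complex neighbourhood of the parameter. In the denominator \<open>|z - q|\<^sup>2\<close> is replaced by
  its maximum with \<open>r\<^sup>2\<close>, which changes nothing where the density is nonzero.\<close>

lemma harmonic_zero_propagates:
  fixes u :: "'a::euclidean_space \<Rightarrow> complex"
  assumes dim: "DIM('a) = 2 * m + 2" and m1: "m \<ge> 1" and u: "smooth u"
    and r: "r > 0" and harm: "\<And>x. x \<in> ball q (3 * r) \<Longrightarrow> laplacian u x = 0"
    and Z: "open Z" "q \<in> Z" "\<And>x. x \<in> Z \<Longrightarrow> u x = 0" and x: "x \<in> ball q (r / 4)"
  shows "u x = 0"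
proof -
  obtain \<beta> :: "'a \<Rightarrow> real" where \<beta>: "test_on (cball q (2 * r)) \<beta>" "\<And>x. x \<in> cball q r \<Longrightarrow> \<beta> x = 1"
    using smooth_bump[OF r, of q] by metis
  \<comment> \<open>The cutoff makes the Newtonian representation available. Its density
    \<open>w\<close> is supported in \<open>cball q (2 * r)\<close> and vanishes on
    \<open>ball q r\<close>, where \<open>v = u\<close> is harmonic.\<close>
  define v where "v = (\<lambda>x. \<beta> x *\<^sub>R u x)"
  have tv': "test_on (cball q (2 * r)) v"
    unfolding v_def by (rule test_on_scaleR_left[OF \<beta>(1) u])
  have tv: "test_on UNIV v" by (rule test_on_UNIV[OF tv'])
  define w where "w = laplacian v"
  have tw: "test_on (cball q (2 * r)) w" unfolding w_def by (rule test_on_laplacian[OF tv'])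
  have cw: "continuous_on S w" for S using test_on_continuous[OF tw] .
  have vu: "v y = u y" if "y \<in> ball q r" for y using that \<beta>(2)[of y] by (simp add: v_def)
  have w0: "w y = 0" if y: "y \<in> ball q r" for y
  proof -
    have "dir_deriv b (dir_deriv b v) y = dir_deriv b (dir_deriv b u) y" for b
      by (rule dir_deriv_cong[of "ball q r"]) (use y vu in \<open>auto intro!: dir_deriv_cong[of "ball q r"]\<close>)
    then have "w y = laplacian u y" by (simp add: w_def laplacian_def)
    then show ?thesis using harm y r by simp
  qed
  obtain a b :: 'a where ab: "cball q (2 * r) \<subseteq> cbox a b" using bounded_subset_cbox_symmetric[of "cball q (2 * r)"] by blast
  define M where "M = (\<lambda>z::'a. max ((z - q) \<bullet> (z - q)) (r\<^sup>2))"
  define h where "h = x - q"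
  \<comment> \<open>For \<open>x = q\<close> any unit vector serves as the direction of the
    line.\<close>
  have "\<exists>h'. norm h' = 1 \<and> h = norm h *\<^sub>R h'"
  proof (cases "h = 0")
    case True
    obtain b :: 'a where "b \<in> Basis" using nonempty_Basis by blast
    then show ?thesis using True by (intro exI[of _ b]) auto
  next
    case False
    then show ?thesis by (intro exI[of _ "h /\<^sub>R norm h"]) auto
  qed
  then obtain h' where h': "norm h' = 1" "h = norm h *\<^sub>R h'" by blast
  define P where "P = (\<lambda>t::complex. \<lambda>z. of_real (M z) - 2 * t * of_real ((z - q) \<bullet> h') + t\<^sup>2)"
  \<comment> \<open>A zero would make \<open>s^2 = M z\<close> at most
    \<open>2 * (s/4) * s + (s/4)^2\<close>, which is only \<open>9/16\<close> of
    \<open>s^2\<close>.\<close>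
  have P0: "P t z \<noteq> 0" if t: "t \<in> ball (0::complex) (r/4)" for t z
  proof
    assume p: "P t z = 0"
    define s where "s = sqrt (M z)"
    have M0: "M z > 0" using r by (simp add: M_def less_max_iff_disj)
    have s: "s > 0" "s\<^sup>2 = M z" using M0 by (auto simp: s_def)
    have "r\<^sup>2 \<le> s\<^sup>2" "(norm (z - q))\<^sup>2 \<le> s\<^sup>2" unfolding s(2) by (auto simp: M_def power2_norm_eq_inner)
    then have rs: "r \<le> s" and zs: "norm (z - q) \<le> s"
      using s(1) power2_le_imp_le less_imp_le by metis+
    have tr: "norm t < s / 4" using t rs by simp
    have B: "\<bar>(z - q) \<bullet> h'\<bar> \<le> s" using Cauchy_Schwarz_ineq2[of "z - q" h'] h'(1) zs by simp
    have "of_real (M z) = 2 * t * of_real ((z - q) \<bullet> h') - t\<^sup>2" using p by (simp add: P_def algebra_simps)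
    then have "norm (of_real (M z) :: complex) \<le> norm (2 * t * of_real ((z - q) \<bullet> h')) + norm (t\<^sup>2)"
      using norm_triangle_ineq4 by metis
    also have "\<dots> = 2 * norm t * \<bar>(z - q) \<bullet> h'\<bar> + (norm t)\<^sup>2" by (simp add: norm_mult norm_power)
    also have "\<dots> \<le> 2 * (s/4) * s + (s/4)\<^sup>2"
      using tr B s by (intro add_mono mult_mono power_mono) auto
    also have "\<dots> < s\<^sup>2" using s(1) by (simp add: power2_eq_square field_simps)
    finally show False using M0 s(2) by simp
  qed
  define F where "F = (\<lambda>t. integral (cbox a b) (\<lambda>z. w z * inverse (P t z ^ m)))"
  have contM: "continuous_on S M" for S unfolding M_def by (intro continuous_intros)
  have contP: "continuous_on S (\<lambda>(t, z). P t z)" for S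
    unfolding P_def case_prod_unfold
    by (intro continuous_intros continuous_on_compose2[OF contM[of UNIV]]) auto
  have contP1: "continuous_on S (\<lambda>z. P t z)" for S t
    unfolding P_def by (intro continuous_intros contM)
  have hol: "F holomorphic_on ball 0 (r/4)"
    unfolding F_def
  proof (rule leibniz_rule_holomorphic)
    fix t :: complex and z assume t: "t \<in> ball 0 (r/4)" and "z \<in> cbox a b"
    have "((\<lambda>t. P t z) has_field_derivative (- 2 * of_real ((z - q) \<bullet> h') + 2 * t)) (at t)"
      unfolding P_def by (auto intro!: derivative_eq_intros)
    from DERIV_inverse_fun[OF DERIV_power[OF this, of m]]
    have "((\<lambda>t. inverse (P t z ^ m)) has_field_derivative
       - (inverse (P t z ^ m) * (of_nat m * ((- 2 * of_real ((z - q) \<bullet> h') + 2 * t) * P t z ^ (m - Suc 0))) * inverse (P t z ^ m))) (at t)"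
      using P0[OF t] by (simp add: mult_ac)
    from DERIV_cmult[OF this, of "w z"]
    show "((\<lambda>t. w z * inverse (P t z ^ m)) has_field_derivative
       w z * (- (inverse (P t z ^ m) * (of_nat m * ((- 2 * of_real ((z - q) \<bullet> h') + 2 * t) * P t z ^ (m - Suc 0))) * inverse (P t z ^ m)))) (at t within ball 0 (r/4))"
      by (rule has_field_derivative_at_within)
  next
    fix t :: complex assume "t \<in> ball 0 (r/4)"
    then show "(\<lambda>z. w z * inverse (P t z ^ m)) integrable_on cbox a b"
      by (intro integrable_continuous continuous_intros cw contP1) (use P0 in auto)
  next
    show "continuous_on (ball 0 (r/4) \<times> cbox a b) (\<lambda>(t, z). w z * (- (inverse (P t z ^ m) * (of_nat m * ((- 2 * of_real ((z - q) \<bullet> h') + 2 * t) * P t z ^ (m - Suc 0))) * inverse (P t z ^ m))))"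
      unfolding case_prod_unfold
      by (intro continuous_intros continuous_on_compose2[OF cw[of UNIV]] contP[unfolded case_prod_unfold])
         (use P0 in auto)
  qed auto
  have FV: "F (of_real t) = newton_const TYPE('a) m * u (q + t *\<^sub>R h')" if t: "\<bar>t\<bar> < r / 4" for t
  proof -
    have int: "w z * inverse (P (of_real t) z ^ m) = of_real (newton m 0 (z - (q + t *\<^sub>R h'))) * w z" for z
    proof (cases "z \<in> ball q r")
      case False
      then have "(norm (z - q))\<^sup>2 \<ge> r\<^sup>2" using r by (intro power_mono) (auto simp: dist_norm norm_minus_commute)
      then have "M z = (z - q) \<bullet> (z - q)" by (simp add: M_def power2_norm_eq_inner)
      then have "P (of_real t) z = of_real ((z - q) \<bullet> (z - q) - 2 * t * ((z - q) \<bullet> h') + t\<^sup>2)"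
        by (simp add: P_def)
      also have "(z - q) \<bullet> (z - q) - 2 * t * ((z - q) \<bullet> h') + t\<^sup>2 = (z - (q + t *\<^sub>R h')) \<bullet> (z - (q + t *\<^sub>R h'))"
      proof -
        have "h' \<bullet> h' = 1" using h'(1) by (simp add: norm_eq_1)
        moreover have "(c - t *\<^sub>R h') \<bullet> (c - t *\<^sub>R h') = c \<bullet> c - 2 * t * (c \<bullet> h') + t\<^sup>2 * (h' \<bullet> h')" for c
          by (simp add: inner_diff_left inner_diff_right inner_commute power2_eq_square algebra_simps)
        from this[of "z - q"] show ?thesis using calculation by (simp add: diff_diff_eq)
      qed
      finally show ?thesis by (simp add: newton_def)
    qed (simp add: w0)
    have "q + t *\<^sub>R h' \<in> ball q r" using t r h'(1) by (simp add: dist_norm)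
    then have "newton_const TYPE('a) m * u (q + t *\<^sub>R h') = newton_const TYPE('a) m * v (q + t *\<^sub>R h')" by (simp add: vu)
    also have "\<dots> = (LINT z|lborel. of_real (newton m 0 (z - (q + t *\<^sub>R h'))) * w z)"
      unfolding w_def by (rule newton_potential[OF dim tv, symmetric])
    also have "\<dots> = (LINT z|lborel. w z * inverse (P (of_real t) z ^ m))" by (simp only: int)
    also have "\<dots> = (LINT z|lborel. indicator (cbox a b) z *\<^sub>R (w z * inverse (P (of_real t) z ^ m)))"
    proof (rule Bochner_Integration.integral_cong[OF refl])
      fix z show "w z * inverse (P (of_real t) z ^ m) = indicator (cbox a b) z *\<^sub>R (w z * inverse (P (of_real t) z ^ m))"
      proof (cases "z \<in> cbox a b")
        case False
        then have "w z = 0" using ab by (intro test_on_outside[OF tw]) blast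
        then show ?thesis by simp
      qed simp
    qed
    also have "\<dots> = integral (cbox a b) (\<lambda>z. w z * inverse (P (of_real t) z ^ m))"
    proof -
      have "continuous_on (cbox a b) (\<lambda>z. w z * inverse (P (of_real t) z ^ m))"
        using t P0[of "of_real t"] by (intro continuous_intros cw contP1) auto
      then have "set_integrable lborel (cbox a b) (\<lambda>z. w z * inverse (P (of_real t) z ^ m))"
        by (intro borel_integrable_compact[folded set_integrable_def]) auto
      from set_borel_integral_eq_integral(2)[OF this] show ?thesis
        by (simp add: set_lebesgue_integral_def)
    qed
    finally show ?thesis by (simp add: F_def)
  qed
  obtain d where d: "d > 0" "ball q d \<subseteq> Z" using Z open_contains_ball by blast
  define d' where "d' = min d (r/4)"
  have d': "d' > 0" using d r by (simp add: d'_def)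
  \<comment> \<open>Near \<open>t = 0\<close> the line lies in \<open>Z\<close>, so \<open>F\<close>
    vanishes on a real interval accumulating at \<open>0\<close>, and the identity theorem carries
    this to the parameter \<open>norm h\<close> of \<open>x\<close>.\<close>
  have "F (of_real (norm h)) = 0"
  proof (rule analytic_continuation[OF hol, of "of_real ` {0<..<d'}" 0])
    show "0 islimpt complex_of_real ` {0<..<d'}"
    proof (rule islimptI)
      fix T :: "complex set" assume T: "0 \<in> T" "open T"
      then obtain e where e: "e > 0" "ball 0 e \<subseteq> T" using open_contains_ball by blast
      define t where "t = min e d' / 2"
      have "t > 0" "t < e" "t < d'" using e d' by (auto simp: t_def)
      then show "\<exists>y\<in>complex_of_real ` {0<..<d'}. y \<in> T \<and> y \<noteq> 0"
        using e by (intro bexI[of _ "of_real t"]) auto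
    qed
    fix z assume "z \<in> complex_of_real ` {0<..<d'}"
    then obtain t where t: "z = of_real t" "0 < t" "t < d'" by auto
    then have "q + t *\<^sub>R h' \<in> Z" using d h'(1) by (intro subsetD[OF d(2)]) (simp add: dist_norm d'_def)
    then show "F z = 0" using FV[of t] t Z(3) by (simp add: d'_def)
  qed (use r d' x in \<open>auto simp: d'_def h_def dist_norm norm_minus_commute\<close>)
  moreover have "F (of_real (norm h)) = newton_const TYPE('a) m * u x"
  proof -
    have "\<bar>norm h\<bar> < r / 4" using x by (simp add: h_def dist_norm norm_minus_commute)
    moreover have "q + norm h *\<^sub>R h' = x" unfolding h'(2)[symmetric] by (simp add: h_def)
    ultimately show ?thesis using FV[of "norm h"] by simp
  qed
  ultimately show ?thesis using newton_const_nonzero[OF dim m1] by simp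
qed

text \<open>The interior of the zero set is relatively closed:
  \<open>harmonic_zero_propagates\<close> reaches a fixed fraction of the radius of harmonicity,
  however small the open set of zeros around the centre is.\<close>

lemma unique_continuation:
  fixes u :: "'a::euclidean_space \<Rightarrow> complex"
  assumes dim: "DIM('a) = 2 * m + 2" and m1: "m \<ge> 1" and u: "smooth u"
    and \<Omega>: "open \<Omega>" "connected \<Omega>" "\<And>x. x \<in> \<Omega> \<Longrightarrow> laplacian u x = 0"
    and Z: "open Z" "Z \<noteq> {}" "Z \<subseteq> \<Omega>" "\<And>x. x \<in> Z \<Longrightarrow> u x = 0" and x: "x \<in> \<Omega>"
  shows "u x = 0"
proof -
  define Y where "Y = interior {y \<in> \<Omega>. u y = 0}"
  have Y: "open Y" "Y \<subseteq> \<Omega>" "\<And>y. y \<in> Y \<Longrightarrow> u y = 0"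
    unfolding Y_def using interior_subset by auto
  have ZY: "Z \<subseteq> Y" unfolding Y_def using Z by (intro interior_maximal) auto
  have cl: "p \<in> Y" if p: "p \<in> \<Omega>" "p \<in> closure Y" for p
  proof -
    obtain e where e: "e > 0" "ball p e \<subseteq> \<Omega>" using \<Omega>(1) p(1) open_contains_ball by blast
    \<comment> \<open>The point \<open>q\<close> is chosen within \<open>r/8\<close> of
      \<open>p\<close>; then \<open>ball q (3 * r)\<close> stays within \<open>e\<close> of
      \<open>p\<close>, and \<open>p\<close> lies in \<open>ball q (r/4)\<close>.\<close>
    define r where "r = e / 6"
    have r: "r > 0" using e by (simp add: r_def)
    obtain q where q: "q \<in> Y" "dist q p < r / 8" using p(2) r closure_approachable[of p Y] by (metis divide_pos_pos zero_less_numeral)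
    have "ball q (3 * r) \<subseteq> \<Omega>"
    proof
      fix y assume "y \<in> ball q (3 * r)"
      then have "dist p y < e" using q(2) r dist_triangle[of p y q] by (simp add: r_def dist_commute)
      then show "y \<in> \<Omega>" using e by auto
    qed
    then have "u y = 0" if "y \<in> ball q (r / 4)" for y
      using harmonic_zero_propagates[OF dim m1 u r _ Y(1) q(1) Y(3) that] \<Omega>(3) by blast
    moreover have "ball q (r/4) \<subseteq> \<Omega>" using \<open>ball q (3 * r) \<subseteq> \<Omega>\<close> r by (auto simp: subset_iff)
    ultimately have "ball q (r/4) \<subseteq> Y" unfolding Y_def by (intro interior_maximal) auto
    then show "p \<in> Y" using q(2) r by (auto simp: subset_iff)
  qed
  have "Y = \<Omega>"
  proof (rule ccontr)
    assume "Y \<noteq> \<Omega>"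
    then have ne: "\<Omega> - closure Y \<noteq> {}" using cl Y(2) by blast
    have "\<Omega> \<subseteq> Y \<union> (- closure Y)" using cl by blast
    moreover have "Y \<inter> (- closure Y) \<inter> \<Omega> = {}" using closure_subset by blast
    moreover have "Y \<inter> \<Omega> \<noteq> {}" using ZY Z(2) Z(3) by blast
    ultimately show False
      using connectedD[OF \<Omega>(2) Y(1), of "- closure Y"] ne by blast
  qed
  then show ?thesis using Y(3) x by blast
qed

subsection \<open>A global defining function\<close>

text \<open>\<open>\<rho>\<close> is smooth on the whole space, but its sign describes
  \<open>D\<close> only on the neighbourhood \<open>W\<close> of the boundary; elsewhere it is
  arbitrary.\<close>

locale defining_function =
  fixes D :: "'a::euclidean_space set" and \<rho> :: "'a \<Rightarrow> real" and W :: "'a set"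
  assumes open_D: "open D" and bounded_D: "bounded D" and smooth_rho: "smooth \<rho>"
    and open_W: "open W" and frontier_W: "frontier D \<subseteq> W"
    and D_iff: "\<And>x. x \<in> W \<Longrightarrow> x \<in> D \<longleftrightarrow> \<rho> x < 0"
    and drho_nonzero: "\<And>p. p \<in> frontier D \<Longrightarrow> \<exists>v. dir_deriv v \<rho> p \<noteq> 0"

lemma small_step_sign:
  fixes \<rho> :: "'a::real_normed_vector \<Rightarrow> real"
  assumes "\<rho> differentiable (at p)" "\<rho> p = 0" "dir_deriv v \<rho> p < 0"
  shows "eventually (\<lambda>t. \<rho> (p + t *\<^sub>R v) < 0) (at_right 0)"
proof -
  have "((\<lambda>t. p + t *\<^sub>R v) has_derivative (\<lambda>t. t *\<^sub>R v)) (at 0)"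
    by (auto intro!: derivative_eq_intros)
  from has_derivative_compose[OF this, of \<rho> "\<lambda>w. dir_deriv w \<rho> p"]
  have "((\<lambda>t. \<rho> (p + t *\<^sub>R v)) has_derivative (\<lambda>t. dir_deriv (t *\<^sub>R v) \<rho> p)) (at 0)"
    using has_derivative_dir_deriv[OF assms(1)] by simp
  moreover have "dir_deriv (t *\<^sub>R v) \<rho> p = dir_deriv v \<rho> p * t" for t
    using linear_scale[OF bounded_linear.linear[OF has_derivative_bounded_linear[OF has_derivative_dir_deriv[OF assms(1)]]]] by simp
  ultimately have "((\<lambda>t. \<rho> (p + t *\<^sub>R v)) has_real_derivative dir_deriv v \<rho> p) (at 0)"
    by (simp add: has_field_derivative_def)
  from DERIV_neg_dec_right[OF this assms(3)] obtain d where "d > 0" "\<And>h. 0 < h \<Longrightarrow> h < d \<Longrightarrow> \<rho> (p + h *\<^sub>R v) < 0"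
    using assms(2) by auto
  then show ?thesis by (auto simp: eventually_at_right_field)
qed

lemma dir_deriv_minus_dir:
  "f differentiable (at x) \<Longrightarrow> dir_deriv (- v) f x = - dir_deriv v f x"
  using linear_neg[OF bounded_linear.linear[OF has_derivative_bounded_linear[OF has_derivative_dir_deriv]]] by blast

text \<open>Local defining functions are glued by bumps. The differential of the sum stays nonzero
  because a direction that decreases one local function at a boundary point increases no other, so
  the terms of the derivative cannot cancel.\<close>

lemma smooth_boundary_defining_function:
  fixes D :: "'a::euclidean_space set"
  assumes "open D" "bounded D" "smooth_boundary D"
  obtains \<rho> W where "defining_function D \<rho> W"
proof -
  let ?P = "\<lambda>p (W, g). open W \<and> p \<in> W \<and> C_infinity_on W (g :: 'a \<Rightarrow> real) \<and>
     (\<forall>x\<in>W. \<exists>v. dir_deriv v g x \<noteq> 0) \<and> D \<inter> W = {x \<in> W. g x < 0}"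
  have "\<exists>Wg. ?P p Wg" if pf: "p \<in> frontier D" for p
  proof -
    obtain W \<rho> where W: "open W" "p \<in> W" "smooth_on W \<rho>"
      "\<exists>v. frechet_derivative \<rho> (at p) v \<noteq> 0" "D \<inter> W = {x \<in> W. \<rho> x < (0::real)}"
      using assms(3)[unfolded smooth_boundary_def, rule_format, OF pf] by blast
    have "C_infinity_on W \<rho>"
    proof -
      obtain W' g where g: "open W'" "W \<subseteq> W'" "C_infinity_on W' g" "\<forall>x\<in>W. g x = \<rho> x"
        using W(3) unfolding smooth_on_def by blast
      show ?thesis
        by (rule C_infinity_on_cong[OF W(1) _ C_infinity_on_subset[OF g(3,2)]]) (use g(4) in auto)
    qed
    obtain v where "dir_deriv v \<rho> p \<noteq> 0" using W(4) by (auto simp: dir_deriv_def)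
    then obtain b where b: "b \<in> Basis" "dir_deriv b \<rho> p \<noteq> 0"
      using dir_deriv_expand[OF C_infinity_on_differentiable[OF \<open>C_infinity_on W \<rho>\<close> W(2)], of v]
      by (metis (no_types, lifting) scaleR_zero_right sum.neutral)
    \<comment> \<open>The differential is given to be nonzero only at \<open>p\<close>; the
      neighbourhood is shrunk so that one fixed partial derivative stays nonzero on it.\<close>
    define W1 where "W1 = {x \<in> W. dir_deriv b \<rho> x \<noteq> 0}"
    have "continuous_on W (dir_deriv b \<rho>)"
      using C_infinity_on_continuous[OF C_infinity_on_dir_deriv[OF \<open>C_infinity_on W \<rho>\<close> b(1)]] .
    moreover have "W1 = dir_deriv b \<rho> -` (- {0}) \<inter> W" by (auto simp: W1_def)
    ultimately have "open W1" using continuous_on_open_vimage[OF W(1), of "dir_deriv b \<rho>"]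
      by (metis open_Compl closed_singleton)
    moreover have "C_infinity_on W1 \<rho>"
      by (rule C_infinity_on_subset[OF \<open>C_infinity_on W \<rho>\<close>]) (auto simp: W1_def)
    moreover have "D \<inter> W1 = {x \<in> W1. \<rho> x < 0}" using W(5) by (auto simp: W1_def)
    ultimately show ?thesis using W(2) b by (intro exI[of _ "(W1, \<rho>)"]) (auto simp: W1_def)
  qed
  then have "\<forall>p\<in>frontier D. \<exists>Wg. ?P p Wg" by blast
  from bchoice[OF this] obtain Wg where "\<forall>p\<in>frontier D. ?P p (Wg p)" by blast
  then have Wg: "\<And>p. p \<in> frontier D \<Longrightarrow> ?P p (Wg p)" by (rule bspec)
  define Wf where "Wf = (\<lambda>p. fst (Wg p))"
  define g where "g = (\<lambda>p. snd (Wg p))"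
  have W: "open (Wf p)" "p \<in> Wf p" "C_infinity_on (Wf p) (g p)" "\<And>x. x \<in> Wf p \<Longrightarrow> \<exists>v. dir_deriv v (g p) x \<noteq> 0"
     "D \<inter> Wf p = {x \<in> Wf p. g p x < 0}" if "p \<in> frontier D" for p
    using Wg[OF that] by (auto simp: Wf_def g_def case_prod_beta)
  have gd: "(g p) differentiable (at x)" if "p \<in> frontier D" "x \<in> Wf p" for p x
    using C_infinity_on_differentiable[OF W(3)] that by blast
  have g0: "g p q = 0" if p: "p \<in> frontier D" and q: "q \<in> frontier D" "q \<in> Wf p" for p q
  proof -
    have "q \<notin> D" using q(1) assms(1) by (simp add: frontier_def interior_open)
    then have ge: "g p q \<ge> 0" using W(5)[OF p] q(2) by force
    have "\<not> g p q > 0"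
    proof
      assume pos: "g p q > 0"
      have "isCont (g p) q" using gd[OF p q(2)] differentiable_imp_continuous_within by blast
      then have "eventually (\<lambda>x. g p x > 0) (nhds q)"
        using pos isCont_def order_tendstoD(1) tendsto_nhds_iff by (metis)
      moreover have "eventually (\<lambda>x. x \<in> Wf p) (nhds q)" using W(1)[OF p] q(2) eventually_nhds by blast
      ultimately have "eventually (\<lambda>x. x \<notin> D) (nhds q)"
        by eventually_elim (use W(5)[OF p] in force)
      then obtain S where S: "open S" "q \<in> S" "\<forall>x\<in>S. x \<notin> D" unfolding eventually_nhds by blast
      moreover have "q \<in> closure D" using q(1) by (simp add: frontier_def)
      ultimately show False unfolding closure_iff_nhds_not_empty by blast
    qed
    then show ?thesis using ge by simp
  qed
  \<comment> \<open>Otherwise a short step along \<open>v\<close> would lie in \<open>D\<close>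
    according to \<open>g p\<close> and outside \<open>D\<close> according to
    \<open>g p'\<close>.\<close>
  have neg: "dir_deriv v (g p') q \<le> 0"
    if p: "p \<in> frontier D" and p': "p' \<in> frontier D" and q: "q \<in> frontier D" "q \<in> Wf p" "q \<in> Wf p'"
      and v: "dir_deriv v (g p) q < 0" for p p' q v
  proof (rule ccontr)
    assume "\<not> dir_deriv v (g p') q \<le> 0"
    then have v': "dir_deriv v (\<lambda>x. - g p' x) q < 0"
      using dir_deriv_bounded_linear[OF bounded_linear_minus[OF bounded_linear_ident] gd[OF p' q(3)], of v] by simp
    have cont: "((\<lambda>t. q + t *\<^sub>R v) \<longlongrightarrow> q) (at_right 0)" by (auto intro!: tendsto_eq_intros)
    have "eventually (\<lambda>t. g p (q + t *\<^sub>R v) < 0) (at_right 0)"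
      by (rule small_step_sign[OF gd[OF p q(2)] g0[OF p q(1,2)] v])
    moreover have "eventually (\<lambda>t. - g p' (q + t *\<^sub>R v) < 0) (at_right 0)"
      by (rule small_step_sign[OF _ _ v']) (use gd[OF p' q(3)] g0[OF p' q(1,3)] in auto)
    moreover have "eventually (\<lambda>t. q + t *\<^sub>R v \<in> Wf p) (at_right 0)"
      using topological_tendstoD[OF cont W(1)[OF p] q(2)] .
    moreover have "eventually (\<lambda>t. q + t *\<^sub>R v \<in> Wf p') (at_right 0)"
      using topological_tendstoD[OF cont W(1)[OF p'] q(3)] .
    ultimately have "eventually (\<lambda>t::real. False) (at_right 0)"
    proof eventually_elim
      case (elim t)
      then have "q + t *\<^sub>R v \<in> D" using W(5)[OF p] by blast
      then show False using elim W(5)[OF p'] by force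
    qed
    then show False by simp
  qed
  have cpt: "compact (frontier D)" using assms(2) by (simp add: compact_frontier_bounded)
  have "\<exists>\<beta> V. test_on (Wf p) (\<beta> :: 'a \<Rightarrow> real) \<and> (\<forall>x. 0 \<le> \<beta> x) \<and> open V \<and> p \<in> V \<and> (\<forall>x\<in>V. \<beta> x = 1)"
    if "p \<in> frontier D" for p
    using smooth_cutoff[of "{p}" "Wf p"] W(1,2)[OF that] by (metis compact_sing empty_subsetI insert_subset)
  then have "\<forall>p\<in>frontier D. \<exists>\<beta>V. test_on (Wf p) (fst \<beta>V :: 'a \<Rightarrow> real) \<and> (\<forall>x. 0 \<le> fst \<beta>V x) \<and> open (snd \<beta>V) \<and> p \<in> snd \<beta>V \<and> (\<forall>x\<in>snd \<beta>V. fst \<beta>V x = 1)"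
    by (metis fst_conv snd_conv)
  from bchoice[OF this] obtain \<beta>V where bv: "\<forall>p\<in>frontier D. test_on (Wf p) (fst (\<beta>V p) :: 'a \<Rightarrow> real) \<and> (\<forall>x. 0 \<le> fst (\<beta>V p) x) \<and> open (snd (\<beta>V p)) \<and> p \<in> snd (\<beta>V p) \<and> (\<forall>x\<in>snd (\<beta>V p). fst (\<beta>V p) x = 1)" by blast
  define \<beta> where "\<beta> = (\<lambda>p. fst (\<beta>V p))"
  define V where "V = (\<lambda>p. snd (\<beta>V p))"
  have \<beta>: "test_on (Wf p) (\<beta> p)" "\<And>x. 0 \<le> \<beta> p x" "open (V p)" "p \<in> V p" "\<And>x. x \<in> V p \<Longrightarrow> \<beta> p x = 1"
    if "p \<in> frontier D" for p using bv that by (auto simp: \<beta>_def V_def)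
  have "frontier D \<subseteq> (\<Union>p\<in>frontier D. V p)" using \<beta>(4) by blast
  then obtain P where P: "P \<subseteq> frontier D" "finite P" "frontier D \<subseteq> (\<Union>p\<in>P. V p)"
    using compactE_image[OF cpt, of "frontier D" V] \<beta>(3) by metis
  define \<tau> where "\<tau> = (\<lambda>p x. if x \<in> Wf p then \<beta> p x *\<^sub>R g p x else 0)"
  have \<tau>t: "test_on (Wf p) (\<tau> p)" if "p \<in> P" for p
    unfolding \<tau>_def using that P(1) by (intro test_on_cut_extend W \<beta>) auto
  define \<rho> where "\<rho> = (\<lambda>x. \<Sum>p\<in>P. \<tau> p x)"
  have \<tau>s: "\<tau> p x < 0 \<longleftrightarrow> x \<in> D \<and> \<beta> p x > 0" "x \<in> D \<Longrightarrow> \<tau> p x \<le> 0" "x \<notin> D \<Longrightarrow> \<tau> p x \<ge> 0" if "p \<in> P" for p x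
  proof -
    have pf: "p \<in> frontier D" using that P(1) by blast
    have d: "x \<in> Wf p \<Longrightarrow> (x \<in> D \<longleftrightarrow> g p x < 0)" using W(5)[OF pf] by blast
    have b0: "x \<notin> Wf p \<Longrightarrow> \<beta> p x = 0" using test_on_outside[OF \<beta>(1)[OF pf]] .
    have b1: "0 \<le> \<beta> p x" by (rule \<beta>(2)[OF pf])
    show "\<tau> p x < 0 \<longleftrightarrow> x \<in> D \<and> \<beta> p x > 0"
      using d b0 b1 by (auto simp: \<tau>_def mult_less_0_iff)
    show "x \<in> D \<Longrightarrow> \<tau> p x \<le> 0" using d b1 by (auto simp: \<tau>_def mult_nonneg_nonpos)
    show "x \<notin> D \<Longrightarrow> \<tau> p x \<ge> 0" using d b1 by (auto simp: \<tau>_def)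
  qed
  have "defining_function D \<rho> (\<Union>p\<in>P. V p)"
  proof
    show "open D" "bounded D" "frontier D \<subseteq> (\<Union>p\<in>P. V p)" by fact+
    show "open (\<Union>p\<in>P. V p)" using \<beta>(3) P(1) by blast
    show "smooth \<rho>" unfolding \<rho>_def by (intro C_infinity_on_sum test_on_smooth[OF \<tau>t]) auto
    fix x assume "x \<in> (\<Union>p\<in>P. V p)"
    then obtain p where p: "p \<in> P" "x \<in> V p" by blast
    then have bp: "\<beta> p x > 0" using \<beta>(5)[of p x] P(1) by auto
    show "x \<in> D \<longleftrightarrow> \<rho> x < 0"
    proof
      assume "x \<in> D"
      then have "\<rho> x \<le> \<tau> p x"
        unfolding \<rho>_def using \<tau>s(2) p P(2) sum_nonpos[of "P - {p}" "\<lambda>p. \<tau> p x"] by (simp add: sum.remove[of P p])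
      also have "\<dots> < 0" using \<tau>s(1)[OF p(1), of x] \<open>x \<in> D\<close> bp by blast
      finally show "\<rho> x < 0" .
    next
      assume "\<rho> x < 0"
      then show "x \<in> D" using sum_nonneg[of P "\<lambda>p. \<tau> p x"] \<tau>s(3) unfolding \<rho>_def by force
    qed
  next
    fix q assume q: "q \<in> frontier D"
    then obtain p where p: "p \<in> P" "q \<in> V p" using P(3) by blast
    have pf: "p \<in> frontier D" using p P(1) by blast
    have bq: "\<beta> p q = 1" using \<beta>(5)[OF pf p(2)] .
    have qW: "q \<in> Wf p" using bq test_on_outside[OF \<beta>(1)[OF pf], of q] by auto
    \<comment> \<open>The derivative of the bump drops out, as the local function vanishes on the
      boundary.\<close>
    have dt: "dir_deriv v (\<tau> p') q = (if q \<in> Wf p' then \<beta> p' q * dir_deriv v (g p') q else 0)" if p': "p' \<in> P" for p' v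
    proof (cases "q \<in> Wf p'")
      case True
      have pf': "p' \<in> frontier D" using p' P(1) by blast
      have "dir_deriv v (\<tau> p') q = dir_deriv v (\<lambda>x. \<beta> p' x * g p' x) q"
        by (rule dir_deriv_cong[OF W(1)[OF pf'] True]) (simp add: \<tau>_def)
      also have "\<dots> = \<beta> p' q * dir_deriv v (g p') q + dir_deriv v (\<beta> p') q * g p' q"
        by (rule dir_deriv_mult[OF smooth_differentiable[OF test_on_smooth[OF \<beta>(1)[OF pf']]] gd[OF pf' True]])
      finally show ?thesis using True g0[OF pf' q True] by simp
    next
      case False
      obtain K where K: "compact K" "K \<subseteq> Wf p'" "\<forall>x. x \<notin> K \<longrightarrow> \<tau> p' x = 0" using \<tau>t[OF p'] unfolding test_on_def by blast
      then show ?thesis using False dir_deriv_outside_compact[OF K(1), of "\<tau> p'" q v] by auto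
    qed
    have "\<exists>v. dir_deriv v (g p) q < 0"
    proof -
      obtain v where v: "dir_deriv v (g p) q \<noteq> 0" using W(4)[OF pf qW] by blast
      then have "dir_deriv v (g p) q < 0 \<or> dir_deriv (- v) (g p) q < 0"
        using dir_deriv_minus_dir[OF gd[OF pf qW], of v] by linarith
      then show ?thesis by blast
    qed
    then obtain v where v: "dir_deriv v (g p) q < 0" by blast
    have "dir_deriv v \<rho> q = (\<Sum>p'\<in>P. dir_deriv v (\<tau> p') q)"
      unfolding \<rho>_def
      by (intro dir_deriv_eqI[THEN trans])
         (auto intro!: has_derivative_sum has_derivative_dir_deriv smooth_differentiable test_on_smooth \<tau>t)
    also have "\<dots> \<le> dir_deriv v (\<tau> p) q"
    proof -
      have "dir_deriv v (\<tau> p') q \<le> 0" if "p' \<in> P" for p'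
      proof -
        have pf': "p' \<in> frontier D" using that P(1) by blast
        show ?thesis using dt[OF that, of v] neg[OF pf pf' q qW _ v] \<beta>(2)[OF pf', of q]
          by (auto simp: mult_nonneg_nonpos)
      qed
      then have "(\<Sum>p'\<in>P - {p}. dir_deriv v (\<tau> p') q) \<le> 0" by (intro sum_nonpos) auto
      then show ?thesis using p P(2) by (simp add: sum.remove[of P p])
    qed
    also have "\<dots> < 0" using dt[OF p(1), of v] qW bq v by simp
    finally show "\<exists>v. dir_deriv v \<rho> q \<noteq> 0" by (intro exI[of _ v]) simp
  qed
  then show ?thesis using that by blast
qed

section \<open>First-order geometry of the boundary\<close>

context defining_function
begin

lemma rho_diff: "\<rho> differentiable (at x)"
  by (rule smooth_differentiable[OF smooth_rho])

lemma rho_frontier: "p \<in> frontier D \<Longrightarrow> \<rho> p = 0"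
proof -
  assume p: "p \<in> frontier D"
  have "p \<notin> D" using p open_D by (simp add: frontier_def interior_open)
  then have ge: "\<rho> p \<ge> 0" using D_iff frontier_W p by force
  have "\<not> \<rho> p > 0"
  proof
    assume pos: "\<rho> p > 0"
    define S where "S = W \<inter> \<rho> -` {0<..}"
    have "open S" unfolding S_def
      using smooth_continuous[OF smooth_rho, of W] open_W by (simp add: continuous_on_open_vimage Int_commute)
    moreover have "p \<in> S" "S \<inter> D = {}" using pos p frontier_W D_iff by (force simp: S_def)+
    moreover have "p \<in> closure D" using p by (simp add: frontier_def)
    ultimately show False unfolding closure_iff_nhds_not_empty by blast
  qed
  then show ?thesis using ge by simp
qed

lemma unit_normal:
  assumes "p \<in> frontier D"
  obtains N where "dir_deriv N \<rho> p = 1"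
proof -
  obtain v where v: "dir_deriv v \<rho> p \<noteq> 0" using drho_nonzero[OF assms] by blast
  have "dir_deriv (c *\<^sub>R v) \<rho> p = c * dir_deriv v \<rho> p" for c
    using linear_scale[OF bounded_linear.linear[OF has_derivative_bounded_linear[OF has_derivative_dir_deriv[OF rho_diff]]]] by simp
  then have "dir_deriv ((1 / dir_deriv v \<rho> p) *\<^sub>R v) \<rho> p = 1" using v by simp
  then show ?thesis using that by blast
qed

text \<open>Moving along a direction that increases \<open>\<rho>\<close> leaves
  \<open>closure D\<close> at once. Continuous functions that vanish off \<open>closure D\<close>
  therefore vanish on the boundary.\<close>

lemma closure_exterior: "p \<in> frontier D \<Longrightarrow> p \<in> closure (- closure D)"
proof -
  assume p: "p \<in> frontier D"
  obtain N where N: "dir_deriv N \<rho> p = 1" using unit_normal[OF p] .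
  have d: "(\<lambda>x. - \<rho> x) differentiable (at p)" using rho_diff by auto
  have "dir_deriv N (\<lambda>x. - \<rho> x) p < 0"
    using dir_deriv_bounded_linear[OF bounded_linear_minus[OF bounded_linear_ident] rho_diff, of N p] N by simp
  from small_step_sign[OF d _ this] have 1: "eventually (\<lambda>t. \<rho> (p + t *\<^sub>R N) > 0) (at_right 0)"
    using rho_frontier[OF p] by simp
  have cont: "((\<lambda>t. p + t *\<^sub>R N) \<longlongrightarrow> p) (at_right 0)" by (auto intro!: tendsto_eq_intros)
  have 2: "eventually (\<lambda>t. p + t *\<^sub>R N \<in> W) (at_right 0)"
    using topological_tendstoD[OF cont open_W] p frontier_W by blast
  have ext: "x \<notin> closure D" if "x \<in> W" "\<rho> x > 0" for x
    using that D_iff[of x] rho_frontier[of x] open_D by (auto simp: frontier_def interior_open)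
  from 1 2 have "eventually (\<lambda>t. p + t *\<^sub>R N \<in> - closure D) (at_right 0)"
    by eventually_elim (use ext in auto)
  then have "eventually (\<lambda>t. p + t *\<^sub>R N \<in> closure (- closure D)) (at_right 0)"
    by (rule eventually_mono) (rule closure_subset[THEN subsetD])
  from Lim_in_closed_set[OF closed_closure this _ cont] show ?thesis by simp
qed

text \<open>By the intermediate value theorem the segment between \<open>p + tv - \<epsilon>tN\<close> and \<open>p + tv + \<epsilon>tN\<close> meets the boundary.\<close>

lemma tangential_deriv_zero:
  fixes g :: "'a \<Rightarrow> complex"
  assumes g: "g differentiable (at p)" "\<And>x. x \<in> frontier D \<Longrightarrow> g x = 0"
    and p: "p \<in> frontier D" and v: "dir_deriv v \<rho> p = 0"
  shows "dir_deriv v g p = 0"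
proof -
  obtain N where N: "dir_deriv N \<rho> p = 1" using unit_normal[OF p] .
  define L where "L = (\<lambda>w. dir_deriv w g p)"
  have gL: "(g has_derivative L) (at p)" unfolding L_def by (rule has_derivative_dir_deriv[OF g(1)])
  interpret L: bounded_linear L using gL by (rule has_derivative_bounded_linear)
  define A where "A = (\<lambda>w. dir_deriv w \<rho> p)"
  have rA: "(\<rho> has_derivative A) (at p)" unfolding A_def by (rule has_derivative_dir_deriv[OF rho_diff])
  interpret A: bounded_linear A using rA by (rule has_derivative_bounded_linear)
  define C where "C = norm v + norm N + 1"
  have C: "C > 0" by (simp add: C_def add_nonneg_pos)
  have "norm (L v) \<le> \<epsilon> * (norm (L N) + C)" if \<epsilon>: "0 < \<epsilon>" "\<epsilon> \<le> 1" for \<epsilon>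
  proof -
    obtain d1 where d1: "d1 > 0" "\<And>y. norm (y - p) < d1 \<Longrightarrow> norm (g y - g p - L (y - p)) \<le> \<epsilon> * norm (y - p)"
      using gL \<epsilon> unfolding has_derivative_at_alt by metis
    \<comment> \<open>The accuracy \<open>\<epsilon> / (2 * C)\<close> keeps the error of
      \<open>\<rho>\<close> below half of \<open>\<epsilon> * t\<close>, the size of the linear part
      at the ends of the segment, so that the sign of \<open>\<rho>\<close> there is
      decided.\<close>
    obtain d2 where d2: "d2 > 0" "\<And>y. norm (y - p) < d2 \<Longrightarrow> norm (\<rho> y - \<rho> p - A (y - p)) \<le> (\<epsilon> / (2 * C)) * norm (y - p)"
      using rA \<epsilon> C unfolding has_derivative_at_alt by (metis divide_pos_pos mult_pos_pos zero_less_numeral)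
    obtain d3 where d3: "d3 > 0" "ball p d3 \<subseteq> W" using open_W p frontier_W open_contains_ball by (metis subsetD)
    define t where "t = min d1 (min d2 d3) / (2 * C)"
    have t: "t > 0" using d1 d2 d3 C by (simp add: t_def)
    have tC: "t * C < d1" "t * C < d2" "t * C < d3" using d1 d2 d3 C by (auto simp: t_def field_simps min_def)
    define y where "y = (\<lambda>s. p + t *\<^sub>R v + s *\<^sub>R N)"
    have ny: "norm (y s - p) \<le> t * C" if "\<bar>s\<bar> \<le> \<epsilon> * t" for s
    proof -
      have "norm (y s - p) \<le> t * norm v + \<bar>s\<bar> * norm N"
        using norm_triangle_ineq[of "t *\<^sub>R v" "s *\<^sub>R N"] t by (simp add: y_def algebra_simps)
      also have "\<bar>s\<bar> * norm N \<le> t * norm N"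
      proof (rule mult_right_mono)
        have "\<epsilon> * t \<le> 1 * t" using \<epsilon> t by (intro mult_right_mono) auto
        then show "\<bar>s\<bar> \<le> t" using that by linarith
      qed simp
      also have "t * norm v + t * norm N \<le> t * C" using t by (simp add: C_def algebra_simps)
      finally show ?thesis by simp
    qed
    have Ay: "A (y s - p) = s" for s
      using v N by (simp add: y_def A.add A.scaleR A_def[symmetric] algebra_simps) (simp add: A_def)
    have rho_est: "\<bar>\<rho> (y s) - s\<bar> \<le> \<epsilon> * t / 2" if "\<bar>s\<bar> \<le> \<epsilon> * t" for s
    proof -
      have "\<bar>\<rho> (y s) - s\<bar> \<le> (\<epsilon> / (2 * C)) * norm (y s - p)"
        using d2(2)[of "y s"] ny[OF that] tC rho_frontier[OF p] Ay by simp
      also have "\<dots> \<le> (\<epsilon> / (2 * C)) * (t * C)" using ny[OF that] \<epsilon> C by (intro mult_left_mono) auto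
      also have "\<dots> = \<epsilon> * t / 2" using C by simp
      finally show ?thesis .
    qed
    have et: "\<epsilon> * t > 0" using \<epsilon> t by simp
    have yW: "y s \<in> W" if "\<bar>s\<bar> \<le> \<epsilon> * t" for s
      using ny[OF that] tC d3(2) by (auto simp: subset_iff dist_norm norm_minus_commute)
    have "y (- (\<epsilon> * t)) \<in> D" using rho_est[of "- (\<epsilon> * t)"] et yW[of "- (\<epsilon> * t)"] D_iff by (auto simp: abs_if split: if_splits)
    moreover have "y (\<epsilon> * t) \<notin> D" using rho_est[of "\<epsilon> * t"] et yW[of "\<epsilon> * t"] D_iff by (auto simp: abs_if split: if_splits)
    moreover have "connected (y ` {- (\<epsilon> * t)..\<epsilon> * t})"
      unfolding y_def by (intro connected_continuous_image continuous_intros) auto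
    ultimately have "y ` {- (\<epsilon> * t)..\<epsilon> * t} \<inter> frontier D \<noteq> {}"
    proof (intro connected_Int_frontier)
      have m: "- (\<epsilon> * t) \<in> {- (\<epsilon> * t)..\<epsilon> * t}" "\<epsilon> * t \<in> {- (\<epsilon> * t)..\<epsilon> * t}" using et by auto
      assume "y (- (\<epsilon> * t)) \<in> D" "y (\<epsilon> * t) \<notin> D"
      then show "y ` {- (\<epsilon> * t)..\<epsilon> * t} \<inter> D \<noteq> {}" "y ` {- (\<epsilon> * t)..\<epsilon> * t} - D \<noteq> {}" using m by blast+
    qed
    then obtain s where s': "s \<in> {- (\<epsilon> * t)..\<epsilon> * t}" "y s \<in> frontier D" by blast
    then have s: "\<bar>s\<bar> \<le> \<epsilon> * t" "y s \<in> frontier D" by auto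
    have "norm (L (y s - p)) \<le> \<epsilon> * (t * C)"
    proof -
      have "norm (L (y s - p)) \<le> \<epsilon> * norm (y s - p)"
        using d1(2)[of "y s"] ny[OF s(1)] tC g(2)[OF s(2)] g(2)[OF p] by simp
      also have "\<dots> \<le> \<epsilon> * (t * C)" using ny[OF s(1)] \<epsilon> by (intro mult_left_mono) auto
      finally show ?thesis .
    qed
    moreover have "L (y s - p) = t *\<^sub>R L v + s *\<^sub>R L N"
      by (simp add: y_def L.add[symmetric] L.scaleR[symmetric] algebra_simps)
    ultimately have "norm (t *\<^sub>R L v) \<le> \<epsilon> * (t * C) + norm (s *\<^sub>R L N)"
      using norm_triangle_ineq4[of "t *\<^sub>R L v + s *\<^sub>R L N" "s *\<^sub>R L N"] by simp
    also have "norm (s *\<^sub>R L N) \<le> (\<epsilon> * t) * norm (L N)" using s(1) by (simp add: mult_right_mono)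
    finally have "t * norm (L v) \<le> t * (\<epsilon> * (norm (L N) + C))" using t by (simp add: algebra_simps)
    then show ?thesis using t by simp
  qed
  note est = this
  show ?thesis
  proof (rule ccontr)
    assume "dir_deriv v g p \<noteq> 0"
    then have Lv: "norm (L v) > 0" by (simp add: L_def)
    define B where "B = norm (L N) + C"
    have B: "B > 0" using C by (simp add: B_def add_nonneg_pos)
    define \<epsilon> where "\<epsilon> = min 1 (norm (L v) / (2 * B))"
    have "norm (L v) \<le> \<epsilon> * B" unfolding B_def by (rule est) (use Lv B in \<open>auto simp: \<epsilon>_def\<close>)
    also have "\<dots> \<le> (norm (L v) / (2 * B)) * B" using B by (intro mult_right_mono) (auto simp: \<epsilon>_def)
    also have "\<dots> = norm (L v) / 2" using B by simp
    finally show False using Lv by simp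
  qed
qed

text \<open>Subtracting a multiple of \<open>N\<close> from \<open>v\<close> leaves a tangential
  vector, so the differential of \<open>g\<close> is a multiple of that of
  \<open>\<rho>\<close>.\<close>

lemma deriv_along_normal:
  fixes g :: "'a \<Rightarrow> complex"
  assumes g: "g differentiable (at p)" "\<And>x. x \<in> frontier D \<Longrightarrow> g x = 0"
    and p: "p \<in> frontier D" and N: "dir_deriv N \<rho> p = 1"
  shows "dir_deriv v g p = of_real (dir_deriv v \<rho> p) * dir_deriv N g p"
proof -
  interpret R: bounded_linear "\<lambda>w. dir_deriv w \<rho> p"
    by (rule has_derivative_bounded_linear[OF has_derivative_dir_deriv[OF rho_diff]])
  interpret G: bounded_linear "\<lambda>w. dir_deriv w g p"
    by (rule has_derivative_bounded_linear[OF has_derivative_dir_deriv[OF g(1)]])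
  define c where "c = dir_deriv v \<rho> p"
  have "dir_deriv (v - c *\<^sub>R N) \<rho> p = 0"
    unfolding R.diff R.scaleR N by (simp add: c_def)
  then have "dir_deriv (v - c *\<^sub>R N) g p = 0"
    using tangential_deriv_zero[of g p "v - c *\<^sub>R N"] g p by blast
  then show ?thesis unfolding G.diff G.scaleR by (simp add: c_def scaleR_conv_of_real)
qed

end

subsection \<open>Jets along the boundary\<close>

lemma smooth_cutoff_ex:
  fixes K :: "'a::euclidean_space set"
  assumes "compact K" "open U" "K \<subseteq> U"
  shows "\<exists>(\<eta> :: 'a \<Rightarrow> real) V. test_on U \<eta> \<and> (\<forall>x. 0 \<le> \<eta> x \<and> \<eta> x \<le> 1) \<and> open V \<and> K \<subseteq> V \<and> V \<subseteq> U \<and> (\<forall>x\<in>V. \<eta> x = 1)"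
proof (rule smooth_cutoff[OF assms])
  fix \<eta> :: "'a \<Rightarrow> real" and V
  assume "test_on U \<eta>" "\<And>x. 0 \<le> \<eta> x" "\<And>x. \<eta> x \<le> 1" "open V" "K \<subseteq> V" "V \<subseteq> U" "\<And>x. x \<in> V \<Longrightarrow> \<eta> x = 1"
  then show ?thesis by (intro exI[of _ \<eta>] exI[of _ V] conjI allI ballI)
qed

lemma dir_deriv_foldr_commute:
  fixes f :: "'a::euclidean_space \<Rightarrow> complex"
  assumes "smooth f" "b \<in> Basis" "set vs \<subseteq> Basis"
  shows "dir_deriv b (foldr dir_deriv vs f) = foldr dir_deriv vs (dir_deriv b f)"
  using assms(3)
proof (induction vs)
  case (Cons v vs)
  have s: "smooth (foldr dir_deriv vs f)" using C_infinity_on_foldr[OF assms(1)] Cons.prems by auto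
  have "dir_deriv b (dir_deriv v (foldr dir_deriv vs f)) = dir_deriv v (dir_deriv b (foldr dir_deriv vs f))"
    using Cons.prems assms(2)
    by (intro ext dir_deriv_commute smooth_differentiable smooth_dir_deriv s) auto
  then show ?case using Cons by simp
qed simp

lemma foldr_dir_deriv_add:
  fixes f g :: "'a::euclidean_space \<Rightarrow> complex"
  assumes "smooth f" "smooth g" "set vs \<subseteq> Basis"
  shows "foldr dir_deriv vs (\<lambda>x. f x + g x) = (\<lambda>x. foldr dir_deriv vs f x + foldr dir_deriv vs g x)"
  using assms(3)
proof (induction vs)
  case (Cons v vs)
  then show ?case
    using C_infinity_on_foldr[OF assms(1), of vs] C_infinity_on_foldr[OF assms(2), of vs]
    by (auto simp: dir_deriv_add smooth_differentiable)
qed simp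

lemma foldr_dir_deriv_cmult:
  fixes f :: "'a::euclidean_space \<Rightarrow> complex"
  assumes "smooth f" "set vs \<subseteq> Basis"
  shows "foldr dir_deriv vs (\<lambda>x. c * f x) = (\<lambda>x. c * foldr dir_deriv vs f x)"
  using assms(2)
proof (induction vs)
  case (Cons v vs)
  have d: "foldr dir_deriv vs f differentiable (at x)" for x
    using C_infinity_on_foldr[OF assms(1), of vs] Cons.prems smooth_differentiable by auto
  show ?case using Cons dir_deriv_bounded_linear[OF bounded_linear_mult_right d] by auto
qed simp

lemma foldr_dir_deriv_sum:
  fixes f :: "'i \<Rightarrow> 'a::euclidean_space \<Rightarrow> complex"
  assumes "\<And>i. i \<in> I \<Longrightarrow> smooth (f i)" "set vs \<subseteq> Basis"
  shows "foldr dir_deriv vs (\<lambda>x. \<Sum>i\<in>I. f i x) = (\<lambda>x. \<Sum>i\<in>I. foldr dir_deriv vs (f i) x)"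
  using assms(1)
proof (induction I rule: infinite_finite_induct)
  case (insert i I)
  then show ?case by (simp add: foldr_dir_deriv_add[OF _ _ assms(2)] smooth_sum)
qed auto

section \<open>Symbols of constant coefficient operators\<close>

definition sg :: "('a::euclidean_space \<Rightarrow> complex) \<Rightarrow> 'a \<Rightarrow> complex" where
  "sg \<xi> n = (\<Sum>b\<in>Basis. \<xi> b * of_real (n \<bullet> b))"

lemma symb_Cons: "symb (t # ts) n w = (\<Prod>\<xi>\<leftarrow>fst t. sg \<xi> n) * w (snd t) + symb ts n w"
  by (simp add: symb_def sg_def case_prod_beta)

lemma symb_Nil [simp]: "symb [] n w = 0"
  by (simp add: symb_def)

lemma symb_cmult: "symb ts n (\<lambda>i. a * w i) = a * symb ts n w"
  by (induction ts) (auto simp: symb_Cons algebra_simps)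

context defining_function
begin

definition grad :: "'a \<Rightarrow> 'a" where
  "grad p = (\<Sum>b\<in>Basis. dir_deriv b \<rho> p *\<^sub>R b)"

lemma grad_inner: "b \<in> Basis \<Longrightarrow> grad p \<bullet> b = dir_deriv b \<rho> p"
  unfolding grad_def by simp

lemma grad_nonzero: "p \<in> frontier D \<Longrightarrow> grad p \<noteq> 0"
proof
  assume p: "p \<in> frontier D" and "grad p = 0"
  then have "dir_deriv b \<rho> p = 0" if "b \<in> Basis" for b using grad_inner[OF that, of p] by simp
  then have "dir_deriv v \<rho> p = 0" for v using dir_deriv_expand[OF rho_diff, of v] by simp
  then show False using drho_nonzero[OF p] by blast
qed

lemma smooth_drho: "b \<in> Basis \<Longrightarrow> smooth (dir_deriv b \<rho>)"
  by (rule smooth_dir_deriv[OF smooth_rho])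

lemma compact_frontier: "compact (frontier D)"
  using bounded_D by (simp add: compact_frontier_bounded)

text \<open>The reciprocal of the squared gradient exists only near the boundary; cut off, it
  becomes a global smooth function by which jets can be normalised.\<close>

lemma inverse_grad_square:
  "\<exists>q :: 'a \<Rightarrow> complex. smooth q \<and> (\<forall>p\<in>frontier D. q p * of_real (grad p \<bullet> grad p) = 1)"
proof -
  define s where "s = (\<lambda>x. \<Sum>b\<in>Basis. (dir_deriv b \<rho> x)\<^sup>2)"
  have sg: "s x = grad x \<bullet> grad x" for x
    unfolding s_def by (subst euclidean_inner) (simp add: grad_inner power2_eq_square)
  have ss: "smooth s"
    unfolding s_def by (intro C_infinity_on_sum C_infinity_on_power smooth_drho) auto
  define V where "V = s -` (- {0})"
  have oV: "open V" unfolding V_def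
    using continuous_open_vimage[of "- {0}" s] smooth_continuous[OF ss, of UNIV]
    by (auto simp: continuous_on_eq_continuous_at)
  have fV: "frontier D \<subseteq> V"
  proof
    fix x assume "x \<in> frontier D"
    from grad_nonzero[OF this] show "x \<in> V" by (simp add: V_def sg)
  qed
  obtain \<eta> :: "'a \<Rightarrow> real" and V' where \<eta>: "test_on V \<eta>" "frontier D \<subseteq> V'" "\<forall>x\<in>V'. \<eta> x = 1"
    using smooth_cutoff_ex[OF compact_frontier oV fV] by (elim exE conjE) (rule that)
  have "C_infinity_on V (\<lambda>x. inverse (complex_of_real (s x)))"
    by (rule C_infinity_on_inverse[OF oV C_infinity_on_of_real[OF oV C_infinity_on_UNIV[OF ss]]])
       (simp add: V_def)
  from test_on_smooth[OF test_on_cut_extend[OF oV this \<eta>(1)]]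
  have sm: "smooth (\<lambda>x. if x \<in> V then \<eta> x *\<^sub>R inverse (complex_of_real (s x)) else 0)" .
  show ?thesis
  proof (intro exI conjI ballI)
    show "smooth (\<lambda>x. if x \<in> V then \<eta> x *\<^sub>R inverse (complex_of_real (s x)) else 0)" by (rule sm)
    fix p assume p: "p \<in> frontier D"
    then have "\<eta> p = 1" "p \<in> V" "grad p \<bullet> grad p \<noteq> 0" using \<eta> fV grad_nonzero by auto
    then show "(if p \<in> V then \<eta> p *\<^sub>R inverse (complex_of_real (s p)) else 0) * of_real (grad p \<bullet> grad p) = 1"
      by (simp add: sg)
  qed
qed

definition dn :: "'a list \<Rightarrow> 'a \<Rightarrow> complex" where
  "dn vs p = (\<Prod>v\<leftarrow>vs. complex_of_real (dir_deriv v \<rho> p))"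

lemma dn_simps [simp]: "dn [] p = 1" "dn (v # vs) p = of_real (dir_deriv v \<rho> p) * dn vs p"
  "dn (us @ vs) p = dn us p * dn vs p"
  by (simp_all add: dn_def)

definition flat :: "nat \<Rightarrow> ('a \<Rightarrow> complex) \<Rightarrow> bool" where
  "flat m g \<longleftrightarrow> (\<forall>p\<in>frontier D. \<forall>vs. set vs \<subseteq> Basis \<and> length vs < m \<longrightarrow> foldr dir_deriv vs g p = 0)"

text \<open>This is the jet of \<open>c * \<rho>^m / fact m\<close> at a boundary point
  \<open>p\<close>: a function flat to order \<open>m\<close> along the boundary has a leading term
  of this shape.\<close>

definition jet :: "nat \<Rightarrow> ('a \<Rightarrow> complex) \<Rightarrow> 'a \<Rightarrow> complex \<Rightarrow> bool" where
  "jet m g p c \<longleftrightarrow> (\<forall>vs. set vs \<subseteq> Basis \<and> length vs \<le> m \<longrightarrow>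
     foldr dir_deriv vs g p = (if length vs = m then dn vs p * c else 0))"

lemma jet_zero_imp_flat: "(\<And>p. p \<in> frontier D \<Longrightarrow> jet m g p 0) \<Longrightarrow> flat (Suc m) g"
  unfolding jet_def flat_def by (auto simp: less_Suc_eq_le)

lemma flat_mono: "flat m g \<Longrightarrow> m' \<le> m \<Longrightarrow> flat m' g"
  unfolding flat_def by auto

text \<open>Induction through the partial derivatives: each \<open>dir_deriv b g\<close> has a
  leading coefficient \<open>k b\<close>, and these must be proportional to
  \<open>dir_deriv b \<rho>\<close>. Contracting with the normalised gradient yields a coefficient
  that is smooth on the whole space.\<close>

lemma normal_jet:
  assumes "smooth g" "flat m g"
  shows "\<exists>\<kappa>. smooth \<kappa> \<and> (\<forall>p\<in>frontier D. jet m g p (\<kappa> p))"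
  using assms
proof (induction m arbitrary: g)
  case 0
  then show ?case by (intro exI[of _ g]) (auto simp: jet_def)
next
  case (Suc m)
  have "\<exists>\<kappa>. smooth \<kappa> \<and> (\<forall>p\<in>frontier D. jet m (dir_deriv b g) p (\<kappa> p))" if b: "b \<in> Basis" for b
  proof (rule Suc.IH)
    show "smooth (dir_deriv b g)" using smooth_dir_deriv[OF Suc.prems(1) b] .
    show "flat m (dir_deriv b g)" unfolding flat_def
    proof (intro ballI allI impI)
      fix p and vs :: "'a list" assume "p \<in> frontier D" "set vs \<subseteq> Basis \<and> length vs < m"
      then show "foldr dir_deriv vs (dir_deriv b g) p = 0"
        using Suc.prems(2)[unfolded flat_def, rule_format, of p "vs @ [b]"] b by simp
    qed
  qed
  then have "\<forall>b\<in>Basis. \<exists>\<kappa>. smooth \<kappa> \<and> (\<forall>p\<in>frontier D. jet m (dir_deriv b g) p (\<kappa> p))" by blast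
  from bchoice[OF this] obtain k where k: "\<forall>b\<in>Basis. smooth (k b) \<and> (\<forall>p\<in>frontier D. jet m (dir_deriv b g) p (k b p))" by blast
  obtain q :: "'a \<Rightarrow> complex" where q: "smooth q" "\<forall>p\<in>frontier D. q p * of_real (grad p \<bullet> grad p) = 1"
    using inverse_grad_square by blast
  define \<kappa> where "\<kappa> = (\<lambda>x. \<Sum>b\<in>Basis. (q x * of_real (dir_deriv b \<rho> x)) * k b x)"
  have "smooth \<kappa>" unfolding \<kappa>_def
    using k by (intro smooth_sum smooth_mult q C_infinity_on_of_real smooth_drho) auto
  moreover have "jet (Suc m) g p (\<kappa> p)" if p: "p \<in> frontier D" for p
  proof -
    have kb: "foldr dir_deriv vs (dir_deriv b g) p = dn vs p * k b p"
      if "b \<in> Basis" "set vs \<subseteq> Basis" "length vs = m" for b vs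
      using k that p unfolding jet_def by auto
    obtain b0 :: 'a where b0: "b0 \<in> Basis" "dir_deriv b0 \<rho> p \<noteq> 0"
      using drho_nonzero[OF p] dir_deriv_expand[OF rho_diff, of _ p] by (metis (no_types, lifting) scaleR_zero_right sum.neutral)
    define a where "a = dn (replicate m b0) p"
    have a: "a \<noteq> 0" using b0 unfolding a_def by (induction m) auto
    \<comment> \<open>All derivatives of order \<open>m\<close> vanish on the boundary, so the
      differential of \<open>h\<close> there is a multiple of that of \<open>\<rho>\<close>. Since
      \<open>b0\<close> is transversal, comparison with the jets of \<open>dir_deriv b g\<close>
      determines all the \<open>k b\<close> at once.\<close>
    define h where "h = foldr dir_deriv (replicate m b0) g"
    have sr: "set (replicate m b0) \<subseteq> Basis" using b0 by (auto simp: set_replicate_conv_if)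
    have hs: "smooth h" unfolding h_def by (rule C_infinity_on_foldr[OF Suc.prems(1) sr])
    have h0: "h x = 0" if "x \<in> frontier D" for x
      using Suc.prems(2)[unfolded flat_def, rule_format, OF that, of "replicate m b0"] sr unfolding h_def by simp
    obtain N where N: "dir_deriv N \<rho> p = 1" using unit_normal[OF p] .
    define c where "c = dir_deriv N h p"
    have hb: "a * k b p = of_real (dir_deriv b \<rho> p) * c" if b: "b \<in> Basis" for b
    proof -
      have "a * k b p = dir_deriv b h p"
        unfolding a_def h_def dir_deriv_foldr_commute[OF Suc.prems(1) b sr]
        by (rule kb[symmetric, OF b sr]) simp
      also have "\<dots> = of_real (dir_deriv b \<rho> p) * c"
        unfolding c_def by (rule deriv_along_normal[OF smooth_differentiable[OF hs] h0 p N])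
      finally show ?thesis .
    qed
    have "a * \<kappa> p = q p * c * (\<Sum>b\<in>Basis. of_real (dir_deriv b \<rho> p * dir_deriv b \<rho> p))"
    proof -
      have "a * \<kappa> p = (\<Sum>b\<in>Basis. q p * of_real (dir_deriv b \<rho> p) * (a * k b p))"
        unfolding \<kappa>_def by (simp add: sum_distrib_left mult_ac)
      also have "\<dots> = (\<Sum>b\<in>Basis. q p * of_real (dir_deriv b \<rho> p) * (of_real (dir_deriv b \<rho> p) * c))"
        by (rule sum.cong) (auto simp: hb)
      also have "\<dots> = q p * c * (\<Sum>b\<in>Basis. of_real (dir_deriv b \<rho> p * dir_deriv b \<rho> p))"
        by (simp add: sum_distrib_left mult_ac)
      finally show ?thesis .
    qed
    also have "(\<Sum>b\<in>Basis. complex_of_real (dir_deriv b \<rho> p * dir_deriv b \<rho> p)) = of_real (grad p \<bullet> grad p)"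
      by (subst euclidean_inner) (simp add: grad_inner)
    finally have ak: "a * \<kappa> p = c" using q(2) p by (simp add: mult_ac)
    have kk: "k b p = of_real (dir_deriv b \<rho> p) * \<kappa> p" if "b \<in> Basis" for b
    proof -
      have "a * k b p = a * (of_real (dir_deriv b \<rho> p) * \<kappa> p)" using hb[OF that] ak by (simp add: mult_ac)
      then show ?thesis using a by simp
    qed
    show ?thesis
      unfolding jet_def
    proof (intro allI impI)
      fix vs :: "'a list" assume vs: "set vs \<subseteq> Basis \<and> length vs \<le> Suc m"
      show "foldr dir_deriv vs g p = (if length vs = Suc m then dn vs p * \<kappa> p else 0)"
      proof (cases "length vs = Suc m")
        case True
        then obtain us b where ub: "vs = us @ [b]" "length us = m" by (cases vs rule: rev_cases) auto
        then show ?thesis using vs True kb[of b us] kk[of b] by simp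
      next
        case False
        then show ?thesis using Suc.prems(2)[unfolded flat_def] p vs by auto
      qed
    qed
  qed
  ultimately show ?case by blast
qed

lemma jet_rho_power:
  fixes h :: "'a \<Rightarrow> complex"
  assumes "smooth h" "p \<in> frontier D"
  shows "jet m (\<lambda>x. of_real (\<rho> x) ^ m * h x) p (fact m * h p)"
  unfolding jet_def
proof (intro allI impI)
  fix vs :: "'a list" assume "set vs \<subseteq> Basis \<and> length vs \<le> m"
  then have "set vs \<subseteq> Basis" "length vs \<le> m" by auto
  then show "foldr dir_deriv vs (\<lambda>x. of_real (\<rho> x) ^ m * h x) p = (if length vs = m then dn vs p * (fact m * h p) else 0)"
    using assms(1)
  proof (induction vs arbitrary: m h rule: rev_induct)
    case Nil
    then show ?case using rho_frontier[OF assms(2)] by (cases m) auto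
  next
    case (snoc b us)
    then obtain m' where m': "m = Suc m'" by (cases m) auto
    have b: "b \<in> Basis" using snoc.prems by auto
    have sr: "smooth (\<lambda>x. complex_of_real (\<rho> x))" by (rule C_infinity_on_of_real[OF open_UNIV smooth_rho])
    \<comment> \<open>Each derivative lowers the exponent by one at the price of a new factor. Its
      second term vanishes on the boundary, so the leading coefficient is multiplied by
      \<open>m\<close> and a derivative of \<open>\<rho>\<close>; the factors \<open>m\<close> build
      up the factorial.\<close>
    define h' where "h' = (\<lambda>x. of_nat m * of_real (dir_deriv b \<rho> x) * h x + of_real (\<rho> x) * dir_deriv b h x)"
    have sh': "smooth h'" unfolding h'_def
      by (intro smooth_add smooth_mult C_infinity_on_const C_infinity_on_of_real smooth_drho smooth_dir_deriv sr snoc.prems b) auto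
    have "dir_deriv b (\<lambda>x. of_real (\<rho> x) ^ m * h x) = (\<lambda>x. of_real (\<rho> x) ^ m' * h' x)"
    proof
      fix x
      have "((\<lambda>x. complex_of_real (\<rho> x)) has_derivative (\<lambda>v. of_real (dir_deriv v \<rho> x))) (at x)"
        by (rule bounded_linear.has_derivative[OF bounded_linear_of_real has_derivative_dir_deriv[OF rho_diff]])
      then have "((\<lambda>x. of_real (\<rho> x) ^ m * h x) has_derivative
          (\<lambda>v. of_real (\<rho> x) ^ m * dir_deriv v h x + of_nat m * of_real (dir_deriv v \<rho> x) * of_real (\<rho> x) ^ (m - 1) * h x)) (at x)"
        by (intro has_derivative_mult has_derivative_power has_derivative_dir_deriv smooth_differentiable snoc.prems)
      then have "dir_deriv b (\<lambda>x. of_real (\<rho> x) ^ m * h x) x =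
         of_real (\<rho> x) ^ m * dir_deriv b h x + of_nat m * of_real (dir_deriv b \<rho> x) * of_real (\<rho> x) ^ (m - 1) * h x"
        by (rule dir_deriv_eqI)
      then show "dir_deriv b (\<lambda>x. of_real (\<rho> x) ^ m * h x) x = of_real (\<rho> x) ^ m' * h' x"
        by (simp add: m' h'_def algebra_simps)
    qed
    then have "foldr dir_deriv (us @ [b]) (\<lambda>x. of_real (\<rho> x) ^ m * h x) p =
        foldr dir_deriv us (\<lambda>x. of_real (\<rho> x) ^ m' * h' x) p" by simp
    also have "\<dots> = (if length us = m' then dn us p * (fact m' * h' p) else 0)"
      by (rule snoc.IH) (use snoc.prems m' sh' in auto)
    also have "h' p = of_nat m * of_real (dir_deriv b \<rho> p) * h p"
      using rho_frontier[OF assms(2)] by (simp add: h'_def)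
    finally show ?case using m' by (auto simp: mult_ac)
  qed
qed

lemma jet_add:
  "smooth f \<Longrightarrow> smooth g \<Longrightarrow> jet m f p c \<Longrightarrow> jet m g p d \<Longrightarrow> jet m (\<lambda>x. f x + g x) p (c + d)"
  unfolding jet_def by (simp add: foldr_dir_deriv_add distrib_left)

lemma jet_zero: "jet m (\<lambda>x. 0) p 0"
  unfolding jet_def by simp

lemma jet_cd:
  assumes "smooth g" "jet (Suc m) g p c"
  shows "jet m (cd \<xi> g) p (sg \<xi> (grad p) * c)"
  unfolding jet_def
proof (intro allI impI)
  fix vs :: "'a list" assume vs: "set vs \<subseteq> Basis \<and> length vs \<le> m"
  have "foldr dir_deriv vs (cd \<xi> g) = (\<lambda>x. \<Sum>b\<in>Basis. foldr dir_deriv vs (\<lambda>x. \<xi> b * dir_deriv b g x) x)"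
    unfolding cd_def[abs_def] using vs
    by (intro foldr_dir_deriv_sum smooth_cmult smooth_dir_deriv assms) auto
  then have "foldr dir_deriv vs (cd \<xi> g) p = (\<Sum>b\<in>Basis. \<xi> b * foldr dir_deriv (vs @ [b]) g p)"
    using vs by (simp add: foldr_dir_deriv_cmult smooth_dir_deriv assms)
  also have "\<dots> = (\<Sum>b\<in>Basis. \<xi> b * (if length vs = m then dn (vs @ [b]) p * c else 0))"
  proof (rule sum.cong[OF refl])
    fix b :: 'a assume b: "b \<in> Basis"
    have "foldr dir_deriv (vs @ [b]) g p = (if length vs = m then dn (vs @ [b]) p * c else 0)"
      using assms(2)[unfolded jet_def, rule_format, of "vs @ [b]"] vs b by simp
    then show "\<xi> b * foldr dir_deriv (vs @ [b]) g p = \<xi> b * (if length vs = m then dn (vs @ [b]) p * c else 0)"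
      by simp
  qed
  also have "\<dots> = (if length vs = m then dn vs p * (sg \<xi> (grad p) * c) else 0)"
    by (auto simp: sg_def sum_distrib_left sum_distrib_right grad_inner mult_ac intro!: sum.cong)
  finally show "foldr dir_deriv vs (cd \<xi> g) p = (if length vs = m then dn vs p * (sg \<xi> (grad p) * c) else 0)" .
qed

lemma jet_cds:
  assumes "smooth g" "jet (m + length \<xi>s) g p c"
  shows "jet m (foldr cd \<xi>s g) p ((\<Prod>\<xi>\<leftarrow>\<xi>s. sg \<xi> (grad p)) * c)"
  using assms
proof (induction \<xi>s arbitrary: m)
  case (Cons \<xi> \<xi>s)
  have "jet (Suc m) (foldr cd \<xi>s g) p ((\<Prod>\<xi>\<leftarrow>\<xi>s. sg \<xi> (grad p)) * c)"
    using Cons.prems by (intro Cons.IH) auto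
  from jet_cd[OF smooth_cds[OF Cons.prems(1)] this] show ?case by (simp add: mult_ac)
qed simp

lemma jet_cop:
  assumes "\<And>\<xi>s i. (\<xi>s, i) \<in> set ts \<Longrightarrow> length \<xi>s = r \<and> smooth (g i) \<and> jet (m + r) (g i) p (c i)"
  shows "jet m (cop ts g) p (symb ts (grad p) c)"
  using assms
proof (induction ts)
  case (Cons t ts)
  obtain \<xi>s i where t: "t = (\<xi>s, i)" by (cases t)
  have 1: "length \<xi>s = r" "smooth (g i)" "jet (m + r) (g i) p (c i)" using Cons.prems t by auto
  have 2: "jet m (cop ts g) p (symb ts (grad p) c)" using Cons by auto
  have "smooth (cop ts g)" using Cons.prems by (intro smooth_cop) force
  then show ?case unfolding cop_Cons symb_Cons t fst_conv snd_conv
    using 1 2 by (intro jet_add smooth_cds jet_cds) auto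
qed (auto simp: jet_zero)

lemma smooth_symb:
  assumes "\<And>i. i \<in> snd ` set ts \<Longrightarrow> smooth (w i)"
  shows "smooth (\<lambda>x. symb ts (grad x) (\<lambda>i. w i x))"
  using assms
proof (induction ts)
  case (Cons t ts)
  have "smooth (\<lambda>x. sg \<xi> (grad x))" for \<xi>
    unfolding sg_def using smooth_drho
    by (intro smooth_sum smooth_cmult C_infinity_on_of_real) (auto simp: grad_inner)
  then have "smooth (\<lambda>x. \<Prod>\<xi>\<leftarrow>\<xi>s. sg \<xi> (grad x))" for \<xi>s
    by (induction \<xi>s) (auto intro: smooth_mult C_infinity_on_const)
  then show ?case unfolding symb_Cons using Cons by (intro smooth_add smooth_mult) auto
qed (auto simp: C_infinity_on_const)

end

subsection \<open>Borel summation at the boundary\<close>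

text \<open>Derivatives of length \<open>l\<close> are controlled only from the \<open>l\<close>-th
  term on, which is enough for uniform convergence of every differentiated series.\<close>

lemma smooth_series:
  fixes T :: "nat \<Rightarrow> 'a::euclidean_space \<Rightarrow> complex"
  assumes sm: "\<And>k. smooth (T k)"
    and bd: "\<And>k vs x. set vs \<subseteq> Basis \<Longrightarrow> length vs \<le> k \<Longrightarrow> norm (foldr dir_deriv vs (T k) x) \<le> (1/2) ^ k"
  obtains S where "smooth S"
    "\<And>vs x. set vs \<subseteq> Basis \<Longrightarrow> (\<lambda>k. foldr dir_deriv vs (T k) x) sums foldr dir_deriv vs S x"
proof -
  define Sv where "Sv = (\<lambda>vs x. \<Sum>k. foldr dir_deriv vs (T k) x)"
  have sumhalf: "summable (\<lambda>k. (1/2) ^ k :: real)" by (simp add: summable_geometric)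
  have ul: "uniform_limit UNIV (\<lambda>n x. \<Sum>k<n. foldr dir_deriv vs (T k) x) (Sv vs) sequentially"
    if "set vs \<subseteq> Basis" for vs
    unfolding Sv_def
  proof (rule Weierstrass_m_test_ev[OF _ sumhalf])
    show "\<forall>\<^sub>F n in sequentially. \<forall>x\<in>UNIV. norm (foldr dir_deriv vs (T n) x) \<le> (1/2) ^ n"
      using eventually_ge_at_top[of "length vs"] by eventually_elim (use bd that in auto)
  qed
  have sms: "(\<lambda>k. foldr dir_deriv vs (T k) x) sums Sv vs x" if "set vs \<subseteq> Basis" for vs x
    using tendsto_uniform_limitI[OF ul[OF that], of x] by (simp add: sums_def)
  have der: "(Sv vs has_derivative (\<lambda>h. \<Sum>b\<in>Basis. (h \<bullet> b) *\<^sub>R Sv (b # vs) x)) (at x)" if vs: "set vs \<subseteq> Basis" for vs x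
  proof -
    have sv: "smooth (foldr dir_deriv vs (T k))" for k by (rule C_infinity_on_foldr[OF sm vs])
    have "\<exists>g. \<forall>x\<in>UNIV. (\<lambda>n. foldr dir_deriv vs (T n) x) sums g x \<and>
        (g has_derivative (\<lambda>h. \<Sum>b\<in>Basis. (h \<bullet> b) *\<^sub>R Sv (b # vs) x)) (at x within UNIV)"
    proof (rule has_derivative_series[where f' = "\<lambda>n x h. \<Sum>b\<in>Basis. (h \<bullet> b) *\<^sub>R foldr dir_deriv (b # vs) (T n) x" and x = 0])
      fix n x
      have "(foldr dir_deriv vs (T n) has_derivative (\<lambda>h. dir_deriv h (foldr dir_deriv vs (T n)) x)) (at x)"
        by (rule has_derivative_dir_deriv[OF smooth_differentiable[OF sv]])
      moreover have "(\<lambda>h. dir_deriv h (foldr dir_deriv vs (T n)) x) = (\<lambda>h. \<Sum>b\<in>Basis. (h \<bullet> b) *\<^sub>R foldr dir_deriv (b # vs) (T n) x)"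
        unfolding foldr.simps comp_def by (rule ext, rule dir_deriv_expand[OF smooth_differentiable[OF sv]])
      ultimately show "(foldr dir_deriv vs (T n) has_derivative (\<lambda>h. \<Sum>b\<in>Basis. (h \<bullet> b) *\<^sub>R foldr dir_deriv (b # vs) (T n) x)) (at x within UNIV)"
        by simp
    next
      fix e :: real assume e: "e > 0"
      define e' where "e' = e / DIM('a)"
      have e': "e' > 0" using e by (simp add: e'_def)
      have "\<forall>\<^sub>F n in sequentially. \<forall>b\<in>Basis. \<forall>x. dist (\<Sum>k<n. foldr dir_deriv (b # vs) (T k) x) (Sv (b # vs) x) < e'"
        unfolding eventually_ball_finite_distrib[OF finite_Basis]
      proof
        fix b :: 'a assume "b \<in> Basis"
        then have "set (b # vs) \<subseteq> Basis" using vs by auto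
        from uniform_limitD[OF ul[OF this] e']
        show "\<forall>\<^sub>F n in sequentially. \<forall>x. dist (\<Sum>k<n. foldr dir_deriv (b # vs) (T k) x) (Sv (b # vs) x) < e'" by simp
      qed
      then show "\<forall>\<^sub>F n in sequentially. \<forall>x\<in>UNIV. \<forall>h. norm ((\<Sum>i<n. \<Sum>b\<in>Basis. (h \<bullet> b) *\<^sub>R foldr dir_deriv (b # vs) (T i) x) -
          (\<Sum>b\<in>Basis. (h \<bullet> b) *\<^sub>R Sv (b # vs) x)) \<le> e * norm h"
      proof eventually_elim
        case (elim n)
        show ?case
        proof (intro ballI allI)
          fix x h :: 'a
          have "(\<Sum>i<n. \<Sum>b\<in>Basis. (h \<bullet> b) *\<^sub>R foldr dir_deriv (b # vs) (T i) x) - (\<Sum>b\<in>Basis. (h \<bullet> b) *\<^sub>R Sv (b # vs) x) =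
             (\<Sum>b\<in>Basis. (h \<bullet> b) *\<^sub>R ((\<Sum>i<n. foldr dir_deriv (b # vs) (T i) x) - Sv (b # vs) x))"
            by (subst sum.swap) (simp only: scaleR_diff_right scaleR_sum_right sum_subtractf)
          also have "norm \<dots> \<le> (\<Sum>b\<in>(Basis::'a set). norm h * e')"
          proof (rule sum_norm_le)
            fix b :: 'a assume b: "b \<in> Basis"
            have "norm ((h \<bullet> b) *\<^sub>R ((\<Sum>i<n. foldr dir_deriv (b # vs) (T i) x) - Sv (b # vs) x)) =
                \<bar>h \<bullet> b\<bar> * norm ((\<Sum>i<n. foldr dir_deriv (b # vs) (T i) x) - Sv (b # vs) x)" by (rule norm_scaleR)
            also have "\<dots> \<le> norm h * e'"
              using elim b by (intro mult_mono Basis_le_norm) (auto simp: dist_norm less_imp_le)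
            finally show "norm ((h \<bullet> b) *\<^sub>R ((\<Sum>i<n. foldr dir_deriv (b # vs) (T i) x) - Sv (b # vs) x)) \<le> norm h * e'" .
          qed
          also have "\<dots> = e * norm h" by (simp add: e'_def)
          finally show "norm ((\<Sum>i<n. \<Sum>b\<in>Basis. (h \<bullet> b) *\<^sub>R foldr dir_deriv (b # vs) (T i) x) -
            (\<Sum>b\<in>Basis. (h \<bullet> b) *\<^sub>R Sv (b # vs) x)) \<le> e * norm h" .
        qed
      qed
    qed (use sms[OF vs] in auto)
    then obtain g where g: "\<And>x. (\<lambda>n. foldr dir_deriv vs (T n) x) sums g x"
       "\<And>x. (g has_derivative (\<lambda>h. \<Sum>b\<in>Basis. (h \<bullet> b) *\<^sub>R Sv (b # vs) x)) (at x)" by auto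
    have "g = Sv vs" using g(1) sms[OF vs] sums_unique2 by blast
    then show ?thesis using g(2) by blast
  qed
  have dd: "dir_deriv b (Sv vs) = Sv (b # vs)" if "set vs \<subseteq> Basis" "b \<in> Basis" for b vs
  proof
    fix x
    have "dir_deriv b (Sv vs) x = (\<Sum>c\<in>Basis. (b \<bullet> c) *\<^sub>R Sv (c # vs) x)" by (rule dir_deriv_eqI[OF der[OF that(1)]])
    also have "\<dots> = Sv (b # vs) x"
    proof -
      have "(\<Sum>c\<in>Basis. (b \<bullet> c) *\<^sub>R Sv (c # vs) x) = (\<Sum>c\<in>Basis. if c = b then Sv (c # vs) x else 0)"
        using that(2) by (intro sum.cong) (auto simp: inner_Basis)
      then show ?thesis using that(2) by simp
    qed
    finally show "dir_deriv b (Sv vs) x = Sv (b # vs) x" .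
  qed
  have fl: "foldr dir_deriv vs (Sv []) = Sv vs" if "set vs \<subseteq> Basis" for vs
    using that by (induction vs) (auto simp: dd)
  show ?thesis
  proof (rule that[of "Sv []"])
    show "smooth (Sv [])"
      unfolding C_infinity_on_def
    proof (intro allI impI ballI)
      fix vs :: "'a list" and x assume vs: "set vs \<subseteq> Basis"
      show "foldr dir_deriv vs (Sv []) differentiable at x"
        unfolding fl[OF vs] using der[OF vs] unfolding differentiable_def by blast
    qed
    show "(\<lambda>k. foldr dir_deriv vs (T k) x) sums foldr dir_deriv vs (Sv []) x" if "set vs \<subseteq> Basis" for vs x
      using sms[OF that] fl[OF that] by simp
  qed
qed

text \<open>Where \<open>\<theta> (c * \<rho> x)\<close> is nonzero,
  \<open>\<bar>\<rho> x\<bar> \<le> 1 / c\<close>, so \<open>\<rho> x ^ M\<close> gains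
  \<open>c ^ M\<close> in the denominator; each derivative costs at most one factor
  \<open>c\<close>, with constants independent of \<open>c\<close>.\<close>

lemma cut_power_bound:
  fixes \<rho> :: "'a::euclidean_space \<Rightarrow> real" and h :: "'a \<Rightarrow> complex" and \<theta> :: "real \<Rightarrow> real"
  assumes \<rho>: "smooth \<rho>" and h: "test_on UNIV h" and \<theta>: "test_on {-1..1} \<theta>" and vs: "set vs \<subseteq> Basis" "length vs \<le> M"
  shows "\<exists>C\<ge>0. \<forall>c\<ge>1. \<forall>x. norm (foldr dir_deriv vs (\<lambda>x. of_real (\<rho> x ^ M * \<theta> (c * \<rho> x)) * h x) x) \<le> C * (c ^ length vs / c ^ M)"
  using assms(2-5)
proof (induction vs arbitrary: M h \<theta> rule: rev_induct)
  case Nil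
  obtain A where A: "A > 0" "\<And>x. norm (h x) \<le> A" using test_on_bounded[OF Nil.prems(1)] by blast
  obtain B where B: "B > 0" "\<And>x. norm (\<theta> x) \<le> B" using test_on_bounded[OF test_on_UNIV[OF Nil.prems(2)]] by blast
  have "norm (of_real (\<rho> x ^ M * \<theta> (c * \<rho> x)) * h x) \<le> (B * A) * (1 / c ^ M)" if c: "c \<ge> 1" for c x
  proof (cases "\<bar>c * \<rho> x\<bar> \<le> 1")
    case True
    then have "\<bar>\<rho> x\<bar> \<le> 1 / c" using c by (simp add: abs_mult field_simps)
    then have "\<bar>\<rho> x\<bar> ^ M \<le> (1 / c) ^ M" by (intro power_mono) auto
    then have 1: "\<bar>\<rho> x\<bar> ^ M \<le> 1 / c ^ M" by (simp add: power_one_over)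
    have "norm (of_real (\<rho> x ^ M * \<theta> (c * \<rho> x)) * h x) = \<bar>\<rho> x\<bar> ^ M * (\<bar>\<theta> (c * \<rho> x)\<bar> * norm (h x))"
      by (simp add: norm_mult norm_power)
    also have "\<dots> \<le> (1 / c ^ M) * (B * A)"
      using 1 A B c by (intro mult_mono) (auto simp: less_imp_le)
    finally show ?thesis by (simp add: mult_ac)
  next
    case False
    then have "c * \<rho> x \<notin> {-1..1}" by auto
    then have "\<theta> (c * \<rho> x) = 0" by (rule test_on_outside[OF Nil.prems(2)])
    then show ?thesis using A B c by simp
  qed
  then show ?case using A B by (intro exI[of _ "B * A"]) auto
next
  case (snoc b us)
  then obtain M' where M: "M = Suc M'" by (cases M) auto
  have b: "b \<in> Basis" and us: "set us \<subseteq> Basis" "length us \<le> M'" "length us \<le> M" using snoc.prems M by auto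
  define n where "n = (\<lambda>x. complex_of_real (dir_deriv b \<rho> x))"
  have sn: "smooth n" unfolding n_def by (intro C_infinity_on_of_real smooth_dir_deriv \<rho> b) auto
  define \<theta>' where "\<theta>' = dir_deriv 1 \<theta>"
  have t': "test_on {-1..1} \<theta>'" unfolding \<theta>'_def by (rule test_on_dir_deriv[OF snoc.prems(2)]) simp
  have t1: "test_on UNIV (\<lambda>x. of_nat M * n x * h x)" and t2: "test_on UNIV (\<lambda>x. n x * h x)" and t3: "test_on UNIV (dir_deriv b h)"
    using snoc.prems(1) sn b by (auto intro!: test_on_mult_right smooth_mult C_infinity_on_const test_on_dir_deriv)
  \<comment> \<open>The innermost derivative falls on the power of \<open>\<rho>\<close> (lowering
    its exponent), on \<open>\<theta>\<close> (a factor \<open>c\<close>) or on \<open>h\<close>;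
    each of the three terms again has the shape of the claim.\<close>
  obtain C1 where C1: "C1 \<ge> 0" "\<And>c x. c \<ge> 1 \<Longrightarrow> norm (foldr dir_deriv us (\<lambda>x. of_real (\<rho> x ^ M' * \<theta> (c * \<rho> x)) * (of_nat M * n x * h x)) x) \<le> C1 * (c ^ length us / c ^ M')"
    using snoc.IH[OF t1 snoc.prems(2) us(1,2)] by blast
  obtain C2 where C2: "C2 \<ge> 0" "\<And>c x. c \<ge> 1 \<Longrightarrow> norm (foldr dir_deriv us (\<lambda>x. of_real (\<rho> x ^ M * \<theta>' (c * \<rho> x)) * (n x * h x)) x) \<le> C2 * (c ^ length us / c ^ M)"
    using snoc.IH[OF t2 t' us(1,3)] by blast
  obtain C3 where C3: "C3 \<ge> 0" "\<And>c x. c \<ge> 1 \<Longrightarrow> norm (foldr dir_deriv us (\<lambda>x. of_real (\<rho> x ^ M * \<theta> (c * \<rho> x)) * dir_deriv b h x) x) \<le> C3 * (c ^ length us / c ^ M)"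
    using snoc.IH[OF t3 snoc.prems(2) us(1,3)] by blast
  have est: "norm (foldr dir_deriv (us @ [b]) (\<lambda>x. of_real (\<rho> x ^ M * \<theta> (c * \<rho> x)) * h x) x) \<le> (C1 + C2 + C3) * (c ^ length (us @ [b]) / c ^ M)"
    if c: "c \<ge> 1" for c x
  proof -
    define f1 where "f1 = (\<lambda>x. of_real (\<rho> x ^ M' * \<theta> (c * \<rho> x)) * (of_nat M * n x * h x))"
    define f2 where "f2 = (\<lambda>x. of_real (\<rho> x ^ M * \<theta>' (c * \<rho> x)) * (n x * h x))"
    define f3 where "f3 = (\<lambda>x. of_real (\<rho> x ^ M * \<theta> (c * \<rho> x)) * dir_deriv b h x)"
    have sc: "smooth (\<lambda>x. complex_of_real (\<rho> x ^ m * \<tau> (c * \<rho> x)))" if "smooth \<tau>" for m and \<tau> :: "real \<Rightarrow> real"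
      by (intro C_infinity_on_of_real smooth_mult C_infinity_on_power \<rho> C_infinity_on_real_compose[OF that] C_infinity_on_const) auto
    have s\<theta>: "smooth \<theta>" "smooth \<theta>'" using snoc.prems(2) t' test_on_smooth by blast+
    have s1: "smooth f1" unfolding f1_def by (rule smooth_mult[OF sc[OF s\<theta>(1)] test_on_smooth[OF t1]])
    have s2: "smooth f2" unfolding f2_def by (rule smooth_mult[OF sc[OF s\<theta>(2)] test_on_smooth[OF t2]])
    have s3: "smooth f3" unfolding f3_def by (rule smooth_mult[OF sc[OF s\<theta>(1)] test_on_smooth[OF t3]])
    have "dir_deriv b (\<lambda>x. of_real (\<rho> x ^ M * \<theta> (c * \<rho> x)) * h x) = (\<lambda>x. f1 x + (of_real c * f2 x + f3 x))"
    proof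
      fix x
      have d\<rho>: "(\<rho> has_derivative (\<lambda>v. dir_deriv v \<rho> x)) (at x)"
        by (rule has_derivative_dir_deriv[OF smooth_differentiable[OF \<rho>]])
      have d\<theta>: "(\<theta> has_derivative (\<lambda>t. t * \<theta>' y)) (at y)" for y
      proof -
        have "dir_deriv t \<theta> y = t * \<theta>' y" for t
          by (subst dir_deriv_expand[OF smooth_differentiable[OF s\<theta>(1)]]) (simp add: \<theta>'_def)
        then show ?thesis using has_derivative_dir_deriv[OF smooth_differentiable[OF s\<theta>(1)], of y] by simp
      qed
      have "((\<lambda>x. c * \<rho> x) has_derivative (\<lambda>v. c * dir_deriv v \<rho> x)) (at x)"
        by (rule has_derivative_mult_right[OF d\<rho>])
      from has_derivative_compose[OF this d\<theta>]
      have 2: "((\<lambda>x. \<theta> (c * \<rho> x)) has_derivative (\<lambda>v. c * dir_deriv v \<rho> x * \<theta>' (c * \<rho> x))) (at x)" .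
      have 3: "((\<lambda>x. \<rho> x ^ M * \<theta> (c * \<rho> x)) has_derivative
        (\<lambda>v. \<rho> x ^ M * (c * dir_deriv v \<rho> x * \<theta>' (c * \<rho> x)) + (of_nat M * dir_deriv v \<rho> x * \<rho> x ^ (M - 1)) * \<theta> (c * \<rho> x))) (at x)"
        by (rule has_derivative_mult[OF has_derivative_power[OF d\<rho>] 2])
      have "((\<lambda>x. of_real (\<rho> x ^ M * \<theta> (c * \<rho> x)) * h x) has_derivative
        (\<lambda>v. of_real (\<rho> x ^ M * \<theta> (c * \<rho> x)) * dir_deriv v h x + of_real (\<rho> x ^ M * (c * dir_deriv v \<rho> x * \<theta>' (c * \<rho> x)) + (of_nat M * dir_deriv v \<rho> x * \<rho> x ^ (M - 1)) * \<theta> (c * \<rho> x)) * h x)) (at x)"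
        by (rule has_derivative_mult[OF bounded_linear.has_derivative[OF bounded_linear_of_real 3]
              has_derivative_dir_deriv[OF smooth_differentiable[OF test_on_smooth[OF snoc.prems(1)]]]])
      from dir_deriv_eqI[OF this]
      show "dir_deriv b (\<lambda>x. of_real (\<rho> x ^ M * \<theta> (c * \<rho> x)) * h x) x = f1 x + (of_real c * f2 x + f3 x)"
        unfolding f1_def f2_def f3_def n_def M by (simp add: algebra_simps)
    qed
    then have "foldr dir_deriv (us @ [b]) (\<lambda>x. of_real (\<rho> x ^ M * \<theta> (c * \<rho> x)) * h x) x =
       foldr dir_deriv us f1 x + (of_real c * foldr dir_deriv us f2 x + foldr dir_deriv us f3 x)"
      by (simp add: foldr_dir_deriv_add foldr_dir_deriv_cmult s1 s2 s3 us(1) smooth_add smooth_cmult)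
    also have "norm \<dots> \<le> norm (foldr dir_deriv us f1 x) + (c * norm (foldr dir_deriv us f2 x) + norm (foldr dir_deriv us f3 x))"
      using c by (intro norm_triangle_le add_left_mono) (simp add: norm_mult norm_triangle_le)
    also have "\<dots> \<le> C1 * (c ^ length us / c ^ M') + (c * (C2 * (c ^ length us / c ^ M)) + C3 * (c ^ length us / c ^ M))"
      using C1(2)[OF c, of x] C2(2)[OF c, of x] C3(2)[OF c, of x] c
      by (intro add_mono mult_left_mono) (auto simp: f1_def f2_def f3_def)
    also have "\<dots> \<le> (C1 + C2 + C3) * (c ^ length (us @ [b]) / c ^ M)"
    proof -
      have "c ^ length us / c ^ M' = c ^ length (us @ [b]) / c ^ M" using c by (simp add: M)
      moreover have "c * (C2 * (c ^ length us / c ^ M)) = C2 * (c ^ length (us @ [b]) / c ^ M)" by simp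
      moreover have "C3 * (c ^ length us / c ^ M) \<le> C3 * (c ^ length (us @ [b]) / c ^ M)"
        using c C3(1) by (intro mult_left_mono divide_right_mono) (auto simp: mult_le_cancel_right1)
      ultimately show ?thesis by (simp only: distrib_right)
    qed
    finally show ?thesis .
  qed
  show ?case by (rule exI[of _ "C1 + C2 + C3"]) (use est C1(1) C2(1) C3(1) in auto)
qed

lemma real_plateau:
  obtains \<theta> :: "real \<Rightarrow> real" where "test_on {-1..1} \<theta>" "\<And>t. \<bar>t\<bar> \<le> 1/2 \<Longrightarrow> \<theta> t = 1"
proof (rule smooth_bump[of "1/2" "0::real"])
  fix \<theta> :: "real \<Rightarrow> real"
  assume \<theta>: "test_on (cball 0 (2 * (1/2))) \<theta>" "\<And>x. x \<in> cball 0 (1/2) \<Longrightarrow> \<theta> x = 1"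
  show ?thesis
  proof (rule that)
    show "test_on {-1..1} \<theta>" by (rule test_on_mono[OF \<theta>(1)]) (auto simp: abs_le_iff)
    show "\<theta> t = 1" if "\<bar>t\<bar> \<le> 1/2" for t using \<theta>(2)[of t] that by auto
  qed
qed simp

lemma foldr_dir_deriv_diff:
  fixes f g :: "'a::euclidean_space \<Rightarrow> complex"
  assumes "smooth f" "smooth g" "set vs \<subseteq> Basis"
  shows "foldr dir_deriv vs (\<lambda>x. f x - g x) = (\<lambda>x. foldr dir_deriv vs f x - foldr dir_deriv vs g x)"
  using foldr_dir_deriv_add[of f "\<lambda>x. (-1) * g x" vs] foldr_dir_deriv_cmult[of g vs "-1"]
    smooth_cmult[of g "-1"] assms by simp

context defining_function
begin

text \<open>The cutoff scale of the \<open>k\<close>-th term is chosen so large that its derivatives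
  up to order \<open>k\<close> are below \<open>(1/2)^k\<close>; this is possible because
  \<open>M k > k\<close> leaves a spare factor \<open>1/c\<close>. Near the boundary each cutoff
  equals \<open>1\<close>, so the boundary jets are those of the formal series.\<close>

lemma borel_sum:
  fixes h :: "nat \<Rightarrow> 'a \<Rightarrow> complex"
  assumes h: "\<And>k. test_on UNIV (h k)" and M: "\<And>k. M k > k"
  shows "\<exists>S. smooth S \<and> (\<forall>m. flat (Suc m) (\<lambda>x. S x - (\<Sum>k<m. of_real (\<rho> x) ^ M k * h k x)))"
proof -
  obtain \<theta> :: "real \<Rightarrow> real" where \<theta>: "test_on {-1..1} \<theta>" "\<And>t. \<bar>t\<bar> \<le> 1/2 \<Longrightarrow> \<theta> t = 1"
    using real_plateau by blast
  define T where "T = (\<lambda>k c x. of_real (\<rho> x ^ M k * \<theta> (c * \<rho> x)) * h k x)"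
  have "\<exists>c\<ge>1. \<forall>vs x. set vs \<subseteq> Basis \<longrightarrow> length vs \<le> k \<longrightarrow> norm (foldr dir_deriv vs (T k c) x) \<le> (1/2) ^ k" for k
  proof -
    define A where "A = {vs. set vs \<subseteq> (Basis :: 'a set) \<and> length vs \<le> k}"
    have finA: "finite A" unfolding A_def by (rule finite_lists_length_le) simp
    have "\<forall>vs\<in>A. \<exists>C\<ge>0. \<forall>c\<ge>1. \<forall>x. norm (foldr dir_deriv vs (T k c) x) \<le> C * (c ^ length vs / c ^ M k)"
      unfolding T_def using M[of k] by (intro ballI cut_power_bound[OF smooth_rho h \<theta>(1)]) (auto simp: A_def)
    then obtain C where C: "\<And>vs. vs \<in> A \<Longrightarrow> C vs \<ge> (0::real)"
      "\<And>vs c x. vs \<in> A \<Longrightarrow> c \<ge> 1 \<Longrightarrow> norm (foldr dir_deriv vs (T k c) x) \<le> C vs * (c ^ length vs / c ^ M k)" by metis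
    define B where "B = (\<Sum>vs\<in>A. C vs)"
    have B: "C vs \<le> B" if "vs \<in> A" for vs unfolding B_def using that finA C(1) by (intro member_le_sum) auto
    \<comment> \<open>Large enough to absorb the constants of the finitely many derivatives of
      length up to \<open>k\<close>.\<close>
    define c where "c = max 1 (B * 2 ^ k)"
    have c: "c \<ge> 1" by (simp add: c_def)
    have "norm (foldr dir_deriv vs (T k c) x) \<le> (1/2) ^ k" if vs: "set vs \<subseteq> Basis" "length vs \<le> k" for vs x
    proof -
      have A: "vs \<in> A" using vs by (simp add: A_def)
      have "norm (foldr dir_deriv vs (T k c) x) \<le> C vs * (c ^ length vs / c ^ M k)" by (rule C(2)[OF A c])
      also have "\<dots> \<le> B * (1 / c)"
      proof (rule mult_mono)
        have "c ^ length vs * c \<le> c ^ M k"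
          unfolding power_Suc2[symmetric] using vs M[of k] c by (intro power_increasing) auto
        then show "c ^ length vs / c ^ M k \<le> 1 / c" using c by (simp add: field_simps)
      qed (use B[OF A] C(1)[OF A] c in auto)
      also have "\<dots> \<le> (1/2) ^ k"
      proof -
        have "B * 2 ^ k \<le> c" by (simp add: c_def)
        then show ?thesis using c by (simp add: field_simps power_one_over)
      qed
      finally show ?thesis .
    qed
    then show ?thesis using c by blast
  qed
  then obtain c where c: "\<And>k. c k \<ge> (1::real)"
    "\<And>k vs x. set vs \<subseteq> Basis \<Longrightarrow> length vs \<le> k \<Longrightarrow> norm (foldr dir_deriv vs (T k (c k)) x) \<le> (1/2) ^ k" by metis
  have sT: "smooth (T k (c k))" for k
    unfolding T_def
    by (intro smooth_mult C_infinity_on_of_real C_infinity_on_power smooth_rho test_on_smooth[OF h]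
        C_infinity_on_real_compose[OF test_on_smooth[OF \<theta>(1)]] C_infinity_on_const) auto
  obtain S where S: "smooth S" "\<And>vs x. set vs \<subseteq> Basis \<Longrightarrow> (\<lambda>k. foldr dir_deriv vs (T k (c k)) x) sums foldr dir_deriv vs S x"
    using smooth_series[OF sT c(2)] by blast
  define t where "t = (\<lambda>k x. of_real (\<rho> x) ^ M k * h k x)"
  have st: "smooth (t k)" for k unfolding t_def
    by (intro smooth_mult C_infinity_on_power C_infinity_on_of_real smooth_rho test_on_smooth[OF h]) auto
  have Tt: "foldr dir_deriv vs (T k (c k)) p = foldr dir_deriv vs (t k) p" if p: "p \<in> frontier D" for k vs p
  proof (rule foldr_dir_deriv_cong)
    show "open {x. \<bar>c k * \<rho> x\<bar> < 1/2}"
      using smooth_continuous[OF smooth_rho, of UNIV] by (intro open_Collect_less continuous_intros) auto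
    show "p \<in> {x. \<bar>c k * \<rho> x\<bar> < 1/2}" using rho_frontier[OF p] by simp
    fix y assume "y \<in> {x. \<bar>c k * \<rho> x\<bar> < 1/2}"
    then show "T k (c k) y = t k y" using \<theta>(2)[of "c k * \<rho> y"] by (simp add: T_def t_def)
  qed
  have "flat (Suc m) (\<lambda>x. S x - (\<Sum>k<m. t k x))" for m
    unfolding flat_def
  proof (intro ballI allI impI)
    fix p and vs :: "'a list" assume p: "p \<in> frontier D" and vs: "set vs \<subseteq> Basis \<and> length vs < Suc m"
    \<comment> \<open>As \<open>M k > k \<ge> m\<close>, the terms from \<open>m\<close> on
      contribute no derivative of order up to \<open>m\<close> on the boundary.\<close>
    have z: "foldr dir_deriv vs (t k) p = 0" if "k \<ge> m" for k
      using jet_rho_power[OF test_on_smooth[OF h] p, of "M k" k] M[of k] that vs unfolding jet_def t_def by auto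
    have "(\<lambda>k. foldr dir_deriv vs (t k) p) sums foldr dir_deriv vs S p"
      using S(2)[of vs p] vs Tt[OF p] by simp
    moreover have "(\<lambda>k. foldr dir_deriv vs (t k) p) sums (\<Sum>k<m. foldr dir_deriv vs (t k) p)"
      by (rule sums_finite) (use z in auto)
    ultimately have e: "foldr dir_deriv vs S p = (\<Sum>k<m. foldr dir_deriv vs (t k) p)" by (rule sums_unique2)
    have "foldr dir_deriv vs (\<lambda>x. S x - (\<Sum>k<m. t k x)) p = foldr dir_deriv vs S p - (\<Sum>k<m. foldr dir_deriv vs (t k) p)"
      using vs S(1) st by (simp add: foldr_dir_deriv_diff foldr_dir_deriv_sum smooth_sum)
    then show "foldr dir_deriv vs (\<lambda>x. S x - (\<Sum>k<m. t k x)) p = 0" using e by simp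
  qed
  then show ?thesis using S(1) unfolding t_def by blast
qed

end

subsection \<open>Polynomial weights on a half space\<close>

lemma foldr_cd_translate:
  assumes "smooth \<phi>"
  shows "foldr cd \<xi>s (\<lambda>y. \<phi> (x + y)) = (\<lambda>y. foldr cd \<xi>s \<phi> (x + y))"
proof (induction \<xi>s)
  case (Cons \<xi> \<xi>s)
  have "cd \<xi> (\<lambda>y. foldr cd \<xi>s \<phi> (x + y)) = (\<lambda>y. cd \<xi> (foldr cd \<xi>s \<phi>) (x + y))"
    by (rule ext, unfold cd_def[of \<xi>])
       (simp add: dir_deriv_affine[of "\<lambda>y. y", OF linear_id[unfolded id_def] smooth_cds[OF assms]])
  then show ?case using Cons by simp
qed simp

lemma foldr_cd_scale:
  assumes "smooth \<phi>"
  shows "foldr cd \<xi>s (\<lambda>x. \<phi> (c *\<^sub>R (x - p))) = (\<lambda>x. of_real (c ^ length \<xi>s) * foldr cd \<xi>s \<phi> (c *\<^sub>R (x - p)))"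
proof (induction \<xi>s)
  case (Cons \<xi> \<xi>s)
  have lin: "linear (\<lambda>x::'a. c *\<^sub>R x)" by (rule linear_scaleR)
  have ss: "smooth (foldr cd \<xi>s \<phi>)" by (rule smooth_cds[OF assms])
  have e: "c *\<^sub>R (x - p) = - (c *\<^sub>R p) + c *\<^sub>R x" for x by (simp add: algebra_simps)
  have sm: "smooth (\<lambda>x. foldr cd \<xi>s \<phi> (c *\<^sub>R (x - p)))"
    by (rule C_infinity_on_compose[OF _ _ _ ss])
       (auto intro!: C_infinity_on_scaleR C_infinity_on_diff C_infinity_on_const C_infinity_on_id)
  have "cd \<xi> (\<lambda>x. foldr cd \<xi>s \<phi> (c *\<^sub>R (x - p))) = (\<lambda>x. of_real c * cd \<xi> (foldr cd \<xi>s \<phi>) (c *\<^sub>R (x - p)))"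
  proof
    fix x
    have "dir_deriv b (\<lambda>x. foldr cd \<xi>s \<phi> (c *\<^sub>R (x - p))) x = of_real c * dir_deriv b (foldr cd \<xi>s \<phi>) (c *\<^sub>R (x - p))" for b
      unfolding e dir_deriv_affine[OF lin ss]
      using linear_scale[OF bounded_linear.linear[OF has_derivative_bounded_linear[OF has_derivative_dir_deriv[OF smooth_differentiable[OF ss]]]]]
      by (simp add: scaleR_conv_of_real)
    then show "cd \<xi> (\<lambda>x. foldr cd \<xi>s \<phi> (c *\<^sub>R (x - p))) x = of_real c * cd \<xi> (foldr cd \<xi>s \<phi>) (c *\<^sub>R (x - p))"
      by (simp add: cd_def sum_distrib_left mult_ac)
  qed
  then show ?case using Cons by (simp add: cd_cmult sm mult_ac)
qed simp

text \<open>Under blow-up at a boundary point with conormal \<open>n\<close> the domain tends to the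
  half space \<open>y \<bullet> n < 0\<close>, and \<open>\<rho>^m\<close>, rescaled, to
  \<open>(y \<bullet> n)^m\<close>; this is the limiting weight.\<close>

definition half_kernel :: "'a::euclidean_space \<Rightarrow> nat \<Rightarrow> 'a \<Rightarrow> real" where
  "half_kernel n m y = (if y \<bullet> n < 0 then (y \<bullet> n) ^ m else 0)"

lemma half_kernel_locally_integrable: "locally_integrable (half_kernel n m)"
  unfolding locally_integrable_def
proof (intro conjI allI)
  have eq: "half_kernel n m = (\<lambda>y. indicator {y. y \<bullet> n < 0} y * (y \<bullet> n) ^ m)"
    by (rule ext) (simp add: half_kernel_def)
  have S: "{y. y \<bullet> n < 0} \<in> sets borel" by (intro borel_open open_Collect_less continuous_intros)
  show b: "half_kernel n m \<in> borel_measurable borel"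
    unfolding eq by (intro borel_measurable_times borel_measurable_indicator S) measurable
  fix R
  have "integrable lborel (\<lambda>y. indicator (cball 0 R) y *\<^sub>R half_kernel n m y)"
  proof (rule integrableI_bounded_set_indicator[where B = "(\<bar>R\<bar> * norm n) ^ m"])
    show "AE y in lborel. y \<in> cball 0 R \<longrightarrow> norm (half_kernel n m y) \<le> (\<bar>R\<bar> * norm n) ^ m"
    proof (rule AE_I2, rule impI)
      fix y :: 'a assume y: "y \<in> cball 0 R"
      have "\<bar>y \<bullet> n\<bar> \<le> norm y * norm n" by (rule Cauchy_Schwarz_ineq2)
      also have "\<dots> \<le> \<bar>R\<bar> * norm n" using y by (intro mult_right_mono) auto
      finally have "\<bar>y \<bullet> n\<bar> ^ m \<le> (\<bar>R\<bar> * norm n) ^ m" by (intro power_mono) auto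
      then show "norm (half_kernel n m y) \<le> (\<bar>R\<bar> * norm n) ^ m"
        by (auto simp: half_kernel_def power_abs)
    qed
    show "emeasure lborel (cball (0::'a) R) < \<infinity>" by (rule emeasure_lborel_cball_finite)
  qed (use b in auto)
  then show "integrable lborel (\<lambda>y. indicator (cball 0 R) y * half_kernel n m y)" by simp
qed

lemma half_kernel_op: "kernel_op (half_kernel n m) (\<lambda>y::'a::euclidean_space. y)"
  by (simp add: kernel_op_def half_kernel_locally_integrable linear_id[unfolded id_def])

abbreviation hint :: "'a::euclidean_space \<Rightarrow> nat \<Rightarrow> ('a \<Rightarrow> complex) \<Rightarrow> complex" where
  "hint n m \<psi> \<equiv> kconv (half_kernel n m) (\<lambda>y. y) \<psi> 0"

text \<open>The weight is invariant under translations along \<open>t\<close>, so the convolution is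
  constant in that direction.\<close>

lemma hint_tangential:
  assumes "test_on UNIV \<psi>" "t \<bullet> n = 0"
  shows "hint n m (dir_deriv t \<psi>) = 0"
proof -
  interpret kernel_op "half_kernel n m" "\<lambda>y. y" by (rule half_kernel_op)
  have [measurable]: "\<psi> \<in> borel_measurable borel"
    using borel_measurable_continuous_onI test_on_continuous assms(1) by blast
  have const: "kconv (half_kernel n m) (\<lambda>y. y) \<psi> (s *\<^sub>R t) = hint n m \<psi>" for s
  proof -
    have "half_kernel n m (s *\<^sub>R t + y) = half_kernel n m y" for y
      using assms(2) by (simp add: half_kernel_def inner_add_left)
    then have "kconv (half_kernel n m) (\<lambda>y. y) \<psi> (s *\<^sub>R t) = (LINT y|lborel. of_real (half_kernel n m (s *\<^sub>R t + y)) * \<psi> (s *\<^sub>R t + y))"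
      by (simp add: kconv_def)
    also have "\<dots> = (LINT y|lborel. of_real (half_kernel n m y) * \<psi> y)"
      by (rule lborel_integral_translate[of "\<lambda>y. of_real (half_kernel n m y) * \<psi> y"]) measurable
    finally show ?thesis by (simp add: kconv_def)
  qed
  have "((\<lambda>s. s *\<^sub>R t) has_derivative (\<lambda>s. s *\<^sub>R t)) (at 0)"
    by (auto intro!: derivative_eq_intros)
  from has_derivative_compose[OF this, of "kconv (half_kernel n m) (\<lambda>y. y) \<psi>" "\<lambda>h. hint n m (dir_deriv h \<psi>)"]
  have "((\<lambda>s. kconv (half_kernel n m) (\<lambda>y. y) \<psi> (s *\<^sub>R t)) has_derivative (\<lambda>s. hint n m (dir_deriv (s *\<^sub>R t) \<psi>))) (at 0)"
    using kconv_has_derivative[OF assms(1), of 0] by simp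
  then have 1: "((\<lambda>s::real. hint n m \<psi>) has_derivative (\<lambda>s. hint n m (dir_deriv (s *\<^sub>R t) \<psi>))) (at 0)"
    unfolding const .
  have 2: "((\<lambda>s::real. hint n m \<psi>) has_derivative (\<lambda>s. 0)) (at 0)" by simp
  have "(\<lambda>s::real. hint n m (dir_deriv (s *\<^sub>R t) \<psi>)) = (\<lambda>s. 0)" by (rule has_derivative_unique[OF 1 2])
  from fun_cong[OF this, of 1] show ?thesis by simp
qed

definition normal_field :: "'a::euclidean_space \<Rightarrow> 'a \<Rightarrow> complex" where
  "normal_field n b = of_real (n \<bullet> b)"

text \<open>Only the component along \<open>n\<close> survives integration against the weight, so a
  field acts as its symbol times the normal derivative, up to the squared length of
  \<open>n\<close>.\<close>

lemma hint_cd: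
  assumes \<psi>: "test_on UNIV \<psi>" and n: "n \<noteq> 0"
  shows "hint n m (cd \<xi> \<psi>) = sg \<xi> n / of_real (n \<bullet> n) * hint n m (cd (normal_field n) \<psi>)"
proof -
  interpret kernel_op "half_kernel n m" "\<lambda>y. y" by (rule half_kernel_op)
  have exp: "hint n m (cd \<xi> \<psi>) = (\<Sum>b\<in>Basis. \<xi> b * hint n m (dir_deriv b \<psi>))" for \<xi>
    unfolding cd_def[abs_def]
    by (subst kconv_sum) (auto simp: kconv_cmult intro!: test_on_mult_right test_on_dir_deriv \<psi> C_infinity_on_const)
  have d: "\<psi> differentiable (at x)" for x using \<psi> test_on_smooth smooth_differentiable by blast
  have dn: "cd (normal_field n) \<psi> = dir_deriv n \<psi>"
    by (rule ext, subst dir_deriv_expand[OF d]) (simp add: cd_def normal_field_def scaleR_conv_of_real)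
  have b: "hint n m (dir_deriv b \<psi>) = of_real (n \<bullet> b) / of_real (n \<bullet> n) * hint n m (dir_deriv n \<psi>)" for b
  proof -
    define a where "a = (n \<bullet> b) / (n \<bullet> n)"
    have "(b - a *\<^sub>R n) \<bullet> n = 0" using n by (simp add: a_def inner_diff_left inner_commute[of b n])
    then have z: "hint n m (dir_deriv (b - a *\<^sub>R n) \<psi>) = 0" by (rule hint_tangential[OF \<psi>])
    have bl: "bounded_linear (\<lambda>h. hint n m (dir_deriv h \<psi>))"
      by (rule has_derivative_bounded_linear[OF kconv_has_derivative[OF \<psi>]])
    then interpret B: bounded_linear "\<lambda>h. hint n m (dir_deriv h \<psi>)" .
    show ?thesis using z unfolding B.diff B.scaleR by (simp add: a_def scaleR_conv_of_real)
  qed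
  have "hint n m (cd \<xi> \<psi>) = (\<Sum>b\<in>Basis. \<xi> b * (of_real (n \<bullet> b) / of_real (n \<bullet> n) * hint n m (dir_deriv n \<psi>)))"
    unfolding exp by (intro sum.cong refl arg_cong2[of _ _ _ _ "(*)"] b)
  also have "\<dots> = sg \<xi> n / of_real (n \<bullet> n) * hint n m (dir_deriv n \<psi>)"
    unfolding sg_def sum_divide_distrib sum_distrib_right by (intro sum.cong refl) simp
  finally show ?thesis by (simp add: dn)
qed

lemma hint_cds:
  assumes "test_on UNIV \<psi>" "n \<noteq> 0"
  shows "hint n m (foldr cd \<xi>s \<psi>) = (\<Prod>\<xi>\<leftarrow>\<xi>s. sg \<xi> n) / of_real (n \<bullet> n) ^ length \<xi>s *
    hint n m (foldr cd (replicate (length \<xi>s) (normal_field n)) \<psi>)"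
  using assms(1)
proof (induction \<xi>s arbitrary: \<psi>)
  case (Cons \<xi> \<xi>s)
  have sm: "smooth \<psi>" by (rule test_on_smooth[OF Cons.prems])
  have "hint n m (foldr cd (\<xi> # \<xi>s) \<psi>) = sg \<xi> n / of_real (n \<bullet> n) * hint n m (cd (normal_field n) (foldr cd \<xi>s \<psi>))"
    unfolding foldr.simps comp_def by (rule hint_cd[OF test_on_cds[OF Cons.prems] assms(2)])
  also have "cd (normal_field n) (foldr cd \<xi>s \<psi>) = foldr cd \<xi>s (cd (normal_field n) \<psi>)"
    by (rule cd_cds_commute[OF sm])
  also have "hint n m \<dots> = (\<Prod>\<xi>\<leftarrow>\<xi>s. sg \<xi> n) / of_real (n \<bullet> n) ^ length \<xi>s *
    hint n m (foldr cd (replicate (length \<xi>s) (normal_field n)) (cd (normal_field n) \<psi>))"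
    by (rule Cons.IH[OF test_on_cd[OF Cons.prems]])
  also have "foldr cd (replicate (length \<xi>s) (normal_field n)) (cd (normal_field n) \<psi>) =
      foldr cd (replicate (length (\<xi> # \<xi>s)) (normal_field n)) \<psi>"
    using cd_cds_commute[OF sm, of "normal_field n" "replicate (length \<xi>s) (normal_field n)"] by simp
  finally show ?case by simp
qed simp

text \<open>Normal derivatives can be stripped one by one: if the integrals of all derivatives along
  \<open>n\<close> vanish, the convolution is constant along \<open>n\<close>, and it is zero once
  the half space has been moved off the support.\<close>

lemma hint_normal_zero:
  assumes n: "n \<noteq> 0" and z: "\<And>\<phi>. test_on UNIV \<phi> \<Longrightarrow> hint n m (foldr cd (replicate r (normal_field n)) \<phi>) = 0"
    and \<phi>: "test_on UNIV \<phi>"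
  shows "hint n m \<phi> = 0"
  using z \<phi>
proof (induction r arbitrary: \<phi>)
  case (Suc r)
  interpret kernel_op "half_kernel n m" "\<lambda>y. y" by (rule half_kernel_op)
  have "hint n m (foldr cd (replicate r (normal_field n)) \<phi>) = 0" if \<phi>: "test_on UNIV \<phi>" for \<phi>
  proof -
    define \<psi> where "\<psi> = foldr cd (replicate r (normal_field n)) \<phi>"
    have t: "test_on UNIV \<psi>" unfolding \<psi>_def by (rule test_on_cds[OF \<phi>])
    have d: "\<psi> differentiable (at x)" for x using t test_on_smooth smooth_differentiable by blast
    have dn: "cd (normal_field n) \<psi> = dir_deriv n \<psi>"
      by (rule ext, subst dir_deriv_expand[OF d]) (simp add: cd_def normal_field_def scaleR_conv_of_real)
    define f where "f = (\<lambda>s. kconv (half_kernel n m) (\<lambda>y. y) \<psi> (s *\<^sub>R n))"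
    have z: "kconv (half_kernel n m) (\<lambda>y. y) (cd (normal_field n) \<psi>) x = 0" for x
    proof -
      have tt: "test_on UNIV (\<lambda>y. \<phi> (x + y))"
        by (rule test_on_affine[of "\<lambda>y. y", OF linear_id[unfolded id_def] refl \<phi>])
      have "kconv (half_kernel n m) (\<lambda>y. y) (cd (normal_field n) \<psi>) x = hint n m (\<lambda>y. cd (normal_field n) \<psi> (x + y))"
        by (simp add: kconv_def)
      also have "(\<lambda>y. cd (normal_field n) \<psi> (x + y)) = foldr cd (replicate (Suc r) (normal_field n)) (\<lambda>y. \<phi> (x + y))"
        unfolding foldr_cd_translate[OF test_on_smooth[OF \<phi>]] by (simp add: \<psi>_def)
      also have "hint n m \<dots> = 0" by (rule Suc.prems(1)[OF tt])
      finally show ?thesis .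
    qed
    have fd: "(f has_derivative (\<lambda>s. 0)) (at s)" for s
    proof -
      have "((\<lambda>s. s *\<^sub>R n) has_derivative (\<lambda>s. s *\<^sub>R n)) (at s)" by (auto intro!: derivative_eq_intros)
      from has_derivative_compose[OF this kconv_has_derivative[OF t]]
      have 1: "(f has_derivative (\<lambda>h. kconv (half_kernel n m) (\<lambda>y. y) (dir_deriv (h *\<^sub>R n) \<psi>) (s *\<^sub>R n))) (at s)"
        by (simp add: f_def)
      interpret B: bounded_linear "\<lambda>h. kconv (half_kernel n m) (\<lambda>y. y) (dir_deriv h \<psi>) (s *\<^sub>R n)"
        by (rule has_derivative_bounded_linear[OF kconv_has_derivative[OF t]])
      show ?thesis using 1 z[of "s *\<^sub>R n"] unfolding B.scaleR dn by simp
    qed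
    have "norm (f s - f s') \<le> 0 * norm (s - s')" for s s'
      by (rule differentiable_bound[of UNIV f "\<lambda>_ _. 0"]) (auto intro: fd simp: onorm_zero)
    then have fc: "f s = f s'" for s s' by simp
    obtain L where L: "compact L" "\<forall>x. x \<notin> L \<longrightarrow> \<psi> x = 0" using t unfolding test_on_def by blast
    obtain R where R: "\<forall>x\<in>L. norm x \<le> R" using compact_imp_bounded[OF L(1)] bounded_iff by blast
    \<comment> \<open>This translation sends the half space \<open>y \<bullet> n < 0\<close> to
      points of norm larger than \<open>R\<close>, away from the support.\<close>
    define s where "s = - (\<bar>R\<bar> / norm n)"
    have "of_real (half_kernel n m y) * \<psi> (s *\<^sub>R n + y) = 0" for y
    proof (cases "y \<bullet> n < 0 \<and> \<psi> (s *\<^sub>R n + y) \<noteq> 0")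
      case True
      then have "norm (s *\<^sub>R n + y) \<le> \<bar>R\<bar>" using L R abs_ge_self order_trans by blast
      then have "\<bar>(s *\<^sub>R n + y) \<bullet> n\<bar> \<le> \<bar>R\<bar> * norm n"
        using Cauchy_Schwarz_ineq2[of "s *\<^sub>R n + y" n] mult_right_mono[of "norm (s *\<^sub>R n + y)" "\<bar>R\<bar>" "norm n"] by simp
      moreover have "(s *\<^sub>R n) \<bullet> n = - (\<bar>R\<bar> * norm n)"
        using n by (simp add: s_def power2_norm_eq_inner[symmetric] power2_eq_square)
      ultimately have False using True unfolding inner_add_left by linarith
      then show ?thesis ..
    qed (auto simp: half_kernel_def)
    then have "f s = (LINT (y::'a)|lborel. 0)" unfolding f_def kconv_def by presburger
    then have "f s = 0" by simp
    then show ?thesis using fc[of 0 s] by (simp add: f_def \<psi>_def)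
  qed
  then show ?case using Suc.IH Suc.prems(2) by blast
qed simp

text \<open>A bump around \<open>- n\<close> of radius at most half the norm of \<open>n\<close>
  stays inside the half space, where the weight has the constant sign \<open>(-1)^m\<close>.\<close>

lemma hint_nonzero:
  fixes n :: "'a::euclidean_space"
  assumes n: "n \<noteq> 0"
  obtains \<phi> where "test_on UNIV \<phi>" "hint n m \<phi> \<noteq> 0"
proof -
  define r where "r = norm n / 4"
  have r: "r > 0" using n by (simp add: r_def)
  obtain \<beta> :: "'a \<Rightarrow> real" where \<beta>: "test_on (cball (- n) (2 * r)) \<beta>" "\<And>x. 0 \<le> \<beta> x" "\<And>x. x \<in> cball (- n) r \<Longrightarrow> \<beta> x = 1"
    using smooth_bump[OF r, of "- n"] by metis
  have H: "y \<bullet> n < 0" if "y \<in> cball (- n) (2 * r)" for y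
  proof -
    have "\<bar>(y + n) \<bullet> n\<bar> \<le> norm (y + n) * norm n" by (rule Cauchy_Schwarz_ineq2)
    also have "\<dots> \<le> (norm n / 2) * norm n"
      using that by (intro mult_right_mono) (auto simp: dist_norm r_def norm_minus_commute add.commute)
    finally have "(y + n) \<bullet> n \<le> (n \<bullet> n) / 2" by (simp add: power2_norm_eq_inner[symmetric] power2_eq_square)
    moreover have "n \<bullet> n > 0" using n by simp
    moreover have "(y + n) \<bullet> n = y \<bullet> n + n \<bullet> n" by (rule inner_add_left)
    ultimately show ?thesis by linarith
  qed
  define \<phi> where "\<phi> = (\<lambda>x. complex_of_real (\<beta> x))"
  have t: "test_on UNIV \<phi>" unfolding \<phi>_def
    by (rule test_on_bounded_linear[OF bounded_linear_of_real test_on_UNIV[OF \<beta>(1)]])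
  interpret kernel_op "half_kernel n m" "\<lambda>y. y" by (rule half_kernel_op)
  define g where "g = (\<lambda>y. (-1) ^ m * (half_kernel n m y * \<beta> y))"
  have g0: "g y \<ge> 0" for y
  proof (cases "y \<bullet> n < 0")
    case True
    have "g y = (- (y \<bullet> n)) ^ m * \<beta> y" using True by (simp add: g_def half_kernel_def power_minus[of "y \<bullet> n"])
    then show ?thesis using True \<beta>(2) by simp
  qed (simp add: g_def half_kernel_def)
  have gp: "g y > 0" if "y \<in> cball (- n) r" for y
  proof -
    have "y \<bullet> n < 0" using H[of y] that r by auto
    then have "g y = (- (y \<bullet> n)) ^ m" using \<beta>(3)[OF that] by (simp add: g_def half_kernel_def power_minus[of "y \<bullet> n"])
    then show ?thesis using \<open>y \<bullet> n < 0\<close> by simp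
  qed
  have gi: "integrable lborel g"
  proof -
    have "integrable lborel (\<lambda>y. of_real (half_kernel n m y) * \<phi> (0 + y))" by (rule kernel_integrable[OF t])
    from integrable_Re[OF this] have "integrable lborel (\<lambda>y. half_kernel n m y * \<beta> y)" by (simp add: \<phi>_def)
    then show ?thesis unfolding g_def by (rule integrable_mult_right)
  qed
  have "hint n m \<phi> \<noteq> 0"
  proof
    assume "hint n m \<phi> = 0"
    then have "complex_of_real (LINT y|lborel. half_kernel n m y * \<beta> y) = 0"
      by (simp add: kconv_def \<phi>_def flip: of_real_mult)
    then have "(LINT y|lborel. g y) = 0" by (simp add: g_def)
    then have "AE y in lborel. g y = 0"
      using integral_nonneg_eq_0_iff_AE[OF gi] g0 by simp
    then have ae: "AE y in lborel. y \<notin> ball (- n) r"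
      by eventually_elim (metis gp ball_subset_cball less_irrefl subsetD)
    have "emeasure lborel (ball (- n) r) = 0"
      using ae by (subst (asm) AE_iff_measurable[of "ball (- n) r"]) auto
    moreover have "unit_ball_vol (DIM('a)) * r ^ DIM('a) > 0" using r by simp
    ultimately show False using emeasure_ball[of r "- n"] r by (simp add: ennreal_eq_0_iff not_le)
  qed
  then show ?thesis using that t by blast
qed

subsection \<open>Extension by zero and the weak boundary condition\<close>

lemma AE_hyperplane:
  fixes n :: "'a::euclidean_space"
  assumes "n \<noteq> 0"
  shows "AE y in lborel. y \<bullet> n \<noteq> 0"
proof -
  have "negligible {y. n \<bullet> y = 0}" using assms by (intro negligible_hyperplane) auto
  moreover have "{y. n \<bullet> y = 0} \<in> sets lborel"
    by (simp add: borel_closed closed_hyperplane)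
  ultimately have "{y. n \<bullet> y = 0} \<in> null_sets lborel"
    using null_sets_completion_iff negligible_iff_null_sets by blast
  then have "AE y in lborel. y \<notin> {y. n \<bullet> y = 0}" by (rule AE_not_in)
  then show ?thesis by (auto simp: inner_commute)
qed

context defining_function
begin

definition cutD :: "('a \<Rightarrow> complex) \<Rightarrow> 'a \<Rightarrow> complex" where
  "cutD g x = (if x \<in> D then g x else 0)"

lemma cutD_measurable: "smooth g \<Longrightarrow> cutD g \<in> borel_measurable borel"
proof -
  assume g: "smooth g"
  have "cutD g = (\<lambda>x. indicator D x *\<^sub>R g x)" by (rule ext) (simp add: cutD_def)
  moreover have "g \<in> borel_measurable borel"
    by (rule borel_measurable_continuous_onI[OF smooth_continuous[OF g]])
  moreover have "D \<in> sets borel" using open_D by simp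
  ultimately show ?thesis by (simp add: borel_measurable_scaleR borel_measurable_indicator)
qed

lemma cutD_integrable:
  assumes "test_on UNIV g"
  shows "integrable lborel (cutD g)"
proof (rule Bochner_Integration.integrable_bound[OF test_on_integrable[OF assms]])
  show "cutD g \<in> borel_measurable lborel" using cutD_measurable[OF test_on_smooth[OF assms]] by simp
  show "AE x in lborel. norm (cutD g x) \<le> norm (g x)" by (rule AE_I2) (simp add: cutD_def)
qed

text \<open>Flatness of order two makes the value and the first derivatives vanish on the boundary,
  so that the derivative from inside agrees with the zero outside.\<close>

lemma cutD_has_derivative:
  assumes "smooth g" "flat 2 g"
  shows "(cutD g has_derivative (\<lambda>h. cutD (dir_deriv h g) x)) (at x)"
proof -
  have d: "(g has_derivative (\<lambda>h. dir_deriv h g x)) (at x)" by (rule has_derivative_dir_deriv[OF smooth_differentiable[OF assms(1)]])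
  consider "x \<in> D" | "x \<notin> closure D" | "x \<in> frontier D"
    using open_D by (auto simp: frontier_def interior_open)
  then show ?thesis
  proof cases
    case 1
    have "(cutD g has_derivative (\<lambda>h. dir_deriv h g x)) (at x)"
      by (rule has_derivative_transform_within_open[OF d open_D 1]) (simp add: cutD_def)
    then show ?thesis using 1 by (simp add: cutD_def)
  next
    case 2
    have "(cutD g has_derivative (\<lambda>h. 0)) (at x)"
      by (rule has_derivative_transform_within_open[of "\<lambda>_. 0" _ _ _ "- closure D"])
         (use 2 closure_subset in \<open>auto simp: cutD_def\<close>)
    moreover have "x \<notin> D" using 2 closure_subset by blast
    ultimately show ?thesis by (simp add: cutD_def)
  next
    case 3
    then have xD: "x \<notin> D" using open_D by (simp add: frontier_def interior_open)
    have g0: "g x = 0" using assms(2)[unfolded flat_def, rule_format, OF 3, of "[]"] by simp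
    have "dir_deriv b g x = 0" if "b \<in> Basis" for b
      using assms(2)[unfolded flat_def, rule_format, OF 3, of "[b]"] that by simp
    then have dg: "dir_deriv h g x = 0" for h
      using dir_deriv_expand[OF smooth_differentiable[OF assms(1)], of h x] by simp
    show ?thesis unfolding has_derivative_at_alt
    proof (intro conjI allI impI)
      show "bounded_linear (\<lambda>h. cutD (dir_deriv h g) x)" using xD by (simp add: cutD_def)
      fix e :: real assume e: "e > 0"
      then obtain \<delta> where "\<delta> > 0" "\<And>y. norm (y - x) < \<delta> \<Longrightarrow> norm (g y - g x - dir_deriv (y - x) g x) \<le> e * norm (y - x)"
        using d unfolding has_derivative_at_alt by blast
      then show "\<exists>\<delta>>0. \<forall>y. norm (y - x) < \<delta> \<longrightarrow> norm (cutD g y - cutD g x - cutD (dir_deriv (y - x) g) x) \<le> e * norm (y - x)"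
        using e by (intro exI[of _ \<delta>]) (auto simp: cutD_def xD g0 dg)
    qed
  qed
qed

lemma flat_dir_deriv: "flat (Suc m) g \<Longrightarrow> b \<in> Basis \<Longrightarrow> flat m (dir_deriv b g)"
  unfolding flat_def
proof (intro ballI allI impI)
  fix p and vs :: "'a list"
  assume a: "\<forall>p\<in>frontier D. \<forall>vs. set vs \<subseteq> Basis \<and> length vs < Suc m \<longrightarrow> foldr dir_deriv vs g p = 0" "b \<in> Basis"
    and "p \<in> frontier D" "set vs \<subseteq> Basis \<and> length vs < m"
  then show "foldr dir_deriv vs (dir_deriv b g) p = 0"
    using a(1)[rule_format, of p "vs @ [b]"] by simp
qed

lemma dir_deriv_cutD: "smooth g \<Longrightarrow> flat 2 g \<Longrightarrow> dir_deriv v (cutD g) = cutD (dir_deriv v g)"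
  by (rule ext) (rule dir_deriv_eqI[OF cutD_has_derivative])

lemma smooth_cutD:
  assumes "smooth g" "\<And>m. flat m g"
  shows "smooth (cutD g)"
proof -
  have "Cn_on n UNIV (cutD g)" for n using assms
  proof (induction n arbitrary: g)
    case 0
    then show ?case using cutD_has_derivative[OF 0] differentiable_def Cn_on.simps(1) by metis
  next
    case (Suc n)
    have "Cn_on n UNIV (dir_deriv b (cutD g))" if b: "b \<in> Basis" for b
      unfolding dir_deriv_cutD[OF Suc.prems]
      by (rule Suc.IH[OF smooth_dir_deriv[OF Suc.prems(1) b] flat_dir_deriv[OF Suc.prems(2) b]])
    moreover have "\<forall>x\<in>UNIV. cutD g differentiable at x"
      using cutD_has_derivative[OF Suc.prems] unfolding differentiable_def by blast
    ultimately show ?case by simp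
  qed
  then show ?thesis unfolding C_infinity_on_iff_Cn_on by blast
qed

lemma cd_cutD: "smooth g \<Longrightarrow> flat 2 g \<Longrightarrow> cd \<xi> (cutD g) = cutD (cd \<xi> g)"
  by (rule ext) (simp add: cd_def dir_deriv_cutD cutD_def)

lemma flat_cd: "smooth g \<Longrightarrow> flat (Suc m) g \<Longrightarrow> flat m (cd \<xi> g)"
proof -
  assume g: "smooth g" "flat (Suc m) g"
  show "flat m (cd \<xi> g)" unfolding flat_def
  proof (intro ballI allI impI)
    fix p and vs :: "'a list" assume p: "p \<in> frontier D" and vs: "set vs \<subseteq> Basis \<and> length vs < m"
    have "foldr dir_deriv vs (cd \<xi> g) p = (\<Sum>b\<in>Basis. \<xi> b * foldr dir_deriv vs (dir_deriv b g) p)"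
      unfolding cd_def[abs_def] using vs
      by (simp add: foldr_dir_deriv_sum foldr_dir_deriv_cmult smooth_cmult smooth_dir_deriv g)
    then show "foldr dir_deriv vs (cd \<xi> g) p = 0"
      using flat_dir_deriv[OF g(2)] p vs unfolding flat_def by simp
  qed
qed

lemma cds_cutD:
  assumes "smooth g" "\<And>m. flat m g"
  shows "foldr cd \<xi>s (cutD g) = cutD (foldr cd \<xi>s g) \<and> (\<forall>m. flat m (foldr cd \<xi>s g))"
proof (induction \<xi>s)
  case (Cons \<xi> \<xi>s)
  then show ?case using cd_cutD[OF smooth_cds[OF assms(1)], of \<xi>s \<xi>] flat_cd[OF smooth_cds[OF assms(1)]] by simp
qed (use assms in auto)

lemma cop_cutD:
  assumes "\<And>i. i \<in> snd ` set ts \<Longrightarrow> smooth (g i) \<and> (\<forall>m. flat m (g i))"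
  shows "cop ts (\<lambda>i. cutD (g i)) = cutD (cop ts g)"
  using assms
proof (induction ts)
  case (Cons t ts)
  have "foldr cd (fst t) (cutD (g (snd t))) = cutD (foldr cd (fst t) (g (snd t)))"
    using cds_cutD[of "g (snd t)" "fst t"] Cons.prems by auto
  moreover have "cop ts (\<lambda>i. cutD (g i)) = cutD (cop ts g)" using Cons by auto
  ultimately show ?case unfolding cop_Cons by (auto simp: cutD_def)
qed (auto simp: cutD_def)

text \<open>When all terms of \<open>ts\<close> have the same order, this is, up to a common sign,
  the integral over \<open>D\<close> of \<open>G\<close> against the transposed operator applied to
  \<open>\<phi>\<close>. It is the scalar form of the right-hand side in the definition of zero
  Cauchy data.\<close>

definition wint :: "(('a \<Rightarrow> complex) list \<times> 'j) list \<Rightarrow> ('j \<Rightarrow> 'a \<Rightarrow> complex) \<Rightarrow> ('a \<Rightarrow> complex) \<Rightarrow> complex" where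
  "wint ts G \<phi> = (\<Sum>(\<xi>s, j)\<leftarrow>ts. LINT x|lborel. cutD (\<lambda>x. G j x * foldr cd \<xi>s \<phi> x) x)"

section \<open>Blow-up at a boundary point\<close>

definition eps :: "nat \<Rightarrow> real" where "eps i = 1 / real (Suc i)"

lemma eps_pos: "eps i > 0" "eps i \<le> 1" by (auto simp: eps_def)

lemma eps_nonzero: "eps i \<noteq> 0" by (simp add: eps_def)

lemma eps_lim: "eps \<longlonglongrightarrow> 0"
  unfolding eps_def[abs_def] using LIMSEQ_inverse_real_of_nat by (simp add: inverse_eq_divide)

lemma in_D_blowup:
  assumes p: "p \<in> frontier D" and y: "y \<bullet> grad p \<noteq> 0"
  shows "eventually (\<lambda>i. p + eps i *\<^sub>R y \<in> D \<longleftrightarrow> y \<bullet> grad p < 0) sequentially"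
proof -
  have fl: "filterlim eps (at_right 0) sequentially"
    using eps_lim eps_pos eps_nonzero by (auto simp: filterlim_at eventually_sequentially intro!: exI[of _ 0])
  have dg: "dir_deriv y \<rho> p = y \<bullet> grad p"
    by (subst dir_deriv_expand[OF rho_diff]) (simp add: grad_def inner_sum_right mult.commute)
  have cont: "((\<lambda>t. p + t *\<^sub>R y) \<longlongrightarrow> p) (at_right 0)" by (auto intro!: tendsto_eq_intros)
  have W: "eventually (\<lambda>t. p + t *\<^sub>R y \<in> W) (at_right 0)"
    using topological_tendstoD[OF cont open_W] p frontier_W by blast
  have "eventually (\<lambda>t. p + t *\<^sub>R y \<in> D \<longleftrightarrow> y \<bullet> grad p < 0) (at_right 0)"
  proof (cases "y \<bullet> grad p < 0")
    case True
    then have "eventually (\<lambda>t. \<rho> (p + t *\<^sub>R y) < 0) (at_right 0)"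
      using small_step_sign[OF rho_diff rho_frontier[OF p]] dg by simp
    with W show ?thesis by eventually_elim (use True D_iff in auto)
  next
    case False
    then have "dir_deriv y (\<lambda>x. - \<rho> x) p < 0"
      using dir_deriv_bounded_linear[OF bounded_linear_minus[OF bounded_linear_ident] rho_diff, of y p] dg y by simp
    then have "eventually (\<lambda>t. - \<rho> (p + t *\<^sub>R y) < 0) (at_right 0)"
      by (intro small_step_sign) (use rho_frontier[OF p] rho_diff in auto)
    with W show ?thesis by eventually_elim (use False D_iff in auto)
  qed
  then show ?thesis using fl unfolding filterlim_iff by blast
qed

text \<open>Boundedness for \<open>m = 0\<close> and a Lipschitz bound for \<open>m = 1\<close>
  dominate the rescaled functions; the value or the differential at \<open>p\<close> gives the
  pointwise limit. The points of the limiting hyperplane, where membership in \<open>D\<close> is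
  undecided, form a null set.\<close>

lemma blowup_limit:
  assumes p: "p \<in> frontier D" and G: "test_on UNIV G" and m: "m \<le> 1" and j: "jet m G p \<kappa>" and \<psi>: "test_on UNIV \<psi>"
  shows "(\<lambda>i. LINT y|lborel. cutD G (p + eps i *\<^sub>R y) / of_real (eps i ^ m) * \<psi> y) \<longlonglongrightarrow> \<kappa> * hint (grad p) m \<psi>"
proof -
  let ?n = "grad p"
  have sG: "smooth G" by (rule test_on_smooth[OF G])
  obtain L where L: "compact L" "\<forall>x. x \<notin> L \<longrightarrow> \<psi> x = 0" using \<psi> unfolding test_on_def by blast
  obtain R where R: "\<forall>x\<in>L. norm x \<le> R" using compact_imp_bounded[OF L(1)] bounded_iff by blast
  have m01: "m = 0 \<or> m = 1" using m by auto
  have "\<exists>B\<ge>0. \<forall>i y. norm y \<le> R \<longrightarrow> norm (G (p + eps i *\<^sub>R y)) / eps i ^ m \<le> B"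
    using m01
  proof
    assume "m = 0"
    then show ?thesis using test_on_bounded[OF G] by (metis div_by_1 less_imp_le power_0)
  next
    assume m1: "m = 1"
    obtain C where C: "C \<ge> 0" "\<And>x y. norm (G x - G y) \<le> C * norm (x - y)" using test_on_lipschitz[OF G] by blast
    have G0: "G p = 0" using j m1 unfolding jet_def by (metis (no_types, lifting) empty_subsetI foldr_Nil id_apply list.set(1) list.size(3) zero_le zero_neq_one)
    have "norm (G (p + eps i *\<^sub>R y)) / eps i \<le> C * \<bar>R\<bar>" if "norm y \<le> R" for i y
    proof -
      have "norm (G (p + eps i *\<^sub>R y)) \<le> C * (eps i * norm y)"
        using C(2)[of "p + eps i *\<^sub>R y" p] G0 eps_pos[of i] by simp
      also have "\<dots> \<le> C * (eps i * \<bar>R\<bar>)" using that C(1) eps_pos[of i] by (intro mult_left_mono) auto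
      finally show ?thesis using eps_pos[of i] by (simp add: field_simps)
    qed
    then show ?thesis using C(1) m1 by (intro exI[of _ "C * \<bar>R\<bar>"]) auto
  qed
  then obtain B where B: "B \<ge> 0" "\<And>i y. norm y \<le> R \<Longrightarrow> norm (G (p + eps i *\<^sub>R y)) / eps i ^ m \<le> B" by blast
  have lim: "(\<lambda>i. G (p + eps i *\<^sub>R y) / of_real (eps i ^ m)) \<longlonglongrightarrow> of_real ((y \<bullet> ?n) ^ m) * \<kappa>" for y
    using m01
  proof
    assume m0: "m = 0"
    have "G p = \<kappa>" using j m0 unfolding jet_def by (metis dn_simps(1) empty_subsetI foldr_Nil id_apply list.set(1) list.size(3) mult_1 order_refl)
    moreover have "(\<lambda>i. G (p + eps i *\<^sub>R y)) \<longlonglongrightarrow> G (p + 0 *\<^sub>R y)"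
      using smooth_continuous[OF sG, of UNIV]
      by (intro isCont_tendsto_compose[of _ G] tendsto_intros eps_lim) (simp add: continuous_on_eq_continuous_at)
    ultimately show ?thesis using m0 by simp
  next
    assume m1: "m = 1"
    have G0: "G p = 0" using j m1 unfolding jet_def by (metis (no_types, lifting) empty_subsetI foldr_Nil id_apply list.set(1) list.size(3) zero_le zero_neq_one)
    have db: "dir_deriv b G p = of_real (dir_deriv b \<rho> p) * \<kappa>" if "b \<in> Basis" for b
      using j[unfolded jet_def, rule_format, of "[b]"] m1 that by simp
    have dy: "dir_deriv y G p = of_real (y \<bullet> ?n) * \<kappa>"
    proof -
      have "dir_deriv y G p = (\<Sum>b\<in>Basis. (y \<bullet> b) *\<^sub>R dir_deriv b G p)" by (rule dir_deriv_expand[OF smooth_differentiable[OF sG]])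
      also have "\<dots> = (\<Sum>b\<in>Basis. of_real (y \<bullet> b * dir_deriv b \<rho> p)) * \<kappa>"
        unfolding sum_distrib_right by (intro sum.cong refl) (simp add: db scaleR_conv_of_real)
      also have "(\<Sum>b\<in>Basis. complex_of_real (y \<bullet> b * dir_deriv b \<rho> p)) = of_real (y \<bullet> ?n)"
        by (simp add: grad_def inner_sum_right mult.commute)
      finally show ?thesis .
    qed
    obtain C where C: "C \<ge> 0" "\<And>z h. norm (G (z + h) - G z - dir_deriv h G z) \<le> C * (norm h)\<^sup>2"
      using test_on_taylor[OF G] by blast
    interpret BL: bounded_linear "\<lambda>h. dir_deriv h G p"
      by (rule has_derivative_bounded_linear[OF has_derivative_dir_deriv[OF smooth_differentiable[OF sG]]])
    have "norm (G (p + eps i *\<^sub>R y) / of_real (eps i) - dir_deriv y G p) \<le> C * (norm y)\<^sup>2 * eps i" for i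
    proof -
      have "G (p + eps i *\<^sub>R y) / of_real (eps i) - dir_deriv y G p =
          (G (p + eps i *\<^sub>R y) - G p - dir_deriv (eps i *\<^sub>R y) G p) / of_real (eps i)"
        using eps_nonzero[of i] unfolding BL.scaleR G0 by (simp add: scaleR_conv_of_real field_simps)
      also have "norm \<dots> \<le> C * (norm (eps i *\<^sub>R y))\<^sup>2 / eps i"
        using C(2)[of p "eps i *\<^sub>R y"] eps_pos[of i] by (simp add: norm_divide divide_right_mono)
      also have "\<dots> = C * (norm y)\<^sup>2 * eps i"
        using eps_pos[of i] by (simp add: power_mult_distrib power2_eq_square)
      finally show ?thesis .
    qed
    note est = this
    have "(\<lambda>i. C * (norm y)\<^sup>2 * eps i) \<longlonglongrightarrow> C * (norm y)\<^sup>2 * 0" by (intro tendsto_intros eps_lim)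
    then have l0: "(\<lambda>i. C * (norm y)\<^sup>2 * eps i) \<longlonglongrightarrow> 0" by simp
    have "(\<lambda>i. G (p + eps i *\<^sub>R y) / of_real (eps i) - dir_deriv y G p) \<longlonglongrightarrow> 0"
      by (rule Lim_null_comparison[OF always_eventually[OF allI[OF est]] l0])
    then show ?thesis unfolding dy using m1 by (simp add: LIM_zero_iff)
  qed
  have mG: "(\<lambda>y. cutD G (p + eps i *\<^sub>R y)) \<in> borel_measurable borel" for i
    by (rule measurable_compose[OF _ cutD_measurable[OF sG]]) measurable
  have m\<psi>: "\<psi> \<in> borel_measurable borel" by (rule borel_measurable_continuous_onI[OF test_on_continuous[OF \<psi>]])
  interpret kernel_op "half_kernel ?n m" "\<lambda>y. y" by (rule half_kernel_op)
  have "(\<lambda>i. LINT y|lborel. cutD G (p + eps i *\<^sub>R y) / of_real (eps i ^ m) * \<psi> y) \<longlonglongrightarrow>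
      (LINT y|lborel. \<kappa> * (of_real (half_kernel ?n m y) * \<psi> y))"
  proof (rule integral_dominated_convergence[where w = "\<lambda>y. B * norm (\<psi> y)"])
    show "integrable lborel (\<lambda>y. B * norm (\<psi> y))"
      by (intro integrable_mult_right integrable_norm test_on_integrable \<psi>)
    show "(\<lambda>y. cutD G (p + eps i *\<^sub>R y) / of_real (eps i ^ m) * \<psi> y) \<in> borel_measurable lborel" for i
      unfolding measurable_lborel2 divide_inverse
      by (rule borel_measurable_times[OF borel_measurable_times[OF mG borel_measurable_const] m\<psi>])
    show "(\<lambda>y. \<kappa> * (of_real (half_kernel ?n m y) * \<psi> y)) \<in> borel_measurable lborel"
      unfolding measurable_lborel2
      by (intro borel_measurable_times borel_measurable_const m\<psi> measurable_compose[OF borel_K borel_measurable_of_real])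
    show "AE y in lborel. (\<lambda>i. cutD G (p + eps i *\<^sub>R y) / of_real (eps i ^ m) * \<psi> y) \<longlonglongrightarrow> \<kappa> * (of_real (half_kernel ?n m y) * \<psi> y)"
      using AE_hyperplane[OF grad_nonzero[OF p]]
    proof eventually_elim
      case (elim y)
      have ev: "eventually (\<lambda>i. p + eps i *\<^sub>R y \<in> D \<longleftrightarrow> y \<bullet> ?n < 0) sequentially" by (rule in_D_blowup[OF p elim])
      have "(\<lambda>i. cutD G (p + eps i *\<^sub>R y) / of_real (eps i ^ m)) \<longlonglongrightarrow> \<kappa> * of_real (half_kernel ?n m y)"
      proof (cases "y \<bullet> ?n < 0")
        case True
        have "eventually (\<lambda>i. G (p + eps i *\<^sub>R y) / of_real (eps i ^ m) = cutD G (p + eps i *\<^sub>R y) / of_real (eps i ^ m)) sequentially"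
          using ev by eventually_elim (use True in \<open>simp add: cutD_def\<close>)
        from Lim_transform_eventually[OF lim this] show ?thesis using True by (simp add: half_kernel_def mult.commute)
      next
        case False
        have "eventually (\<lambda>i. 0 = cutD G (p + eps i *\<^sub>R y) / of_real (eps i ^ m)) sequentially"
          using ev by eventually_elim (use False in \<open>simp add: cutD_def\<close>)
        from Lim_transform_eventually[OF tendsto_const this] show ?thesis using False by (simp add: half_kernel_def)
      qed
      from tendsto_mult_right[OF this, of "\<psi> y"] show ?case by (simp add: mult_ac)
    qed
    show "AE y in lborel. norm (cutD G (p + eps i *\<^sub>R y) / of_real (eps i ^ m) * \<psi> y) \<le> B * norm (\<psi> y)" for i
    proof (rule AE_I2)
      fix y
      show "norm (cutD G (p + eps i *\<^sub>R y) / of_real (eps i ^ m) * \<psi> y) \<le> B * norm (\<psi> y)"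
      proof (cases "y \<in> L")
        case True
        have "norm (cutD G (p + eps i *\<^sub>R y) / of_real (eps i ^ m)) \<le> norm (G (p + eps i *\<^sub>R y)) / eps i ^ m"
          using eps_pos[of i] by (simp add: cutD_def norm_divide norm_power)
        also have "\<dots> \<le> B" using B(2) True R by blast
        finally show ?thesis unfolding norm_mult by (intro mult_right_mono) auto
      next
        case False
        then show ?thesis using L by simp
      qed
    qed
  qed
  also have "(LINT y|lborel. \<kappa> * (of_real (half_kernel ?n m y) * \<psi> y)) = \<kappa> * hint ?n m \<psi>"
    by (simp add: kconv_def)
  finally show ?thesis .
qed

text \<open>Testing with \<open>\<phi> ((x - p) / eps i)\<close> and letting \<open>eps i\<close>
  tend to \<open>0\<close> gives the symbol times a half space integral of the \<open>r\<close>-fold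
  normal derivative of \<open>\<phi>\<close>. Were that integral zero for every
  \<open>\<phi>\<close>, stripping the derivatives would contradict
  \<open>hint_nonzero\<close>.\<close>

lemma weak_imp_symbol:
  assumes p: "p \<in> frontier D" and U: "open U" "frontier D \<subseteq> U" and m: "m \<le> 1"
    and ts: "\<And>\<xi>s j. (\<xi>s, j) \<in> set ts \<Longrightarrow> length \<xi>s = r \<and> test_on UNIV (G j) \<and> jet m (G j) p (\<kappa> j)"
    and weak: "\<And>\<phi>. test_on U \<phi> \<Longrightarrow> wint ts G \<phi> = 0"
  shows "symb ts (grad p) \<kappa> = 0"
proof -
  let ?n = "grad p"
  have nz: "?n \<noteq> 0" by (rule grad_nonzero[OF p])
  have key: "symb ts ?n \<kappa> * hint ?n m (foldr cd (replicate r (normal_field ?n)) \<phi>) = 0" if \<phi>: "test_on UNIV \<phi>" for \<phi>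
  proof -
    define A where "A = (\<lambda>(\<xi>s, j) i. LINT y|lborel. cutD (G j) (p + eps i *\<^sub>R y) / of_real (eps i ^ m) * foldr cd \<xi>s \<phi> y)"
    have lim: "(\<lambda>i. A t i) \<longlonglongrightarrow> \<kappa> (snd t) * hint ?n m (foldr cd (fst t) \<phi>)" if t: "t \<in> set ts" for t
    proof -
      obtain \<xi>s j where tj: "t = (\<xi>s, j)" by (cases t)
      show ?thesis unfolding A_def tj prod.case fst_conv snd_conv
        by (rule blowup_limit[OF p _ m]) (use ts[of \<xi>s j] t tj test_on_cds[OF \<phi>] in auto)
    qed
    have limsum: "(\<lambda>i. \<Sum>t\<leftarrow>ts'. A t i) \<longlonglongrightarrow> (\<Sum>t\<leftarrow>ts'. \<kappa> (snd t) * hint ?n m (foldr cd (fst t) \<phi>))" if "set ts' \<subseteq> set ts" for ts'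
      using that
    proof (induction ts')
      case (Cons t ts')
      then show ?case using lim[of t] by (auto intro: tendsto_add)
    qed simp
    obtain L where L: "compact L" "\<forall>x. x \<notin> L \<longrightarrow> \<phi> x = 0" using \<phi> unfolding test_on_def by blast
    obtain R where R: "\<forall>x\<in>L. norm x \<le> R" using compact_imp_bounded[OF L(1)] bounded_iff by blast
    obtain \<delta> where \<delta>: "\<delta> > 0" "ball p \<delta> \<subseteq> U" using U p open_contains_ball by (metis subsetD)
    have "(\<lambda>i. \<bar>R\<bar> * eps i) \<longlonglongrightarrow> \<bar>R\<bar> * 0" by (intro tendsto_intros eps_lim)
    then have "eventually (\<lambda>i. \<bar>R\<bar> * eps i < \<delta>) sequentially" using \<delta>(1) order_tendstoD(2) by fastforce
    then have "eventually (\<lambda>i. (\<Sum>t\<leftarrow>ts. A t i) = 0) sequentially"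
    proof eventually_elim
      case (elim i)
      define c where "c = inverse (eps i)"
      have c: "c > 0" "c * eps i = 1" using eps_pos[of i] by (auto simp: c_def)
      define \<phi>i where "\<phi>i = (\<lambda>x. \<phi> (c *\<^sub>R (x - p)))"
      have "smooth \<phi>i" unfolding \<phi>i_def
        by (rule C_infinity_on_compose[OF _ _ _ test_on_smooth[OF \<phi>]])
           (auto intro!: C_infinity_on_scaleR C_infinity_on_diff C_infinity_on_const C_infinity_on_id)
      moreover have "\<phi>i x = 0" if "x \<notin> cball p (\<bar>R\<bar> * eps i)" for x
      proof -
        have "norm (x - p) > \<bar>R\<bar> * eps i" using that by (simp add: dist_norm norm_minus_commute)
        then have "c * norm (x - p) > c * (\<bar>R\<bar> * eps i)" using c(1) by (rule mult_strict_left_mono)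
        moreover have "c * (\<bar>R\<bar> * eps i) = \<bar>R\<bar>" using c(2) by (simp add: mult.left_commute)
        ultimately have "norm (c *\<^sub>R (x - p)) > \<bar>R\<bar>" using c(1) by simp
        then have "c *\<^sub>R (x - p) \<notin> L" using R by force
        then show ?thesis using L by (simp add: \<phi>i_def)
      qed
      moreover have "cball p (\<bar>R\<bar> * eps i) \<subseteq> U" using elim \<delta>(2) by (auto simp: subset_iff)
      ultimately have ti: "test_on U \<phi>i" unfolding test_on_def by (auto intro!: exI[of _ "cball p (\<bar>R\<bar> * eps i)"])
      \<comment> \<open>By the change of variables the volume gives the power \<open>DIM\<close> of
        \<open>eps i\<close>, the derivatives the power \<open>-r\<close> and the leading jet the
        power \<open>m\<close>. The factor is common to all terms since all have order
        \<open>r\<close>, so it can be divided out.\<close>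
      have tm: "(LINT x|lborel. cutD (\<lambda>x. G j x * foldr cd \<xi>s \<phi>i x) x) =
          of_real (eps i ^ DIM('a) * c ^ r * eps i ^ m) * A (\<xi>s, j) i" if t: "(\<xi>s, j) \<in> set ts" for \<xi>s j
      proof -
        have lr: "length \<xi>s = r" and tG: "test_on UNIV (G j)" using ts[OF t] by auto
        have s: "smooth (\<lambda>x. G j x * foldr cd \<xi>s \<phi>i x)"
          by (intro smooth_mult test_on_smooth[OF tG] smooth_cds test_on_smooth[OF ti])
        have "(LINT x|lborel. cutD (\<lambda>x. G j x * foldr cd \<xi>s \<phi>i x) x) =
            \<bar>eps i\<bar> ^ DIM('a) *\<^sub>R (LINT y|lborel. cutD (\<lambda>x. G j x * foldr cd \<xi>s \<phi>i x) (p + eps i *\<^sub>R y))"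
          using eps_pos[of i] by (intro lborel_integral_affine cutD_measurable[OF s]) simp
        also have "(\<lambda>y. cutD (\<lambda>x. G j x * foldr cd \<xi>s \<phi>i x) (p + eps i *\<^sub>R y)) =
            (\<lambda>y. of_real (c ^ r * eps i ^ m) * (cutD (G j) (p + eps i *\<^sub>R y) / of_real (eps i ^ m) * foldr cd \<xi>s \<phi> y))"
          unfolding \<phi>i_def foldr_cd_scale[OF test_on_smooth[OF \<phi>]] lr
          using c eps_pos[of i] by (auto simp: cutD_def)
        finally show ?thesis unfolding A_def prod.case
          using eps_pos[of i] by (simp add: scaleR_conv_of_real mult.assoc)
      qed
      have "wint ts G \<phi>i = (\<Sum>t\<leftarrow>ts. of_real (eps i ^ DIM('a) * c ^ r * eps i ^ m) * A t i)"
        unfolding wint_def by (intro arg_cong[of _ _ sum_list] map_cong refl) (use tm in auto)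
      then have "of_real (eps i ^ DIM('a) * c ^ r * eps i ^ m) * (\<Sum>t\<leftarrow>ts. A t i) = 0"
        using weak[OF ti] by (simp add: sum_list_const_mult)
      moreover have "eps i ^ DIM('a) * c ^ r * eps i ^ m \<noteq> 0" using c eps_pos[of i] by simp
      ultimately show ?case by (metis mult_eq_0_iff of_real_eq_0_iff)
    qed
    then have "(\<lambda>i. \<Sum>t\<leftarrow>ts. A t i) \<longlonglongrightarrow> 0" by (rule tendsto_eventually)
    then have z: "(\<Sum>t\<leftarrow>ts. \<kappa> (snd t) * hint ?n m (foldr cd (fst t) \<phi>)) = 0"
      using LIMSEQ_unique[OF limsum] by blast
    define Hn where "Hn = hint ?n m (foldr cd (replicate r (normal_field ?n)) \<phi>)"
    have "(\<Sum>t\<leftarrow>ts'. \<kappa> (snd t) * hint ?n m (foldr cd (fst t) \<phi>)) = symb ts' ?n \<kappa> / of_real (?n \<bullet> ?n) ^ r * Hn"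
      if "set ts' \<subseteq> set ts" for ts'
      using that
    proof (induction ts')
      case (Cons t ts')
      obtain \<xi>s j where t: "t = (\<xi>s, j)" by (cases t)
      then have "length \<xi>s = r" using ts Cons.prems by auto
      then have "hint ?n m (foldr cd \<xi>s \<phi>) = (\<Prod>\<xi>\<leftarrow>\<xi>s. sg \<xi> ?n) / of_real (?n \<bullet> ?n) ^ r * Hn"
        using hint_cds[OF \<phi> nz, of m \<xi>s] by (simp add: Hn_def)
      then show ?case using Cons t by (simp add: symb_Cons add_divide_distrib distrib_right)
    qed simp
    from this[of ts] z have "symb ts ?n \<kappa> / of_real (?n \<bullet> ?n) ^ r * Hn = 0" by simp
    then show ?thesis using nz by (auto simp: Hn_def)
  qed
  show ?thesis
  proof (rule ccontr)
    assume "symb ts ?n \<kappa> \<noteq> 0"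
    then have z: "hint ?n m (foldr cd (replicate r (normal_field ?n)) \<phi>) = 0" if "test_on UNIV \<phi>" for \<phi>
      using key[OF that] by simp
    obtain \<phi> where "test_on UNIV \<phi>" "hint ?n m \<phi> \<noteq> 0" using hint_nonzero[OF nz] by blast
    then show False using hint_normal_zero[OF nz z] by blast
  qed
qed

end

lemma cds_cds_commute: "smooth f \<Longrightarrow> foldr cd \<xi>s (foldr cd \<eta>s f) = foldr cd \<eta>s (foldr cd \<xi>s f)"
proof (induction \<xi>s)
  case (Cons \<xi> \<xi>s)
  have "foldr cd (\<xi> # \<xi>s) (foldr cd \<eta>s f) = cd \<xi> (foldr cd \<eta>s (foldr cd \<xi>s f))" using Cons by simp
  also have "\<dots> = foldr cd \<eta>s (cd \<xi> (foldr cd \<xi>s f))" by (rule cd_cds_commute[OF smooth_cds[OF Cons.prems]])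
  finally show ?case by simp
qed simp

text \<open>The coefficients \<open>c i\<close> are constants: freezing a variable coefficient at
  one point lets an operator identity be applied to the single test function
  \<open>\<phi>\<close>.\<close>

lemma cds_cop_frozen:
  assumes "smooth \<phi>"
  shows "foldr cd \<xi>s (cop ps (\<lambda>i y. c i * \<phi> y)) = (\<lambda>x. \<Sum>(\<eta>s, i)\<leftarrow>ps. c i * foldr cd \<eta>s (foldr cd \<xi>s \<phi>) x)"
proof (induction ps)
  case (Cons t ps)
  have s: "smooth (cop ps (\<lambda>i y. c i * \<phi> y))" by (intro smooth_cop smooth_cmult assms)
  show ?case unfolding cop_Cons
    using Cons by (simp add: cds_add smooth_cds smooth_cmult assms s cds_cmult case_prod_beta cds_cds_commute[of \<phi> \<xi>s "fst t"])
qed simp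

context defining_function
begin

text \<open>The divergence theorem for a function vanishing on the boundary, obtained without
  surface measure. A layer around the boundary is cut away, after which extension by zero is smooth.
  The factor \<open>\<rho>\<close> keeps the first derivatives of the layer term bounded, and at
  each point of \<open>D\<close> the layer eventually disappears.\<close>

lemma integral_cutD_cd_zero:
  assumes k: "test_on W k"
  shows "(LINT x|lborel. cutD (cd \<xi> (\<lambda>x. of_real (\<rho> x) * k x)) x) = 0"
proof -
  obtain \<theta> :: "real \<Rightarrow> real" where \<theta>: "test_on {-1..1} \<theta>" "\<And>t. \<bar>t\<bar> \<le> 1/2 \<Longrightarrow> \<theta> t = 1"
    using real_plateau by blast
  have tk: "test_on UNIV k" by (rule test_on_UNIV[OF k])
  have sk: "smooth k" by (rule test_on_smooth[OF k])
  obtain L where L: "compact L" "L \<subseteq> W" "\<forall>x. x \<notin> L \<longrightarrow> k x = 0" using k unfolding test_on_def by blast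
  obtain Rr where Rr: "\<forall>x\<in>L. norm x \<le> Rr" using compact_imp_bounded[OF L(1)] bounded_iff by blast
  define c where "c = (\<lambda>i::nat. real (Suc i))"
  have c1: "c i \<ge> 1" for i by (simp add: c_def)
  define e where "e = (\<lambda>i x. of_real (\<rho> x ^ 1 * \<theta> (c i * \<rho> x)) * k x)"
  define rk where "rk = (\<lambda>x. of_real (\<rho> x) * k x)"
  have se: "smooth (e i)" for i unfolding e_def
    by (intro smooth_mult C_infinity_on_of_real C_infinity_on_power smooth_rho sk
        C_infinity_on_real_compose[OF test_on_smooth[OF \<theta>(1)]] C_infinity_on_const) auto
  have srk: "smooth rk" unfolding rk_def by (intro smooth_mult C_infinity_on_of_real smooth_rho sk) auto
  define w where "w = (\<lambda>i x. rk x - e i x)"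
  have sw: "smooth (w i)" for i unfolding w_def by (intro smooth_diff srk se)
  have w0: "w i x = 0" if "x \<notin> L" for i x using L(3) that by (simp add: w_def rk_def e_def)
  have wf: "flat m (w i)" for m i
    unfolding flat_def
  proof (intro ballI allI impI)
    fix p and vs :: "'a list" assume p: "p \<in> frontier D"
    have "foldr dir_deriv vs (w i) p = foldr dir_deriv vs (\<lambda>_. 0) p"
    proof (rule foldr_dir_deriv_cong)
      show "open {x. \<bar>c i * \<rho> x\<bar> < 1/2}"
        using smooth_continuous[OF smooth_rho, of UNIV] by (intro open_Collect_less continuous_intros) auto
      show "p \<in> {x. \<bar>c i * \<rho> x\<bar> < 1/2}" using rho_frontier[OF p] by simp
      fix y assume "y \<in> {x. \<bar>c i * \<rho> x\<bar> < 1/2}"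
      then show "w i y = 0" using \<theta>(2)[of "c i * \<rho> y"] by (simp add: w_def rk_def e_def)
    qed
    then show "foldr dir_deriv vs (w i) p = 0" by simp
  qed
  have int0: "(LINT x|lborel. cutD (cd \<xi> (w i)) x) = 0" for i
  proof -
    have "smooth (cutD (w i))" by (rule smooth_cutD[OF sw wf])
    moreover have "cutD (w i) x = 0" if "x \<notin> L" for x using w0[OF that] by (simp add: cutD_def)
    ultimately have "test_on UNIV (cutD (w i))" unfolding test_on_def using L(1) by blast
    from integral_cd_zero[OF this, of \<xi>] show ?thesis unfolding cd_cutD[OF sw wf] .
  qed
  \<comment> \<open>One power of \<open>\<rho>\<close> pays for one derivative of the cutoff:
    \<open>cut_power_bound\<close> with \<open>M = 1\<close> and a single derivative has the factor
    \<open>c / c\<close>.\<close>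
  have "\<exists>C. \<forall>i x. norm (dir_deriv b (e i) x) \<le> C" if b: "b \<in> Basis" for b
  proof -
    obtain C where "C \<ge> 0" "\<forall>c\<ge>1. \<forall>x. norm (foldr dir_deriv [b] (\<lambda>x. of_real (\<rho> x ^ 1 * \<theta> (c * \<rho> x)) * k x) x) \<le> C * (c ^ length [b] / c ^ 1)"
      using cut_power_bound[OF smooth_rho tk \<theta>(1), of "[b]" 1] b by auto
    then have "norm (dir_deriv b (e i) x) \<le> C" for i x
      using c1[of i] unfolding e_def by (auto dest!: spec[of _ "c i"])
    then show ?thesis by blast
  qed
  then obtain C where C: "\<And>b i x. b \<in> Basis \<Longrightarrow> norm (dir_deriv b (e i) x) \<le> C b" by metis
  have "test_on UNIV (cd \<xi> rk)"
    unfolding rk_def by (intro test_on_cd test_on_mult_right tk C_infinity_on_of_real smooth_rho) auto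
  then obtain B where B: "B > 0" "\<And>x. norm (cd \<xi> rk x) \<le> B" using test_on_bounded by blast
  define A where "A = B + (\<Sum>b\<in>Basis. norm (\<xi> b) * C b)"
  have bound: "norm (cd \<xi> (w i) x) \<le> A" for i x
  proof -
    have "cd \<xi> (w i) x = cd \<xi> rk x - cd \<xi> (e i) x" unfolding w_def by (simp add: cd_diff srk se)
    then have "norm (cd \<xi> (w i) x) \<le> norm (cd \<xi> rk x) + norm (cd \<xi> (e i) x)" by (simp add: norm_triangle_ineq4)
    also have "norm (cd \<xi> (e i) x) \<le> (\<Sum>b\<in>Basis. norm (\<xi> b) * C b)"
      unfolding cd_def by (rule sum_norm_le) (auto simp: norm_mult intro!: mult_left_mono C)
    finally show ?thesis using B(2)[of x] by (simp add: A_def)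
  qed
  have "(\<lambda>i. LINT x|lborel. cutD (cd \<xi> (w i)) x) \<longlonglongrightarrow> (LINT x|lborel. cutD (cd \<xi> rk) x)"
  proof (rule integral_dominated_convergence[where w = "\<lambda>x. indicator (cball 0 Rr) x *\<^sub>R A"])
    show "integrable lborel (\<lambda>x::'a. indicator (cball 0 Rr) x *\<^sub>R A)"
      using emeasure_lborel_cball_finite[of 0 Rr] by (intro integrable_scaleR_left integrable_real_indicator) auto
    show "cutD (cd \<xi> rk) \<in> borel_measurable lborel" using cutD_measurable[OF smooth_cd[OF srk]] by simp
    show "cutD (cd \<xi> (w i)) \<in> borel_measurable lborel" for i using cutD_measurable[OF smooth_cd[OF sw]] by simp
    show "AE x in lborel. norm (cutD (cd \<xi> (w i)) x) \<le> indicator (cball 0 Rr) x *\<^sub>R A" for i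
    proof (rule AE_I2)
      fix x
      show "norm (cutD (cd \<xi> (w i)) x) \<le> indicator (cball 0 Rr) x *\<^sub>R A"
      proof (cases "x \<in> L")
        case True
        then show ?thesis using bound[of i x] Rr order_trans[OF norm_ge_zero bound[of i x]] by (auto simp: cutD_def)
      next
        case False
        have "cd \<xi> (w i) x = 0"
          unfolding cd_def using dir_deriv_outside_compact[OF L(1) w0 False] by simp
        then show ?thesis using order_trans[OF norm_ge_zero bound[of i x]] by (auto simp: cutD_def indicator_def)
      qed
    qed
    show "AE x in lborel. (\<lambda>i. cutD (cd \<xi> (w i)) x) \<longlonglongrightarrow> cutD (cd \<xi> rk) x"
    proof (rule AE_I2)
      fix x
      have "eventually (\<lambda>i. cutD (cd \<xi> (w i)) x = cutD (cd \<xi> rk) x) sequentially"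
      proof (cases "x \<in> D \<and> x \<in> L")
        case True
        then have neg: "\<rho> x < 0" using D_iff L(2) by blast
        obtain N :: nat where N: "real N > 1 / (- \<rho> x)" using reals_Archimedean2 by blast
        show ?thesis
          using eventually_ge_at_top[of N]
        proof eventually_elim
          case (elim i)
          have "c i > 1 / (- \<rho> x)" using N elim by (simp add: c_def)
          then have cr: "c i * \<rho> x < -1" using neg by (simp add: field_simps)
          have "cd \<xi> (w i) x = cd \<xi> rk x"
          proof (rule cd_cong)
            show "open {x. c i * \<rho> x < -1}"
              using smooth_continuous[OF smooth_rho, of UNIV] by (intro open_Collect_less continuous_intros) auto
            show "x \<in> {x. c i * \<rho> x < -1}" using cr by simp
            fix y assume "y \<in> {x. c i * \<rho> x < -1}"
            then have "\<theta> (c i * \<rho> y) = 0" by (intro test_on_outside[OF \<theta>(1)]) auto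
            then show "w i y = rk y" by (simp add: w_def e_def)
          qed
          then show ?case by (simp add: cutD_def)
        qed
      next
        case False
        then consider "x \<notin> D" | "x \<notin> L" by blast
        then have "cutD (cd \<xi> (w i)) x = cutD (cd \<xi> rk) x" for i
        proof cases
          case 2
          have r0: "rk y = 0" if "y \<notin> L" for y using L(3) that by (simp add: rk_def)
          have "cd \<xi> rk x = 0" unfolding cd_def using dir_deriv_outside_compact[OF L(1) r0 2] by simp
          moreover have "cd \<xi> (w i) x = 0" unfolding cd_def using dir_deriv_outside_compact[OF L(1) w0 2] by simp
          ultimately show ?thesis by (simp add: cutD_def)
        qed (simp add: cutD_def)
        then show ?thesis by simp
      qed
      then show "(\<lambda>i. cutD (cd \<xi> (w i)) x) \<longlonglongrightarrow> cutD (cd \<xi> rk) x" by (rule tendsto_eventually)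
    qed
  qed
  then show ?thesis unfolding int0 rk_def using LIMSEQ_unique tendsto_const by blast
qed

lemma cutD_add: "cutD (\<lambda>x. f x + g x) x = cutD f x + cutD g x"
  by (simp add: cutD_def)

lemma integral_cutD_by_parts:
  assumes "smooth h" "test_on W \<psi>"
  shows "(LINT x|lborel. cutD (\<lambda>x. cd \<xi> (\<lambda>x. of_real (\<rho> x) * h x) x * \<psi> x) x) =
    - (LINT x|lborel. cutD (\<lambda>x. of_real (\<rho> x) * h x * cd \<xi> \<psi> x) x)"
proof -
  have s\<psi>: "smooth \<psi>" and t\<psi>: "test_on UNIV \<psi>" using assms(2) test_on_smooth test_on_UNIV by blast+
  have sr: "smooth (\<lambda>x. of_real (\<rho> x) * h x)" by (intro smooth_mult C_infinity_on_of_real smooth_rho assms) auto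
  have "cd \<xi> (\<lambda>x. of_real (\<rho> x) * (h x * \<psi> x)) = (\<lambda>x. of_real (\<rho> x) * h x * cd \<xi> \<psi> x + cd \<xi> (\<lambda>x. of_real (\<rho> x) * h x) x * \<psi> x)"
    using cd_mult[OF sr s\<psi>, of \<xi>] by (simp add: mult.assoc)
  moreover have "(LINT x|lborel. cutD (cd \<xi> (\<lambda>x. of_real (\<rho> x) * (h x * \<psi> x))) x) = 0"
    by (rule integral_cutD_cd_zero) (intro test_on_mult_right assms)
  ultimately have "(LINT x|lborel. cutD (\<lambda>x. of_real (\<rho> x) * h x * cd \<xi> \<psi> x) x + cutD (\<lambda>x. cd \<xi> (\<lambda>x. of_real (\<rho> x) * h x) x * \<psi> x) x) = 0"
    by (simp add: cutD_add)
  moreover have "integrable lborel (cutD (\<lambda>x. of_real (\<rho> x) * h x * cd \<xi> \<psi> x))"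
    by (intro cutD_integrable test_on_mult_right test_on_cd t\<psi> sr)
  moreover have "integrable lborel (cutD (\<lambda>x. cd \<xi> (\<lambda>x. of_real (\<rho> x) * h x) x * \<psi> x))"
    by (intro cutD_integrable test_on_mult_right t\<psi> smooth_cd sr)
  ultimately show ?thesis by (simp add: add_eq_0_iff2)
qed

text \<open>One integration by parts has no boundary term because of the factor
  \<open>\<rho>\<close>. It leaves \<open>\<rho> * h\<close> times derivatives of
  \<open>\<phi>\<close>, and with the coefficients frozen at each point these sum to zero by the
  identity \<open>QP\<close>.\<close>

lemma weak_vanishing_factor:
  assumes P1: "\<And>\<xi>s j \<eta>s i. (\<xi>s, j) \<in> set ts \<Longrightarrow> (\<eta>s, i) \<in> set (P j) \<Longrightarrow> length \<eta>s = 1"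
    and h: "\<And>i. smooth (h i)"
    and QP: "\<And>f. (\<And>i. smooth (f i)) \<Longrightarrow> cop ts (\<lambda>j. cop (P j) f) = (\<lambda>x. 0)"
    and \<phi>: "test_on W \<phi>"
  shows "wint ts (\<lambda>j. cop (P j) (\<lambda>i x. of_real (\<rho> x) * h i x)) \<phi> = 0"
proof -
  define rhs where "rhs = (\<lambda>ps \<psi> x. \<Sum>(\<eta>s, i)\<leftarrow>ps. of_real (\<rho> x) * h i x * foldr cd \<eta>s \<psi> x)"
  have sr: "smooth (\<lambda>x. of_real (\<rho> x) * h i x)" for i by (intro smooth_mult C_infinity_on_of_real smooth_rho h) auto
  have trhs: "test_on UNIV (rhs ps \<psi>)" if "test_on UNIV \<psi>" for ps \<psi>
  proof (induction ps)
    case (Cons t ps)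
    have "rhs (t # ps) \<psi> = (\<lambda>x. of_real (\<rho> x) * h (snd t) x * foldr cd (fst t) \<psi> x + rhs ps \<psi> x)"
      by (simp add: rhs_def case_prod_beta)
    then show ?case using Cons by (auto intro!: test_on_add test_on_mult_right test_on_cds that sr)
  qed (simp add: rhs_def test_on_zero)
  have A: "(LINT x|lborel. cutD (\<lambda>x. cop ps (\<lambda>i x. of_real (\<rho> x) * h i x) x * \<psi> x) x) = - (LINT x|lborel. cutD (rhs ps \<psi>) x)"
    if ps: "\<And>\<eta>s i. (\<eta>s, i) \<in> set ps \<Longrightarrow> length \<eta>s = 1" and \<psi>: "test_on W \<psi>" for ps \<psi>
    using ps
  proof (induction ps)
    case Nil
    then show ?case by (simp add: rhs_def cutD_def)
  next
    case (Cons t ps)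
    obtain \<xi> i where t: "t = ([\<xi>], i)"
    proof -
      obtain \<eta>s i where "t = (\<eta>s, i)" by (cases t)
      moreover then have "length \<eta>s = 1" using Cons.prems by auto
      ultimately show ?thesis using that by (auto simp: length_Suc_conv)
    qed
    have t\<psi>: "test_on UNIV \<psi>" using \<psi> test_on_UNIV by blast
    have sc: "smooth (cop ps (\<lambda>i x. of_real (\<rho> x) * h i x))" by (intro smooth_cop sr)
    have i1: "integrable lborel (cutD (\<lambda>x. cd \<xi> (\<lambda>x. of_real (\<rho> x) * h i x) x * \<psi> x))"
      by (intro cutD_integrable test_on_mult_right t\<psi> smooth_cd sr)
    have i2: "integrable lborel (cutD (\<lambda>x. cop ps (\<lambda>i x. of_real (\<rho> x) * h i x) x * \<psi> x))"
      by (intro cutD_integrable test_on_mult_right t\<psi> sc)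
    have i3: "integrable lborel (cutD (\<lambda>x. of_real (\<rho> x) * h i x * cd \<xi> \<psi> x))"
      by (intro cutD_integrable test_on_mult_right test_on_cd t\<psi> sr)
    have i4: "integrable lborel (cutD (rhs ps \<psi>))" by (intro cutD_integrable trhs t\<psi>)
    have "(LINT x|lborel. cutD (\<lambda>x. cop (t # ps) (\<lambda>i x. of_real (\<rho> x) * h i x) x * \<psi> x) x) =
       (LINT x|lborel. cutD (\<lambda>x. cd \<xi> (\<lambda>x. of_real (\<rho> x) * h i x) x * \<psi> x) x + cutD (\<lambda>x. cop ps (\<lambda>i x. of_real (\<rho> x) * h i x) x * \<psi> x) x)"
      unfolding cop_Cons t by (simp add: distrib_right cutD_add)
    also have "\<dots> = (LINT x|lborel. cutD (\<lambda>x. cd \<xi> (\<lambda>x. of_real (\<rho> x) * h i x) x * \<psi> x) x) + (LINT x|lborel. cutD (\<lambda>x. cop ps (\<lambda>i x. of_real (\<rho> x) * h i x) x * \<psi> x) x)"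
      by (rule Bochner_Integration.integral_add[OF i1 i2])
    also have "\<dots> = - (LINT x|lborel. cutD (\<lambda>x. of_real (\<rho> x) * h i x * cd \<xi> \<psi> x) x) - (LINT x|lborel. cutD (rhs ps \<psi>) x)"
    proof -
      have "(LINT x|lborel. cutD (\<lambda>x. cop ps (\<lambda>i x. of_real (\<rho> x) * h i x) x * \<psi> x) x) = - (LINT x|lborel. cutD (rhs ps \<psi>) x)"
        using Cons.prems by (intro Cons.IH) auto
      then show ?thesis using integral_cutD_by_parts[OF h \<psi>] by simp
    qed
    also have "\<dots> = - (LINT x|lborel. cutD (\<lambda>x. of_real (\<rho> x) * h i x * cd \<xi> \<psi> x) x + cutD (rhs ps \<psi>) x)"
      using Bochner_Integration.integral_add[OF i3 i4] by simp
    also have "(\<lambda>x. cutD (\<lambda>x. of_real (\<rho> x) * h i x * cd \<xi> \<psi> x) x + cutD (rhs ps \<psi>) x) = cutD (rhs (t # ps) \<psi>)"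
      by (rule ext) (simp add: rhs_def t cutD_def)
    finally show ?case .
  qed
  have B: "wint ts' (\<lambda>j. cop (P j) (\<lambda>i x. of_real (\<rho> x) * h i x)) \<phi> = - (LINT x|lborel. cutD (\<lambda>x. \<Sum>(\<xi>s, j)\<leftarrow>ts'. rhs (P j) (foldr cd \<xi>s \<phi>) x) x)
      \<and> test_on UNIV (\<lambda>x. \<Sum>(\<xi>s, j)\<leftarrow>ts'. rhs (P j) (foldr cd \<xi>s \<phi>) x)"
    if "set ts' \<subseteq> set ts" for ts'
    using that
  proof (induction ts')
    case Nil
    then show ?case by (simp add: wint_def cutD_def test_on_zero)
  next
    case (Cons t ts')
    obtain \<xi>s j where t: "t = (\<xi>s, j)" by (cases t)
    have t1: "test_on UNIV (rhs (P j) (foldr cd \<xi>s \<phi>))" by (intro trhs test_on_cds test_on_UNIV[OF \<phi>])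
    let ?S = "\<lambda>x. \<Sum>(\<xi>s, j)\<leftarrow>ts'. rhs (P j) (foldr cd \<xi>s \<phi>) x"
    have IH: "wint ts' (\<lambda>j. cop (P j) (\<lambda>i x. of_real (\<rho> x) * h i x)) \<phi> = - (LINT x|lborel. cutD ?S x)" "test_on UNIV ?S"
      using Cons by auto
    have "wint (t # ts') (\<lambda>j. cop (P j) (\<lambda>i x. of_real (\<rho> x) * h i x)) \<phi> =
       - (LINT x|lborel. cutD (rhs (P j) (foldr cd \<xi>s \<phi>)) x) - (LINT x|lborel. cutD ?S x)"
      using A[of "P j" "foldr cd \<xi>s \<phi>"] P1[of \<xi>s j] Cons.prems t IH(1) test_on_cds[OF \<phi>] by (simp add: wint_def)
    also have "\<dots> = - (LINT x|lborel. cutD (rhs (P j) (foldr cd \<xi>s \<phi>)) x + cutD ?S x)"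
      using Bochner_Integration.integral_add[OF cutD_integrable[OF t1] cutD_integrable[OF IH(2)]] by simp
    finally show ?case using test_on_add[OF t1 IH(2)] by (simp add: t cutD_add)
  qed
  have "(\<Sum>(\<xi>s, j)\<leftarrow>ts. rhs (P j) (foldr cd \<xi>s \<phi>) x) = 0" for x
  proof -
    have s\<phi>: "smooth \<phi>" by (rule test_on_smooth[OF \<phi>])
    \<comment> \<open>The point \<open>x\<close> of the coefficient is fixed, while \<open>y\<close>
      is the variable of differentiation.\<close>
    have "cop ts (\<lambda>j. cop (P j) (\<lambda>i y. (of_real (\<rho> x) * h i x) * \<phi> y)) x = 0"
      by (subst QP) (auto intro: smooth_cmult s\<phi>)
    then show ?thesis
      unfolding cop_def[of ts] cds_cop_frozen[OF s\<phi>] rhs_def .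
  qed
  then show ?thesis using B[OF order_refl] by (simp add: cutD_def)
qed

end

subsection \<open>Flattening the inhomogeneity at the boundary\<close>

text \<open>\<open>P\<close> and \<open>Q\<close> hold the rows of \<open>\<D>\<^sub>0\<close> and
  \<open>\<D>\<^sub>1\<close>, of orders \<open>r0\<close> and \<open>r1\<close>, and
  \<open>R\<close> is the homotopy; \<open>Js\<close> consists of the rows of \<open>P\<close> that
  correspond to components of the bundle. The alternatives in \<open>orders\<close> are the cases
  \<open>k \<noteq> 1\<close> and \<open>k = 1\<close>.\<close>

locale symbol_complex =
  fixes P :: "'j \<Rightarrow> (('a::euclidean_space \<Rightarrow> complex) list \<times> 'i) list"
    and Q :: "'l \<Rightarrow> (('a \<Rightarrow> complex) list \<times> 'j) list"
    and R :: "'i \<Rightarrow> (('a \<Rightarrow> complex) list \<times> 'j) list"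
    and Js :: "'j set" and r0 r1 :: nat
  assumes P_len: "\<And>j \<xi>s i. j \<in> Js \<Longrightarrow> (\<xi>s, i) \<in> set (P j) \<Longrightarrow> length \<xi>s = r0"
    and Q_len: "\<And>l \<xi>s j. (\<xi>s, j) \<in> set (Q l) \<Longrightarrow> length \<xi>s = r1 \<and> j \<in> Js"
    and R_in: "\<And>i \<xi>s j. (\<xi>s, j) \<in> set (R i) \<Longrightarrow> j \<in> Js"
    and r0_pos: "r0 \<ge> 1" and orders: "r1 \<le> 1 \<or> (r1 = 2 \<and> r0 = 1)"
    and QP: "\<And>f l. (\<And>i. smooth (f i)) \<Longrightarrow> cop (Q l) (\<lambda>j. cop (P j) f) = (\<lambda>x. 0)"
    and symbol_exact: "\<And>n w j. (\<And>l. symb (Q l) n w = 0) \<Longrightarrow> j \<in> Js \<Longrightarrow>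
      symb (P j) n (\<lambda>i. symb (R i) n w) = of_real (n \<bullet> n) * w j"

locale boundary_problem = defining_function D \<rho> W + symbol_complex P Q R Js r0 r1
  for D :: "'a::euclidean_space set" and \<rho> W
    and P :: "'j \<Rightarrow> (('a \<Rightarrow> complex) list \<times> 'i) list"
    and Q :: "'l \<Rightarrow> (('a \<Rightarrow> complex) list \<times> 'j) list"
    and R :: "'i \<Rightarrow> (('a \<Rightarrow> complex) list \<times> 'j) list" and Js r0 r1 +
  fixes U :: "'a set"
  assumes U: "open U" "frontier D \<subseteq> U" "U \<subseteq> W"
begin

definition weak :: "('i \<Rightarrow> 'a \<Rightarrow> complex) \<Rightarrow> bool" where
  "weak F \<longleftrightarrow> (\<forall>l \<phi>. test_on U \<phi> \<longrightarrow> wint (Q l) (\<lambda>j. cop (P j) F) \<phi> = 0)"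

lemma wint_diff:
  assumes "\<And>\<xi>s j. (\<xi>s, j) \<in> set ts \<Longrightarrow> test_on UNIV (G j) \<and> test_on UNIV (H j)" "smooth \<phi>"
  shows "wint ts (\<lambda>j x. G j x - H j x) \<phi> = wint ts G \<phi> - wint ts H \<phi>"
  using assms(1)
proof (induction ts)
  case (Cons t ts)
  obtain \<xi>s j where t: "t = (\<xi>s, j)" by (cases t)
  have tt: "test_on UNIV (G j)" "test_on UNIV (H j)" using Cons.prems t by auto
  have "integrable lborel (cutD (\<lambda>x. G j x * foldr cd \<xi>s \<phi> x))" "integrable lborel (cutD (\<lambda>x. H j x * foldr cd \<xi>s \<phi> x))"
    by (intro cutD_integrable test_on_mult_left tt smooth_cds assms)+
  moreover have "cutD (\<lambda>x. (G j x - H j x) * foldr cd \<xi>s \<phi> x) =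
      (\<lambda>x. cutD (\<lambda>x. G j x * foldr cd \<xi>s \<phi> x) x - cutD (\<lambda>x. H j x * foldr cd \<xi>s \<phi> x) x)"
    by (rule ext) (simp add: cutD_def left_diff_distrib)
  ultimately have "(LINT x|lborel. cutD (\<lambda>x. (G j x - H j x) * foldr cd \<xi>s \<phi> x) x) =
      (LINT x|lborel. cutD (\<lambda>x. G j x * foldr cd \<xi>s \<phi> x) x) - (LINT x|lborel. cutD (\<lambda>x. H j x * foldr cd \<xi>s \<phi> x) x)"
    using Bochner_Integration.integral_diff by simp
  moreover have "wint ts (\<lambda>j x. G j x - H j x) \<phi> = wint ts G \<phi> - wint ts H \<phi>"
    using Cons.prems by (intro Cons.IH) auto
  ultimately show ?case by (simp add: wint_def t)
qed (simp add: wint_def)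

lemma jet_diff:
  "smooth f \<Longrightarrow> smooth g \<Longrightarrow> jet m f p c \<Longrightarrow> jet m g p d \<Longrightarrow> jet m (\<lambda>x. f x - g x) p (c - d)"
  unfolding jet_def by (simp add: foldr_dir_deriv_diff right_diff_distrib)

text \<open>The leading jet of \<open>cop (Q l) G\<close>, of order \<open>m - r1\<close>, has the
  symbol applied to \<open>\<kappa>\<close> as its coefficient; as the function is zero, repeated
  differentiation in a transversal direction shows that this coefficient is zero. From order
  \<open>r1\<close> on this replaces the weak condition.\<close>

lemma closed_imp_symbol:
  assumes p: "p \<in> frontier D" and m: "r1 \<le> m"
    and G: "\<And>j. j \<in> Js \<Longrightarrow> smooth (G j) \<and> jet m (G j) p (\<kappa> j)"
    and closed: "cop (Q l) G = (\<lambda>x. 0)"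
  shows "symb (Q l) (grad p) \<kappa> = 0"
proof -
  have j: "jet (m - r1) (cop (Q l) G) p (symb (Q l) (grad p) \<kappa>)"
    by (rule jet_cop[where r = r1]) (use Q_len G m in auto)
  obtain b0 :: 'a where b0: "b0 \<in> Basis" "dir_deriv b0 \<rho> p \<noteq> 0"
    using drho_nonzero[OF p] dir_deriv_expand[OF rho_diff, of _ p] by (metis (no_types, lifting) scaleR_zero_right sum.neutral)
  define vs where "vs = replicate (m - r1) b0"
  have "set vs \<subseteq> Basis" "length vs = m - r1" using b0 by (auto simp: vs_def set_replicate_conv_if)
  then have "0 = dn vs p * symb (Q l) (grad p) \<kappa>"
    using j[unfolded jet_def closed, rule_format, of vs] by simp
  moreover have "dn (replicate k b0) p \<noteq> 0" for k using b0 by (induction k) auto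
  ultimately show ?thesis by (simp add: vs_def)
qed

lemma cutoff_near_frontier:
  "\<exists>\<eta> :: 'a \<Rightarrow> complex. test_on UNIV \<eta> \<and> (\<forall>p\<in>frontier D. \<eta> p = 1)"
proof -
  obtain \<eta> :: "'a \<Rightarrow> real" and V where \<eta>: "test_on UNIV \<eta>" "frontier D \<subseteq> V" "\<forall>x\<in>V. \<eta> x = 1"
    using smooth_cutoff_ex[OF compact_frontier open_UNIV subset_UNIV] by (elim exE conjE) (rule that)
  show ?thesis
    by (rule exI[of _ "\<lambda>x. of_real (\<eta> x)"]) (use \<eta> test_on_bounded_linear[OF bounded_linear_of_real \<eta>(1)] in auto)
qed

text \<open>Below order \<open>r1\<close> the symbol equation for the leading jet comes from the
  weak condition, from there on from \<open>QP\<close>. Symbol exactness then exhibits the jet as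
  that of \<open>P\<close> applied to \<open>\<rho>^(m + r0) * h\<close>, which is
  subtracted.\<close>

lemma flatten_step:
  assumes F: "\<And>i. test_on UNIV (F i)" and fl: "\<And>j. j \<in> Js \<Longrightarrow> flat m (cop (P j) F)"
    and wk: "m < r1 \<Longrightarrow> weak F"
  shows "\<exists>h. (\<forall>i. test_on UNIV (h i)) \<and>
    (\<forall>j\<in>Js. flat (Suc m) (cop (P j) (\<lambda>i x. F i x - of_real (\<rho> x) ^ (m + r0) * h i x))) \<and>
    (Suc m < r1 \<longrightarrow> weak (\<lambda>i x. F i x - of_real (\<rho> x) ^ (m + r0) * h i x))"
proof -
  have sF: "smooth (F i)" for i by (rule test_on_smooth[OF F])
  have sG: "smooth (cop (P j) F)" for j by (intro smooth_cop sF)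
  have tG: "test_on UNIV (cop (P j) F)" for j by (intro test_on_cop F)
  have "\<forall>j. \<exists>\<kappa>. smooth \<kappa> \<and> (j \<in> Js \<longrightarrow> (\<forall>p\<in>frontier D. jet m (cop (P j) F) p (\<kappa> p)))"
  proof
    fix j show "\<exists>\<kappa>. smooth \<kappa> \<and> (j \<in> Js \<longrightarrow> (\<forall>p\<in>frontier D. jet m (cop (P j) F) p (\<kappa> p)))"
      using normal_jet[OF sG fl, of j] C_infinity_on_const[of UNIV 0] by (cases "j \<in> Js") blast+
  qed
  from choice[OF this] obtain \<kappa> where \<kappa>: "\<And>j. smooth (\<kappa> j)"
    "\<And>j p. j \<in> Js \<Longrightarrow> p \<in> frontier D \<Longrightarrow> jet m (cop (P j) F) p (\<kappa> j p)" by blast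
  have symQ: "symb (Q l) (grad p) (\<lambda>j. \<kappa> j p) = 0" if p: "p \<in> frontier D" for l p
  proof (cases "m < r1")
    case True
    then have m1: "m \<le> 1" using orders by auto
    show ?thesis
    proof (rule weak_imp_symbol[OF p U(1,2) m1])
      show "length \<xi>s = r1 \<and> test_on UNIV (cop (P j) F) \<and> jet m (cop (P j) F) p (\<kappa> j p)"
        if "(\<xi>s, j) \<in> set (Q l)" for \<xi>s j
        using Q_len[OF that] tG \<kappa>(2) p by auto
      show "wint (Q l) (\<lambda>j. cop (P j) F) \<phi> = 0" if "test_on U \<phi>" for \<phi>
        using wk[OF True] that unfolding weak_def by blast
    qed
  next
    case False
    then show ?thesis
      by (intro closed_imp_symbol[OF p, of m "\<lambda>j. cop (P j) F"] QP sF) (use sG \<kappa>(2) p in auto)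
  qed
  obtain q :: "'a \<Rightarrow> complex" where q: "smooth q" "\<forall>p\<in>frontier D. q p * of_real (grad p \<bullet> grad p) = 1"
    using inverse_grad_square by blast
  obtain \<eta> :: "'a \<Rightarrow> complex" where \<eta>: "test_on UNIV \<eta>" "\<forall>p\<in>frontier D. \<eta> p = 1"
    using cutoff_near_frontier by blast
  \<comment> \<open>The function \<open>q\<close> divides by the squared conormal of the symbol
    identity, the factorial is the leading coefficient of \<open>\<rho>^(m + r0)\<close>, and
    \<open>\<eta>\<close> makes the support compact.\<close>
  define h where "h = (\<lambda>i x. \<eta> x * (inverse (fact (m + r0)) * (q x * symb (R i) (grad x) (\<lambda>j. \<kappa> j x))))"
  have th: "test_on UNIV (h i)" for i
    unfolding h_def by (intro test_on_mult_left \<eta> smooth_mult q C_infinity_on_const smooth_symb \<kappa>)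
  define T where "T = (\<lambda>i x. of_real (\<rho> x) ^ (m + r0) * h i x)"
  have tT: "test_on UNIV (T i)" for i unfolding T_def
    by (intro test_on_mult_right th C_infinity_on_power C_infinity_on_of_real smooth_rho) auto
  have sT: "smooth (T i)" for i by (rule test_on_smooth[OF tT])
  have cd: "cop (P j) (\<lambda>i x. F i x - T i x) = (\<lambda>x. cop (P j) F x - cop (P j) T x)" for j
    by (intro cop_diff sF sT)
  have "flat (Suc m) (cop (P j) (\<lambda>i x. F i x - T i x))" if j: "j \<in> Js" for j
  proof (rule jet_zero_imp_flat)
    fix p assume p: "p \<in> frontier D"
    have jT: "jet (m + r0) (T i) p (q p * symb (R i) (grad p) (\<lambda>j. \<kappa> j p))" for i
    proof -
      have "fact (m + r0) * h i p = q p * symb (R i) (grad p) (\<lambda>j. \<kappa> j p)"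
        using \<eta>(2) p by (simp add: h_def)
      then show ?thesis using jet_rho_power[OF test_on_smooth[OF th] p, of "m + r0" i] by (simp add: T_def)
    qed
    have "jet m (cop (P j) T) p (symb (P j) (grad p) (\<lambda>i. q p * symb (R i) (grad p) (\<lambda>j. \<kappa> j p)))"
      by (rule jet_cop[where r = r0]) (use P_len[OF j] sT jT in auto)
    also have "symb (P j) (grad p) (\<lambda>i. q p * symb (R i) (grad p) (\<lambda>j. \<kappa> j p)) = q p * (of_real (grad p \<bullet> grad p) * \<kappa> j p)"
      unfolding symb_cmult by (simp add: symbol_exact[OF symQ[OF p] j])
    also have "\<dots> = \<kappa> j p" using q(2) p by (simp flip: mult.assoc)
    finally have "jet m (cop (P j) T) p (\<kappa> j p)" .
    from jet_diff[OF sG smooth_cop \<kappa>(2)[OF j p] this] show "jet m (cop (P j) (\<lambda>i x. F i x - T i x)) p 0"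
      unfolding cd using sT by simp
  qed
  \<comment> \<open>The weak condition is used again only if \<open>r1 = 2\<close>, after the step
    \<open>m = 0\<close>. There \<open>r0 = 1\<close>, so the correction is
    \<open>\<rho> * h\<close> and satisfies the weak condition itself.\<close>
  moreover have "weak (\<lambda>i x. F i x - T i x)" if sm: "Suc m < r1"
  proof -
    have m0: "m = 0" "r0 = 1" "r1 = 2" using sm orders by auto
    have wF: "weak F" using wk sm by simp
    have T: "T = (\<lambda>i x. of_real (\<rho> x) * h i x)" by (simp add: T_def m0)
    show ?thesis unfolding weak_def
    proof (intro allI impI)
      fix l and \<phi> :: "'a \<Rightarrow> complex" assume \<phi>: "test_on U \<phi>"
      have "wint (Q l) (\<lambda>j. cop (P j) T) \<phi> = 0"
        unfolding T
      proof (rule weak_vanishing_factor)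
        show "length \<eta>s = 1" if "(\<xi>s, j) \<in> set (Q l)" "(\<eta>s, i) \<in> set (P j)" for \<xi>s j \<eta>s i
          using P_len[of j \<eta>s i] Q_len[OF that(1)] that(2) m0 by simp
        show "test_on W \<phi>" using test_on_mono[OF \<phi> U(3)] .
      qed (auto intro: test_on_smooth[OF th] QP)
      moreover have "wint (Q l) (\<lambda>j. cop (P j) F) \<phi> = 0" using wF \<phi> unfolding weak_def by blast
      ultimately show "wint (Q l) (\<lambda>j. cop (P j) (\<lambda>i x. F i x - T i x)) \<phi> = 0"
        unfolding cd by (subst wint_diff) (auto intro: tG test_on_cop tT test_on_smooth[OF \<phi>])
    qed
  qed
  ultimately show ?thesis using th unfolding T_def by blast
qed

lemma flat_add: "smooth f \<Longrightarrow> smooth g \<Longrightarrow> flat m f \<Longrightarrow> flat m g \<Longrightarrow> flat m (\<lambda>x. f x + g x)"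
  unfolding flat_def by (simp add: foldr_dir_deriv_add)

lemma flat_cds: "smooth g \<Longrightarrow> flat (m + length \<xi>s) g \<Longrightarrow> flat m (foldr cd \<xi>s g)"
proof (induction \<xi>s arbitrary: m)
  case (Cons \<xi> \<xi>s)
  have "flat (Suc m) (foldr cd \<xi>s g)" using Cons.prems by (intro Cons.IH) auto
  then show ?case using flat_cd[OF smooth_cds[OF Cons.prems(1)]] by simp
qed simp

lemma flat_cop:
  assumes "\<And>\<xi>s i. (\<xi>s, i) \<in> set ts \<Longrightarrow> length \<xi>s = r" "\<And>i. smooth (g i)" "\<And>i. flat (m + r) (g i)"
  shows "flat m (cop ts g)"
  using assms(1)
proof (induction ts)
  case (Cons t ts)
  obtain \<xi>s i where t: "t = (\<xi>s, i)" by (cases t)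
  then have "length \<xi>s = r" using Cons.prems by auto
  then have "flat m (foldr cd \<xi>s (g i))" using flat_cds[OF assms(2)] assms(3) by blast
  then show ?case unfolding cop_Cons t
    using Cons by (auto intro!: flat_add smooth_cds smooth_cop assms(2))
qed (simp add: flat_def)

text \<open>Infinitely many corrections are collected in one smooth function by
  \<open>borel_sum\<close>. The exponents \<open>k + r0\<close> exceed \<open>k\<close>, as
  \<open>borel_sum\<close> demands, because \<open>r0 \<ge> 1\<close>; for the same reason no
  correction changes the boundary values.\<close>

theorem flatten:
  assumes F: "\<And>i. test_on UNIV (F i)" and wk: "weak F"
  obtains F' where "\<And>i. smooth (F' i)" "\<And>i p. p \<in> frontier D \<Longrightarrow> F' i p = F i p"
    "\<And>j m. j \<in> Js \<Longrightarrow> flat m (cop (P j) F')"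
proof -
  define Inv where "Inv = (\<lambda>m Fm. (\<forall>i. test_on UNIV (Fm i)) \<and> (\<forall>j\<in>Js. flat m (cop (P j) Fm)) \<and> (m < r1 \<longrightarrow> weak Fm))"
  define Stp where "Stp = (\<lambda>m (Fm :: 'i \<Rightarrow> 'a \<Rightarrow> complex) Fs. \<exists>h. (\<forall>i. test_on UNIV (h i)) \<and> Fs = (\<lambda>i x. Fm i x - of_real (\<rho> x) ^ (m + r0) * h i x))"
  have "\<exists>f. f 0 = F \<and> (\<forall>m. Inv m (f m) \<and> Stp m (f m) (f (Suc m)))"
  proof -
    \<comment> \<open>Dependent choice leaves the starting value free; the clause for
      \<open>m = 0\<close> pins it to \<open>F\<close>.\<close>
    have "\<exists>f. \<forall>m. (Inv m (f m) \<and> (m = 0 \<longrightarrow> f m = F)) \<and> Stp m (f m) (f (Suc m))"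
    proof (rule dependent_nat_choice)
      have "flat 0 g" for g by (simp add: flat_def)
      then show "\<exists>x. Inv 0 x \<and> (0 = (0::nat) \<longrightarrow> x = F)" using F wk by (auto simp: Inv_def)
      fix Fm and m :: nat assume "Inv m Fm \<and> (m = 0 \<longrightarrow> Fm = F)"
      then have I: "\<And>i. test_on UNIV (Fm i)" "\<And>j. j \<in> Js \<Longrightarrow> flat m (cop (P j) Fm)" "m < r1 \<Longrightarrow> weak Fm" by (auto simp: Inv_def)
      obtain h where h: "\<forall>i. test_on UNIV (h i)" "\<forall>j\<in>Js. flat (Suc m) (cop (P j) (\<lambda>i x. Fm i x - of_real (\<rho> x) ^ (m + r0) * h i x))"
         "Suc m < r1 \<longrightarrow> weak (\<lambda>i x. Fm i x - of_real (\<rho> x) ^ (m + r0) * h i x)"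
        using flatten_step[OF I] by blast
      let ?N = "\<lambda>i x. Fm i x - of_real (\<rho> x) ^ (m + r0) * h i x"
      have "Inv (Suc m) ?N" unfolding Inv_def
        using h I(1) by (auto intro!: test_on_diff test_on_mult_right C_infinity_on_power C_infinity_on_of_real smooth_rho)
      moreover have "Stp m Fm ?N" unfolding Stp_def using h(1) by blast
      ultimately show "\<exists>y. (Inv (Suc m) y \<and> (Suc m = 0 \<longrightarrow> y = F)) \<and> Stp m Fm y" by blast
    qed
    then show ?thesis by blast
  qed
  then obtain f where f0: "f 0 = F" and fI: "\<And>m. Inv m (f m)" and fS: "\<And>m. Stp m (f m) (f (Suc m))" by blast
  from choice[of "\<lambda>m h. (\<forall>i. test_on UNIV (h i)) \<and> f (Suc m) = (\<lambda>i x. f m i x - of_real (\<rho> x) ^ (m + r0) * h i x)"] fS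
  obtain h where h: "\<And>m i. test_on UNIV (h m i)" "\<And>m. f (Suc m) = (\<lambda>i x. f m i x - of_real (\<rho> x) ^ (m + r0) * h m i x)"
    unfolding Stp_def by blast
  have fm: "f m i x = F i x - (\<Sum>k<m. of_real (\<rho> x) ^ (k + r0) * h k i x)" for m i x
    by (induction m) (simp_all add: f0 h(2))
  have "\<forall>i. \<exists>S. smooth S \<and> (\<forall>m. flat (Suc m) (\<lambda>x. S x - (\<Sum>k<m. of_real (\<rho> x) ^ (k + r0) * h k i x)))"
    using borel_sum[of "\<lambda>k. h k _" "\<lambda>k. k + r0"] h(1) r0_pos by auto
  from choice[OF this] obtain S where S: "\<And>i. smooth (S i)"
    "\<And>i m. flat (Suc m) (\<lambda>x. S i x - (\<Sum>k<m. of_real (\<rho> x) ^ (k + r0) * h k i x))" by blast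
  define F' where "F' = (\<lambda>i x. F i x - S i x)"
  have sF': "smooth (F' i)" for i unfolding F'_def by (intro smooth_diff test_on_smooth[OF F] S)
  show ?thesis
  proof (rule that[of F'])
    show "smooth (F' i)" for i by (rule sF')
    show "F' i p = F i p" if "p \<in> frontier D" for i p
      using S(2)[of 0 i, unfolded flat_def, rule_format, OF that, of "[]"] by (simp add: F'_def)
    fix j m assume j: "j \<in> Js"
    \<comment> \<open>Stage \<open>M\<close> differs from \<open>F'\<close> by a function flat of
      order \<open>Suc M\<close>, and \<open>P\<close> consumes \<open>r0\<close> of these
      orders.\<close>
    define M where "M = m + r0"
    have sf: "smooth (f M i)" for i using fI[of M] test_on_smooth unfolding Inv_def by blast
    have ff: "flat m (cop (P j) (f M))"
      using fI[of M] j flat_mono[of M _ m] by (auto simp: Inv_def M_def)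
    have dF: "flat (m + r0) (\<lambda>x. f M i x - F' i x)" for i
    proof -
      have "(\<lambda>x. f M i x - F' i x) = (\<lambda>x. S i x - (\<Sum>k<M. of_real (\<rho> x) ^ (k + r0) * h k i x))"
        by (rule ext) (simp add: fm F'_def)
      then show ?thesis using flat_mono[OF S(2)[of M i], of "m + r0"] by (simp add: M_def)
    qed
    have "flat m (cop (P j) (\<lambda>i x. f M i x - F' i x))"
      by (rule flat_cop[where r = r0]) (use P_len[OF j] dF in \<open>auto intro: smooth_diff sf sF'\<close>)
    then have "flat m (\<lambda>x. cop (P j) (f M) x - cop (P j) F' x)"
      by (subst (asm) cop_diff) (auto intro: sf sF')
    then show "flat m (cop (P j) F')"
      using ff smooth_cop[of "P j" "f M"] smooth_cop[of "P j" F'] sf sF'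
      unfolding flat_def by (simp add: foldr_dir_deriv_diff)
  qed
qed

end

subsection \<open>Extension from the boundary\<close>

lemma cop_cmult: "(\<And>i. smooth (f i)) \<Longrightarrow> cop ts (\<lambda>i x. c * f i x) = (\<lambda>x. c * cop ts f x)"
  by (induction ts) (auto simp: cop_Cons cds_cmult algebra_simps)

lemma cop_zero: "cop ts (\<lambda>_ _. 0) = (\<lambda>x. 0)"
  by (induction ts) (auto simp: cop_Cons)

text \<open>Two homotopies serve different ends: \<open>R0\<close>, built on one block, solves the
  equation with the Laplacian of a four-dimensional slice and so produces zeros; \<open>R\<close>,
  with the full Laplacian, shows that the solution is harmonic off \<open>closure D\<close>.\<close>

lemma (in boundary_problem) extension:
  fixes J :: "'b::euclidean_space \<Rightarrow> 'a" and R0 :: "'i \<Rightarrow> (('a \<Rightarrow> complex) list \<times> 'j) list"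
  assumes dimb: "DIM('b) = 4" and lin: "linear J" and iso: "\<And>y. norm (J y) = norm y"
    and JB: "\<And>b. b \<in> Basis \<Longrightarrow> J b \<in> Basis"
    and e': "e' \<in> Basis" "\<And>y. J y \<bullet> e' = 0"
    and dima: "DIM('a) = 2 * M + 2" "M \<ge> 1"
    and conn: "connected (- closure D)"
    and R0_in: "\<And>i \<xi>s j. (\<xi>s, j) \<in> set (R0 i) \<Longrightarrow> j \<in> Js"
    and solve: "\<And>G j. (\<And>j. smooth (G j)) \<Longrightarrow> (\<And>l. cop (Q l) G = (\<lambda>x. 0)) \<Longrightarrow> j \<in> Js \<Longrightarrow>
       cop (P j) (\<lambda>i. cop (R0 i) G) = (\<lambda>x. \<Sum>b\<in>Basis. dir_deriv (J b) (dir_deriv (J b) (G j)) x)"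
    and RP: "\<And>f i. i \<in> Is \<Longrightarrow> (\<And>i. smooth (f i)) \<Longrightarrow> cop (R i) (\<lambda>j. cop (P j) f) = laplacian (f i)"
    and R0_empty: "\<And>i. i \<notin> Is \<Longrightarrow> R0 i = []"
    and F: "\<And>i. test_on UNIV (F i)" and wk: "weak F"
  shows "\<exists>ft. (\<forall>i. smooth (ft i)) \<and> (\<forall>i. \<forall>p\<in>frontier D. ft i p = F i p) \<and>
    (\<forall>j\<in>Js. \<forall>x\<in>D. cop (P j) ft x = 0)"
proof -
  obtain F' where F': "\<And>i. smooth (F' i)" "\<And>i p. p \<in> frontier D \<Longrightarrow> F' i p = F i p"
    "\<And>j m. j \<in> Js \<Longrightarrow> flat m (cop (P j) F')"
    using flatten[OF F wk] by metis
  \<comment> \<open>Indices outside \<open>Js\<close> carry no component of the section; the value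
    zero there keeps every \<open>G j\<close> smooth and supported in
    \<open>closure D\<close>.\<close>
  define G where "G = (\<lambda>j. if j \<in> Js then cutD (cop (P j) F') else (\<lambda>x. 0))"
  have sPF: "smooth (cop (P j) F')" for j by (intro smooth_cop F')
  have sG: "smooth (G j)" for j
    unfolding G_def using smooth_cutD[OF sPF F'(3)] C_infinity_on_const[of UNIV 0] by auto
  have cpt: "compact (closure D)" using bounded_D by (simp add: compact_closure)
  have G0: "G j x = 0" if "x \<notin> closure D" for j x
    using that closure_subset by (auto simp: G_def cutD_def)
  have tG: "test_on UNIV (G j)" for j
    unfolding test_on_def using sG G0 cpt by blast
  \<comment> \<open>Flatness of every order lets the extension by zero commute with
    \<open>Q\<close>, so the identity \<open>QP\<close> for \<open>F'\<close> passes to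
    \<open>G\<close>.\<close>
  have QG: "cop (Q l) G = (\<lambda>x. 0)" for l
  proof -
    have "cop (Q l) G = cop (Q l) (\<lambda>j. cutD (cop (P j) F'))"
      by (rule ext, rule cop_cong[of UNIV]) (auto simp: G_def dest: Q_len)
    also have "\<dots> = cutD (cop (Q l) (\<lambda>j. cop (P j) F'))"
      by (rule cop_cutD) (use Q_len F'(3) sPF in force)
    also have "\<dots> = (\<lambda>x. 0)" by (simp add: QP[OF F'(1)] cutD_def[abs_def])
    finally show ?thesis .
  qed
  have dimb': "DIM('b) = 2 * 1 + 2" using dimb by simp
  define c where "c = newton_const TYPE('b) 1"
  have c: "c \<noteq> 0" unfolding c_def by (rule newton_const_nonzero[OF dimb']) simp
  interpret ko: kernel_op "newton 1 0" J by (rule newton_kernel_op[OF dimb' lin iso])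
  have tR: "test_on UNIV (cop (R0 i) G)" for i by (intro test_on_cop tG)
  define v where "v = (\<lambda>i. kconv (newton 1 0) J (cop (R0 i) G))"
  have sv: "smooth (v i)" for i unfolding v_def by (rule ko.smooth_kconv[OF tR])
  define u where "u = (\<lambda>i x. inverse c * v i x)"
  have su: "smooth (u i)" for i unfolding u_def by (rule smooth_cmult[OF sv])
  have Pu: "cop (P j) u = G j" if j: "j \<in> Js" for j
  proof
    fix x
    have "cop (P j) v = kconv (newton 1 0) J (cop (P j) (\<lambda>i. cop (R0 i) G))"
      unfolding v_def by (rule ko.cop_kconv) (rule tR)
    also have "cop (P j) (\<lambda>i. cop (R0 i) G) = (\<lambda>x. \<Sum>b\<in>Basis. dir_deriv (J b) (dir_deriv (J b) (G j)) x)"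
      by (rule solve[OF sG QG j])
    finally have "cop (P j) v x = c * G j x"
      using newton_slice[OF dimb' lin iso JB tG, of j x] by (simp add: c_def)
    then show "cop (P j) u x = G j x" unfolding u_def cop_cmult[OF sv] using c by simp
  qed
  obtain Rb where Rb: "Rb > 0" "\<And>x. x \<in> closure D \<Longrightarrow> norm x \<le> Rb"
    using compact_imp_bounded[OF cpt] unfolding bounded_pos by blast
  \<comment> \<open>The vector \<open>e'\<close> is orthogonal to the range of \<open>J\<close>, so
    a slice through a point of \<open>Z\<close> stays in \<open>Z\<close> and never meets the
    support of \<open>G\<close>.\<close>
  define Z where "Z = {x. x \<bullet> e' > Rb}"
  have ne': "norm e' = 1" using e'(1) by simp
  have Zout: "x \<notin> closure D" if "x \<in> Z" for x
  proof
    assume "x \<in> closure D"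
    then have "norm x \<le> Rb" by (rule Rb(2))
    moreover have "x \<bullet> e' \<le> norm x" using norm_cauchy_schwarz[of x e'] ne' by simp
    ultimately show False using that by (simp add: Z_def)
  qed
  have openZ: "open Z" unfolding Z_def by (intro open_Collect_less continuous_intros)
  have Zne: "Z \<noteq> {}"
  proof -
    have "(2 * Rb) *\<^sub>R e' \<in> Z" using Rb(1) e'(1) by (simp add: Z_def)
    then show ?thesis by blast
  qed
  have uZ: "u i x = 0" if x: "x \<in> Z" for i x
  proof -
    have "cop (R0 i) G (x + J y) = 0" for y
    proof -
      have xy: "x + J y \<in> Z" using x e'(2)[of y] by (simp add: Z_def inner_add_left)
      have "cop (R0 i) G (x + J y) = cop (R0 i) (\<lambda>_ _. 0) (x + J y)"
        by (rule cop_cong[OF openZ xy]) (use G0 Zout in auto)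
      also have "\<dots> = 0" by (simp add: cop_zero)
      finally show ?thesis .
    qed
    then show ?thesis by (simp add: u_def v_def kconv_def)
  qed
  have lap: "laplacian (u i) x = 0" if x: "x \<in> - closure D" for i x
  proof (cases "i \<in> Is")
    case True
    have "laplacian (u i) x = cop (R i) (\<lambda>j. cop (P j) u) x" using RP[OF True su] by simp
    also have "\<dots> = cop (R i) (\<lambda>_ _. 0) x"
    proof (rule cop_cong[of "- closure D"])
      fix j y assume "j \<in> snd ` set (R i)" "y \<in> - closure D"
      then show "cop (P j) u y = 0" using Pu[of j] G0 R_in by auto
    qed (use x in auto)
    also have "\<dots> = 0" by (simp add: cop_zero)
    finally show ?thesis .
  next
    case False
    then have "u i = (\<lambda>x. 0)" by (simp add: u_def v_def R0_empty kconv_def)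
    then show ?thesis by (simp add: laplacian_def)
  qed
  have uext: "u i x = 0" if x: "x \<in> - closure D" for i x
  proof (rule unique_continuation[OF dima su _ conn lap openZ Zne _ _ x])
    show "open (- closure D)" by auto
    show "Z \<subseteq> - closure D" using Zout by blast
  qed (auto intro: uZ)
  have ufr: "u i p = 0" if p: "p \<in> frontier D" for i p
  proof -
    have "closed {x. u i x = 0}"
      using smooth_continuous[OF su, of UNIV] by (intro closed_Collect_eq continuous_on_const) auto
    then have "closure (- closure D) \<subseteq> {x. u i x = 0}"
      using uext by (intro closure_minimal) auto
    then show ?thesis using closure_exterior[OF p] by blast
  qed
  define ft where "ft = (\<lambda>i x. F' i x - u i x)"
  have "smooth (ft i)" for i unfolding ft_def by (intro smooth_diff F' su)
  moreover have "ft i p = F i p" if "p \<in> frontier D" for i p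
    using F'(2)[OF that] ufr[OF that] by (simp add: ft_def)
  moreover have "cop (P j) ft x = 0" if "j \<in> Js" "x \<in> D" for j x
    unfolding ft_def using Pu[OF that(1)] that
    by (subst cop_diff) (auto intro: F' su simp: G_def cutD_def)
  ultimately show ?thesis by blast
qed

subsection \<open>The fields \<open>\<nabla>\<^sub>A\<close> and their commutation identities\<close>

lemma cd_minus_field: "cd (\<lambda>b. - \<xi> b) f = (\<lambda>x. - cd \<xi> f x)"
  by (rule ext) (simp add: cd_def sum_negf)

lemma cop_append: "cop (ts @ us) f = (\<lambda>x. cop ts f x + cop us f x)"
  by (induction ts) (auto simp: cop_Cons)

text \<open>Exponentials are joint eigenfunctions of all fields; on them an operator is
  multiplication by its symbol.\<close>

lemma cd_cd_mult_exp:
  fixes n :: "'a::euclidean_space"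
  defines "E \<equiv> \<lambda>x. complex_of_real (exp (x \<bullet> n))"
  shows "smooth E" and "foldr cd \<xi>s (\<lambda>x. w * E x) = (\<lambda>x. ((\<Prod>\<xi>\<leftarrow>\<xi>s. sg \<xi> n) * w) * E x)"
proof -
  have dE: "dir_deriv b E = (\<lambda>x. of_real (n \<bullet> b) * E x)" for b
  proof
    fix x
    have "((\<lambda>x. exp (x \<bullet> n)) has_derivative (\<lambda>v. exp (x \<bullet> n) * (v \<bullet> n))) (at x)"
      by (auto intro!: derivative_eq_intros)
    from dir_deriv_eqI[OF bounded_linear.has_derivative[OF bounded_linear_of_real this], of b]
    show "dir_deriv b E x = of_real (n \<bullet> b) * E x" by (simp add: E_def inner_commute mult.commute)
  qed
  have diffE: "E differentiable (at x)" for x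
  proof -
    have "((\<lambda>x. exp (x \<bullet> n)) has_derivative (\<lambda>v. exp (x \<bullet> n) * (v \<bullet> n))) (at x)"
      by (auto intro!: derivative_eq_intros)
    from bounded_linear.has_derivative[OF bounded_linear_of_real this] show ?thesis
      unfolding E_def differentiable_def by blast
  qed
  show s: "smooth E"
  proof -
    have "Cn_on m UNIV E" for m
    proof (induction m)
      case (Suc m)
      then have "Cn_on m UNIV (\<lambda>x. of_real (n \<bullet> b) * E x)" for b
        by (intro Cn_on_bounded_linear[OF open_UNIV bounded_linear_mult_right])
      then show ?case using diffE dE by simp
    qed (use diffE in simp)
    then show ?thesis unfolding C_infinity_on_iff_Cn_on by blast
  qed
  have c: "cd \<xi> E = (\<lambda>x. sg \<xi> n * E x)" for \<xi>
    unfolding cd_def[abs_def] dE by (simp add: sg_def sum_distrib_left mult_ac)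
  show "foldr cd \<xi>s (\<lambda>x. w * E x) = (\<lambda>x. ((\<Prod>\<xi>\<leftarrow>\<xi>s. sg \<xi> n) * w) * E x)"
  proof (induction \<xi>s)
    case (Cons \<xi> \<xi>s)
    have "cd \<xi> (\<lambda>x. ((\<Prod>\<xi>\<leftarrow>\<xi>s. sg \<xi> n) * w) * E x) = (\<lambda>x. ((\<Prod>\<xi>\<leftarrow>\<xi>s. sg \<xi> n) * w) * cd \<xi> E x)"
      by (rule cd_cmult[OF s])
    then have "cd \<xi> (foldr cd \<xi>s (\<lambda>x. w * E x)) = (\<lambda>x. ((\<Prod>\<xi>\<leftarrow>\<xi>s. sg \<xi> n) * w) * (sg \<xi> n * E x))"
      unfolding Cons c .
    then show ?case by (simp add: fun_eq_iff)
  qed simp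
qed

lemma cop_exp: "cop ts (\<lambda>i x. w i * complex_of_real (exp (x \<bullet> n))) = (\<lambda>x. symb ts n w * complex_of_real (exp (x \<bullet> n)))"
  by (induction ts) (simp_all add: cop_Cons symb_Cons cd_cd_mult_exp distrib_right)

lemma dir_deriv_exp:
  fixes m :: "'a::euclidean_space"
  shows "dir_deriv v (\<lambda>x. w * complex_of_real (exp (x \<bullet> m))) = (\<lambda>x. (of_real (m \<bullet> v) * w) * complex_of_real (exp (x \<bullet> m)))"
proof
  fix x
  have "((\<lambda>x. exp (x \<bullet> m)) has_derivative (\<lambda>v. exp (x \<bullet> m) * (v \<bullet> m))) (at x)"
    by (auto intro!: derivative_eq_intros)
  from dir_deriv_eqI[OF bounded_linear.has_derivative[OF bounded_linear_mult_right bounded_linear.has_derivative[OF bounded_linear_of_real this]], of v w]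
  show "dir_deriv v (\<lambda>x. w * complex_of_real (exp (x \<bullet> m))) x = (of_real (m \<bullet> v) * w) * complex_of_real (exp (x \<bullet> m))"
    by (simp add: inner_commute mult_ac)
qed

locale frame =
  fixes n :: nat and e :: "nat \<Rightarrow> 'a::euclidean_space"
  assumes bij: "bij_betw e {1..4*n+4} Basis"
begin

lemma e_Basis: "1 \<le> i \<Longrightarrow> i \<le> 4*n+4 \<Longrightarrow> e i \<in> Basis"
  using bij bij_betwE by force

lemma e_inj: "1 \<le> i \<Longrightarrow> i \<le> 4*n+4 \<Longrightarrow> 1 \<le> j \<Longrightarrow> j \<le> 4*n+4 \<Longrightarrow> e i = e j \<Longrightarrow> i = j"
  using bij unfolding bij_betw_def inj_on_def by auto

lemma DIM_a: "DIM('a) = 4*n+4"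
  using bij_betw_same_card[OF bij] by simp

text \<open>Coefficient vectors of the fields with raised primed index: \<open>X A\<close> for
  \<open>0'\<close> and, below, \<open>Y A\<close> for \<open>1'\<close>. The minus sign from
  raising the index is absorbed into \<open>Y\<close>.\<close>

definition X :: "nat \<Rightarrow> 'a \<Rightarrow> complex" where
  "X A b = (let l = A div 2 in if even A then - of_bool (b = e (4*l+3)) - \<i> * of_bool (b = e (4*l+4))
     else of_bool (b = e (4*l+1)) - \<i> * of_bool (b = e (4*l+2)))"

definition Y :: "nat \<Rightarrow> 'a \<Rightarrow> complex" where
  "Y A b = (let l = A div 2 in if even A then - of_bool (b = e (4*l+1)) - \<i> * of_bool (b = e (4*l+2))
     else - of_bool (b = e (4*l+3)) + \<i> * of_bool (b = e (4*l+4)))"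

lemma cd_two_fields:
  assumes "v \<in> Basis" "w \<in> Basis"
  shows "cd (\<lambda>b. c * of_bool (b = v) + d * of_bool (b = w)) f x = c * dir_deriv v f x + d * dir_deriv w f x"
proof -
  have "cd (\<lambda>b. c * of_bool (b = v) + d * of_bool (b = w)) f x =
      (\<Sum>b\<in>Basis. if b = v then c * dir_deriv b f x else 0) + (\<Sum>b\<in>Basis. if b = w then d * dir_deriv b f x else 0)"
    unfolding cd_def sum.distrib[symmetric] by (intro sum.cong refl) (auto simp: distrib_right)
  then show ?thesis using assms by (simp add: distrib_right)
qed

lemma index_bounds:
  assumes "A \<le> 2*n+1"
  shows "e (4*(A div 2)+1) \<in> Basis" "e (4*(A div 2)+2) \<in> Basis" "e (4*(A div 2)+3) \<in> Basis" "e (4*(A div 2)+4) \<in> Basis"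
  using assms by (intro e_Basis; presburger)+

lemma cd_X:
  assumes "A \<le> 2*n+1"
  shows "cd (X A) f x = nabla e A P0 f x"
proof (cases "even A")
  case True
  have "X A = (\<lambda>b. (-1) * of_bool (b = e (4*(A div 2)+3)) + (-\<i>) * of_bool (b = e (4*(A div 2)+4)))"
    using True by (intro ext) (simp add: X_def Let_def)
  then show ?thesis using True cd_two_fields[OF index_bounds(3,4)[OF assms], of "-1" "-\<i>" f x]
    by (simp only: nabla.simps nabla_low.simps Let_def) simp
next
  case False
  have "X A = (\<lambda>b. 1 * of_bool (b = e (4*(A div 2)+1)) + (-\<i>) * of_bool (b = e (4*(A div 2)+2)))"
    using False by (intro ext) (simp add: X_def Let_def)
  then show ?thesis using False cd_two_fields[OF index_bounds(1,2)[OF assms], of 1 "-\<i>" f x]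
    by (simp only: nabla.simps nabla_low.simps Let_def) simp
qed

lemma cd_Y:
  assumes "A \<le> 2*n+1"
  shows "cd (Y A) f x = nabla e A P1 f x"
proof (cases "even A")
  case True
  have "Y A = (\<lambda>b. (-1) * of_bool (b = e (4*(A div 2)+1)) + (-\<i>) * of_bool (b = e (4*(A div 2)+2)))"
    using True by (intro ext) (simp add: Y_def Let_def)
  then show ?thesis using True cd_two_fields[OF index_bounds(1,2)[OF assms], of "-1" "-\<i>" f x]
    by (simp only: nabla.simps nabla_low.simps Let_def) simp
next
  case False
  have "Y A = (\<lambda>b. (-1) * of_bool (b = e (4*(A div 2)+3)) + \<i> * of_bool (b = e (4*(A div 2)+4)))"
    using False by (intro ext) (simp add: Y_def Let_def)
  then show ?thesis using False cd_two_fields[OF index_bounds(3,4)[OF assms], of "-1" "\<i>" f x]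
    by (simp only: nabla.simps nabla_low.simps Let_def) simp
qed

definition block_laplacian :: "nat \<Rightarrow> ('a \<Rightarrow> complex) \<Rightarrow> 'a \<Rightarrow> complex" where
  "block_laplacian l f x = (\<Sum>r\<in>{1..4}. dir_deriv (e (4*l+r)) (dir_deriv (e (4*l+r)) f) x)"

text \<open>The two by two determinant of the fields of one quaternionic variable is its Laplacian,
  the operator form of the fact that a quaternion times its conjugate is its squared norm.\<close>

lemma bracket_block:
  assumes l: "l \<le> n" and f: "smooth f"
  shows "cd (X (2*l)) (cd (Y (2*l+1)) f) x - cd (X (2*l+1)) (cd (Y (2*l)) f) x = block_laplacian l f x"
proof -
  have b: "e (4*l+1) \<in> Basis" "e (4*l+2) \<in> Basis" "e (4*l+3) \<in> Basis" "e (4*l+4) \<in> Basis"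
    using l by (intro e_Basis; simp)+
  have i: "2*l \<le> 2*n+1" "2*l+1 \<le> 2*n+1" using l by auto
  have dv: "(2*l) div 2 = l" "(2*l+1) div 2 = l" "even (2*l)" "odd (2*l+1)" by auto
  have s: "smooth (dir_deriv (e (4*l+r)) f)" if "r \<in> {1..4}" for r
    using that l by (intro smooth_dir_deriv f e_Basis) auto
  have sc: "smooth (\<lambda>x. c * dir_deriv (e (4*l+r)) f x)" if "r \<in> {1..4}" for r c
    using s[OF that] by (rule smooth_cmult)
  let ?d = "\<lambda>r. dir_deriv (e (4*l+r)) f"
  have dd: "dir_deriv v (\<lambda>x. c * ?d r x + d * ?d q x) x = c * dir_deriv v (?d r) x + d * dir_deriv v (?d q) x"
    if "r \<in> {1..4}" "q \<in> {1..4}" for v c d r q x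
    by (simp add: dir_deriv_add[OF smooth_differentiable[OF sc[OF that(1)]] smooth_differentiable[OF sc[OF that(2)]]]
      dir_deriv_bounded_linear[OF bounded_linear_mult_right smooth_differentiable[OF s[OF that(1)]]]
      dir_deriv_bounded_linear[OF bounded_linear_mult_right smooth_differentiable[OF s[OF that(2)]]])
  have comm: "dir_deriv (e (4*l+r)) (?d q) x = dir_deriv (e (4*l+q)) (?d r) x" if "r \<in> {1..4}" "q \<in> {1..4}" for r q
    using s that smooth_differentiable f by (intro dir_deriv_commute) blast+
  have dd12: "dir_deriv v (\<lambda>x. c * ?d 1 x + d * ?d 2 x) x = c * dir_deriv v (?d 1) x + d * dir_deriv v (?d 2) x" for v c d x
    by (rule dd) auto
  have dd34: "dir_deriv v (\<lambda>x. c * ?d 3 x + d * ?d 4 x) x = c * dir_deriv v (?d 3) x + d * dir_deriv v (?d 4) x" for v c d x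
    by (rule dd) auto
  have Y1: "cd (Y (2*l+1)) f = (\<lambda>x. (-1) * ?d 3 x + \<i> * ?d 4 x)"
    using i dv by (intro ext) (simp only: cd_Y nabla.simps nabla_low.simps Let_def if_False, simp)
  have Y0: "cd (Y (2*l)) f = (\<lambda>x. (-1) * ?d 1 x + (-\<i>) * ?d 2 x)"
    using i dv by (intro ext) (simp only: cd_Y nabla.simps nabla_low.simps Let_def if_True, simp)
  have X0: "cd (X (2*l)) h x = (-1) * dir_deriv (e (4*l+3)) h x + (-\<i>) * dir_deriv (e (4*l+4)) h x" for h
    using i dv by (simp only: cd_X nabla.simps nabla_low.simps Let_def if_True) simp
  have X1: "cd (X (2*l+1)) h x = dir_deriv (e (4*l+1)) h x + (-\<i>) * dir_deriv (e (4*l+2)) h x" for h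
    using i dv by (simp only: cd_X nabla.simps nabla_low.simps Let_def if_False) simp
  have "block_laplacian l f x = dir_deriv (e (4*l+1)) (?d 1) x + dir_deriv (e (4*l+2)) (?d 2) x + dir_deriv (e (4*l+3)) (?d 3) x + dir_deriv (e (4*l+4)) (?d 4) x"
    unfolding block_laplacian_def by (simp add: numeral_eq_Suc)
  then show ?thesis
    unfolding Y0 Y1 X0 X1 dd12 dd34 using comm[of 3 4] comm[of 1 2] by (simp add: algebra_simps)
qed

lemma laplacian_blocks: "laplacian f x = (\<Sum>l\<le>n. block_laplacian l f x)"
proof -
  define g where "g = (\<lambda>i. dir_deriv (e i) (dir_deriv (e i) f) x)"
  have "laplacian f x = (\<Sum>i\<in>{1..4*n+4}. g i)"
    unfolding laplacian_def g_def by (rule sum.reindex_bij_betw[OF bij, symmetric])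
  also have "\<dots> = (\<Sum>l\<le>n. \<Sum>r\<in>{1..4}. g (4*l+r))"
  proof -
    have "(\<Sum>i\<in>{1..4*m+4}. g i) = (\<Sum>l\<le>m. \<Sum>r\<in>{1..4}. g (4*l+r))" for m
    proof (induction m)
      case (Suc m)
      have "{1..4*Suc m+4} = {1..4*m+4} \<union> {4*m+5, 4*m+6, 4*m+7, 4*m+8}" by auto
      then have "(\<Sum>i\<in>{1..4*Suc m+4}. g i) = (\<Sum>i\<in>{1..4*m+4}. g i) + (\<Sum>i\<in>{4*m+5, 4*m+6, 4*m+7, 4*m+8}. g i)"
        by (simp only:) (rule sum.union_disjoint, auto)
      also have "(\<Sum>i\<in>{4*m+5, 4*m+6, 4*m+7, 4*m+8}. g i) = (\<Sum>r\<in>{1..4}. g (4*Suc m+r))"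
        by (simp add: numeral_eq_Suc)
      finally show ?case using Suc by simp
    qed simp
    then show ?thesis .
  qed
  finally show ?thesis by (simp add: block_laplacian_def g_def)
qed

section \<open>The first quaternionic variable as a slice\<close>

definition slice :: "real \<times> real \<times> real \<times> real \<Rightarrow> 'a" where
  "slice y = fst y *\<^sub>R e 1 + fst (snd y) *\<^sub>R e 2 + fst (snd (snd y)) *\<^sub>R e 3 + snd (snd (snd y)) *\<^sub>R e 4"

lemma Basis_R4: "(Basis :: (real \<times> real \<times> real \<times> real) set) = {(1,0,0,0), (0,1,0,0), (0,0,1,0), (0,0,0,1)}"
  by (auto simp: Basis_prod_def zero_prod_def)

lemma linear_slice: "linear slice"
  unfolding slice_def by (rule linearI) (auto simp: algebra_simps scaleR_add_left)

lemma e_orthonormal: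
  assumes "1 \<le> i" "i \<le> 4*n+4" "1 \<le> j" "j \<le> 4*n+4"
  shows "e i \<bullet> e j = of_bool (i = j)"
  using e_Basis[OF assms(1,2)] e_Basis[OF assms(3,4)] e_inj[OF assms] by (auto simp: inner_Basis)

lemma norm_slice: "norm (slice y) = norm y"
proof -
  have "slice y \<bullet> slice y = y \<bullet> y"
    unfolding slice_def by (simp add: inner_add_left inner_add_right e_orthonormal inner_prod_def)
  then show ?thesis by (simp add: norm_eq_sqrt_inner)
qed

lemma slice_Basis: "b \<in> Basis \<Longrightarrow> slice b \<in> Basis"
  unfolding Basis_R4 using e_Basis[of 1] e_Basis[of 2] e_Basis[of 3] e_Basis[of 4] by (auto simp: slice_def)

lemma slice_laplacian: "(\<Sum>b\<in>Basis. dir_deriv (slice b) (dir_deriv (slice b) f) x) = block_laplacian 0 f x"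
proof -
  have "slice (1,0,0,0) = e 1" "slice (0,1,0,0) = e 2" "slice (0,0,1,0) = e 3" "slice (0,0,0,1) = e 4"
    by (auto simp: slice_def)
  moreover have "block_laplacian 0 f x = dir_deriv (e 1) (dir_deriv (e 1) f) x + dir_deriv (e 2) (dir_deriv (e 2) f) x + dir_deriv (e 3) (dir_deriv (e 3) f) x + dir_deriv (e 4) (dir_deriv (e 4) f) x"
    unfolding block_laplacian_def by (simp add: numeral_eq_Suc)
  ultimately show ?thesis unfolding Basis_R4 by simp
qed

lemma slice_e5: "n \<ge> 1 \<Longrightarrow> slice y \<bullet> e 5 = 0"
  unfolding slice_def by (simp add: inner_add_left e_orthonormal)

lemma block_laplacian_exp:
  assumes "l \<le> n"
  shows "block_laplacian l (\<lambda>x. w * complex_of_real (exp (x \<bullet> m))) x = of_real (\<Sum>r\<in>{1..4}. (m \<bullet> e (4*l+r))\<^sup>2) * w * complex_of_real (exp (x \<bullet> m))"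
  unfolding block_laplacian_def dir_deriv_exp by (simp add: power2_eq_square sum_distrib_left mult_ac)

lemma inner_blocks: "m \<bullet> m = (\<Sum>l\<le>n. \<Sum>r\<in>{1..4}. (m \<bullet> e (4*l+r))\<^sup>2)"
proof -
  have "complex_of_real (m \<bullet> m) = laplacian (\<lambda>x. 1 * complex_of_real (exp (x \<bullet> m))) 0"
    unfolding laplacian_def dir_deriv_exp by (subst euclidean_inner) simp
  also have "\<dots> = of_real (\<Sum>l\<le>n. \<Sum>r\<in>{1..4}. (m \<bullet> e (4*l+r))\<^sup>2)"
  proof -
    have "block_laplacian l (\<lambda>x. 1 * complex_of_real (exp (x \<bullet> m))) 0 = of_real (\<Sum>r\<in>{1..4}. (m \<bullet> e (4*l+r))\<^sup>2)" if "l \<le> n" for l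
      by (subst block_laplacian_exp[OF that]) simp
    then show ?thesis unfolding laplacian_blocks of_real_sum[of _ "{..n}"] by (intro sum.cong refl) (simp only: atMost_iff)
  qed
  finally show ?thesis by (simp only: of_real_eq_iff)
qed

text \<open>The symbol identity follows from the operator identity applied to the exponential \<open>w exp (x \<bullet> m)\<close>.\<close>

lemma symbol_exact_from_blocks:
  assumes solve: "\<And>G l. (\<And>j. smooth (G j)) \<Longrightarrow> (\<And>q. cop (Q q) G = (\<lambda>x. 0)) \<Longrightarrow> l \<le> n \<Longrightarrow>
      cop (P j) (\<lambda>i. cop (Rl [l] i) G) = block_laplacian l (G j)"
    and Rl: "\<And>ls i. Rl ls i = concat (map (\<lambda>l. Rl [l] i) ls)"
    and closed: "\<And>q. symb (Q q) m w = 0"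
  shows "symb (P j) m (\<lambda>i. symb (Rl [0..<Suc n] i) m w) = of_real (m \<bullet> m) * w j"
proof -
  define E where "E = (\<lambda>x. complex_of_real (exp (x \<bullet> m)))"
  define G where "G = (\<lambda>j x. w j * E x)"
  have sG: "smooth (G j)" for j unfolding G_def E_def by (intro smooth_cmult cd_cd_mult_exp)
  have ce: "cop ts (\<lambda>i x. w i * E x) = (\<lambda>x. symb ts m w * E x)" for ts :: "(('a \<Rightarrow> complex) list \<times> 'x) list" and w
    unfolding E_def by (rule cop_exp)
  have QG: "cop (Q q) G = (\<lambda>x. 0)" for q unfolding G_def ce closed by simp
  have one: "symb (P j) m (\<lambda>i. symb (Rl [l] i) m w) = of_real (\<Sum>r\<in>{1..4}. (m \<bullet> e (4*l+r))\<^sup>2) * w j" if l: "l \<le> n" for l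
  proof -
    have "symb (P j) m (\<lambda>i. symb (Rl [l] i) m w) * E 0 = cop (P j) (\<lambda>i. cop (Rl [l] i) G) 0"
      unfolding G_def ce by (simp add: ce)
    also have "\<dots> = block_laplacian l (G j) 0" using solve[OF sG QG l] by simp
    also have "\<dots> = of_real (\<Sum>r\<in>{1..4}. (m \<bullet> e (4*l+r))\<^sup>2) * w j * E 0"
      unfolding G_def E_def by (rule block_laplacian_exp[OF l])
    finally show ?thesis by (simp add: E_def)
  qed
  have app: "symb (ts @ us) m w = symb ts m w + symb us m w" for ts us
    by (induction ts) (auto simp: symb_Cons)
  have add: "symb ts m (\<lambda>i. f i + g i) = symb ts m f + symb ts m g" for ts :: "(('a \<Rightarrow> complex) list \<times> 'x) list" and f g
    by (induction ts) (auto simp: symb_Cons algebra_simps)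
  have zero: "symb ts m (\<lambda>i. 0) = 0" for ts :: "(('a \<Rightarrow> complex) list \<times> 'x) list"
    by (induction ts) (auto simp: symb_Cons)
  have "symb (P j) m (\<lambda>i. symb (concat (map (\<lambda>l. Rl [l] i) [0..<k])) m w) = of_real (\<Sum>l<k. \<Sum>r\<in>{1..4}. (m \<bullet> e (4*l+r))\<^sup>2) * w j"
    if "k \<le> Suc n" for k
    using that
  proof (induction k)
    case (Suc k)
    then show ?case using one[of k] by (simp add: app add distrib_right)
  qed (simp add: zero)
  from this[of "Suc n"] show ?thesis by (simp add: Rl[symmetric] inner_blocks lessThan_Suc_atMost del: upt_Suc)
qed

end

subsection \<open>Exactness of the complex at level one\<close>

text \<open>The closedness relations are available only for increasing triples; antisymmetry extends
  them to all triples, including those with repetitions.\<close>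

lemma alternating_all:
  fixes J :: "nat \<Rightarrow> nat \<Rightarrow> nat \<Rightarrow> complex"
  assumes sorted: "\<And>A B C. A < B \<Longrightarrow> B < C \<Longrightarrow> C \<le> N \<Longrightarrow> J A B C = 0"
    and s12: "\<And>A B C. J B A C = - J A B C" and s23: "\<And>A B C. J A C B = - J A B C"
    and bounds: "A \<le> N" "B \<le> N" "C \<le> N"
  shows "J A B C = 0"
proof -
  have eq12: "J A A C = 0" for A C using s12[of A A C] by simp
  have eq23: "J A B B = 0" for A B using s23[of A B B] by simp
  have eq13: "J A B A = 0" for A B using s12[of B A A] eq23 by simp
  consider "A = B" | "B = C" | "A = C" | "A < B" "B < C" | "A < C" "C < B" | "B < A" "A < C" | "B < C" "C < A"
    | "C < A" "A < B" | "C < B" "B < A" by linarith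
  then show ?thesis
  proof cases
    case 4 then show ?thesis using sorted bounds by blast
  next
    case 5 then show ?thesis using sorted[of A C B] s23[of A B C] bounds by simp
  next
    case 6 then show ?thesis using sorted[of B A C] s12[of A B C] bounds by simp
  next
    case 7
    have "J A B C = - J B A C" using s12[of A B C] by simp
    also have "\<dots> = J B C A" using s23[of B A C] by simp
    finally show ?thesis using sorted[of B C A] 7 bounds by simp
  next
    case 8
    have "J A B C = - J A C B" using s23[of A B C] by simp
    also have "\<dots> = J C A B" using s12[of A C B] by simp
    finally show ?thesis using sorted[of C A B] 8 bounds by simp
  next
    case 9
    have "J A B C = - J A C B" using s23[of A B C] by simp
    also have "\<dots> = J C A B" using s12[of A C B] by simp
    also have "\<dots> = - J C B A" using s23[of C B A] by simp
    finally show ?thesis using sorted[of C B A] 9 bounds by simp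
  qed (use eq12 eq23 eq13 in auto)
qed

lemma cop_concat: "cop (concat (map t ls)) G x = (\<Sum>l\<leftarrow>ls. cop (t l) G x)"
  by (induction ls) (auto simp: cop_append)

lemmas cd_simps = cop_Cons cd_add cd_diff cd_minus cd_minus_field smooth_add smooth_diff smooth_minus smooth_cd

context frame
begin

abbreviation nX where "nX A \<equiv> (\<lambda>b. - X A b)"
abbreviation nY where "nY A \<equiv> (\<lambda>b. - Y A b)"

text \<open>With the coefficient of \<open>(s\<^sup>0\<^sup>')\<^sup>a (s\<^sup>1\<^sup>')\<^sup>b\<close> rescaled by \<open>a! b!\<close> the derivatives \<open>\<partial>\<^sub>A\<^sub>'\<close> become shifts of \<open>a\<close>.
  The pair \<open>(A, a)\<close> stands for the component at \<open>\<omega>\<^sup>A\<close>; \<open>Q2\<close> is \<open>\<D>\<^sub>1\<close> for \<open>k \<ge> 2\<close>, \<open>Q1\<close> is \<open>\<D>\<^sub>1\<close> for \<open>k = 1\<close>.\<close>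

definition Pk :: "nat \<times> nat \<Rightarrow> (('a \<Rightarrow> complex) list \<times> nat) list" where
  "Pk = (\<lambda>(A, a). [([X A], Suc a), ([Y A], a)])"

text \<open>For the top index \<open>a = k\<close> the section has no component of the same index,
  so there the \<open>Y\<close> fields act on index \<open>k - 1\<close>. For intermediate indices
  the analogous \<open>Y\<close> expression agrees with the \<open>X\<close> expression on closed
  sections. Rows beyond \<open>k\<close> are empty.\<close>

definition Rk :: "nat \<Rightarrow> nat list \<Rightarrow> nat \<Rightarrow> (('a \<Rightarrow> complex) list \<times> (nat \<times> nat)) list" where
  "Rk k ls a = concat (map (\<lambda>l. if a < k then [([X (2*l)], (2*l+1, a)), ([nX (2*l+1)], (2*l, a))]
     else if a = k then [([Y (2*l+1)], (2*l, k-1)), ([nY (2*l)], (2*l+1, k-1))] else []) ls)"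

definition Jk :: "nat \<Rightarrow> (nat \<times> nat) set" where
  "Jk k = {(A, a). A \<le> 2*n+1 \<and> a < k}"

definition Q2 :: "nat \<Rightarrow> nat \<times> nat \<times> nat \<Rightarrow> (('a \<Rightarrow> complex) list \<times> (nat \<times> nat)) list" where
  "Q2 k = (\<lambda>(A, B, a). if A < B \<and> B \<le> 2*n+1 \<and> Suc a < k then
     [([X A], (B, Suc a)), ([nX B], (A, Suc a)), ([Y A], (B, a)), ([nY B], (A, a))] else [])"

definition Q1 :: "nat \<times> nat \<times> nat \<Rightarrow> (('a \<Rightarrow> complex) list \<times> (nat \<times> nat)) list" where
  "Q1 = (\<lambda>(A, B, C). if A < B \<and> B < C \<and> C \<le> 2*n+1 then
     [([X A, Y B], (C, 0)), ([nX B, Y A], (C, 0)), ([nX A, Y C], (B, 0)), ([X C, Y A], (B, 0)),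
      ([X B, Y C], (A, 0)), ([nX C, Y B], (A, 0))] else [])"

lemma Rk_concat: "Rk k ls a = concat (map (\<lambda>l. Rk k [l] a) ls)"
  by (simp add: Rk_def)

definition bracket :: "nat \<Rightarrow> nat \<Rightarrow> ('a \<Rightarrow> complex) \<Rightarrow> 'a \<Rightarrow> complex" where
  "bracket A B g x = cd (X A) (cd (Y B) g) x - cd (X B) (cd (Y A) g) x"

text \<open>The cyclic identity \<open>J\<close> exchanges the free index \<open>A\<close> with the
  pair \<open>2*l\<close>, \<open>2*l+1\<close>, after which the bracket of this pair is the block
  Laplacian. The relation \<open>C\<close> shows that the row of \<open>Rk\<close> at
  \<open>Suc a\<close> may be written through components of index \<open>a\<close>, also below the
  top.\<close>

lemma solve_k:
  assumes sG: "\<And>j. smooth (G j)" and k: "k \<ge> 1" and l: "l \<le> n" and A: "A \<le> 2*n+1" and a: "a < k"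
    and J: "\<And>A B C x. A \<le> 2*n+1 \<Longrightarrow> B \<le> 2*n+1 \<Longrightarrow> C \<le> 2*n+1 \<Longrightarrow>
      bracket A B (G (C, a)) x + bracket B C (G (A, a)) x + bracket C A (G (B, a)) x = 0"
    and C: "\<And>A B x. Suc a < k \<Longrightarrow> A \<le> 2*n+1 \<Longrightarrow> B \<le> 2*n+1 \<Longrightarrow>
      cd (X A) (G (B, Suc a)) x - cd (X B) (G (A, Suc a)) x + cd (Y A) (G (B, a)) x - cd (Y B) (G (A, a)) x = 0"
  shows "cop (Pk (A, a)) (\<lambda>i. cop (Rk k [l] i) G) = block_laplacian l (G (A, a))"
proof
  fix x
  have i: "2*l \<le> 2*n+1" "2*l+1 \<le> 2*n+1" using l by auto
  have 1: "cop (Rk k [l] a) G = (\<lambda>x. cd (X (2*l)) (G (2*l+1, a)) x - cd (X (2*l+1)) (G (2*l, a)) x)"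
    using a by (simp add: Rk_def cop_Cons cd_minus_field)
  have 2: "cop (Rk k [l] (Suc a)) G = (\<lambda>x. cd (Y (2*l+1)) (G (2*l, a)) x - cd (Y (2*l)) (G (2*l+1, a)) x)"
  proof (cases "Suc a < k")
    case True
    show ?thesis using C[OF True i] True by (auto simp: Rk_def cop_Cons cd_minus_field fun_eq_iff algebra_simps add_eq_0_iff)
  next
    case False
    then have "Suc a = k" using a by simp
    then show ?thesis by (auto simp: Rk_def cop_Cons cd_minus_field)
  qed
  have "cop (Pk (A, a)) (\<lambda>i. cop (Rk k [l] i) G) x =
     cd (X A) (\<lambda>x. cd (Y (2*l+1)) (G (2*l, a)) x - cd (Y (2*l)) (G (2*l+1, a)) x) x +
     cd (Y A) (\<lambda>x. cd (X (2*l)) (G (2*l+1, a)) x - cd (X (2*l+1)) (G (2*l, a)) x) x"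
    by (simp add: Pk_def cop_Cons 1 2)
  also have "\<dots> = cd (X A) (cd (Y (2*l+1)) (G (2*l, a))) x - cd (X A) (cd (Y (2*l)) (G (2*l+1, a))) x +
     (cd (X (2*l)) (cd (Y A) (G (2*l+1, a))) x - cd (X (2*l+1)) (cd (Y A) (G (2*l, a))) x)"
    by (simp only: cd_diff smooth_cd sG cd_commute[OF sG, of "Y A"])
  also have "\<dots> = bracket (2*l) (2*l+1) (G (A, a)) x"
    using J[OF i A, of x] unfolding bracket_def by (simp only: add_eq_0_iff) (simp add: algebra_simps)
  also have "\<dots> = block_laplacian l (G (A, a)) x"
    unfolding bracket_def by (rule bracket_block[OF l sG])
  finally show "cop (Pk (A, a)) (\<lambda>i. cop (Rk k [l] i) G) x = block_laplacian l (G (A, a)) x" .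
qed

lemma Q2_closed:
  assumes sG: "\<And>j. smooth (G j)" and Q: "\<And>q. cop (Q2 k q) G = (\<lambda>x. 0)" and a: "Suc a < k" and AB: "A \<le> 2*n+1" "B \<le> 2*n+1"
  shows "cd (X A) (G (B, Suc a)) x - cd (X B) (G (A, Suc a)) x + cd (Y A) (G (B, a)) x - cd (Y B) (G (A, a)) x = 0"
proof -
  have s: "cd (X A) (G (B, Suc a)) x - cd (X B) (G (A, Suc a)) x + cd (Y A) (G (B, a)) x - cd (Y B) (G (A, a)) x = 0"
    if "A < B" "B \<le> 2*n+1" for A B
  proof -
    have "cd (X A) (G (B, Suc a)) x + (- cd (X B) (G (A, Suc a)) x + (cd (Y A) (G (B, a)) x - cd (Y B) (G (A, a)) x)) = 0"
      using fun_cong[OF Q[of "(A, B, a)"], of x] that a by (simp add: Q2_def cop_Cons cd_minus_field)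
    then show ?thesis by algebra
  qed
  consider "A < B" | "B < A" | "A = B" by linarith
  then show ?thesis
  proof cases
    case 2
    then show ?thesis using s[OF 2] AB by (simp add: algebra_simps add_eq_0_iff)
  qed (use s AB in auto)
qed

text \<open>The cyclic identity is a differential consequence of the first-order relations: at
  \<open>a = 0\<close> the relation of index \<open>0\<close> is differentiated by the
  \<open>X\<close> fields, at \<open>Suc a'\<close> that of index \<open>a'\<close> by the
  \<open>Y\<close> fields, and the unwanted terms cancel by commutation.\<close>

lemma solve_Q2:
  assumes sG: "\<And>j. smooth (G j)" and Q: "\<And>q. cop (Q2 k q) G = (\<lambda>x. 0)" and k: "k \<ge> 2" and l: "l \<le> n" and j: "j \<in> Jk k"
  shows "cop (Pk j) (\<lambda>i. cop (Rk k [l] i) G) = block_laplacian l (G j)"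
proof -
  obtain A a where j: "j = (A, a)" "A \<le> 2*n+1" "a < k" using j by (auto simp: Jk_def)
  note C = Q2_closed[OF sG Q]
  have C': "cd D (\<lambda>x. cd (X A) (G (B, Suc a)) x - cd (X B) (G (A, Suc a)) x + cd (Y A) (G (B, a)) x - cd (Y B) (G (A, a)) x) x = 0"
    if "Suc a < k" "A \<le> 2*n+1" "B \<le> 2*n+1" for D A B a x
    using C[OF that] by simp
  have C2: "cd D (cd (X A) (G (B, Suc a))) x - cd D (cd (X B) (G (A, Suc a))) x + cd D (cd (Y A) (G (B, a))) x - cd D (cd (Y B) (G (A, a))) x = 0"
    if "Suc a < k" "A \<le> 2*n+1" "B \<le> 2*n+1" for D A B a x
    using C'[OF that, of D x] by (simp add: cd_diff cd_add smooth_cd smooth_add smooth_diff sG)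
  have J: "bracket A B (G (C, a)) x + bracket B C (G (A, a)) x + bracket C A (G (B, a)) x = 0"
    if b: "A \<le> 2*n+1" "B \<le> 2*n+1" "C \<le> 2*n+1" for A B C x
  proof (cases a)
    case 0
    then have s: "Suc 0 < k" using k by simp
    note comm = cd_commute[OF sG]
    show ?thesis
      using C2[OF s b(2,3), of "X A" x] C2[OF s b(3,1), of "X B" x] C2[OF s b(1,2), of "X C" x]
        fun_cong[OF comm[of "X B" "X A" "(C, Suc 0)"], of x] fun_cong[OF comm[of "X C" "X A" "(B, Suc 0)"], of x]
        fun_cong[OF comm[of "X C" "X B" "(A, Suc 0)"], of x]
      unfolding bracket_def 0 by algebra
  next
    case (Suc a')
    then have s: "Suc a' < k" using j(3) by simp
    note comm = cd_commute[OF sG]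
    show ?thesis
      using C2[OF s b(2,3), of "Y A" x] C2[OF s b(3,1), of "Y B" x] C2[OF s b(1,2), of "Y C" x]
        fun_cong[OF comm[of "Y B" "Y A" "(C, a')"], of x] fun_cong[OF comm[of "Y C" "Y A" "(B, a')"], of x]
        fun_cong[OF comm[of "Y C" "Y B" "(A, a')"], of x]
        fun_cong[OF comm[of "Y A" "X B" "(C, a)"], of x] fun_cong[OF comm[of "Y A" "X C" "(B, a)"], of x]
        fun_cong[OF comm[of "Y B" "X C" "(A, a)"], of x] fun_cong[OF comm[of "Y B" "X A" "(C, a)"], of x]
        fun_cong[OF comm[of "Y C" "X A" "(B, a)"], of x] fun_cong[OF comm[of "Y C" "X B" "(A, a)"], of x]
      unfolding bracket_def Suc by algebra
  qed
  show ?thesis unfolding j(1) by (rule solve_k[OF sG _ l j(2,3) J C]) (use k in auto)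
qed

text \<open>For \<open>k = 1\<close> the second-order condition is itself the cyclic identity on
  increasing triples, and the first-order relations hold vacuously.\<close>

lemma solve_Q1:
  assumes sG: "\<And>j. smooth (G j)" and Q: "\<And>q. cop (Q1 q) G = (\<lambda>x. 0)" and l: "l \<le> n" and j: "j \<in> Jk 1"
  shows "cop (Pk j) (\<lambda>i. cop (Rk 1 [l] i) G) = block_laplacian l (G j)"
proof -
  obtain A where j: "j = (A, 0)" "A \<le> 2*n+1" using j by (auto simp: Jk_def)
  have J: "bracket A B (G (C, 0)) x + bracket B C (G (A, 0)) x + bracket C A (G (B, 0)) x = 0"
    if b: "A \<le> 2*n+1" "B \<le> 2*n+1" "C \<le> 2*n+1" for A B C x
  proof (rule alternating_all[where J = "\<lambda>A B C. bracket A B (G (C, 0)) x + bracket B C (G (A, 0)) x + bracket C A (G (B, 0)) x", OF _ _ _ b])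
    fix A B C assume "A < B" "B < C" "C \<le> 2*n+1"
    then show "bracket A B (G (C, 0)) x + bracket B C (G (A, 0)) x + bracket C A (G (B, 0)) x = 0"
      using fun_cong[OF Q[of "(A, B, C)"], of x] by (simp add: Q1_def cop_Cons cd_minus_field bracket_def algebra_simps)
  qed (simp_all add: bracket_def)
  show ?thesis unfolding j(1) by (rule solve_k[OF sG _ l j(2) _ J]) auto
qed

lemma RP_block:
  assumes sf: "\<And>i. smooth (f i)" and k: "k \<ge> 1" and a: "a \<le> k" and l: "l \<le> n"
  shows "cop (Rk k [l] a) (\<lambda>j. cop (Pk j) f) x = block_laplacian l (f a) x"
proof (cases "a < k")
  case True
  have "cop (Rk k [l] a) (\<lambda>j. cop (Pk j) f) x = cd (X (2*l)) (cd (Y (2*l+1)) (f a)) x - cd (X (2*l+1)) (cd (Y (2*l)) (f a)) x"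
    using True cd_commute[OF sf, of "X (2*l)" "X (2*l+1)" "Suc a"] by (simp add: Rk_def Pk_def cd_simps sf)
  then show ?thesis using bracket_block[OF l sf] by simp
next
  case False
  then have a: "a = k" "Suc (k - 1) = k" using a k by auto
  have "cop (Rk k [l] a) (\<lambda>j. cop (Pk j) f) x = cd (Y (2*l+1)) (cd (X (2*l)) (f a)) x - cd (Y (2*l)) (cd (X (2*l+1)) (f a)) x"
    using a cd_commute[OF sf, of "Y (2*l)" "Y (2*l+1)" "k - 1"] by (simp add: Rk_def Pk_def cd_simps sf)
  then show ?thesis using bracket_block[OF l sf, of a x] cd_commute[OF sf, of "Y (2*l+1)"] cd_commute[OF sf, of "Y (2*l)"] by simp
qed

lemma RP_k:
  assumes sf: "\<And>i. smooth (f i)" and k: "k \<ge> 1" and a: "a \<in> {..k}"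
  shows "cop (Rk k [0..<Suc n] a) (\<lambda>j. cop (Pk j) f) = laplacian (f a)"
proof
  fix x
  have "cop (Rk k [0..<Suc n] a) (\<lambda>j. cop (Pk j) f) x = (\<Sum>l\<leftarrow>[0..<Suc n]. cop (Rk k [l] a) (\<lambda>j. cop (Pk j) f) x)"
    by (subst Rk_concat) (rule cop_concat)
  also have "\<dots> = (\<Sum>l\<le>n. block_laplacian l (f a) x)"
    using a RP_block[OF sf k] by (simp add: sum_list_distinct_conv_sum_set atLeast0LessThan lessThan_Suc_atMost del: upt_Suc)
  finally show "cop (Rk k [0..<Suc n] a) (\<lambda>j. cop (Pk j) f) x = laplacian (f a) x" by (simp add: laplacian_blocks)
qed

lemma QP_Q2: "(\<And>i. smooth (f i)) \<Longrightarrow> cop (Q2 k q) (\<lambda>j. cop (Pk j) f) = (\<lambda>x. 0)"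
proof -
  assume sf: "\<And>i. smooth (f i)"
  obtain A B a where q: "q = (A, B, a)" by (cases q)
  show ?thesis
    using cd_commute[OF sf, of "X A" "X B" "Suc (Suc a)"] cd_commute[OF sf, of "Y A" "Y B" a]
      cd_commute[OF sf, of "X A" "Y B" "Suc a"] cd_commute[OF sf, of "X B" "Y A" "Suc a"]
    by (simp add: q Q2_def Pk_def cd_simps sf)
qed

lemma QP_Q1: "(\<And>i. smooth (f i)) \<Longrightarrow> cop (Q1 q) (\<lambda>j. cop (Pk j) f) = (\<lambda>x. 0)"
proof -
  assume sf: "\<And>i. smooth (f i)"
  obtain A B C where q: "q = (A, B, C)" by (cases q)
  note comm = cd_commute[OF sf] cd_commute[OF smooth_cd[OF sf]]
  have XYX: "cd (X A) (cd (Y B) (cd (X C) (f i))) = cd (X A) (cd (X C) (cd (Y B) (f i)))" for A B C i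
    using comm(1)[of "Y B" "X C" i] by simp
  have XX: "cd (X A) (cd (X C) (cd (Y B) (f i))) = cd (X C) (cd (X A) (cd (Y B) (f i)))" for A B C i by (rule comm(2))
  have YY: "cd (X A) (cd (Y C) (cd (Y B) (f i))) = cd (X A) (cd (Y B) (cd (Y C) (f i)))" for A B C i
    using comm(1)[of "Y C" "Y B" i] by simp
  show ?thesis
    using XX[of A C B "Suc 0"] XX[of B C A "Suc 0"] XX[of A B C "Suc 0"]
      YY[of A B C 0] YY[of B A C 0] YY[of C A B 0]
    by (simp add: q Q1_def Pk_def cd_simps sf XYX)
qed

lemma Rk_in: "(\<xi>s, j) \<in> set (Rk k ls i) \<Longrightarrow> set ls \<subseteq> {..n} \<Longrightarrow> k \<ge> 1 \<Longrightarrow> j \<in> Jk k"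
  by (auto simp: Rk_def Jk_def split: if_splits)

lemma symbol_complex_Q2:
  assumes k: "k \<ge> 2"
  shows "symbol_complex Pk (Q2 k) (Rk k [0..<Suc n]) (Jk k) 1 1"
proof
  show "length \<xi>s = 1" if "j \<in> Jk k" "(\<xi>s, i) \<in> set (Pk j)" for j \<xi>s i using that by (cases j) (auto simp: Pk_def)
  show "length \<xi>s = 1 \<and> j \<in> Jk k" if "(\<xi>s, j) \<in> set (Q2 k q)" for \<xi>s j q
    using that by (cases q) (auto simp: Q2_def Jk_def split: if_splits)
  show "j \<in> Jk k" if "(\<xi>s, j) \<in> set (Rk k [0..<Suc n] i)" for \<xi>s j i
    by (rule Rk_in[OF that]) (use k in auto)
  show "cop (Q2 k q) (\<lambda>j. cop (Pk j) f) = (\<lambda>x. 0)" if "\<And>i. smooth (f i)" for f q by (rule QP_Q2[OF that])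
  show "symb (Pk j) m (\<lambda>i. symb (Rk k [0..<Suc n] i) m w) = of_real (m \<bullet> m) * w j"
    if "\<And>q. symb (Q2 k q) m w = 0" "j \<in> Jk k" for m w j
    by (rule symbol_exact_from_blocks[OF _ Rk_concat that(1)]) (rule solve_Q2[OF _ _ k _ that(2)])
qed auto

lemma symbol_complex_Q1: "symbol_complex Pk Q1 (Rk 1 [0..<Suc n]) (Jk 1) 1 2"
proof
  show "length \<xi>s = 1" if "j \<in> Jk 1" "(\<xi>s, i) \<in> set (Pk j)" for j \<xi>s i using that by (cases j) (auto simp: Pk_def)
  show "length \<xi>s = 2 \<and> j \<in> Jk 1" if "(\<xi>s, j) \<in> set (Q1 q)" for \<xi>s j q
    using that by (cases q) (auto simp: Q1_def Jk_def split: if_splits)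
  show "j \<in> Jk 1" if "(\<xi>s, j) \<in> set (Rk 1 [0..<Suc n] i)" for \<xi>s j i
    by (rule Rk_in[OF that]) auto
  show "cop (Q1 q) (\<lambda>j. cop (Pk j) f) = (\<lambda>x. 0)" if "\<And>i. smooth (f i)" for f q by (rule QP_Q1[OF that])
  show "symb (Pk j) m (\<lambda>i. symb (Rk 1 [0..<Suc n] i) m w) = of_real (m \<bullet> m) * w j"
    if "\<And>q. symb (Q1 q) m w = 0" "j \<in> Jk 1" for m w j
    by (rule symbol_exact_from_blocks[OF _ Rk_concat that(1)]) (rule solve_Q1[OF _ _ _ that(2)])
qed auto

text \<open>For \<open>k = 0\<close> the operator \<open>\<D>\<^sub>0 = d\<^sup>0\<^sup>'d\<^sup>1\<^sup>'\<close> has order two and \<open>\<D>\<^sub>1\<close> gives one condition for each of \<open>d\<^sup>0\<^sup>'\<close> and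
  \<open>d\<^sup>1\<^sup>'\<close>, selected by the boolean in \<open>Q0'\<close>.\<close>

definition P0' :: "nat \<times> nat \<Rightarrow> (('a \<Rightarrow> complex) list \<times> nat) list" where
  "P0' = (\<lambda>(A, B). [([X A, Y B], 0), ([nX B, Y A], 0)])"

text \<open>The homotopy has order zero because \<open>\<D>\<^sub>0\<close> already has order two:
  the component of \<open>\<D>\<^sub>0 f\<close> at the pair \<open>2*l\<close>,
  \<open>2*l+1\<close> is the block Laplacian of \<open>f\<close>.\<close>

definition R0' :: "nat list \<Rightarrow> nat \<Rightarrow> (('a \<Rightarrow> complex) list \<times> (nat \<times> nat)) list" where
  "R0' ls i = concat (map (\<lambda>l. if i = 0 then [([], (2*l, 2*l+1))] else []) ls)"

definition J0' :: "(nat \<times> nat) set" where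
  "J0' = {(A, B). A < B \<and> B \<le> 2*n+1}"

definition Q0' :: "nat \<times> nat \<times> nat \<times> bool \<Rightarrow> (('a \<Rightarrow> complex) list \<times> (nat \<times> nat)) list" where
  "Q0' = (\<lambda>(A, B, C, s). if A < B \<and> B < C \<and> C \<le> 2*n+1 then
     (if s then [([X A], (B, C)), ([nX B], (A, C)), ([X C], (A, B))]
      else [([Y A], (B, C)), ([nY B], (A, C)), ([Y C], (A, B))]) else [])"

lemma R0'_concat: "R0' ls a = concat (map (\<lambda>l. R0' [l] a) ls)"
  by (simp add: R0'_def)

lemma solve_Q0:
  assumes sG: "\<And>j. smooth (G j)" and Q: "\<And>q. cop (Q0' q) G = (\<lambda>x. 0)" and l: "l \<le> n" and j: "j \<in> J0'"
  shows "cop (P0' j) (\<lambda>i. cop (R0' [l] i) G) = block_laplacian l (G j)"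
proof
  fix x
  obtain A B where j: "j = (A, B)" "A < B" "B \<le> 2*n+1" using j by (auto simp: J0'_def)
  \<comment> \<open>The antisymmetric extension of the components, so that the relations for
    increasing triples become relations for all triples.\<close>
  define g where "g = (\<lambda>A B. if A < B then G (A, B) else if B < A then (\<lambda>x. - G (B, A) x) else (\<lambda>x. 0))"
  have sg: "smooth (g A B)" for A B using sG by (auto simp: g_def intro: smooth_minus C_infinity_on_const)
  have anti: "g B A = (\<lambda>x. - g A B x)" for A B by (auto simp: g_def)
  have canti: "cd \<xi> (g B A) x = - cd \<xi> (g A B) x" for \<xi> A B x
    using cd_minus[OF sg, of \<xi> A B] anti[of B A] by simp
  have closed: "cd \<xi>A (g B C) x - cd \<xi>B (g A C) x + cd \<xi>C (g A B) x = 0"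
    if b: "A \<le> 2*n+1" "B \<le> 2*n+1" "C \<le> 2*n+1" and \<xi>: "(\<xi>A = X A \<and> \<xi>B = X B \<and> \<xi>C = X C) \<or> (\<xi>A = Y A \<and> \<xi>B = Y B \<and> \<xi>C = Y C)" for A B C x \<xi>A \<xi>B \<xi>C
  proof -
    have X: "cd (X A) (g B C) x - cd (X B) (g A C) x + cd (X C) (g A B) x = 0"
    proof (rule alternating_all[where J = "\<lambda>A B C. cd (X A) (g B C) x - cd (X B) (g A C) x + cd (X C) (g A B) x", OF _ _ _ b])
      fix A B C assume "A < B" "B < C" "C \<le> 2*n+1"
      then show "cd (X A) (g B C) x - cd (X B) (g A C) x + cd (X C) (g A B) x = 0"
        using fun_cong[OF Q[of "(A, B, C, True)"], of x] by (simp add: Q0'_def cop_Cons cd_minus_field g_def algebra_simps)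
    next
      fix A B C
      show "cd (X B) (g A C) x - cd (X A) (g B C) x + cd (X C) (g B A) x = - (cd (X A) (g B C) x - cd (X B) (g A C) x + cd (X C) (g A B) x)"
        using canti[of "X C" B A x] by simp
      show "cd (X A) (g C B) x - cd (X C) (g A B) x + cd (X B) (g A C) x = - (cd (X A) (g B C) x - cd (X B) (g A C) x + cd (X C) (g A B) x)"
        using canti[of "X A" C B x] by simp
    qed
    have Y: "cd (Y A) (g B C) x - cd (Y B) (g A C) x + cd (Y C) (g A B) x = 0"
    proof (rule alternating_all[where J = "\<lambda>A B C. cd (Y A) (g B C) x - cd (Y B) (g A C) x + cd (Y C) (g A B) x", OF _ _ _ b])
      fix A B C assume "A < B" "B < C" "C \<le> 2*n+1"
      then show "cd (Y A) (g B C) x - cd (Y B) (g A C) x + cd (Y C) (g A B) x = 0"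
        using fun_cong[OF Q[of "(A, B, C, False)"], of x] by (simp add: Q0'_def cop_Cons cd_minus_field g_def algebra_simps)
    next
      fix A B C
      show "cd (Y B) (g A C) x - cd (Y A) (g B C) x + cd (Y C) (g B A) x = - (cd (Y A) (g B C) x - cd (Y B) (g A C) x + cd (Y C) (g A B) x)"
        using canti[of "Y C" B A x] by simp
      show "cd (Y A) (g C B) x - cd (Y C) (g A B) x + cd (Y B) (g A C) x = - (cd (Y A) (g B C) x - cd (Y B) (g A C) x + cd (Y C) (g A B) x)"
        using canti[of "Y A" C B x] by simp
    qed
    show ?thesis using X Y \<xi> by auto
  qed
  have closed': "cd D (cd \<xi>A (g B C)) x - cd D (cd \<xi>B (g A C)) x + cd D (cd \<xi>C (g A B)) x = 0"
    if b: "A \<le> 2*n+1" "B \<le> 2*n+1" "C \<le> 2*n+1" and \<xi>: "(\<xi>A = X A \<and> \<xi>B = X B \<and> \<xi>C = X C) \<or> (\<xi>A = Y A \<and> \<xi>B = Y B \<and> \<xi>C = Y C)" for A B C x \<xi>A \<xi>B \<xi>C D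
  proof -
    have "cd D (\<lambda>x. cd \<xi>A (g B C) x - cd \<xi>B (g A C) x + cd \<xi>C (g A B) x) x = 0" unfolding closed[OF that] by simp
    then show ?thesis by (simp add: cd_diff cd_add smooth_cd smooth_diff sg)
  qed
  have i: "2*l \<le> 2*n+1" "2*l+1 \<le> 2*n+1" "A \<le> 2*n+1" "B \<le> 2*n+1" using l j by auto
  note comm = cd_commute[OF sg]
  note closedX = closed'[OF _ _ _ disjI1[OF conjI[OF refl conjI[OF refl refl]]]]
  note closedY = closed'[OF _ _ _ disjI2[OF conjI[OF refl conjI[OF refl refl]]]]
  have "cop (P0' j) (\<lambda>i. cop (R0' [l] i) G) x = cd (X A) (cd (Y B) (g (2*l) (2*l+1))) x - cd (X B) (cd (Y A) (g (2*l) (2*l+1))) x"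
    by (simp add: j(1) P0'_def R0'_def cop_Cons cd_minus_field g_def)
  \<comment> \<open>Four differentiated relations, two of the \<open>Y\<close> family and two of the
    \<open>X\<close> family, move the second-order operator from the pair \<open>A\<close>,
    \<open>B\<close> to the pair of the block.\<close>
  also have "\<dots> = bracket (2*l) (2*l+1) (g A B) x"
    using closedY[OF i(1,2,4), of "X A" x] closedY[OF i(1,2,3), of "X B" x]
      closedX[OF i(2,3,4), of "Y (2*l)" x] closedX[OF i(1,3,4), of "Y (2*l+1)" x]
      fun_cong[OF comm[of "Y (2*l)" "X (2*l+1)" A B], of x] fun_cong[OF comm[of "Y (2*l+1)" "X (2*l)" A B], of x]
      fun_cong[OF comm[of "Y (2*l)" "X A" "2*l+1" B], of x] fun_cong[OF comm[of "Y (2*l)" "X B" "2*l+1" A], of x]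
      fun_cong[OF comm[of "Y (2*l+1)" "X A" "2*l" B], of x] fun_cong[OF comm[of "Y (2*l+1)" "X B" "2*l" A], of x]
    unfolding bracket_def by algebra
  also have "\<dots> = block_laplacian l (g A B) x"
    unfolding bracket_def by (rule bracket_block[OF l sg])
  also have "g A B = G j" using j by (simp add: g_def)
  finally show "cop (P0' j) (\<lambda>i. cop (R0' [l] i) G) x = block_laplacian l (G j) x" .
qed

lemma RP_0:
  assumes sf: "\<And>i. smooth (f i)" and a: "a \<in> {0}"
  shows "cop (R0' [0..<Suc n] a) (\<lambda>j. cop (P0' j) f) = laplacian (f a)"
proof
  fix x
  have 1: "cop (R0' [l] a) (\<lambda>j. cop (P0' j) f) x = block_laplacian l (f a) x" if "l \<le> n" for l
    using bracket_block[OF that sf, of 0 x] a by (simp add: R0'_def P0'_def cop_Cons cd_minus_field)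
  have "cop (R0' [0..<Suc n] a) (\<lambda>j. cop (P0' j) f) x = (\<Sum>l\<leftarrow>[0..<Suc n]. cop (R0' [l] a) (\<lambda>j. cop (P0' j) f) x)"
    by (subst R0'_concat) (rule cop_concat)
  also have "\<dots> = (\<Sum>l\<le>n. block_laplacian l (f a) x)"
    using 1 by (simp add: sum_list_distinct_conv_sum_set atLeast0LessThan lessThan_Suc_atMost del: upt_Suc)
  finally show "cop (R0' [0..<Suc n] a) (\<lambda>j. cop (P0' j) f) x = laplacian (f a) x" by (simp add: laplacian_blocks)
qed

lemma QP_Q0: "(\<And>i. smooth (f i)) \<Longrightarrow> cop (Q0' q) (\<lambda>j. cop (P0' j) f) = (\<lambda>x. 0)"
proof -
  assume sf: "\<And>i. smooth (f i)"
  obtain A B C s where q: "q = (A, B, C, s)" by (cases q)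
  note comm = cd_commute[OF sf] cd_commute[OF smooth_cd[OF sf]]
  have YX: "cd (Y A) (cd (X B) (cd (Y C) (f i))) = cd (X B) (cd (Y A) (cd (Y C) (f i)))" for A B C i by (rule comm(2))
  have YY: "cd (X A) (cd (Y C) (cd (Y B) (f i))) = cd (X A) (cd (Y B) (cd (Y C) (f i)))" for A B C i
    using comm(1)[of "Y C" "Y B" i] by simp
  show ?thesis
    using comm(2)[of "X A" "X B" "Y C" 0] comm(2)[of "X A" "X C" "Y B" 0] comm(2)[of "X B" "X C" "Y A" 0]
      YY[of A B C 0] YY[of B A C 0] YY[of C A B 0]
    by (cases s) (simp_all add: q Q0'_def P0'_def cd_simps sf YX)
qed

lemma R0'_in: "(\<xi>s, j) \<in> set (R0' ls i) \<Longrightarrow> set ls \<subseteq> {..n} \<Longrightarrow> j \<in> J0'"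
  by (auto simp: R0'_def J0'_def split: if_splits)

lemma symbol_complex_Q0: "symbol_complex P0' Q0' (R0' [0..<Suc n]) J0' 2 1"
proof
  show "length \<xi>s = 2" if "j \<in> J0'" "(\<xi>s, i) \<in> set (P0' j)" for j \<xi>s i using that by (cases j) (auto simp: P0'_def)
  show "length \<xi>s = 1 \<and> j \<in> J0'" if "(\<xi>s, j) \<in> set (Q0' q)" for \<xi>s j q
    using that by (cases q) (auto simp: Q0'_def J0'_def split: if_splits)
  show "j \<in> J0'" if "(\<xi>s, j) \<in> set (R0' [0..<Suc n] i)" for \<xi>s j i
    by (rule R0'_in[OF that]) auto
  show "cop (Q0' q) (\<lambda>j. cop (P0' j) f) = (\<lambda>x. 0)" if "\<And>i. smooth (f i)" for f q by (rule QP_Q0[OF that])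
  show "symb (P0' j) m (\<lambda>i. symb (R0' [0..<Suc n] i) m w) = of_real (m \<bullet> m) * w j"
    if "\<And>q. symb (Q0' q) m w = 0" "j \<in> J0'" for m w j
    by (rule symbol_exact_from_blocks[OF _ R0'_concat that(1)]) (rule solve_Q0[OF _ _ _ that(2)])
qed auto

end

subsection \<open>The operators in coordinates\<close>

definition component :: "fiber \<Rightarrow> nat \<times> nat \<times> nat set \<Rightarrow> complex" where
  "component v = (\<lambda>(a, b, S). v a b S)"

lemma component_simp [simp]: "component v (a, b, S) = v a b S"
  by (simp add: component_def)

lemma fiber_eqI: "(\<And>i. component v i = component w i) \<Longrightarrow> v = w"
proof (intro ext)
  fix a b S assume "\<And>i. component v i = component w i"
  from this[of "(a, b, S)"] show "v a b S = w a b S" by simp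
qed

lemma smooth_on_UNIV: "smooth_on UNIV f \<longleftrightarrow> smooth f"
proof
  assume "smooth_on UNIV f"
  then obtain W g where *: "open W" "UNIV \<subseteq> W" "smooth_on W g" "C_infinity_on W g" "\<forall>x\<in>UNIV. g x = f x"
    unfolding smooth_on_def by blast
  then have "W = UNIV" "g = f" by auto
  then show "smooth f" using * by simp
qed (auto simp: smooth_on_def)

lemma smooth_imp_smooth_on: "smooth f \<Longrightarrow> smooth_on A f"
  unfolding smooth_on_def by (intro exI[of _ UNIV] exI[of _ f]) auto

lemma smooth_sections_UNIV:
  "v \<in> smooth_sections n k j UNIV \<longleftrightarrow> (\<forall>x. v x \<in> bundle_fiber n k j) \<and> (\<forall>a b S. smooth (\<lambda>x. v x a b S))"
  by (simp add: smooth_sections_def smooth_on_UNIV)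

lemma finite_basis_index: "finite (basis_index n k j)"
proof (rule finite_subset)
  show "basis_index n k j \<subseteq> {..sigma_deg k j} \<times> {..sigma_deg k j} \<times> Pow {0..2*n+1}"
    by (auto simp: basis_index_def)
qed auto

lemma herm_component: "herm n k j v w = (\<Sum>i\<in>basis_index n k j. component v i * cnj (component w i))"
  unfolding herm_def component_def by (intro sum.cong) auto

context frame
begin

definition Z :: "primed \<Rightarrow> nat \<Rightarrow> 'a \<Rightarrow> complex" where
  "Z A' = (case A' of P0 \<Rightarrow> X | P1 \<Rightarrow> Y)"

lemma cd_Z: "A \<le> 2*n+1 \<Longrightarrow> cd (Z A' A) f x = nabla e A A' f x"
  by (cases A') (simp_all add: Z_def cd_X cd_Y)

lemma d_prime_sum:
  assumes T: "T \<subseteq> {0..2*n+1}"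
  shows "d_prime n e A' v x a b T =
    (\<Sum>A\<in>T. (-1) ^ card {B \<in> T. B < A} * cd (Z A' A) (\<lambda>y. v y a b (T - {A})) x)"
proof -
  have "d_prime n e A' v x a b T =
     (\<Sum>A = 0..2*n+1. if A \<in> T then (-1) ^ card {B \<in> T. B < A} * cd (Z A' A) (\<lambda>y. v y a b (T - {A})) x else 0)"
    unfolding d_prime_def omega_wedge_def by (intro sum.cong refl) (auto simp: cd_Z)
  also have "\<dots> = (\<Sum>A\<in>{0..2*n+1} \<inter> T. (-1) ^ card {B \<in> T. B < A} * cd (Z A' A) (\<lambda>y. v y a b (T - {A})) x)"
    by (rule sum.inter_restrict[symmetric]) simp
  also have "{0..2*n+1} \<inter> T = T" using T by blast
  finally show ?thesis .
qed

lemma d_prime_single: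
  assumes "A \<le> 2*n+1"
  shows "d_prime n e A' v x a b {A} = cd (Z A' A) (\<lambda>y. v y a b {}) x"
proof -
  have 1: "{A} \<subseteq> {0..2*n+1}" using assms by simp
  have 2: "{B \<in> {A}. B < A} = {}" "{A} - {A} = {}" by auto
  show ?thesis unfolding d_prime_sum[OF 1] by (simp only: sum.insert sum.empty finite.emptyI empty_iff not_False_eq_True 2 card.empty power_0 mult_1 add_0_right)
qed

lemma d_prime_pair:
  assumes "A < B" "B \<le> 2*n+1"
  shows "d_prime n e A' v x a b {A, B} = cd (Z A' A) (\<lambda>y. v y a b {B}) x - cd (Z A' B) (\<lambda>y. v y a b {A}) x"
proof -
  have 1: "{A, B} \<subseteq> {0..2*n+1}" using assms by simp
  have 2: "{D \<in> {A, B}. D < A} = {}" "{D \<in> {A, B}. D < B} = {A}"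
    "{A, B} - {A} = {B}" "{A, B} - {B} = {A}" using assms by auto
  have 3: "(\<Sum>D\<in>{A, B}. h D) = h A + h B" for h :: "nat \<Rightarrow> complex" using assms by simp
  show ?thesis unfolding d_prime_sum[OF 1] 3 2 by simp
qed

lemma d_prime_triple:
  assumes "A < B" "B < C" "C \<le> 2*n+1"
  shows "d_prime n e A' v x a b {A, B, C} = cd (Z A' A) (\<lambda>y. v y a b {B, C}) x -
    cd (Z A' B) (\<lambda>y. v y a b {A, C}) x + cd (Z A' C) (\<lambda>y. v y a b {A, B}) x"
proof -
  have 1: "{A, B, C} \<subseteq> {0..2*n+1}" using assms by simp
  have 2: "{D \<in> {A, B, C}. D < A} = {}" "{D \<in> {A, B, C}. D < B} = {A}" "{D \<in> {A, B, C}. D < C} = {A, B}"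
    "{A, B, C} - {A} = {B, C}" "{A, B, C} - {B} = {A, C}" "{A, B, C} - {C} = {A, B}" using assms by auto
  have 3: "(\<Sum>D\<in>{A, B, C}. h D) = h A + h B + h C" for h :: "nat \<Rightarrow> complex" using assms by simp
  have 4: "card {A, B} = 2" using assms by simp
  show ?thesis unfolding d_prime_sum[OF 1] 3 2 4 by simp
qed

lemma d_prime_cong:
  assumes "open W" "x \<in> W" "\<And>y. y \<in> W \<Longrightarrow> u y = v y"
  shows "d_prime n e A' u x = d_prime n e A' v x"
proof (intro ext)
  fix a b T
  have "omega_wedge A (\<lambda>S. nabla e A A' (\<lambda>y. u y a b S) x) T = omega_wedge A (\<lambda>S. nabla e A A' (\<lambda>y. v y a b S) x) T"
    if "A \<le> 2*n+1" for A
    unfolding cd_Z[OF that, symmetric] using cd_cong[OF assms(1,2), of "\<lambda>y. u y a b (T - {A})" "\<lambda>y. v y a b (T - {A})"] assms(3)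
    by (simp add: omega_wedge_def)
  then show "d_prime n e A' u x a b T = d_prime n e A' v x a b T"
    unfolding d_prime_def by (intro sum.cong) auto
qed

lemma DD_cong:
  assumes W: "open W" "x \<in> W" "\<And>y. y \<in> W \<Longrightarrow> u y = v y"
  shows "DD n e k j u x = DD n e k j v x"
proof (intro ext)
  fix a b S
  have "d_prime n e P0 (d_prime n e P1 u) x = d_prime n e P0 (d_prime n e P1 v) x"
    by (rule d_prime_cong[OF W(1,2)]) (rule d_prime_cong[OF W(1) _ W(3)])
  moreover have "d_prime n e A' u x = d_prime n e A' v x" for A' by (rule d_prime_cong[OF W])
  ultimately show "DD n e k j u x a b S = DD n e k j v x a b S" unfolding DD_def by simp
qed

lemma smooth_d_prime:
  assumes "\<And>a b S. smooth (\<lambda>x. v x a b S)"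
  shows "smooth (\<lambda>x. d_prime n e A' v x a b T)"
proof -
  have "(\<lambda>x. d_prime n e A' v x a b T) =
     (\<lambda>x. \<Sum>A\<in>{0..2*n+1} \<inter> T. (-1) ^ card {B \<in> T. B < A} * cd (Z A' A) (\<lambda>y. v y a b (T - {A})) x)"
    unfolding d_prime_def omega_wedge_def
    by (rule ext, subst sum.inter_restrict) (auto intro!: sum.cong simp: cd_Z)
  then show ?thesis using assms by (simp only: smooth_sum smooth_cmult smooth_cd)
qed

lemma smooth_DD:
  assumes s: "\<And>a b S. smooth (\<lambda>x. v x a b S)"
  shows "smooth (\<lambda>x. DD n e k j v x a b S)"
proof -
  note d = smooth_d_prime[OF s]
  have z: "smooth (\<lambda>x. 0 :: complex)" by (rule C_infinity_on_const)
  show ?thesis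
    unfolding DD_def
    by (cases "j < k"; cases "j = k"; cases "a = 0"; cases "b = 0")
      (simp_all only: s_deriv.simps s_mult.simps if_True if_False smooth_add smooth_cmult smooth_minus z d smooth_d_prime[OF d] simp_thms less_irrefl)
qed

text \<open>\<open>R\<close> is a free predicate because the operator leaves the polynomial degrees
  \<open>a\<close> and \<open>b\<close> alone and raises only the form degree.\<close>

lemma d_prime_support:
  assumes v: "\<And>x a b S. v x a b S \<noteq> 0 \<Longrightarrow> R a b \<and> S \<subseteq> {0..2*n+1} \<and> card S = m"
    and nz: "d_prime n e A' v x a b T \<noteq> 0"
  shows "R a b \<and> T \<subseteq> {0..2*n+1} \<and> card T = Suc m"
proof -
  obtain A where A: "A \<le> 2*n+1" "A \<in> T" "cd (Z A' A) (\<lambda>y. v y a b (T - {A})) x \<noteq> 0"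
  proof -
    assume that: "\<And>A. A \<le> 2*n+1 \<Longrightarrow> A \<in> T \<Longrightarrow> cd (Z A' A) (\<lambda>y. v y a b (T - {A})) x \<noteq> 0 \<Longrightarrow> thesis"
    obtain A where "A \<in> {0..2*n+1}" "omega_wedge A (\<lambda>S. nabla e A A' (\<lambda>y. v y a b S) x) T \<noteq> 0"
      using nz unfolding d_prime_def by (rule sum.not_neutral_contains_not_neutral)
    then show thesis using that[of A] by (auto simp: omega_wedge_def cd_Z split: if_splits)
  qed
  have "\<exists>y. v y a b (T - {A}) \<noteq> 0"
  proof (rule ccontr)
    assume "\<not> ?thesis"
    then have "(\<lambda>y. v y a b (T - {A})) = (\<lambda>y. 0)" by auto
    then show False using A(3) by simp
  qed
  then have r: "R a b" "T - {A} \<subseteq> {0..2*n+1}" "card (T - {A}) = m" using v by blast+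
  then have "finite (T - {A})" using finite_subset by blast
  then have "card (insert A (T - {A})) = Suc m" using r(3) by (simp only: card_insert_disjoint Diff_iff insertI1 simp_thms)
  moreover have "insert A (T - {A}) = T" using A(2) by blast
  ultimately show ?thesis using r(1,2) A(1,2) by auto
qed

lemma DD_0_fiber:
  assumes v: "\<And>x. v x \<in> bundle_fiber n k 0"
  shows "DD n e k 0 v x \<in> bundle_fiber n k 1"
proof -
  have v': "a + b = k \<and> S \<subseteq> {0..2*n+1} \<and> card S = 0" if "v x a b S \<noteq> 0" for x a b S
    using v[of x] that unfolding bundle_fiber_def basis_index_def sigma_deg_def tau_deg_def by auto
  have d: "a + b = k \<and> T \<subseteq> {0..2*n+1} \<and> card T = Suc 0" if "d_prime n e A' v x a b T \<noteq> 0" for A' x a b T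
    by (rule d_prime_support[where R = "\<lambda>a b. a + b = k" and v = v, OF _ that]) (rule v')
  have dd: "a + b = k \<and> T \<subseteq> {0..2*n+1} \<and> card T = Suc (Suc 0)"
    if "d_prime n e A' (d_prime n e B' v) x a b T \<noteq> 0" for A' B' x a b T
    by (rule d_prime_support[where R = "\<lambda>a b. a + b = k" and v = "d_prime n e B' v", OF _ that]) (rule d)
  have "(a, b, T) \<in> basis_index n k 1" if nz: "DD n e k 0 v x a b T \<noteq> 0" for a b T
  proof (cases "k = 0")
    case True
    then have "d_prime n e P0 (d_prime n e P1 v) x a b T \<noteq> 0" using nz by (simp add: DD_def)
    from dd[OF this] show ?thesis using True by (simp add: basis_index_def sigma_deg_def tau_deg_def)
  next
    case False
    then have "d_prime n e P0 v x (a + 1) b T \<noteq> 0 \<or> d_prime n e P1 v x a (b + 1) T \<noteq> 0"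
      using nz by (auto simp: DD_def)
    then show ?thesis using d[of P0 x "a + 1" b T] d[of P1 x a "b + 1" T] False
      by (auto simp: basis_index_def sigma_deg_def tau_deg_def)
  qed
  then show ?thesis by (auto simp: bundle_fiber_def)
qed

lemma smooth_sections_DD_0: "v \<in> smooth_sections n k 0 UNIV \<Longrightarrow> DD n e k 0 v \<in> smooth_sections n k 1 UNIV"
  unfolding smooth_sections_UNIV using DD_0_fiber smooth_DD by blast

end

subsection \<open>The formal adjoint and the weak boundary condition\<close>

definition single :: "nat \<times> nat \<times> nat set \<Rightarrow> ('a \<Rightarrow> complex) \<Rightarrow> 'a \<Rightarrow> fiber" where
  "single i g x a b S = (if (a, b, S) = i then g x else 0)"

lemma component_single: "component (single i g x) i' = (if i' = i then g x else 0)"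
  by (cases i') (simp add: single_def)

lemma component_outside: "v \<in> bundle_fiber n k j \<Longrightarrow> i \<notin> basis_index n k j \<Longrightarrow> component v i = 0"
  by (cases i) (auto simp: bundle_fiber_def)

lemma single_section:
  assumes i: "i \<in> basis_index n k j" and g: "smooth g"
  shows "single i g \<in> smooth_sections n k j UNIV"
proof -
  have "smooth (\<lambda>x. single i g x a b S)" for a b S
    using g C_infinity_on_const[of UNIV "0::complex"] by (cases "(a, b, S) = i") (simp_all add: single_def)
  moreover have "single i g x \<in> bundle_fiber n k j" for x using i by (auto simp: bundle_fiber_def single_def)
  ultimately show ?thesis by (simp add: smooth_sections_UNIV)
qed

lemma single_test_section:
  assumes "i \<in> basis_index n k j" "test_on U g"
  shows "single i g \<in> test_sections n k j U"
proof -
  obtain K where "compact K" "K \<subseteq> U" "\<forall>x. x \<notin> K \<longrightarrow> g x = 0" using assms(2) unfolding test_on_def by blast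
  then have "compact K \<and> K \<subseteq> U \<and> (\<forall>x. x \<notin> K \<longrightarrow> single i g x = (\<lambda>a b S. 0))"
    by (auto simp: single_def fun_eq_iff)
  then show ?thesis unfolding test_sections_def using single_section[OF assms(1) test_on_smooth[OF assms(2)]] by blast
qed

lemma herm_single:
  assumes "i \<in> basis_index n k j"
  shows "herm n k j v (single i g x) = component v i * cnj (g x)"
    and "herm n k j (single i g x) v = g x * cnj (component v i)"
proof -
  have "herm n k j v (single i g x) = (\<Sum>i'\<in>basis_index n k j. if i' = i then component v i * cnj (g x) else 0)"
    unfolding herm_component component_single by (intro sum.cong) auto
  then show "herm n k j v (single i g x) = component v i * cnj (g x)"
    using assms by (simp add: sum.delta[OF finite_basis_index])
  have "herm n k j (single i g x) v = (\<Sum>i'\<in>basis_index n k j. if i' = i then g x * cnj (component v i) else 0)"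
    unfolding herm_component component_single by (intro sum.cong) auto
  then show "herm n k j (single i g x) v = g x * cnj (component v i)"
    using assms by (simp add: sum.delta[OF finite_basis_index])
qed

text \<open>The test function is \<open>d\<close> itself, cut off near \<open>p\<close>, so that the
  integrand is a nonnegative multiple of the squared norm of \<open>d\<close>.\<close>

lemma test_on_integral_square_zero:
  fixes d :: "'a::euclidean_space \<Rightarrow> complex"
  assumes d: "smooth d" and z: "\<And>g. test_on UNIV g \<Longrightarrow> (LINT x|lborel. g x * cnj (d x)) = 0"
  shows "d p = 0"
proof (rule ccontr)
  assume nz: "d p \<noteq> 0"
  obtain \<beta> :: "'a \<Rightarrow> real" where \<beta>: "test_on (cball p (2 * 1)) \<beta>" "\<And>x. 0 \<le> \<beta> x" "\<And>x. \<beta> x \<le> 1"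
    "\<And>x. x \<in> cball p 1 \<Longrightarrow> \<beta> x = 1"
    by (rule smooth_bump[of 1 p]) auto
  define h where "h = (\<lambda>x. \<beta> x * (norm (d x))\<^sup>2)"
  have t\<beta>: "test_on UNIV (\<lambda>x. complex_of_real (\<beta> x))"
    by (rule test_on_bounded_linear[OF bounded_linear_of_real test_on_UNIV[OF \<beta>(1)]])
  have tg: "test_on UNIV (\<lambda>x. complex_of_real (\<beta> x) * d x)" by (rule test_on_mult_left[OF t\<beta> d])
  have sd: "smooth (\<lambda>x. cnj (d x))" by (rule C_infinity_on_bounded_linear[OF open_UNIV bounded_linear_cnj d])
  have eq: "complex_of_real (\<beta> x) * d x * cnj (d x) = complex_of_real (h x)" for x
    unfolding h_def of_real_mult complex_norm_square by (simp add: mult.assoc)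
  have "integrable lborel (\<lambda>x. complex_of_real (\<beta> x) * d x * cnj (d x))"
    by (rule test_on_integrable[OF test_on_mult_left[OF tg sd]])
  then have int: "integrable lborel h" unfolding eq using integrable_Re by fastforce
  have "complex_of_real (LINT x|lborel. h x) = 0"
    using z[OF tg] unfolding eq integral_complex_of_real .
  then have "(LINT x|lborel. h x) = 0" by simp
  then have "AE x in lborel. h x = 0"
    using integral_nonneg_eq_0_iff_AE[OF int] \<beta>(2) by (simp add: h_def)
  moreover define V where "V = ball p 1 \<inter> d -` (- {0})"
  have "h x \<noteq> 0" if "x \<in> V" for x using that \<beta>(4)[of x] by (simp add: V_def h_def)
  ultimately have "AE x in lborel. x \<notin> V" by auto
  moreover have oV: "open V"
    unfolding V_def using smooth_continuous[OF d, of "ball p 1"] by (intro continuous_open_preimage) auto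
  ultimately have "V \<in> null_sets lborel" by (subst AE_iff_null_sets) auto
  then have "negligible V"
    using negligible_iff_null_sets null_sets_completion_iff oV by blast
  moreover have "p \<in> V" using nz by (simp add: V_def)
  ultimately show False using open_not_negligible[OF oV] by blast
qed

text \<open>Uniqueness behind the description operator: pairings with single-component test sections
  determine a smooth section.\<close>

lemma DD_adjoint_eqI:
  assumes \<phi>: "\<phi> \<in> smooth_sections n k j UNIV"
    and adj: "\<And>v. v \<in> test_sections n k j UNIV \<Longrightarrow>
      (LINT x|lborel. herm n k (Suc j) (DD n e k j v x) (\<psi> x)) = (LINT x|lborel. herm n k j (v x) (\<phi> x))"
  shows "DD_adjoint n e k j \<psi> = \<phi>"
  unfolding DD_adjoint_def
proof (rule the_equality)
  show "\<phi> \<in> smooth_sections n k j UNIV \<and> (\<forall>v\<in>test_sections n k j UNIV.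
      (LINT x|lborel. herm n k (Suc j) (DD n e k j v x) (\<psi> x)) = (LINT x|lborel. herm n k j (v x) (\<phi> x)))"
    using \<phi> adj by blast
next
  fix \<phi>'
  assume *: "\<phi>' \<in> smooth_sections n k j UNIV \<and> (\<forall>v\<in>test_sections n k j UNIV.
      (LINT x|lborel. herm n k (Suc j) (DD n e k j v x) (\<psi> x)) = (LINT x|lborel. herm n k j (v x) (\<phi>' x)))"
  show "\<phi>' = \<phi>"
  proof (rule ext, rule fiber_eqI)
    fix p i
    have s: "smooth (\<lambda>x. component (\<phi> x) i)" "smooth (\<lambda>x. component (\<phi>' x) i)"
      using \<phi> * by (cases i; simp add: smooth_sections_UNIV)+
    show "component (\<phi>' p) i = component (\<phi> p) i"
    proof (cases "i \<in> basis_index n k j")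
      case False
      then have "component (\<phi>' p) i = 0" "component (\<phi> p) i = 0"
        using \<phi> * unfolding smooth_sections_UNIV by (blast intro: component_outside)+
      then show ?thesis by simp
    next
      case True
      have "component (\<phi>' p) i - component (\<phi> p) i = 0"
      proof (rule test_on_integral_square_zero[OF smooth_diff[OF s(2,1)]])
        fix g :: "'a \<Rightarrow> complex" assume g: "test_on UNIV g"
        have v: "single i g \<in> test_sections n k j UNIV" by (rule single_test_section[OF True g])
        have "(LINT x|lborel. herm n k j (single i g x) (\<phi>' x)) = (LINT x|lborel. herm n k j (single i g x) (\<phi> x))"
          using * v adj[OF v] by auto
        then have eq: "(LINT x|lborel. g x * cnj (component (\<phi>' x) i)) = (LINT x|lborel. g x * cnj (component (\<phi> x) i))"
          by (simp add: herm_single[OF True])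
        have "integrable lborel (\<lambda>x. g x * cnj (component (\<phi>' x) i))" "integrable lborel (\<lambda>x. g x * cnj (component (\<phi> x) i))"
          by (intro test_on_integrable test_on_mult_left[OF g] C_infinity_on_bounded_linear[OF open_UNIV bounded_linear_cnj] s)+
        then show "(LINT x|lborel. g x * cnj (component (\<phi>' x) i - component (\<phi> x) i)) = 0"
          using eq by (simp add: right_diff_distrib Bochner_Integration.integral_diff)
      qed
      then show ?thesis by simp
    qed
  qed
qed

lemma integral_sum_list:
  "(\<And>t. t \<in> set ts \<Longrightarrow> integrable M (h t)) \<Longrightarrow>
    (LINT x|M. (\<Sum>t\<leftarrow>ts. h t x)) = (\<Sum>t\<leftarrow>ts. (LINT x|M. (h t x :: complex))) \<and> integrable M (\<lambda>x. \<Sum>t\<leftarrow>ts. h t x)"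
  by (induction ts) auto

lemma sum_list_delta:
  assumes "finite B" "\<And>t. t \<in> set ts \<Longrightarrow> idx t \<in> B"
  shows "(\<Sum>i\<in>B. c i * (\<Sum>t\<leftarrow>ts. if idx t = i then h t else 0)) = (\<Sum>t\<leftarrow>ts. c (idx t) * (h t :: complex))"
  using assms(2)
proof (induction ts)
  case (Cons t ts)
  have "(\<Sum>i\<in>B. c i * (\<Sum>t\<leftarrow>t # ts. if idx t = i then h t else 0)) =
     (\<Sum>i\<in>B. (if idx t = i then c (idx t) * h t else 0) + c i * (\<Sum>t\<leftarrow>ts. if idx t = i then h t else 0))"
    by (intro sum.cong) (auto simp: distrib_left)
  then show ?case using Cons assms(1) by (simp add: sum.distrib)
qed simp

lemma cop_as_sum_list: "cop ts G x = (\<Sum>t\<leftarrow>ts. foldr cd (fst t) (G (snd t)) x)"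
  by (induction ts) (simp_all add: cop_Cons)


lemma integral_cop:
  assumes "\<And>j. smooth (G j)" and \<phi>: "test_on UNIV \<phi>"
  shows "(LINT x|lborel. cop ts G x * \<phi> x) =
    (\<Sum>t\<leftarrow>ts. (-1) ^ length (fst t) * (LINT x|lborel. G (snd t) x * foldr cd (fst t) \<phi> x))"
proof -
  have "(LINT x|lborel. cop ts G x * \<phi> x) = (LINT x|lborel. (\<Sum>t\<leftarrow>ts. foldr cd (fst t) (G (snd t)) x * \<phi> x))"
    unfolding cop_as_sum_list by (simp add: sum_list_mult_const)
  also have "\<dots> = (\<Sum>t\<leftarrow>ts. (LINT x|lborel. foldr cd (fst t) (G (snd t)) x * \<phi> x))"
    by (intro integral_sum_list[THEN conjunct1] test_on_integrable test_on_mult_right[OF \<phi>] smooth_cds assms)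
  also have "\<dots> = (\<Sum>t\<leftarrow>ts. (-1) ^ length (fst t) * (LINT x|lborel. G (snd t) x * foldr cd (fst t) \<phi> x))"
    by (simp add: integral_cds_by_parts assms test_on_smooth[OF \<phi>])
  finally show ?thesis .
qed

text \<open>This translates between fibres and the scalar model: \<open>idx\<close> and
  \<open>iq\<close> locate a row among the components, while \<open>w\<close> and \<open>cq\<close>
  are nonzero factors, made of factorials or signs, that turn derivatives in s into index shifts.
  Rows with \<open>Q q = []\<close> belong to indices that describe no component.\<close>

locale complex_model = frame n e + symbol_complex P Q R Js r0 r1
  for n and e :: "nat \<Rightarrow> 'a::euclidean_space"
    and P :: "'j \<Rightarrow> (('a \<Rightarrow> complex) list \<times> nat) list"
    and Q :: "'l \<Rightarrow> (('a \<Rightarrow> complex) list \<times> 'j) list"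
    and R :: "nat \<Rightarrow> (('a \<Rightarrow> complex) list \<times> 'j) list" and Js r0 r1 +
  fixes k :: nat and idx :: "'j \<Rightarrow> nat \<times> nat \<times> nat set" and w :: "'j \<Rightarrow> complex"
    and iq :: "'l \<Rightarrow> nat \<times> nat \<times> nat set" and cq :: "'l \<Rightarrow> complex"
  assumes idx: "idx ` Js = basis_index n k 1" and w: "\<And>j. j \<in> Js \<Longrightarrow> w j \<noteq> 0"
    and iq: "\<And>q. Q q \<noteq> [] \<Longrightarrow> iq q \<in> basis_index n k (Suc 1)"
    and cq: "\<And>q. Q q \<noteq> [] \<Longrightarrow> cq q \<noteq> 0"
    and DD0: "\<And>v j x. v \<in> smooth_sections n k 0 UNIV \<Longrightarrow> j \<in> Js \<Longrightarrow>
      w j * component (DD n e k 0 v x) (idx j) = cop (P j) (\<lambda>i x. of_nat (fact i * fact (k - i)) * v x i (k - i) {}) x"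
    and DD1: "\<And>v q x. v \<in> smooth_sections n k 1 UNIV \<Longrightarrow> Q q \<noteq> [] \<Longrightarrow>
      cq q * component (DD n e k 1 v x) (iq q) = cop (Q q) (\<lambda>j x. w j * component (v x) (idx j)) x"
begin

text \<open>The adjoint of \<open>\<D>\<^sub>1\<close> on the test section whose single component is
  \<open>cnj \<phi>\<close>; the conjugations offset the conjugate linearity of \<open>herm\<close>
  in its second argument.\<close>

definition adj :: "'l \<Rightarrow> ('a \<Rightarrow> complex) \<Rightarrow> 'a \<Rightarrow> fiber" where
  "adj q \<phi> x a b S = cnj (\<Sum>t\<leftarrow>Q q. if idx (snd t) = (a, b, S)
     then (-1) ^ length (fst t) * w (snd t) * foldr cd (fst t) \<phi> x / cq q else 0)"

lemma component_adj: "component (adj q \<phi> x) i = cnj (\<Sum>t\<leftarrow>Q q. if idx (snd t) = i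
     then (-1) ^ length (fst t) * w (snd t) * foldr cd (fst t) \<phi> x / cq q else 0)"
  by (cases i) (simp add: adj_def)

lemma Q_Js: "t \<in> set (Q q) \<Longrightarrow> snd t \<in> Js"
  using Q_len[of "fst t" "snd t"] by simp

lemma herm_adj: "herm n k 1 v (adj q \<phi> x) =
    (\<Sum>t\<leftarrow>Q q. (w (snd t) * component v (idx (snd t))) * ((-1) ^ length (fst t) * foldr cd (fst t) \<phi> x / cq q))"
proof -
  have "herm n k 1 v (adj q \<phi> x) = (\<Sum>t\<leftarrow>Q q. component v (idx (snd t)) *
      ((-1) ^ length (fst t) * w (snd t) * foldr cd (fst t) \<phi> x / cq q))"
    unfolding herm_component component_adj complex_cnj_cnj
    by (rule sum_list_delta[OF finite_basis_index]) (use idx Q_Js in blast)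
  then show ?thesis by (simp add: mult_ac)
qed

lemma adj_section:
  assumes \<phi>: "smooth \<phi>"
  shows "adj q \<phi> \<in> smooth_sections n k 1 UNIV"
proof -
  have "smooth (\<lambda>x. \<Sum>t\<leftarrow>ts. if c t then d t * foldr cd (fst t) \<phi> x / cq q else 0)" for ts c and d :: "_ \<Rightarrow> complex"
  proof (induction ts)
    case (Cons t ts)
    have "smooth (\<lambda>x. if c t then (d t / cq q) * foldr cd (fst t) \<phi> x else 0)"
      using smooth_cmult[OF smooth_cds[OF \<phi>], of "d t / cq q"] C_infinity_on_const[of UNIV 0] by (cases "c t") simp_all
    from smooth_add[OF this Cons.IH] show ?case by (simp only: list.map sum_list.Cons times_divide_eq_left)
  qed (simp add: C_infinity_on_const)
  then have "smooth (\<lambda>x. adj q \<phi> x a b S)" for a b S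
    unfolding adj_def by (intro C_infinity_on_bounded_linear[OF open_UNIV bounded_linear_cnj])
  moreover have "adj q \<phi> x \<in> bundle_fiber n k 1" for x
  proof -
    have "(a, b, S) \<in> basis_index n k 1" if "adj q \<phi> x a b S \<noteq> 0" for a b S
    proof (rule ccontr)
      assume no: "(a, b, S) \<notin> basis_index n k 1"
      have "idx (snd t) \<noteq> (a, b, S)" if "t \<in> set (Q q)" for t
        using imageI[OF Q_Js[OF that], of idx] no unfolding idx by metis
      then have "(\<Sum>t\<leftarrow>Q q. if idx (snd t) = (a, b, S)
          then (-1) ^ length (fst t) * w (snd t) * foldr cd (fst t) \<phi> x / cq q else 0) = (\<Sum>t\<leftarrow>Q q. 0)"
        by (intro arg_cong[of _ _ sum_list] map_cong) auto
      then show False using that by (simp add: adj_def)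
    qed
    then show ?thesis by (simp add: bundle_fiber_def)
  qed
  ultimately show ?thesis by (simp add: smooth_sections_UNIV)
qed

lemma DD_adjoint_single:
  assumes q: "Q q \<noteq> []" and \<phi>: "test_on UNIV \<phi>"
  shows "DD_adjoint n e k 1 (single (iq q) (\<lambda>x. cnj (\<phi> x))) = adj q \<phi>"
proof (rule DD_adjoint_eqI[OF adj_section[OF test_on_smooth[OF \<phi>]]])
  fix v :: "'a \<Rightarrow> fiber" assume "v \<in> test_sections n k 1 UNIV"
  then have v: "v \<in> smooth_sections n k 1 UNIV" by (simp add: test_sections_def)
  define G where "G = (\<lambda>j x. w j * component (v x) (idx j))"
  have sG: "smooth (G j)" for j
    unfolding G_def using v by (cases "idx j") (simp add: smooth_sections_UNIV smooth_cmult)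
  have "(LINT x|lborel. herm n k (Suc 1) (DD n e k 1 v x) (single (iq q) (\<lambda>x. cnj (\<phi> x)) x)) =
      (LINT x|lborel. inverse (cq q) * (cop (Q q) G x * \<phi> x))"
    using DD1[OF v q] cq[OF q] unfolding G_def[symmetric] herm_single[OF iq[OF q]]
    by (intro Bochner_Integration.integral_cong) (auto simp: field_simps)
  also have "\<dots> = inverse (cq q) * (\<Sum>t\<leftarrow>Q q. (-1) ^ length (fst t) * (LINT x|lborel. G (snd t) x * foldr cd (fst t) \<phi> x))"
    by (simp add: integral_cop[OF sG \<phi>])
  also have "\<dots> = (\<Sum>t\<leftarrow>Q q. (LINT x|lborel. ((-1) ^ length (fst t) / cq q) * (G (snd t) x * foldr cd (fst t) \<phi> x)))"
    unfolding integral_mult_right_zero by (simp add: sum_list_const_mult[symmetric] divide_inverse mult_ac)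
  also have "\<dots> = (LINT x|lborel. (\<Sum>t\<leftarrow>Q q. ((-1) ^ length (fst t) / cq q) * (G (snd t) x * foldr cd (fst t) \<phi> x)))"
    by (rule integral_sum_list[THEN conjunct1, symmetric], rule integrable_mult_right)
      (intro test_on_integrable test_on_mult_right sG test_on_cds \<phi>)
  also have "\<dots> = (LINT x|lborel. herm n k 1 (v x) (adj q \<phi> x))"
    unfolding herm_adj G_def by (simp add: mult_ac)
  finally show "(LINT x|lborel. herm n k (Suc 1) (DD n e k 1 v x) (single (iq q) (\<lambda>x. cnj (\<phi> x)) x)) =
      (LINT x|lborel. herm n k 1 (v x) (adj q \<phi> x))" .
qed


text \<open>On the left of the zero Cauchy data condition \<open>\<D>\<^sub>1 \<D>\<^sub>0 F\<close>
  vanishes where the test section lives, so the right side is zero; for a single-component test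
  section this is the weak form of one row of \<open>Q\<close>. The section \<open>Fh\<close> is
  global, as the identities of the model require, and agrees with \<open>F\<close> on
  \<open>V\<close>.\<close>

lemma weak_condition:
  assumes D: "open D" and U: "open U" "V \<subseteq> U" "open V"
    and zc: "DD n e k 0 F \<in> zero_cauchy_data n e k 1 D U"
    and Fh: "Fh \<in> smooth_sections n k 0 UNIV" "\<And>x. x \<in> V \<Longrightarrow> Fh x = F x"
    and \<phi>: "test_on V \<phi>"
  defines "G \<equiv> \<lambda>j. cop (P j) (\<lambda>i x. of_nat (fact i * fact (k - i)) * Fh x i (k - i) {})"
  shows "(\<Sum>t\<leftarrow>Q q. (LINT x|lborel. (if x \<in> D then G (snd t) x * foldr cd (fst t) \<phi> x else 0))) = 0"
proof (cases "Q q = []")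
  case q: False
  define u where "u = DD n e k 0 F"
  define uh where "uh = DD n e k 0 Fh"
  define \<psi> where "\<psi> = single (iq q) (\<lambda>x. cnj (\<phi> x))"
  have uh: "uh \<in> smooth_sections n k 1 UNIV" unfolding uh_def by (rule smooth_sections_DD_0[OF Fh(1)])
  have eq: "uh x = u x" if "x \<in> V" for x
    unfolding u_def uh_def by (rule DD_cong[OF U(3) that Fh(2)])
  have eqG: "w j * component (uh x) (idx j) = G j x" if "j \<in> Js" for j x
    unfolding uh_def G_def by (rule DD0[OF Fh(1) that])
  have sF: "smooth (\<lambda>x. of_nat (fact i * fact (k - i)) * Fh x i (k - i) {})" for i
    using Fh(1) by (intro smooth_cmult) (simp add: smooth_sections_UNIV)
  have out: "foldr cd \<xi>s \<phi> x = 0" if "x \<notin> V" for \<xi>s x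
    by (rule test_on_outside[OF test_on_cds[OF \<phi>] that])
  have closed: "component (DD n e k 1 u x) (iq q) = 0" if x: "x \<in> V" for x
  proof -
    have "DD n e k 1 u x = DD n e k 1 uh x" by (rule DD_cong[OF U(3) x eq[symmetric]])
    moreover have "cq q * component (DD n e k 1 uh x) (iq q) = cop (Q q) (\<lambda>j x. w j * component (uh x) (idx j)) x"
      by (rule DD1[OF uh q])
    moreover have "cop (Q q) (\<lambda>j x. w j * component (uh x) (idx j)) x = cop (Q q) G x"
      by (rule cop_cong[of UNIV]) (use eqG Q_Js in auto)
    moreover have "cop (Q q) G x = 0" unfolding G_def QP[OF sF] by simp
    ultimately show ?thesis using cq[OF q] by simp
  qed
  have tc: "test_on U (\<lambda>x. cnj (\<phi> x))"
    by (rule test_on_mono[OF test_on_bounded_linear[OF bounded_linear_cnj \<phi>] U(2)])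
  have "\<psi> \<in> test_sections n k (Suc 1) U" unfolding \<psi>_def by (rule single_test_section[OF iq[OF q] tc])
  then have "(LINT x:D|lborel. herm n k (Suc 1) (DD n e k 1 u x) (\<psi> x)) =
      (LINT x:D|lborel. herm n k 1 (u x) (DD_adjoint n e k 1 \<psi> x))"
    using zc unfolding zero_cauchy_data_def u_def by blast
  moreover have "herm n k (Suc 1) (DD n e k 1 u x) (\<psi> x) = 0" for x
    using closed[of x] out[of x "[]"] unfolding \<psi>_def herm_single[OF iq[OF q]] by (cases "x \<in> V") auto
  moreover have "DD_adjoint n e k 1 \<psi> = adj q \<phi>"
    unfolding \<psi>_def by (rule DD_adjoint_single[OF q test_on_UNIV[OF \<phi>]])
  ultimately have z: "(LINT x:D|lborel. herm n k 1 (u x) (adj q \<phi> x)) = 0" by simp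
  define h where "h = (\<lambda>t x. if x \<in> D then G (snd t) x * foldr cd (fst t) \<phi> x else 0)"
  have len: "length (fst t) = r1" if "t \<in> set (Q q)" for t using Q_len[of "fst t" "snd t" q] that by simp
  have int: "integrable lborel (h t)" if "t \<in> set (Q q)" for t
  proof (rule Bochner_Integration.integrable_bound)
    have sG: "smooth (G (snd t))" unfolding G_def by (intro smooth_cop sF)
    show i: "integrable lborel (\<lambda>x. G (snd t) x * foldr cd (fst t) \<phi> x)"
      by (intro test_on_integrable test_on_mult_right[OF test_on_cds[OF test_on_UNIV[OF \<phi>]]] sG)
    have "h t = (\<lambda>x. indicator D x *\<^sub>R (G (snd t) x * foldr cd (fst t) \<phi> x))"
      by (rule ext) (simp add: h_def)
    moreover have "D \<in> sets lborel" using D by simp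
    ultimately show "h t \<in> borel_measurable lborel"
      using borel_measurable_scaleR[OF borel_measurable_indicator borel_measurable_integrable[OF i]] by simp
    show "AE x in lborel. norm (h t x) \<le> norm (G (snd t) x * foldr cd (fst t) \<phi> x)"
      by (rule AE_I2) (simp add: h_def)
  qed
  \<comment> \<open>All terms of a row have length \<open>r1\<close>, so the signs of the adjoint
    come out as one factor; off \<open>V\<close> every derivative of \<open>\<phi>\<close> is
    zero.\<close>
  have "indicator D x *\<^sub>R herm n k 1 (u x) (adj q \<phi> x) = ((-1) ^ r1 / cq q) * (\<Sum>t\<leftarrow>Q q. h t x)" for x
  proof (cases "x \<in> V \<and> x \<in> D")
    case True
    have "herm n k 1 (u x) (adj q \<phi> x) = (\<Sum>t\<leftarrow>Q q. ((-1) ^ r1 / cq q) * h t x)"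
      unfolding herm_adj
      by (intro arg_cong[of _ _ sum_list] map_cong refl)
        (use True eqG[OF Q_Js, of _ q x, unfolded eq[OF conjunct1[OF True]]] len in \<open>simp add: h_def\<close>)
    then show ?thesis using True unfolding sum_list_const_mult by simp
  next
    case False
    then have "(\<Sum>t\<leftarrow>Q q. h t x) = (\<Sum>t\<leftarrow>Q q. 0)"
      by (intro arg_cong[of _ _ sum_list] map_cong refl) (auto simp: h_def out)
    moreover have "herm n k 1 (u x) (adj q \<phi> x) = (\<Sum>t\<leftarrow>Q q. 0)" if "x \<notin> V"
      unfolding herm_adj by (intro arg_cong[of _ _ sum_list] map_cong refl) (simp add: out[OF that])
    ultimately show ?thesis using False by (auto simp: indicator_def)
  qed
  then have "(LINT x|lborel. ((-1) ^ r1 / cq q) * (\<Sum>t\<leftarrow>Q q. h t x)) = 0"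
    using z unfolding set_lebesgue_integral_def by simp
  then have "(LINT x|lborel. (\<Sum>t\<leftarrow>Q q. h t x)) = 0" using cq[OF q] by simp
  then show ?thesis using integral_sum_list[of "Q q" lborel h] int unfolding h_def by simp
qed simp

end

subsection \<open>Extension of \<open>k\<close>-CF functions\<close>

lemma smooth_on_open:
  assumes "open U" "smooth_on U f"
  shows "C_infinity_on U f"
proof -
  obtain W g where g: "open W" "U \<subseteq> W" "C_infinity_on W g" "\<forall>x\<in>U. g x = f x"
    using assms(2) unfolding smooth_on_def by blast
  show ?thesis by (rule C_infinity_on_cong[OF assms(1) _ C_infinity_on_subset[OF g(3,2)]]) (use g(4) in auto)
qed

lemma (in complex_model) regular_extension:
  assumes n: "n \<ge> 1" and D: "open D" "bounded D" "smooth_boundary D" "connected (- closure D)" and CF: "k_CF n e k D f"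
    and P_in: "\<And>j \<xi>s i. j \<in> Js \<Longrightarrow> (\<xi>s, i) \<in> set (P j) \<Longrightarrow> i \<le> k"
    and R0_in: "\<And>i \<xi>s j. (\<xi>s, j) \<in> set (R0 i) \<Longrightarrow> j \<in> Js"
    and solve: "\<And>G j. (\<And>j. smooth (G j)) \<Longrightarrow> (\<And>l. cop (Q l) G = (\<lambda>x. 0)) \<Longrightarrow> j \<in> Js \<Longrightarrow>
       cop (P j) (\<lambda>i. cop (R0 i) G) = block_laplacian 0 (G j)"
    and RP: "\<And>f i. i \<in> {..k} \<Longrightarrow> (\<And>i. smooth (f i)) \<Longrightarrow> cop (R i) (\<lambda>j. cop (P j) f) = laplacian (f i)"
    and R0_empty: "\<And>i. i \<notin> {..k} \<Longrightarrow> R0 i = []"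
  shows "\<exists>ft. k_regular n e k D ft \<and> ft \<in> smooth_sections n k 0 (closure D) \<and> (\<forall>x\<in>frontier D. ft x = f x)"
proof -
  obtain U F where F: "open U" "frontier D \<subseteq> U" "F \<in> smooth_sections n k 0 U" "\<forall>x\<in>frontier D. F x = f x"
    "DD n e k 0 F \<in> zero_cauchy_data n e k 1 D U"
    using CF unfolding k_CF_def by blast
  have ffib: "f p \<in> bundle_fiber n k 0" if "p \<in> frontier D" for p
    using CF that unfolding k_CF_def smooth_sections_def by blast
  obtain \<rho> W where df: "defining_function D \<rho> W" by (rule smooth_boundary_defining_function[OF D(1-3)])
  interpret df: defining_function D \<rho> W by (rule df)
  have oUW: "open (U \<inter> W)" "frontier D \<subseteq> U \<inter> W" using F(1,2) df.open_W df.frontier_W by auto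
  obtain \<eta> :: "'a \<Rightarrow> real" and V where \<eta>: "test_on (U \<inter> W) \<eta>" "open V" "frontier D \<subseteq> V" "V \<subseteq> U \<inter> W" "\<forall>x\<in>V. \<eta> x = 1"
    using smooth_cutoff_ex[OF df.compact_frontier oUW] by (elim exE conjE) (rule that)
  \<comment> \<open>The given extension lives only near the boundary. The cutoff makes it global
    without changing it on \<open>V\<close>, and \<open>V\<close> is the neighbourhood on which the
    weak condition is tested.\<close>
  define Fh :: "'a \<Rightarrow> fiber" where "Fh = (\<lambda>x a b S. if x \<in> U \<inter> W then \<eta> x *\<^sub>R F x a b S else 0)"
  have tFh: "test_on UNIV (\<lambda>x. Fh x a b S)" for a b S
  proof -
    have "C_infinity_on (U \<inter> W) (\<lambda>x. F x a b S)"
      by (rule C_infinity_on_subset[OF smooth_on_open[OF F(1)]]) (use F(3) in \<open>auto simp: smooth_sections_def\<close>)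
    from test_on_cut_extend[OF oUW(1) this \<eta>(1)] show ?thesis unfolding Fh_def by (rule test_on_UNIV)
  qed
  have sFh: "Fh \<in> smooth_sections n k 0 UNIV"
  proof -
    have "Fh x \<in> bundle_fiber n k 0" for x
      using F(3) unfolding Fh_def smooth_sections_def bundle_fiber_def by auto
    then show ?thesis unfolding smooth_sections_UNIV using test_on_smooth[OF tFh] by blast
  qed
  have Fh_V: "Fh x = F x" if "x \<in> V" for x
    using that \<eta>(4,5) by (auto simp: Fh_def fun_eq_iff)
  define c where "c = (\<lambda>i. of_nat (fact i * fact (k - i)) :: complex)"
  have c: "c i \<noteq> 0" for i by (simp add: c_def)
  define \<Phi> where "\<Phi> = (\<lambda>i x. c i * Fh x i (k - i) {})"
  have t\<Phi>: "test_on UNIV (\<Phi> i)" for i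
    unfolding \<Phi>_def using test_on_mult_right[OF tFh C_infinity_on_const] by simp
  interpret bp: boundary_problem D \<rho> W P Q R Js r0 r1 V
    by unfold_locales (use \<eta> in auto)
  have wk: "bp.weak \<Phi>"
    unfolding bp.weak_def
  proof (intro allI impI)
    fix l and \<phi> :: "'a \<Rightarrow> complex" assume \<phi>: "test_on V \<phi>"
    have "V \<subseteq> U" using \<eta>(4) by blast
    then have "(\<Sum>t\<leftarrow>Q l. (LINT x|lborel. (if x \<in> D then cop (P (snd t)) (\<lambda>i x. of_nat (fact i * fact (k - i)) * Fh x i (k - i) {}) x *
        foldr cd (fst t) \<phi> x else 0))) = 0"
      using weak_condition[OF D(1) F(1) _ \<eta>(2) F(5) sFh _ \<phi>] Fh_V by blast
    then show "df.wint (Q l) (\<lambda>j. cop (P j) \<Phi>) \<phi> = 0"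
      unfolding df.wint_def df.cutD_def \<Phi>_def c_def by (simp add: case_prod_unfold)
  qed
  \<comment> \<open>The parameter \<open>M = 2*n+1\<close> is half of the dimension
    \<open>4*n+4\<close>, less one; \<open>e 5\<close> is the first coordinate direction of the
    second quaternionic variable, present because \<open>n \<ge> 1\<close>.\<close>
  have "\<exists>ft. (\<forall>i. smooth (ft i)) \<and> (\<forall>i. \<forall>p\<in>frontier D. ft i p = \<Phi> i p) \<and> (\<forall>j\<in>Js. \<forall>x\<in>D. cop (P j) ft x = 0)"
  proof (rule bp.extension[where J = slice and e' = "e 5" and M = "2*n+1" and ?R0.0 = R0 and Is = "{..k}"])
    show "e 5 \<in> Basis" using n by (intro e_Basis) auto
    show "cop (P j) (\<lambda>i. cop (R0 i) G) = (\<lambda>x. \<Sum>b\<in>Basis. dir_deriv (slice b) (dir_deriv (slice b) (G j)) x)"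
      if "\<And>j. smooth (G j)" "\<And>l. cop (Q l) G = (\<lambda>x. 0)" "j \<in> Js" for G j
      unfolding slice_laplacian by (rule solve[OF that])
    show "slice y \<bullet> e 5 = 0" for y by (rule slice_e5[OF n])
    show "DIM('a) = 2 * (2*n+1) + 2" using DIM_a by simp
    show "(\<xi>s, j) \<in> set (R0 i) \<Longrightarrow> j \<in> Js" for \<xi>s j i by (rule R0_in)
    show "i \<in> {..k} \<Longrightarrow> (\<And>i. smooth (f i)) \<Longrightarrow> cop (R i) (\<lambda>j. cop (P j) f) = laplacian (f i)" for f i by (rule RP)
    show "i \<notin> {..k} \<Longrightarrow> R0 i = []" for i by (rule R0_empty)
  qed (use D t\<Phi> wk linear_slice norm_slice slice_Basis in auto)
  then obtain ft where ft: "\<And>i. smooth (ft i)" "\<And>i p. p \<in> frontier D \<Longrightarrow> ft i p = \<Phi> i p"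
    "\<And>j x. j \<in> Js \<Longrightarrow> x \<in> D \<Longrightarrow> cop (P j) ft x = 0" by blast
  \<comment> \<open>Dividing by \<open>c a\<close> undoes the factorial rescaling of the
    model.\<close>
  define v :: "'a \<Rightarrow> fiber" where "v = (\<lambda>x a b S. if S = {} \<and> a + b = k then ft a x / c a else 0)"
  have sv: "v \<in> smooth_sections n k 0 UNIV"
  proof -
    have "smooth (\<lambda>x. v x a b S)" for a b S
    proof (cases "S = {} \<and> a + b = k")
      case True
      then have "(\<lambda>x. v x a b S) = (\<lambda>x. inverse (c a) * ft a x)" by (simp add: v_def divide_inverse mult.commute)
      then show ?thesis using smooth_cmult[OF ft(1)] by simp
    next
      case False
      then have "(\<lambda>x. v x a b S) = (\<lambda>x. 0)" by (auto simp: v_def)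
      then show ?thesis by (simp only: C_infinity_on_const)
    qed
    moreover have "v x \<in> bundle_fiber n k 0" for x
      by (auto simp: v_def bundle_fiber_def basis_index_def sigma_deg_def tau_deg_def)
    ultimately show ?thesis by (simp add: smooth_sections_UNIV)
  qed
  have sec: "v \<in> smooth_sections n k 0 S" for S
    using sv smooth_imp_smooth_on[of "\<lambda>x. v x _ _ _" S] by (simp add: smooth_sections_def smooth_on_UNIV)
  have "DD n e k 0 v x = (\<lambda>a b S. 0)" if x: "x \<in> D" for x
  proof (rule fiber_eqI)
    fix i
    show "component (DD n e k 0 v x) i = component (\<lambda>a b S. 0) i"
    proof (cases "i \<in> idx ` Js")
      case True
      then obtain j where j: "j \<in> Js" "i = idx j" by blast
      have "w j * component (DD n e k 0 v x) (idx j) = cop (P j) (\<lambda>i x. of_nat (fact i * fact (k - i)) * v x i (k - i) {}) x"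
        by (rule DD0[OF sv j(1)])
      also have "\<dots> = cop (P j) ft x"
      proof (rule cop_cong[of UNIV])
        fix i y assume "i \<in> snd ` set (P j)"
        then have "i \<le> k" using P_in[OF j(1)] by auto
        then show "of_nat (fact i * fact (k - i)) * v y i (k - i) {} = ft i y" using c[of i] by (simp add: v_def c_def)
      qed auto
      also have "\<dots> = 0" by (rule ft(3)[OF j(1) x])
      finally show ?thesis using w[OF j(1)] j(2) by (simp add: component_def split: prod.split)
    next
      case False
      have "DD n e k 0 v x \<in> bundle_fiber n k 1" using smooth_sections_DD_0[OF sv] unfolding smooth_sections_UNIV by blast
      from component_outside[OF this, of i] show ?thesis using False unfolding idx by (simp add: component_def split: prod.split)
    qed
  qed
  then have "k_regular n e k D v" using sec by (simp add: k_regular_def)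
  moreover have "v p = f p" if p: "p \<in> frontier D" for p
  proof (intro ext)
    fix a b S
    show "v p a b S = f p a b S"
    proof (cases "S = {} \<and> a + b = k")
      case True
      then have "k - a = b" by auto
      then show ?thesis using True ft(2)[OF p, of a] c[of a] Fh_V[of p] p \<eta>(3) F(4) by (auto simp: v_def \<Phi>_def)
    next
      case False
      have "f p a b S = 0"
      proof (rule ccontr)
        assume "f p a b S \<noteq> 0"
        then have i: "(a, b, S) \<in> basis_index n k 0" using ffib[OF p] unfolding bundle_fiber_def by blast
        then have "finite S" by (auto simp: basis_index_def intro: finite_subset)
        then show False using i False by (auto simp: basis_index_def sigma_deg_def tau_deg_def)
      qed
      then show ?thesis using False by (auto simp: v_def)
    qed
  qed
  ultimately show ?thesis using sec by blast
qed

section \<open>The three ranges of k as instances of the model\<close>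

context frame
begin

lemma DD_below: "j < k \<Longrightarrow> DD n e k j u x a b S =
    of_nat (a + 1) * d_prime n e P0 u x (a + 1) b S + of_nat (b + 1) * d_prime n e P1 u x a (b + 1) S"
  by (simp add: DD_def)

lemma component_smooth: "v \<in> smooth_sections n k j UNIV \<Longrightarrow> smooth (\<lambda>x. v x a b S)"
  by (simp add: smooth_sections_UNIV)

definition idx_k :: "nat \<Rightarrow> nat \<times> nat \<Rightarrow> nat \<times> nat \<times> nat set" where
  "idx_k k = (\<lambda>(A, a). (a, k - 1 - a, {A}))"

definition w_k :: "nat \<Rightarrow> nat \<times> nat \<Rightarrow> complex" where
  "w_k k = (\<lambda>(A, a). of_nat (fact a * fact (k - 1 - a)))"

lemma idx_k_image:
  assumes "k \<ge> 1"
  shows "idx_k k ` Jk k = basis_index n k 1"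
proof
  show "idx_k k ` Jk k \<subseteq> basis_index n k 1"
    using assms by (auto simp: idx_k_def Jk_def basis_index_def sigma_deg_def tau_deg_def)
  show "basis_index n k 1 \<subseteq> idx_k k ` Jk k"
  proof
    fix i assume i: "i \<in> basis_index n k 1"
    obtain a b S where abS: "i = (a, b, S)" by (cases i)
    have *: "a + b = k - 1" "S \<subseteq> {0..2*n+1}" "card S = 1"
      using i assms by (auto simp: abS basis_index_def sigma_deg_def tau_deg_def)
    then obtain A where "S = {A}" by (auto simp: card_1_singleton_iff)
    then have "i = idx_k k (A, a)" "(A, a) \<in> Jk k" using * assms by (auto simp: abS idx_k_def Jk_def)
    then show "i \<in> idx_k k ` Jk k" by blast
  qed
qed

lemma DD0_k:
  assumes v: "v \<in> smooth_sections n k 0 UNIV" and k: "k \<ge> 1" and j: "j \<in> Jk k"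
  shows "w_k k j * component (DD n e k 0 v x) (idx_k k j) =
    cop (Pk j) (\<lambda>i x. of_nat (fact i * fact (k - i)) * v x i (k - i) {}) x"
proof -
  obtain A a where j: "j = (A, a)" "A \<le> 2*n+1" "a < k" using j by (auto simp: Jk_def)
  define m where "m = k - 1 - a"
  have b: "k - Suc a = m" "k - a = Suc m" using j by (auto simp: m_def)
  have c: "cd \<xi> (\<lambda>x. c * v x a b S) x = c * cd \<xi> (\<lambda>x. v x a b S) x" for \<xi> c a b S
    by (rule fun_cong[OF cd_cmult[OF component_smooth[OF v]]])
  have "cop (Pk j) (\<lambda>i x. of_nat (fact i * fact (k - i)) * v x i (k - i) {}) x =
      of_nat (fact (a + 1) * fact (m)) * cd (X A) (\<lambda>x. v x (a + 1) (m) {}) x +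
      of_nat (fact a * fact (m + 1)) * cd (Y A) (\<lambda>x. v x a (m + 1) {}) x"
    using c by (simp add: j(1) Pk_def cop_Cons b del: of_nat_mult fact_Suc)
  also have "\<dots> = w_k k j * component (DD n e k 0 v x) (idx_k k j)"
    using k by (simp add: j(1) w_k_def idx_k_def b DD_below d_prime_single[OF j(2)] Z_def algebra_simps)
  finally show ?thesis by simp
qed

text \<open>With the factor \<open>fact a * fact (k - 2 - a)\<close> on the target, the coefficients
  \<open>a + 1\<close> and \<open>b + 1\<close> produced by the two derivatives in s are absorbed
  into the factorials of the source components.\<close>

lemma complex_model_Q2:
  assumes k: "k \<ge> 2"
  shows "complex_model n e Pk (Q2 k) (Rk k [0..<Suc n]) (Jk k) 1 1 k (idx_k k) (w_k k)
    (\<lambda>(A, B, a). (a, k - 2 - a, {A, B})) (\<lambda>(A, B, a). of_nat (fact a * fact (k - 2 - a)))"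
proof (intro complex_model.intro complex_model_axioms.intro)
  have k1: "k \<ge> 1" using k by simp
  show "frame n e" by (rule frame_axioms)
  show "symbol_complex Pk (Q2 k) (Rk k [0..<Suc n]) (Jk k) 1 1" by (rule symbol_complex_Q2[OF k])
  show "idx_k k ` Jk k = basis_index n k 1" by (rule idx_k_image[OF k1])
  show "w_k k j \<noteq> 0" for j by (simp add: w_k_def split: prod.split)
  show "(case q of (A, B, a) \<Rightarrow> (a, k - 2 - a, {A, B})) \<in> basis_index n k (Suc 1)" if "Q2 k q \<noteq> []" for q
    using that k by (cases q) (auto simp: Q2_def basis_index_def sigma_deg_def tau_deg_def split: if_splits)
  show "(case q of (A, B, a) \<Rightarrow> of_nat (fact a * fact (k - 2 - a))) \<noteq> (0::complex)" for q by (simp split: prod.split)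
  show "w_k k j * component (DD n e k 0 v x) (idx_k k j) =
      cop (Pk j) (\<lambda>i x. of_nat (fact i * fact (k - i)) * v x i (k - i) {}) x"
    if "v \<in> smooth_sections n k 0 UNIV" "j \<in> Jk k" for v j x by (rule DD0_k[OF that(1) k1 that(2)])
  show "(case q of (A, B, a) \<Rightarrow> of_nat (fact a * fact (k - 2 - a))) *
      component (DD n e k 1 v x) (case q of (A, B, a) \<Rightarrow> (a, k - 2 - a, {A, B})) =
      cop (Q2 k q) (\<lambda>j x. w_k k j * component (v x) (idx_k k j)) x"
    if v: "v \<in> smooth_sections n k 1 UNIV" and q: "Q2 k q \<noteq> []" for v q x
  proof -
    obtain A B a where q: "q = (A, B, a)" "A < B" "B \<le> 2*n+1" "Suc a < k"
      using q by (cases q) (auto simp: Q2_def split: if_splits)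
    define m where "m = k - 2 - a"
    have k': "k - Suc a = Suc m" "k - Suc (Suc a) = m" "k - (2 + a) = m" using q by (auto simp: m_def)
    have i: "w_k k (A, Suc a) = of_nat (fact (a + 1) * fact m)" "w_k k (A, a) = of_nat (fact a * fact (m + 1))"
       "idx_k k (A, Suc a) = (a + 1, m, {A})" "idx_k k (A, a) = (a, m + 1, {A})" for A
      by (simp_all add: w_k_def idx_k_def k' distrib_right)
    have c: "cd \<xi> (\<lambda>x. c * v x a b S) x = c * cd \<xi> (\<lambda>x. v x a b S) x" for \<xi> c a b S
      by (rule fun_cong[OF cd_cmult[OF component_smooth[OF v]]])
    have "cop (Q2 k q) (\<lambda>j x. w_k k j * component (v x) (idx_k k j)) x =
        of_nat (fact (a + 1) * fact (m)) * (cd (X A) (\<lambda>x. v x (a + 1) (m) {B}) x - cd (X B) (\<lambda>x. v x (a + 1) (m) {A}) x) +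
        of_nat (fact a * fact (m + 1)) * (cd (Y A) (\<lambda>x. v x a (m + 1) {B}) x - cd (Y B) (\<lambda>x. v x a (m + 1) {A}) x)"
      using c q(2-4) by (simp add: q(1) Q2_def cop_Cons cd_minus_field i right_diff_distrib del: of_nat_mult fact_Suc)
    also have "\<dots> = of_nat (fact a * fact (m)) * component (DD n e k 1 v x) (a, m, {A, B})"
      using k by (simp add: DD_below d_prime_pair[OF q(2,3)] Z_def algebra_simps)
    finally show ?thesis unfolding q(1) prod.case m_def[symmetric] by simp
  qed
qed

text \<open>For \<open>k = 1\<close> the target of \<open>\<D>\<^sub>1\<close> has degree zero in s
  and form degree three, and \<open>\<D>\<^sub>1\<close> applies \<open>d_prime\<close> twice; all
  factors that occur are \<open>1\<close>.\<close>

lemma complex_model_Q1: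
  "complex_model n e Pk Q1 (Rk 1 [0..<Suc n]) (Jk 1) 1 2 1 (idx_k 1) (w_k 1) (\<lambda>(A, B, C). (0, 0, {A, B, C})) (\<lambda>_. 1)"
proof (intro complex_model.intro complex_model_axioms.intro)
  show "frame n e" by (rule frame_axioms)
  show "symbol_complex Pk Q1 (Rk 1 [0..<Suc n]) (Jk 1) 1 2" by (rule symbol_complex_Q1)
  show "idx_k 1 ` Jk 1 = basis_index n 1 1" by (rule idx_k_image) simp
  show "w_k 1 j \<noteq> 0" for j by (simp add: w_k_def split: prod.split)
  show "(case q of (A, B, C) \<Rightarrow> (0, 0, {A, B, C})) \<in> basis_index n 1 (Suc 1)" if "Q1 q \<noteq> []" for q
    using that by (cases q) (auto simp: Q1_def basis_index_def sigma_deg_def tau_deg_def split: if_splits)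
  show "w_k 1 j * component (DD n e 1 0 v x) (idx_k 1 j) =
      cop (Pk j) (\<lambda>i x. of_nat (fact i * fact (1 - i)) * v x i (1 - i) {}) x"
    if "v \<in> smooth_sections n 1 0 UNIV" "j \<in> Jk 1" for v j x by (rule DD0_k[OF that(1) _ that(2)]) simp
  show "1 * component (DD n e 1 1 v x) (case q of (A, B, C) \<Rightarrow> (0, 0, {A, B, C})) =
      cop (Q1 q) (\<lambda>j x. w_k 1 j * component (v x) (idx_k 1 j)) x"
    if v: "v \<in> smooth_sections n 1 1 UNIV" and q: "Q1 q \<noteq> []" for v q x
  proof -
    obtain A B C where q: "q = (A, B, C)" "A < B" "B < C" "C \<le> 2*n+1"
      using q by (cases q) (auto simp: Q1_def split: if_splits)
    have p: "d_prime n e P1 v y 0 0 {A', B'} = cd (Y A') (\<lambda>y. v y 0 0 {B'}) y - cd (Y B') (\<lambda>y. v y 0 0 {A'}) y"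
      if "A' < B'" "B' \<le> 2*n+1" for A' B' y using d_prime_pair[OF that] by (simp add: Z_def)
    have "DD n e 1 1 v x 0 0 {A, B, C} =
        cd (X A) (\<lambda>y. cd (Y B) (\<lambda>y. v y 0 0 {C}) y - cd (Y C) (\<lambda>y. v y 0 0 {B}) y) x -
        cd (X B) (\<lambda>y. cd (Y A) (\<lambda>y. v y 0 0 {C}) y - cd (Y C) (\<lambda>y. v y 0 0 {A}) y) x +
        cd (X C) (\<lambda>y. cd (Y A) (\<lambda>y. v y 0 0 {B}) y - cd (Y B) (\<lambda>y. v y 0 0 {A}) y) x"
      using q by (simp add: DD_def d_prime_triple p Z_def)
    then show ?thesis
      using q unfolding q(1) by (simp add: w_k_def idx_k_def Q1_def cop_Cons cd_minus_field cd_diff smooth_cd component_smooth[OF v])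
  qed
qed auto

text \<open>Here \<open>\<D>\<^sub>1\<close> multiplies by s with lowered index, which is minus the
  second variable for \<open>P0\<close> and the first variable for \<open>P1\<close>. This is the
  origin of the exponents and of the sign attached to the boolean, where \<open>True\<close> selects
  the \<open>X\<close> fields.\<close>

lemma complex_model_Q0:
  "complex_model n e P0' Q0' (R0' [0..<Suc n]) J0' 2 1 0 (\<lambda>(A, B). (0, 0, {A, B})) (\<lambda>_. 1)
    (\<lambda>(A, B, C, s). (if s then 0 else 1, if s then 1 else 0, {A, B, C})) (\<lambda>(A, B, C, s). if s then -1 else 1)"
proof (intro complex_model.intro complex_model_axioms.intro)
  show "frame n e" by (rule frame_axioms)
  show "symbol_complex P0' Q0' (R0' [0..<Suc n]) J0' 2 1" by (rule symbol_complex_Q0)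
  show "(\<lambda>(A, B). (0, 0, {A, B})) ` J0' = basis_index n 0 1"
  proof
    show "(\<lambda>(A, B). (0, 0, {A, B})) ` J0' \<subseteq> basis_index n 0 1"
      by (auto simp: J0'_def basis_index_def sigma_deg_def tau_deg_def)
    show "basis_index n 0 1 \<subseteq> (\<lambda>(A, B). (0, 0, {A, B})) ` J0'"
    proof
      fix i assume i: "i \<in> basis_index n 0 1"
      obtain a b S where abS: "i = (a, b, S)" by (cases i)
      have *: "a = 0" "b = 0" "S \<subseteq> {0..2*n+1}" "card S = 2"
        using i by (auto simp: abS basis_index_def sigma_deg_def tau_deg_def)
      then obtain A B where "S = {A, B}" "A \<noteq> B" by (auto simp: card_2_iff)
      then obtain A B where "S = {A, B}" "A < B" by (metis insert_commute linorder_neqE_nat)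
      then show "i \<in> (\<lambda>(A, B). (0, 0, {A, B})) ` J0'"
        using * by (intro image_eqI[of _ _ "(A, B)"]) (auto simp: abS J0'_def)
    qed
  qed
  show "(case q of (A, B, C, s) \<Rightarrow> (if s then 0 else 1, if s then 1 else 0, {A, B, C})) \<in> basis_index n 0 (Suc 1)"
    if "Q0' q \<noteq> []" for q
    using that by (cases q) (auto simp: Q0'_def basis_index_def sigma_deg_def tau_deg_def split: if_splits)
  show "(case q of (A, B, C, s) \<Rightarrow> if s then - 1 else 1) \<noteq> (0::complex)" for q :: "nat \<times> nat \<times> nat \<times> bool"
    by (auto split: prod.split)
  show "1 * component (DD n e 0 0 v x) (case j of (A, B) \<Rightarrow> (0, 0, {A, B})) =
      cop (P0' j) (\<lambda>i x. of_nat (fact i * fact (0 - i)) * v x i (0 - i) {}) x"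
    if v: "v \<in> smooth_sections n 0 0 UNIV" and j: "j \<in> J0'" for v j x
  proof -
    obtain A B where j: "j = (A, B)" "A < B" "B \<le> 2*n+1" using j by (auto simp: J0'_def)
    have s: "d_prime n e P1 v y 0 0 {A'} = cd (Y A') (\<lambda>y. v y 0 0 {}) y" if "A' \<le> 2*n+1" for A' y
      using d_prime_single[OF that] by (simp add: Z_def)
    show ?thesis using j unfolding j(1)
      by (simp add: DD_def d_prime_pair s Z_def P0'_def cop_Cons cd_minus_field)
  qed
  show "(case q of (A, B, C, s) \<Rightarrow> if s then - 1 else 1) *
      component (DD n e 0 1 v x) (case q of (A, B, C, s) \<Rightarrow> (if s then 0 else 1, if s then 1 else 0, {A, B, C})) =
      cop (Q0' q) (\<lambda>j x. 1 * component (v x) (case j of (A, B) \<Rightarrow> (0, 0, {A, B}))) x"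
    if v: "v \<in> smooth_sections n 0 1 UNIV" and q: "Q0' q \<noteq> []" for v q x
  proof -
    obtain A B C s where q: "q = (A, B, C, s)" "A < B" "B < C" "C \<le> 2*n+1"
      using q by (cases q) (auto simp: Q0'_def split: if_splits)
    show ?thesis using q(2-4) unfolding q(1)
      by (cases s) (simp_all add: DD_def d_prime_triple Z_def Q0'_def cop_Cons cd_minus_field)
  qed
qed auto

end

theorem theorem1p2:
  fixes n k :: nat
    and e :: "nat \<Rightarrow> 'a::euclidean_space"
    and D :: "'a set"
    and f :: "'a \<Rightarrow> fiber"
  assumes "n \<ge> 1"
    and "bij_betw e {1..4*n+4} Basis"
    and "open D" and "connected D" and "D \<noteq> {}" and "bounded D"
    and "smooth_boundary D"
    and "connected (- closure D)"
    and "k_CF n e k D f"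
  shows "\<exists>ft. k_regular n e k D ft \<and> ft \<in> smooth_sections n k 0 (closure D) \<and>
    (\<forall>x\<in>frontier D. ft x = f x)"
proof -
  interpret frame n e by unfold_locales (rule assms(2))
  note D = assms(1,3,6,7,8)
  \<comment> \<open>The operator \<open>\<D>\<^sub>1\<close> has order two exactly for
    \<open>k = 1\<close>, and \<open>\<D>\<^sub>0\<close> exactly for \<open>k = 0\<close>. In each
    case the block \<open>0\<close> alone provides the homotopy \<open>R0\<close> that solves the
    equation.\<close>
  consider "k \<ge> 2" | "k = 1" | "k = 0" by linarith
  then show ?thesis
  proof cases
    case 1
    then have k1: "k \<ge> 1" by simp
    show ?thesis
    proof (rule complex_model.regular_extension[OF complex_model_Q2[OF 1] D assms(9), where ?R0.0 = "Rk k [0]"])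
      show "(\<xi>s, i) \<in> set (Pk j) \<Longrightarrow> j \<in> Jk k \<Longrightarrow> i \<le> k" for j \<xi>s i by (auto simp: Pk_def Jk_def)
      show "(\<xi>s, j) \<in> set (Rk k [0] i) \<Longrightarrow> j \<in> Jk k" for \<xi>s j i by (rule Rk_in) (use k1 in auto)
    qed (use solve_Q2[OF _ _ 1 le0] RP_k[OF _ k1] in \<open>auto simp: Rk_def\<close>)
  next
    case 2
    show ?thesis unfolding 2
    proof (rule complex_model.regular_extension[OF complex_model_Q1 D assms(9)[unfolded 2], where ?R0.0 = "Rk 1 [0]"])
      show "(\<xi>s, i) \<in> set (Pk j) \<Longrightarrow> j \<in> Jk 1 \<Longrightarrow> i \<le> 1" for j \<xi>s i by (auto simp: Pk_def Jk_def)
      show "(\<xi>s, j) \<in> set (Rk 1 [0] i) \<Longrightarrow> j \<in> Jk 1" for \<xi>s j i by (rule Rk_in) auto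
    qed (use solve_Q1[OF _ _ le0] RP_k[of _ 1] in \<open>auto simp: Rk_def\<close>)
  next
    case 3
    show ?thesis unfolding 3
    proof (rule complex_model.regular_extension[OF complex_model_Q0 D assms(9)[unfolded 3], where ?R0.0 = "R0' [0]"])
      show "(\<xi>s, i) \<in> set (P0' j) \<Longrightarrow> j \<in> J0' \<Longrightarrow> i \<le> 0" for j \<xi>s i by (auto simp: P0'_def)
      show "(\<xi>s, j) \<in> set (R0' [0] i) \<Longrightarrow> j \<in> J0'" for \<xi>s j i by (rule R0'_in) auto
    qed (use solve_Q0[OF _ _ le0] RP_0 in \<open>auto simp: R0'_def\<close>)
  qed
qed

end
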